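(* Let $d\ge 3$, $q\in\,]1,d+2]$ (the case of interest being $q>1$ close to $1$), and let $p\in\,]1,\infty[$. There exists a constant $c_{d,p,q}>0$ (depending only on $d,p,q$) such that the following holds. Let $b=b_{\mathfrak s}+b_{\mathfrak b}:\mathbb R^{d+1}\to\mathbb R^d$ be a vector field with $|b_{\mathfrak s}|\in E_q$, $|b_{\mathfrak b}|\in L^\infty(\mathbb R^{d+1})$ and $$\|b_{\mathfrak s}\|_{E_q}<c_{d,p,q}.$$ Then there exists a constant $\lambda_{d,p,q}>0$ (depending on $d,p,q$ and $\|b_{\mathfrak b}\|_{L^\infty}$) such that for every $\lambda\ge\lambda_{d,p,q}$: (i) The operators $R_p=R_p(b)$ and $Q_p=Q_p(b)$ are bounded on $L^p(\mathbb R^{d+1})$, and the operator $T_p:=R_pQ_p$ satisfies $\|T_p\|_{p\to p}<1$. For every $f\in L^p(\mathbb R^{d+1})$, the solutions $u_n\in L^p(\mathbb R^{d+1})$ to the approximating parabolic equations $$(\lambda+\partial_t-\Delta+b_n\cdot\nabla)u_n=f$$ converge in $\mathbb W^{1+\frac1p,p}(\mathbb R^{d+1})$, as $n\to\infty$, to $$u:=(\lambda+\partial_t-\Delta)^{-1}f-(\lambda+\partial_t-\Delta)^{-\frac12-\frac1{2p}}Q_p(1+T_p)^{-1}R_p(\lambda+\partial_t-\Delta)^{-\frac1{2p'}}f .$$ (ii) If moreover $p>d+1$, then the convergence $u_n\to u$ is uniform on $\mathbb R^{d+1}$ and $u\in C_\infty(\mathbb R^{d+1})$.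
   Context: Points of $\mathbb R^{d+1}$ are written $(t,x)$, $t\in\mathbb R$, $x\in\mathbb R^d$; $\nabla,\Delta$ act in $x$; $p'=\frac p{p-1}$. Morrey class: $C_r(t,x):=\{(s,y)\in\mathbb R^{d+1}: t\le s\le t+r^2,\ |x-y|\le r\}$, $|C_r|$ its Lebesgue measure. For $q\in[1,d+2]$ and $b$ with components in $L^q_{\rm loc}(\mathbb R^{d+1})$, $\|b\|_{E_q}:=\sup_{r>0,z\in\mathbb R^{d+1}} r\big(\frac1{|C_r|}\int_{C_r(z)}|b|^q\,dt\,dx\big)^{1/q}$; $b\in E_q$ (equivalently $|b|\in E_q$) means $\|b\|_{E_q}<\infty$. Parabolic operators: for $\lambda>0$, $0<\alpha\le2$, $$(\lambda+\partial_t-\Delta)^{-\frac\alpha2}h(t,x):=\frac1{\Gamma(\alpha/2)}\int_{-\infty}^t\int_{\mathbb R^d}e^{-\lambda(t-s)}\frac{1}{(4\pi(t-s))^{d/2}}\frac1{(t-s)^{\frac{2-\alpha}2}}e^{-\frac{|x-y|^2}{4(t-s)}}h(s,y)\,dy\,ds,$$ bounded on $L^p(\mathbb R^{d+1})$ with norm at most $\lambda^{-\alpha/2}$; $(\lambda+\partial_t-\Delta)^{\alpha/2}$ denotes the inverse (the fractional power). $\mathbb W^{\alpha,p}(\mathbb R^{d+1}):=(\lambda+\partial_t-\Delta)^{-\frac\alpha2}L^p(\mathbb R^{d+1})$ with norm $\|h\|_{\mathbb W^{\alpha,p}}:=\|(\lambda+\partial_t-\Delta)^{\frac\alpha2}h\|_p$,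 where $\|\cdot\|_p$ is the $L^p(\mathbb R^{d+1})$ norm; $\|\cdot\|_{p\to p}$ is the operator norm on $L^p(\mathbb R^{d+1})$. $b_n:=\mathbf 1_{\{|b|\le n\}}b$, $n=1,2,\dots$; $b^{\frac1p}:=b|b|^{-1+\frac1p}$ (zero where $b=0$). Further, $$R_p(b):=b^{\frac1p}\cdot\nabla(\lambda+\partial_t-\Delta)^{-\frac12-\frac1{2p}},\qquad Q_p(b):=\big[(\lambda+\partial_t-\Delta)^{-\frac1{2p'}}|b|^{\frac1{p'}}\upharpoonright\mathcal E\big]^{\rm clos}_{p\to p},$$ the closure in $L^p(\mathbb R^{d+1})$ of the operator defined on the dense subspace $\mathcal E:=\cup_{\varepsilon>0}e^{-\varepsilon|b|}L^p(\mathbb R^{d+1})$. $C_\infty(\mathbb R^{d+1})$ is the space of continuous functions vanishing at infinity with the sup-norm. The solutions $u_n$ (with bounded drift $b_n$) are those given by the standard $L^p$ theory. *)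

theory Defs
  imports "HOL-Analysis.Analysis" "HOL-Probability.Essential_Supremum"
begin

text \<open>
  Points of space-time are pairs \<open>(t, x)\<close> of type \<open>real \<times> 'a\<close>, with \<open>'a\<close> the
  \<open>d\<close>-dimensional space of the variable \<open>x\<close>. Elements of \<open>L^p\<close> are represented by Lebesgue
  measurable functions, and equality of classes is written as equality almost everywhere.
\<close>

definition Lp :: "real \<Rightarrow> ('b::euclidean_space \<Rightarrow> real) set" where
  "Lp p = {f \<in> borel_measurable lebesgue. integrable lebesgue (\<lambda>z. \<bar>f z\<bar> powr p)}"

definition Lp_norm :: "real \<Rightarrow> ('b::euclidean_space \<Rightarrow> real) \<Rightarrow> real" where
  "Lp_norm p f = (\<integral>z. \<bar>f z\<bar> powr p \<partial>lebesgue) powr (1 / p)"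

text \<open>Linearity up to null sets together with the norm bound makes the operator well defined on
  equivalence classes.\<close>

definition Lp_bounded_op ::
  "real \<Rightarrow> (('b::euclidean_space \<Rightarrow> real) \<Rightarrow> 'b \<Rightarrow> real) \<Rightarrow> bool" where
  "Lp_bounded_op p T \<longleftrightarrow>
     (\<forall>f\<in>Lp p. T f \<in> Lp p) \<and>
     (\<forall>f\<in>Lp p. \<forall>g\<in>Lp p. AE z in lebesgue. T (\<lambda>w. f w + g w) z = T f z + T g z) \<and>
     (\<forall>f\<in>Lp p. \<forall>c. AE z in lebesgue. T (\<lambda>w. c * f w) z = c * T f z) \<and>
     (\<exists>C. \<forall>f\<in>Lp p. Lp_norm p (T f) \<le> C * Lp_norm p f)"

text \<open>A supremum of reals, hence meaningful only for operators satisfying \<^const>\<open>Lp_bounded_op\<close>.\<close>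

definition Lp_opnorm ::
  "real \<Rightarrow> (('b::euclidean_space \<Rightarrow> real) \<Rightarrow> 'b \<Rightarrow> real) \<Rightarrow> real" where
  "Lp_opnorm p T = (SUP f\<in>{f \<in> Lp p. Lp_norm p f \<le> 1}. Lp_norm p (T f))"

text \<open>The inverse of an operator on \<open>L^p\<close>; for an operator that is injective on \<open>L^p\<close> the value is
  determined almost everywhere on the range of the operator, and arbitrary elsewhere.\<close>

definition Lp_inverse ::
  "real \<Rightarrow> (('b::euclidean_space \<Rightarrow> real) \<Rightarrow> 'b \<Rightarrow> real) \<Rightarrow> ('b \<Rightarrow> real) \<Rightarrow> 'b \<Rightarrow> real" where
  "Lp_inverse p A h = (SOME g. g \<in> Lp p \<and> (AE z in lebesgue. A g z = h z))"

text \<open>The closure in \<open>L^p \<times> L^p\<close> of the graph of \<open>A\<close> restricted to \<open>D\<close>.\<close>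

definition Lp_graph_closure ::
  "real \<Rightarrow> ('b::euclidean_space \<Rightarrow> real) set \<Rightarrow> (('b \<Rightarrow> real) \<Rightarrow> 'b \<Rightarrow> real)
     \<Rightarrow> (('b \<Rightarrow> real) \<times> ('b \<Rightarrow> real)) set" where
  "Lp_graph_closure p D A =
     {(f, g). f \<in> Lp p \<and> g \<in> Lp p \<and>
        (\<exists>h :: nat \<Rightarrow> 'b \<Rightarrow> real.
           (\<forall>n. h n \<in> D \<and> h n \<in> Lp p \<and> A (h n) \<in> Lp p) \<and>
           (\<lambda>n. Lp_norm p (\<lambda>z. h n z - f z)) \<longlonglongrightarrow> 0 \<and>
           (\<lambda>n. Lp_norm p (\<lambda>z. A (h n) z - g z)) \<longlonglongrightarrow> 0)}"

definition Lp_closable ::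
  "real \<Rightarrow> ('b::euclidean_space \<Rightarrow> real) set \<Rightarrow> (('b \<Rightarrow> real) \<Rightarrow> 'b \<Rightarrow> real) \<Rightarrow> bool" where
  "Lp_closable p D A \<longleftrightarrow>
     (\<forall>f g g'. (f, g) \<in> Lp_graph_closure p D A \<and> (f, g') \<in> Lp_graph_closure p D A
        \<longrightarrow> (AE z in lebesgue. g z = g' z))"

definition Lp_closure_op ::
  "real \<Rightarrow> ('b::euclidean_space \<Rightarrow> real) set \<Rightarrow> (('b \<Rightarrow> real) \<Rightarrow> 'b \<Rightarrow> real)
     \<Rightarrow> ('b \<Rightarrow> real) \<Rightarrow> 'b \<Rightarrow> real" where
  "Lp_closure_op p D A f = (SOME g. (f, g) \<in> Lp_graph_closure p D A)"

text \<open>The value \<^term>\<open>Lp_closure_op p D A f\<close> is the value of the closure only when \<open>A\<close> is closable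
  and \<open>f\<close> lies in the domain of the closure, so both are part of the following notion.\<close>

definition Lp_bounded_closure ::
  "real \<Rightarrow> ('b::euclidean_space \<Rightarrow> real) set \<Rightarrow> (('b \<Rightarrow> real) \<Rightarrow> 'b \<Rightarrow> real) \<Rightarrow> bool" where
  "Lp_bounded_closure p D A \<longleftrightarrow>
     Lp_closable p D A \<and> Domain (Lp_graph_closure p D A) = Lp p \<and>
     Lp_bounded_op p (Lp_closure_op p D A)"

definition par_cylinder :: "real \<Rightarrow> real \<times> 'a::euclidean_space \<Rightarrow> (real \<times> 'a) set" where
  "par_cylinder r z =
     {(s, y). fst z \<le> s \<and> s \<le> fst z + r\<^sup>2 \<and> norm (snd z - y) \<le> r}"

definition morrey_norm :: "real \<Rightarrow> (real \<times> 'a::euclidean_space \<Rightarrow> 'a) \<Rightarrow> ereal" where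
  "morrey_norm q b =
     (SUP (r, z)\<in>{0<..} \<times> UNIV.
        ereal (r * ((1 / measure lebesgue (par_cylinder r z)) *
                    (LINT w:par_cylinder r z|lebesgue. norm (b w) powr q)) powr (1 / q)))"

definition morrey_class :: "real \<Rightarrow> (real \<times> 'a::euclidean_space \<Rightarrow> 'a) set" where
  "morrey_class q =
     {b \<in> borel_measurable lebesgue.
        (\<forall>K. compact K \<longrightarrow> set_integrable lebesgue K (\<lambda>z. norm (b z) powr q)) \<and>
        morrey_norm q b < \<infinity>}"

definition Linf_norm :: "('b::euclidean_space \<Rightarrow> 'c::real_normed_vector) \<Rightarrow> ereal" where
  "Linf_norm b = esssup lebesgue (\<lambda>z. ereal (norm (b z)))"

definition Linf :: "('b::euclidean_space \<Rightarrow> 'c::real_normed_vector) set" where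
  "Linf = {b \<in> borel_measurable lebesgue. Linf_norm b < \<infinity>}"

definition par_kernel :: "real \<Rightarrow> real \<Rightarrow> real \<Rightarrow> 'a::euclidean_space \<Rightarrow> real" where
  "par_kernel lam \<alpha> \<tau> \<xi> =
     exp (- lam * \<tau>) * (1 / (4 * pi * \<tau>) powr (real DIM('a) / 2)) *
     (1 / \<tau> powr ((2 - \<alpha>) / 2)) * exp (- (norm \<xi>)\<^sup>2 / (4 * \<tau>))"

text \<open>\<open>par_potential lam \<alpha> = (lam + \<partial>_t - \<Delta>)^(-\<alpha>/2)\<close>.\<close>

definition par_potential ::
  "real \<Rightarrow> real \<Rightarrow> (real \<times> 'a::euclidean_space \<Rightarrow> real) \<Rightarrow> real \<times> 'a \<Rightarrow> real" where
  "par_potential lam \<alpha> h = (\<lambda>(t, x).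
     (1 / Gamma (\<alpha> / 2)) *
     (LINT (s, y):{..<t} \<times> UNIV|lebesgue. par_kernel lam \<alpha> (t - s) (x - y) * h (s, y)))"

text \<open>\<open>par_power p lam \<alpha> = (lam + \<partial>_t - \<Delta>)^(\<alpha>/2)\<close>, on the range of the potential on \<open>L^p\<close>.\<close>

definition par_power ::
  "real \<Rightarrow> real \<Rightarrow> real \<Rightarrow> (real \<times> 'a::euclidean_space \<Rightarrow> real) \<Rightarrow> real \<times> 'a \<Rightarrow> real" where
  "par_power p lam \<alpha> = Lp_inverse p (par_potential lam \<alpha>)"

definition par_space ::
  "real \<Rightarrow> real \<Rightarrow> real \<Rightarrow> (real \<times> 'a::euclidean_space \<Rightarrow> real) set" where
  "par_space lam \<alpha> p =
     {h. \<exists>g\<in>Lp p. AE z in lebesgue. par_potential lam \<alpha> g z = h z}"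

definition par_space_norm ::
  "real \<Rightarrow> real \<Rightarrow> real \<Rightarrow> (real \<times> 'a::euclidean_space \<Rightarrow> real) \<Rightarrow> real" where
  "par_space_norm lam \<alpha> p h = Lp_norm p (par_power p lam \<alpha> h)"

fun C_order :: "nat \<Rightarrow> ('b::euclidean_space \<Rightarrow> real) \<Rightarrow> bool" where
  "C_order 0 f \<longleftrightarrow> continuous_on UNIV f"
| "C_order (Suc k) f \<longleftrightarrow>
     (\<forall>z. f differentiable (at z)) \<and> (\<forall>v. C_order k (\<lambda>z. frechet_derivative f (at z) v))"

definition test_functions :: "('b::euclidean_space \<Rightarrow> real) set" where
  "test_functions = {\<phi>. (\<forall>k. C_order k \<phi>) \<and> compact (closure {z. \<phi> z \<noteq> 0})}"

definition locally_integrable :: "('b::euclidean_space \<Rightarrow> 'c::euclidean_space) \<Rightarrow> bool" where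
  "locally_integrable f \<longleftrightarrow> (\<forall>K. compact K \<longrightarrow> set_integrable lebesgue K f)"

definition has_weak_grad ::
  "(real \<times> 'a::euclidean_space \<Rightarrow> real) \<Rightarrow> (real \<times> 'a \<Rightarrow> 'a) \<Rightarrow> bool" where
  "has_weak_grad u G \<longleftrightarrow>
     locally_integrable u \<and> locally_integrable G \<and>
     (\<forall>\<phi>\<in>test_functions. \<forall>e\<in>Basis.
        (\<integral>z. u z * frechet_derivative \<phi> (at z) (0, e) \<partial>lebesgue) =
        - (\<integral>z. (G z \<bullet> e) * \<phi> z \<partial>lebesgue))"

definition weak_grad ::
  "(real \<times> 'a::euclidean_space \<Rightarrow> real) \<Rightarrow> real \<times> 'a \<Rightarrow> 'a" where
  "weak_grad u = (SOME G. has_weak_grad u G)"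

definition conj_exp :: "real \<Rightarrow> real" where
  "conj_exp p = p / (p - 1)"

definition vec_root :: "real \<Rightarrow> 'a::euclidean_space \<Rightarrow> 'a" where
  "vec_root p v = (norm v powr (- 1 + 1 / p)) *\<^sub>R v"

definition truncated :: "(real \<times> 'a::euclidean_space \<Rightarrow> 'a) \<Rightarrow> nat \<Rightarrow> real \<times> 'a \<Rightarrow> 'a" where
  "truncated b n z = (if norm (b z) \<le> real n then b z else 0)"

definition R_op :: "real \<Rightarrow> real \<Rightarrow> (real \<times> 'a::euclidean_space \<Rightarrow> 'a)
     \<Rightarrow> (real \<times> 'a \<Rightarrow> real) \<Rightarrow> real \<times> 'a \<Rightarrow> real" where
  "R_op p lam b h = (\<lambda>z. vec_root p (b z) \<bullet> weak_grad (par_potential lam (1 + 1 / p) h) z)"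

definition Q_dom :: "real \<Rightarrow> (real \<times> 'a::euclidean_space \<Rightarrow> 'a) \<Rightarrow> (real \<times> 'a \<Rightarrow> real) set" where
  "Q_dom p b = (\<Union>\<epsilon>\<in>{0<..}. (\<lambda>g z. exp (- \<epsilon> * norm (b z)) * g z) ` Lp p)"

definition Q_pre :: "real \<Rightarrow> real \<Rightarrow> (real \<times> 'a::euclidean_space \<Rightarrow> 'a)
     \<Rightarrow> (real \<times> 'a \<Rightarrow> real) \<Rightarrow> real \<times> 'a \<Rightarrow> real" where
  "Q_pre p lam b h =
     par_potential lam (1 / conj_exp p) (\<lambda>z. norm (b z) powr (1 / conj_exp p) * h z)"

definition Q_op :: "real \<Rightarrow> real \<Rightarrow> (real \<times> 'a::euclidean_space \<Rightarrow> 'a)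
     \<Rightarrow> (real \<times> 'a \<Rightarrow> real) \<Rightarrow> real \<times> 'a \<Rightarrow> real" where
  "Q_op p lam b = Lp_closure_op p (Q_dom p b) (Q_pre p lam b)"

definition T_op :: "real \<Rightarrow> real \<Rightarrow> (real \<times> 'a::euclidean_space \<Rightarrow> 'a)
     \<Rightarrow> (real \<times> 'a \<Rightarrow> real) \<Rightarrow> real \<times> 'a \<Rightarrow> real" where
  "T_op p lam b = R_op p lam b \<circ> Q_op p lam b"

definition limit_solution :: "real \<Rightarrow> real \<Rightarrow> (real \<times> 'a::euclidean_space \<Rightarrow> 'a)
     \<Rightarrow> (real \<times> 'a \<Rightarrow> real) \<Rightarrow> real \<times> 'a \<Rightarrow> real" where
  "limit_solution p lam b f = (\<lambda>z.
     par_potential lam 2 f z -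
     par_potential lam (1 + 1 / p)
       (Q_op p lam b
         (Lp_inverse p (\<lambda>g w. g w + T_op p lam b g w)
           (R_op p lam b (par_potential lam (1 / conj_exp p) f)))) z)"

text \<open>Strong \<open>L^p\<close> solutions of \<open>(lam + \<partial>_t - \<Delta> + B \<cdot> \<nabla>) u = f\<close> for a bounded drift \<open>B\<close>: \<open>u\<close> lies in
  the domain of \<open>lam + \<partial>_t - \<Delta>\<close> in \<open>L^p\<close> and the equation holds in \<open>L^p\<close>.\<close>

definition Lp_solution :: "real \<Rightarrow> real \<Rightarrow> (real \<times> 'a::euclidean_space \<Rightarrow> 'a)
     \<Rightarrow> (real \<times> 'a \<Rightarrow> real) \<Rightarrow> (real \<times> 'a \<Rightarrow> real) \<Rightarrow> bool" where
  "Lp_solution p lam B f u \<longleftrightarrow>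
     u \<in> Lp p \<and> u \<in> par_space lam 2 p \<and>
     (AE z in lebesgue. par_power p lam 2 u z + B z \<bullet> weak_grad u z = f z)"

definition C_infinity :: "('b::euclidean_space \<Rightarrow> real) set" where
  "C_infinity = {f. continuous_on UNIV f \<and> (f \<longlongrightarrow> 0) at_infinity}"

end

theory Submission imports Defs "HOL-Probability.Distributions"
begin

text \<open>Write $G_\alpha = (\lambda+\partial_t-\Delta)^{-\alpha/2}$ and $p' = p/(p-1)$, and split the drift term as
$b\cdot\nabla = |b|^{1/p'}\,(b^{1/p}\cdot\nabla)$. If $u = G_2 v$ solves the equation with drift $b$, put
$g = b^{1/p}\cdot\nabla u = R_p G_{1/p'} v$. Then $v = f - |b|^{1/p'} g$, and applying $R_p G_{1/p'}$ to this identity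
turns the equation into $(1+T_p)g = R_p G_{1/p'}f$ with $T_p = R_p Q_p$, while $u = G_{1+1/p}(G_{1/p'}f - Q_p g)$.
As soon as $\|R_p\|\,\|Q_p\| \le 1/2$, a Neumann series produces $g$, for $b$ and equally for every truncation $b_n$.

The estimate of $R_p$ and $Q_p$ is the heart of the matter. With the parabolic distance $\rho$ and $D = d+2$, their kernels
are dominated by $|b(z)|^{1/p}\rho(z,w)^{1/p-D}$ and $\rho(z,w)^{1/p'-D}|b(w)|^{1/p'}$. A weight $w$ in a Morrey class of
exponent $q>1$ is replaced by the larger $V = \max(w^q, M(w^q))^{1/q}$ with the maximal function $M$. By Kolmogorov's
inequality the fractional powers of $M(w^q)$ have averages controlled by their point values, and this together with
the Morrey condition on large balls gives $\rho^{\beta-D} * V^\gamma \le C K^\beta V^{\gamma-\beta}$ for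
$0<\beta<\gamma<q$, $K$ being the Morrey norm (lemma \<open>Riesz_potential_of_pmajorant\<close>). Schur's test with the
test function $V^{1/p+\epsilon}$ then yields $\|R_p\|\lesssim K^{1/p}$ and $\|Q_p\|\lesssim K^{1/p'}$
(\<open>Riesz_trace_inequality\<close>), whose product is small with $K$. A bounded part of size $M$ contributes
$M^{1/p}\lambda^{-1/(2p)}$ and $M^{1/p'}\lambda^{-1/(2p')}$, which is no worse once $M \le K\sqrt\lambda$
(\<open>weighted_potential_bounds\<close>).

Two facts make the objects well defined. The distributional gradient of $G_\alpha h$, $\alpha>1$, is the integral operator
with the differentiated kernel, and weak gradients are unique (\<open>weak_grad_potential\<close>,
\<open>fundamental_lemma\<close>). The potentials are injective on $L^p$: by the resolvent identity a zero of $G_2$ for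
one $\lambda$ is a zero for all larger $\mu$, and $\mu G_2^{(\mu)}$ is an approximate identity (\<open>par_potential_inj\<close>).

For the truncations one has $R_p(b_n) = 1_n R_p(b)$ and $Q_p(b_n) = Q_p(b) 1_n$ with $1_n$ the indicator of $|b|\le n$, so that
$(1+T_p(b_n))(g_n-g) = 1_n T_p(b)(1-1_n)g - (1-1_n)g$, which tends to zero by dominated convergence; this gives the
convergence in $\mathbb W^{1+1/p,p}$ (\<open>density_converges\<close>). If $p>d+1$ the kernel of $G_{1+1/p}$ lies in
$L^{p'}$, and Hoelder's inequality turns convergence of the densities in $L^p$ into uniform convergence of functions in
$C_\infty$ (\<open>potential_C_infinity\<close>).\<close>

section \<open>Lebesgue integrals of nonnegative functions on space-time\<close>

abbreviation lborel_nn_integral :: "('b::euclidean_space \<Rightarrow> ennreal) \<Rightarrow> ennreal" (binder "NNINT " 10)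
  where "lborel_nn_integral \<equiv> nn_integral lborel"

lemma nn_integral_lborel_translate:
  fixes f :: "'b::euclidean_space \<Rightarrow> ennreal"
  assumes [measurable]: "f \<in> borel_measurable borel"
  shows "(NNINT x. f (c + x)) = (NNINT x. f x)"
proof -
  have "(NNINT x. f x) = (\<integral>\<^sup>+x. f x \<partial>distr lborel borel ((+) c))"
    by (simp add: lborel_distr_plus)
  also have "\<dots> = (NNINT x. f (c + x))"
    by (subst nn_integral_distr) auto
  finally show ?thesis by simp
qed

lemma nn_integral_lborel_reflect:
  fixes f :: "'b::euclidean_space \<Rightarrow> ennreal"
  assumes [measurable]: "f \<in> borel_measurable borel"
  shows "(NNINT x. f (c - x)) = (NNINT x. f x)"
proof -
  have "(NNINT x. f x) = (\<integral>\<^sup>+x. f x \<partial>density (distr lborel borel (\<lambda>x::'b. c + (-1) *\<^sub>R x)) (\<lambda>_. 1))"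
    using lborel_affine[of "-1" c] by simp
  also have "\<dots> = (NNINT x. f (c - x))"
    by (simp add: nn_integral_density nn_integral_distr density_1)
  finally show ?thesis by simp
qed

lemma nn_integral_spacetime:
  fixes f :: "'b::euclidean_space \<times> 'c::euclidean_space \<Rightarrow> ennreal"
  assumes [measurable]: "f \<in> borel_measurable borel"
  shows "(NNINT z. f z) = (NNINT s. NNINT y. f (s, y))"
proof -
  have "f \<in> borel_measurable (lborel \<Otimes>\<^sub>M lborel)"
    by (simp add: lborel_prod)
  then show ?thesis
    by (subst lborel_prod[symmetric]) (simp add: lborel.nn_integral_fst)
qed

text \<open>The integral factorises over an orthonormal basis into one-dimensional normal densities.\<close>

lemma nn_integral_gauss:
  assumes a: "a > 0"
  shows "(NNINT (x::'a::euclidean_space). ennreal (exp (- a * (norm x)\<^sup>2)))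
    = ennreal ((pi / a) powr (real DIM('a) / 2))"
proof -
  define \<sigma> where "\<sigma> = sqrt (1 / (2 * a))"
  have s: "\<sigma> > 0" "\<sigma>\<^sup>2 = 1 / (2 * a)" using a by (auto simp: \<sigma>_def)
  have nd: "normal_density 0 \<sigma> x = (1 / sqrt (pi / a)) * exp (- a * x\<^sup>2)" for x
    using s a by (simp add: normal_density_def)
  have "(NNINT x. ennreal (normal_density 0 \<sigma> x)) = ennreal 1"
    using s by (subst nn_integral_eq_integral) (auto simp: integrable_normal_density)
  then have "ennreal (1 / sqrt (pi / a)) * (NNINT x. ennreal (exp (- a * x\<^sup>2))) = 1"
    using a by (simp add: nn_integral_cmult[symmetric] nd flip: ennreal_mult')
  then have "ennreal (sqrt (pi / a)) * (ennreal (1 / sqrt (pi / a)) * (NNINT x. ennreal (exp (- a * x\<^sup>2)))) = ennreal (sqrt (pi / a))"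
    by simp
  then have one: "(NNINT x. ennreal (exp (- a * x\<^sup>2))) = ennreal (sqrt (pi / a))"
    using a by (simp flip: mult.assoc ennreal_mult')
  have n: "exp (- a * (norm x)\<^sup>2) = (\<Prod>b\<in>Basis. exp (- a * (x \<bullet> b)\<^sup>2))" for x :: 'a
  proof -
    have "(norm x)\<^sup>2 = (\<Sum>b\<in>Basis. (x \<bullet> b)\<^sup>2)"
      using euclidean_inner[of x x] by (simp add: power2_norm_eq_inner[symmetric] power2_eq_square)
    then show ?thesis by (simp add: exp_sum sum_distrib_left)
  qed
  have "(NNINT (x::'a). ennreal (exp (- a * (norm x)\<^sup>2)))
     = (NNINT (x::'a). (\<Prod>b\<in>Basis. ennreal (exp (- a * (x \<bullet> b)\<^sup>2))))"
    unfolding n by (simp add: prod_ennreal)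
  also have "\<dots> = (\<Prod>b\<in>(Basis::'a set). NNINT x. ennreal (exp (- a * x\<^sup>2)))"
    by (rule nn_integral_lborel_prod) auto
  also have "\<dots> = ennreal (sqrt (pi / a) ^ DIM('a))"
    unfolding one prod_constant using a by (intro ennreal_power) simp
  also have "sqrt (pi / a) ^ DIM('a) = (pi / a) powr (real DIM('a) / 2)"
    using a by (simp add: powr_half_sqrt[symmetric] powr_powr flip: powr_realpow)
  finally show ?thesis .
qed

section \<open>The heat kernel\<close>

definition heat :: "real \<Rightarrow> 'a::euclidean_space \<Rightarrow> real" where
  "heat \<tau> x = exp (- (norm x)\<^sup>2 / (4 * \<tau>)) / (4 * pi * \<tau>) powr (real DIM('a) / 2)"

lemma heat_nonneg: "0 \<le> heat \<tau> x"
  by (simp add: heat_def)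

lemma heat_measurable[measurable (raw)]:
  assumes [measurable]: "f \<in> borel_measurable M" "g \<in> borel_measurable M"
  shows "(\<lambda>x. heat (f x) (g x)) \<in> borel_measurable M"
  unfolding heat_def by measurable

lemma heat_mass:
  assumes "\<tau> > 0"
  shows "(NNINT (x::'a::euclidean_space). heat \<tau> x) = 1"
proof -
  let ?c = "(4 * pi * \<tau>) powr (real DIM('a) / 2)"
  have c: "?c > 0" using assms by simp
  have "(NNINT (x::'a). heat \<tau> x)
      = (NNINT (x::'a). ennreal (1 / ?c) * ennreal (exp (- (1 / (4*\<tau>)) * (norm x)\<^sup>2)))"
    by (intro nn_integral_cong) (simp add: heat_def flip: ennreal_mult')
  also have "\<dots> = ennreal (1 / ?c) * ennreal ((pi / (1 / (4*\<tau>))) powr (real DIM('a) / 2))"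
    using assms nn_integral_gauss[of "1 / (4*\<tau>)", where 'a='a] by (subst nn_integral_cmult) auto
  also have "\<dots> = 1"
    using c by (simp flip: ennreal_mult' add: mult.commute mult.left_commute)
  finally show ?thesis .
qed

text \<open>Completing the square in the exponent reduces the integral to a Gaussian one centred at \<open>m\<close>.\<close>

lemma heat_chapman_kolmogorov:
  assumes "s > 0" "t > 0"
  shows "(NNINT (y::'a::euclidean_space). ennreal (heat s (x - y) * heat t y)) = ennreal (heat (s + t) x)"
proof -
  let ?d = "real DIM('a) / 2"
  define a where "a = (s + t) / (4 * s * t)"
  define m where "m = (t / (s + t)) *\<^sub>R x"
  have a: "a > 0" using assms by (simp add: a_def)
  have sq: "(norm (x - y))\<^sup>2 / (4 * s) + (norm y)\<^sup>2 / (4 * t)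
      = (norm x)\<^sup>2 / (4 * (s + t)) + a * (norm (y - m))\<^sup>2" for y
  proof -
    have e: "(norm (x - y))\<^sup>2 = (norm x)\<^sup>2 - 2 * (x \<bullet> y) + (norm y)\<^sup>2"
      by (simp add: power2_norm_eq_inner inner_diff inner_commute)
    have e2: "(norm (y - m))\<^sup>2 = (norm y)\<^sup>2 - 2 * (t / (s + t)) * (x \<bullet> y) + (t / (s + t))\<^sup>2 * (norm x)\<^sup>2"
      unfolding m_def power2_norm_eq_inner inner_diff_left inner_diff_right inner_scaleR_left inner_scaleR_right
      by (simp add: inner_commute power2_eq_square right_diff_distrib diff_divide_distrib)
    have p: "s + t > 0" "s \<noteq> 0" "t \<noteq> 0" "s + t \<noteq> 0" using assms by auto
    have k1: "a * (2 * (t / (s + t))) = 1 / (2 * s)" "a = 1 / (4 * s) + 1 / (4 * t)"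
      using assms p by (simp_all add: a_def divide_simps)
    have k2: "a * (t / (s + t))\<^sup>2 = 1 / (4 * s) - 1 / (4 * (s + t))"
      using p by (simp add: a_def power2_eq_square divide_simps)
    have "a * (norm (y - m))\<^sup>2 = a * (norm y)\<^sup>2 - a * (2 * (t / (s + t))) * (x \<bullet> y) + a * (t / (s + t))\<^sup>2 * (norm x)\<^sup>2"
      unfolding e2 by (simp add: algebra_simps)
    also have "\<dots> = (norm y)\<^sup>2 / (4 * s) + (norm y)\<^sup>2 / (4 * t) - (x \<bullet> y) / (2 * s) + (norm x)\<^sup>2 / (4 * s) - (norm x)\<^sup>2 / (4 * (s + t))"
      unfolding k1(1) k2 unfolding k1(2) by (simp add: algebra_simps)
    finally show ?thesis unfolding e by (simp add: diff_divide_distrib add_divide_distrib)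
  qed
  let ?c = "1 / ((4 * pi * s) powr ?d * (4 * pi * t) powr ?d) * exp (- (norm x)\<^sup>2 / (4 * (s + t)))"
  have h: "heat s (x - y) * heat t y = ?c * exp (- a * (norm (y - m))\<^sup>2)" for y
  proof -
    have "exp (- (norm (x - y))\<^sup>2 / (4 * s)) * exp (- (norm y)\<^sup>2 / (4 * t))
       = exp (- (norm x)\<^sup>2 / (4 * (s + t))) * exp (- a * (norm (y - m))\<^sup>2)"
      using sq[of y] by (simp flip: exp_add)
    then show ?thesis by (simp add: heat_def)
  qed
  have "(NNINT (y::'a). ennreal (heat s (x - y) * heat t y))
      = (NNINT (y::'a). ennreal ?c * ennreal (exp (- a * (norm (- m + y))\<^sup>2)))"
    by (intro nn_integral_cong) (simp add: h flip: ennreal_mult')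
  also have "\<dots> = ennreal ?c * (NNINT (y::'a). ennreal (exp (- a * (norm y)\<^sup>2)))"
    by (subst nn_integral_cmult, simp, subst nn_integral_lborel_translate[of "\<lambda>y. ennreal (exp (- a * (norm y)\<^sup>2))"]) auto
  also have "\<dots> = ennreal (?c * (pi / a) powr ?d)"
    by (subst nn_integral_gauss[OF a]) (rule ennreal_mult'[symmetric], simp)
  also have "?c * (pi / a) powr ?d = heat (s + t) x"
  proof -
    have "(pi / a) powr ?d * (4 * pi * (s + t)) powr ?d = (4 * pi * s) powr ?d * (4 * pi * t) powr ?d"
    proof -
      have "(pi / a) * (4 * pi * (s + t)) = (4 * pi * s) * (4 * pi * t)"
        using assms by (simp add: a_def field_simps)
      then show ?thesis using a assms by (simp flip: powr_mult)
    qed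
    moreover have "(4 * pi * s) powr ?d > 0" "(4 * pi * t) powr ?d > 0" "(4 * pi * (s+t)) powr ?d > 0"
      using assms by auto
    ultimately show ?thesis by (simp add: heat_def field_simps)
  qed
  finally show ?thesis .
qed

section \<open>The kernels of the fractional powers\<close>

text \<open>The convolution kernel of \<open>(lam + \<partial>_t - \<Delta>)^(-\<alpha>/2)\<close>, with the factor \<open>1 / Gamma (\<alpha>/2)\<close> included and extended by zero to nonpositive times.\<close>

definition pk :: "real \<Rightarrow> real \<Rightarrow> real \<times> 'a::euclidean_space \<Rightarrow> real" where
  "pk lam \<alpha> z = (if fst z > 0 then
     1 / Gamma (\<alpha> / 2) * exp (- lam * fst z) * fst z powr (\<alpha> / 2 - 1) * heat (fst z) (snd z) else 0)"

lemma pk_measurable[measurable]: "pk lam \<alpha> \<in> borel_measurable borel"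
  unfolding borel_prod[symmetric] pk_def by measurable

lemma pk_measurable'[measurable (raw)]:
  "f \<in> borel_measurable M \<Longrightarrow> (\<lambda>x. pk lam \<alpha> (f x)) \<in> borel_measurable M"
  using measurable_compose[OF _ pk_measurable] by blast

lemma pk_nonneg: "\<alpha> > 0 \<Longrightarrow> 0 \<le> pk lam \<alpha> z"
  by (simp add: pk_def heat_nonneg Gamma_real_pos less_imp_le)

lemma par_potential_eq:
  "par_potential lam \<alpha> h z = (\<integral>w. pk lam \<alpha> (z - w) * h w \<partial>lebesgue)"
proof -
  obtain t x where z: "z = (t, x)" by (cases z)
  have "par_potential lam \<alpha> h z = (\<integral>w. (1 / Gamma (\<alpha> / 2)) * (indicator ({..<t} \<times> UNIV) w *
      (par_kernel lam \<alpha> (t - fst w) (x - snd w) * h w)) \<partial>lebesgue)"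
    by (simp add: par_potential_def z set_lebesgue_integral_def case_prod_beta')
  also have "(\<lambda>w. (1 / Gamma (\<alpha> / 2)) * (indicator ({..<t} \<times> UNIV) w *
      (par_kernel lam \<alpha> (t - fst w) (x - snd w) * h w))) = (\<lambda>w. pk lam \<alpha> (z - w) * h w)"
  proof
    fix w
    show "(1 / Gamma (\<alpha> / 2)) * (indicator ({..<t} \<times> UNIV) w *
      (par_kernel lam \<alpha> (t - fst w) (x - snd w) * h w)) = pk lam \<alpha> (z - w) * h w"
    proof (cases "fst w < t")
      case True
      then have "1 / (t - fst w) powr ((2 - \<alpha>) / 2) = (t - fst w) powr (\<alpha> / 2 - 1)"
        by (simp add: powr_minus_divide[symmetric] diff_divide_distrib)
      then show ?thesis using True
        by (cases w) (simp add: z par_kernel_def pk_def heat_def mult_ac)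
    next
      case False then show ?thesis by (cases w) (simp add: z pk_def)
    qed
  qed
  finally show ?thesis .
qed

lemma nn_integral_Gamma:
  assumes "a > 0" "l > 0"
  shows "(NNINT t. ennreal (if t > 0 then exp (- l * t) * t powr (a - 1) else 0))
    = ennreal (Gamma a * l powr (- a))"
proof -
  have "(NNINT t. ennreal (if t > 0 then exp (- t) * t powr (a - 1) else 0))
     = (NNINT t. indicator {0..} t * ennreal (t powr (a - 1) / exp t))"
    by (intro nn_integral_cong) (auto simp: indicator_def exp_minus field_simps)
  also have "\<dots> = (NNINT t. ennreal (indicator {0..} t * (t powr (a - 1) / exp t)))"
    by (intro nn_integral_cong) (auto simp: indicator_def)
  also have "\<dots> = ennreal (Gamma a)"
    using nn_integral_has_integral_lebesgue[OF _ Gamma_integral_real[OF assms(1)]] by simp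
  finally have 1: "(NNINT t. ennreal (if t > 0 then exp (- t) * t powr (a - 1) else 0)) = ennreal (Gamma a)" .
  have "(NNINT t. ennreal (if t > 0 then exp (- l * t) * t powr (a - 1) else 0))
    = (NNINT t. ennreal (l powr (1 - a)) * ennreal (if l * t > 0 then exp (- (l * t)) * (l * t) powr (a - 1) else 0))"
    using assms by (intro nn_integral_cong)
      (auto simp: zero_less_mult_iff powr_mult powr_diff powr_minus simp flip: ennreal_mult')
  also have "\<dots> = ennreal (l powr (1 - a)) * (NNINT t. ennreal (if l * t > 0 then exp (- (l * t)) * (l * t) powr (a - 1) else 0))"
    by (subst nn_integral_cmult) auto
  also have "l powr (1 - a) = l powr (- a) * l"
    using assms by (simp add: powr_diff powr_minus field_simps)
  also have "ennreal (l powr (- a) * l) * (NNINT t. ennreal (if l * t > 0 then exp (- (l * t)) * (l * t) powr (a - 1) else 0))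
     = ennreal (l powr (- a)) * (ennreal l * (NNINT t. ennreal (if l * t > 0 then exp (- (l * t)) * (l * t) powr (a - 1) else 0)))"
    using assms by (simp add: ennreal_mult' mult.assoc)
  also have "ennreal l * (NNINT t. ennreal (if l * t > 0 then exp (- (l * t)) * (l * t) powr (a - 1) else 0)) = ennreal (Gamma a)"
    using nn_integral_real_affine[of "\<lambda>t. ennreal (if t > 0 then exp (- t) * t powr (a - 1) else 0)" l 0] assms
    unfolding 1 add_0 by simp
  finally show ?thesis
    using assms by (simp add: mult.commute Gamma_real_pos less_imp_le ennreal_mult)
qed

lemma nn_integral_Beta:
  assumes "a > 0" "b > 0" "t > 0"
  shows "(NNINT s. ennreal (if 0 < s \<and> s < t then (t - s) powr (a - 1) * s powr (b - 1) else 0))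
    = ennreal (t powr (a + b - 1) * Beta a b)"
proof -
  have "(NNINT s. ennreal (if 0 < s \<and> s < 1 then (1 - s) powr (a - 1) * s powr (b - 1) else 0))
     = (NNINT s. ennreal (indicator {0..1} s * (s powr (b - 1) * (1 - s) powr (a - 1))))"
    using AE_lborel_singleton[of 0] AE_lborel_singleton[of 1]
    by (intro nn_integral_cong_AE) (auto simp: indicator_def elim!: eventually_mono)
  also have "\<dots> = ennreal (Beta b a)"
    using nn_integral_has_integral_lebesgue[OF _ has_integral_Beta_real[OF assms(2,1)]] by simp
  finally have 1: "(NNINT s. ennreal (if 0 < s \<and> s < 1 then (1 - s) powr (a - 1) * s powr (b - 1) else 0)) = ennreal (Beta a b)"
    by (simp add: Beta_commute)
  let ?g = "\<lambda>s. ennreal (if 0 < s \<and> s < t then (t - s) powr (a - 1) * s powr (b - 1) else 0)"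
  have p: "(t - t * s) powr (a - 1) * (t * s) powr (b - 1) = t powr (a + b - 2) * ((1 - s) powr (a - 1) * s powr (b - 1))"
    if "0 < s" "s < 1" for s
  proof -
    have "t - t * s = t * (1 - s)" by (simp add: algebra_simps)
    moreover have "t powr (a + b - 2) = t powr (a - 1) * t powr (b - 1)"
      by (simp add: powr_add[symmetric] algebra_simps)
    ultimately show ?thesis using that assms by (simp add: powr_mult)
  qed
  have "(NNINT s. ?g s) = ennreal t * (NNINT s. ?g (0 + t * s))"
    using assms by (subst nn_integral_real_affine[of ?g t 0]) auto
  also have "(NNINT s. ?g (0 + t * s)) = (NNINT s. ennreal (t powr (a + b - 2)) * ennreal (if 0 < s \<and> s < 1 then (1 - s) powr (a - 1) * s powr (b - 1) else 0))"
    using assms by (intro nn_integral_cong) (auto simp: p zero_less_mult_iff simp flip: ennreal_mult')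
  also have "\<dots> = ennreal (t powr (a + b - 2)) * ennreal (Beta a b)"
    by (subst nn_integral_cmult) (auto simp: 1)
  also have "ennreal t * (ennreal (t powr (a + b - 2)) * ennreal (Beta a b)) = ennreal (t powr (a + b - 1) * Beta a b)"
  proof -
    have "t * t powr (a + b - 2) = t powr (a + b - 1)"
      using assms by (simp add: powr_mult_base)
    then show ?thesis using assms by (simp flip: ennreal_mult' mult.assoc)
  qed
  finally show ?thesis .
qed

lemma pk_mass:
  assumes "\<alpha> > 0" "lam > 0"
  shows "(NNINT (z::real \<times> 'a::euclidean_space). pk lam \<alpha> z) = ennreal (lam powr (- \<alpha> / 2))"
proof -
  let ?G = "Gamma (\<alpha> / 2)"
  have G: "?G > 0" using assms by (simp add: Gamma_real_pos)
  have "(NNINT (z::real \<times> 'a). pk lam \<alpha> z) = (NNINT s. NNINT (y::'a). pk lam \<alpha> (s, y))"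
    by (subst nn_integral_spacetime) auto
  also have "\<dots> = (NNINT s. ennreal (1 / ?G) * ennreal (if s > 0 then exp (- lam * s) * s powr (\<alpha> / 2 - 1) else 0))"
  proof (intro nn_integral_cong)
    fix s :: real
    show "(NNINT (y::'a). pk lam \<alpha> (s, y)) = ennreal (1 / ?G) * ennreal (if s > 0 then exp (- lam * s) * s powr (\<alpha> / 2 - 1) else 0)"
    proof (cases "s > 0")
      case True
      have "(NNINT (y::'a). pk lam \<alpha> (s, y)) = (NNINT (y::'a). ennreal (1 / ?G * (exp (- lam * s) * s powr (\<alpha> / 2 - 1))) * ennreal (heat s y))"
        using True G by (intro nn_integral_cong) (simp add: pk_def mult.assoc flip: ennreal_mult')
      also have "\<dots> = ennreal (1 / ?G * (exp (- lam * s) * s powr (\<alpha> / 2 - 1)))"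
        by (subst nn_integral_cmult) (auto simp: heat_mass True)
      finally show ?thesis using True G by (simp flip: ennreal_mult')
    qed (simp add: pk_def)
  qed
  also have "\<dots> = ennreal (1 / ?G) * ennreal (?G * lam powr (- (\<alpha> / 2)))"
    using assms by (subst nn_integral_cmult) (auto simp only: nn_integral_Gamma, auto)
  also have "\<dots> = ennreal (lam powr (- \<alpha> / 2))"
    using G by (simp flip: ennreal_mult')
  finally show ?thesis .
qed

text \<open>In space this is the Chapman--Kolmogorov identity; in time what remains is a Beta integral, and its value cancels the Gamma factors.\<close>

lemma pk_convolution:
  assumes "\<alpha> > 0" "\<beta> > 0"
  shows "(NNINT (w::real \<times> 'a::euclidean_space). ennreal (pk lam \<alpha> (z - w) * pk lam \<beta> w)) = ennreal (pk lam (\<alpha> + \<beta>) z)"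
proof -
  obtain t x where z: "z = (t, x)" by (cases z)
  let ?c = "1 / Gamma (\<alpha> / 2) * (1 / Gamma (\<beta> / 2))"
  have G: "Gamma (\<alpha> / 2) > 0" "Gamma (\<beta> / 2) > 0" "Gamma ((\<alpha> + \<beta>) / 2) > 0" "?c > 0"
    using assms by (simp_all add: Gamma_real_pos)
  have "(NNINT (w::real \<times> 'a). ennreal (pk lam \<alpha> (z - w) * pk lam \<beta> w))
     = (NNINT s. NNINT (y::'a). ennreal (pk lam \<alpha> (t - s, x - y) * pk lam \<beta> (s, y)))"
    by (subst nn_integral_spacetime) (auto simp: z)
  also have "\<dots> = (NNINT s. ennreal (?c * exp (- lam * t) * heat t x) *
       ennreal (if 0 < s \<and> s < t then (t - s) powr (\<alpha> / 2 - 1) * s powr (\<beta> / 2 - 1) else 0))"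
  proof (intro nn_integral_cong)
    fix s :: real
    show "(NNINT (y::'a). ennreal (pk lam \<alpha> (t - s, x - y) * pk lam \<beta> (s, y))) = ennreal (?c * exp (- lam * t) * heat t x) *
       ennreal (if 0 < s \<and> s < t then (t - s) powr (\<alpha> / 2 - 1) * s powr (\<beta> / 2 - 1) else 0)"
    proof (cases "0 < s \<and> s < t")
      case True
      let ?b = "?c * exp (- lam * t) * ((t - s) powr (\<alpha> / 2 - 1) * s powr (\<beta> / 2 - 1))"
      have e: "exp (- lam * (t - s)) * exp (- lam * s) = exp (- lam * t)"
        by (simp add: exp_add[symmetric] algebra_simps)
      have "(NNINT (y::'a). ennreal (pk lam \<alpha> (t - s, x - y) * pk lam \<beta> (s, y)))
        = (NNINT (y::'a). ennreal ?b * ennreal (heat (t - s) (x - y) * heat s y))"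
      proof (intro nn_integral_cong)
        fix y :: 'a
        have "pk lam \<alpha> (t - s, x - y) * pk lam \<beta> (s, y) = ?b * (heat (t - s) (x - y) * heat s y)"
          unfolding e[symmetric] using True by (simp add: pk_def)
        then show "ennreal (pk lam \<alpha> (t - s, x - y) * pk lam \<beta> (s, y)) = ennreal ?b * ennreal (heat (t - s) (x - y) * heat s y)"
          using G(1,2) by (simp only:) (rule ennreal_mult', simp)
      qed
      also have "\<dots> = ennreal ?b * ennreal (heat t x)"
        using True by (subst nn_integral_cmult) (auto simp: heat_chapman_kolmogorov)
      finally show ?thesis using True G by (simp add: heat_nonneg mult_ac flip: ennreal_mult')
    next
      case False
      then have *: "pk lam \<alpha> (t - s, x - y) * pk lam \<beta> (s, y) = 0" for y :: 'a
        by (auto simp: pk_def)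
      show ?thesis unfolding * using False by (simp only: if_False) simp
    qed
  qed
  also have "\<dots> = ennreal (?c * exp (- lam * t) * heat t x) *
     (NNINT s. ennreal (if 0 < s \<and> s < t then (t - s) powr (\<alpha> / 2 - 1) * s powr (\<beta> / 2 - 1) else 0))"
    by (subst nn_integral_cmult) auto
  also have "\<dots> = ennreal (pk lam (\<alpha> + \<beta>) z)"
  proof (cases "t > 0")
    case True
    have "ennreal (?c * exp (- lam * t) * heat t x) *
     (NNINT s. ennreal (if 0 < s \<and> s < t then (t - s) powr (\<alpha> / 2 - 1) * s powr (\<beta> / 2 - 1) else 0))
     = ennreal (?c * exp (- lam * t) * heat t x) * ennreal (t powr (\<alpha> / 2 + \<beta> / 2 - 1) * Beta (\<alpha> / 2) (\<beta> / 2))"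
      using assms True by (subst nn_integral_Beta) auto
    also have "\<dots> = ennreal (?c * exp (- lam * t) * heat t x * (t powr (\<alpha> / 2 + \<beta> / 2 - 1) * Beta (\<alpha> / 2) (\<beta> / 2)))"
      using G by (subst ennreal_mult') (auto simp: heat_nonneg)
    also have "?c * exp (- lam * t) * heat t x * (t powr (\<alpha> / 2 + \<beta> / 2 - 1) * Beta (\<alpha> / 2) (\<beta> / 2)) = pk lam (\<alpha> + \<beta>) z"
      using True G by (simp add: pk_def z Beta_def add_divide_distrib)
    finally show ?thesis .
  next
    case False
    then have "(\<lambda>s. ennreal (if 0 < s \<and> s < t then (t - s) powr (\<alpha> / 2 - 1) * s powr (\<beta> / 2 - 1) else 0)) = (\<lambda>s. 0)"
      by auto
    with False show ?thesis by (simp add: pk_def z)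
  qed
  finally show ?thesis .
qed

section \<open>Real powers of extended nonnegative numbers\<close>

text \<open>Values in \<open>[0, \<infinity>]\<close> allow integral operators and maximal functions to be estimated before they are known to be finite.\<close>

definition epowr :: "ennreal \<Rightarrow> real \<Rightarrow> ennreal" where
  "epowr x p = (if x = top then top else ennreal (enn2real x powr p))"

lemma epowr_ennreal: "0 \<le> a \<Longrightarrow> epowr (ennreal a) p = ennreal (a powr p)"
  by (simp add: epowr_def)

lemma epowr_top[simp]: "epowr top p = top"
  by (simp add: epowr_def)

lemma epowr_0[simp]: "epowr 0 p = 0"
  by (simp add: epowr_def)

lemma epowr_1[simp]: "epowr x 1 = x"
  by (cases x) (auto simp: epowr_def)

lemma epowr_eq_top_iff[simp]: "epowr x p = top \<longleftrightarrow> x = top"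
  by (simp add: epowr_def)

lemma epowr_eq_0_iff[simp]: "epowr x p = 0 \<longleftrightarrow> x = 0"
  by (cases x) (auto simp: epowr_def)

lemma epowr_mono: "x \<le> y \<Longrightarrow> 0 \<le> p \<Longrightarrow> epowr x p \<le> epowr y p"
  by (cases x; cases y) (auto simp: epowr_def top_unique intro!: ennreal_leI powr_mono2)

lemma epowr_mult: "epowr (x * y) p = epowr x p * epowr y p"
  by (cases x; cases y)
     (auto simp: epowr_def ennreal_mult_eq_top_iff ennreal_mult_top ennreal_top_mult powr_mult enn2real_mult simp flip: ennreal_mult)

lemma epowr_epowr: "epowr (epowr x a) b = epowr x (a * b)"
  by (cases x) (auto simp: epowr_def powr_powr)

lemma epowr_add_exponents: "epowr x (a + b) = epowr x a * epowr x b"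
  by (cases x) (auto simp: epowr_def powr_add ennreal_mult)

lemma epowr_measurable[measurable (raw)]:
  assumes [measurable]: "f \<in> borel_measurable M"
  shows "(\<lambda>x. epowr (f x) p) \<in> borel_measurable M"
  unfolding epowr_def by measurable

lemma epowr_add_le:
  assumes "0 \<le> p"
  shows "epowr (x + y) p \<le> ennreal (2 powr p) * (epowr x p + epowr y p)"
proof -
  have "x + y \<le> ennreal 2 * max x y"
  proof -
    have "x + y \<le> max x y + max x y" by (intro add_mono) auto
    then show ?thesis by (simp add: mult_2)
  qed
  then have "epowr (x + y) p \<le> epowr (ennreal 2 * max x y) p"
    using assms by (rule epowr_mono)
  also have "\<dots> = ennreal (2 powr p) * epowr (max x y) p"
    by (simp add: epowr_mult epowr_ennreal del: ennreal_numeral)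
  also have "epowr (max x y) p \<le> epowr x p + epowr y p"
    by (auto simp: max_def)
  finally show ?thesis by (simp add: mult_left_mono)
qed

lemma conjugate_exponents:
  fixes p q :: real
  assumes "1 < p" "1 / p + 1 / q = 1"
  shows "1 < q" "q = p / (p - 1)" "p / q = p - 1"
proof -
  have q: "q \<noteq> 0" using assms by auto
  have e: "q + p = p * q" using assms q by (simp add: field_simps)
  then have e2: "q * (p - 1) = p" by (simp add: algebra_simps)
  then show 2: "q = p / (p - 1)" using assms by (simp add: field_simps)
  show "1 < q" unfolding 2 using assms by (simp add: field_simps)
  show "p / q = p - 1" using e2 q by (simp add: field_simps)
qed

text \<open>The free parameters \<open>a\<close> and \<open>b\<close> are later taken to be the two norms in Hoelder's inequality, which normalises both factors.\<close>

lemma Young_epowr: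
  assumes p: "1 < p" "1 / p + 1 / q = 1" and ab: "a > 0" "b > 0"
  shows "x * y \<le> ennreal (a * b / p / a powr p) * epowr x p + ennreal (a * b / q / b powr q) * epowr y q"
proof -
  note q = conjugate_exponents[OF p]
  show ?thesis
  proof (cases "x = top \<or> y = top")
    case True
    have "a * b / p / a powr p > 0" "a * b / q / b powr q > 0" using p q ab by auto
    then show ?thesis using True
      by (auto simp: ennreal_mult_top top_unique)
  next
    case False
    then obtain r s where rs: "x = ennreal r" "y = ennreal s" "0 \<le> r" "0 \<le> s"
      by (cases x; cases y) auto
    have "(r / a) * (s / b) \<le> (r / a) powr p / p + (s / b) powr q / q"
      using p q rs ab by (intro Youngs_inequality) auto
    then have "a * b * ((r / a) * (s / b)) \<le> a * b * ((r / a) powr p / p + (s / b) powr q / q)"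
      using ab by (intro mult_left_mono) auto
    then have "r * s \<le> a * b / p / a powr p * r powr p + a * b / q / b powr q * s powr q"
      using ab rs by (simp add: powr_divide algebra_simps)
    then have "ennreal (r * s) \<le> ennreal (a * b / p / a powr p * r powr p + a * b / q / b powr q * s powr q)"
      by (rule ennreal_leI)
    also have "\<dots> = ennreal (a * b / p / a powr p) * ennreal (r powr p) + ennreal (a * b / q / b powr q) * ennreal (s powr q)"
    proof -
      have "0 \<le> a * b / p / a powr p" "0 \<le> a * b / q / b powr q" using p(1) q(1) ab by auto
      then show ?thesis by (simp only: ennreal_plus ennreal_mult powr_ge_zero mult_nonneg_nonneg)
    qed
    finally show ?thesis using rs by (simp add: epowr_ennreal ennreal_mult)
  qed
qed

lemma Hoelder_nn_integral:
  assumes p: "1 < p" "1 / p + 1 / q = 1"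
    and [measurable]: "f \<in> borel_measurable M" "g \<in> borel_measurable M"
  shows "(\<integral>\<^sup>+x. f x * g x \<partial>M) \<le> epowr (\<integral>\<^sup>+x. epowr (f x) p \<partial>M) (1 / p) * epowr (\<integral>\<^sup>+x. epowr (g x) q \<partial>M) (1 / q)"
proof -
  note q = conjugate_exponents[OF p]
  let ?I = "\<integral>\<^sup>+x. epowr (f x) p \<partial>M" and ?J = "\<integral>\<^sup>+x. epowr (g x) q \<partial>M"
  consider "?I = 0 \<or> ?J = 0" | "?I \<noteq> 0" "?J \<noteq> 0" "?I = top \<or> ?J = top"
    | "?I \<noteq> 0" "?J \<noteq> 0" "?I \<noteq> top" "?J \<noteq> top" by blast
  then show ?thesis
  proof cases
    case 1
    then have "(AE x in M. f x = 0) \<or> (AE x in M. g x = 0)"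
      by (auto simp: nn_integral_0_iff_AE)
    then have "AE x in M. f x * g x = 0" by (auto elim!: eventually_mono)
    then have "(\<integral>\<^sup>+x. f x * g x \<partial>M) = 0" by (subst nn_integral_0_iff_AE) auto
    then show ?thesis by simp
  next
    case 2
    then have "epowr ?I (1 / p) * epowr ?J (1 / q) = top"
      by (auto simp: ennreal_mult_eq_top_iff)
    then show ?thesis by simp
  next
    case 3
    define a where "a = enn2real ?I powr (1 / p)"
    define b where "b = enn2real ?J powr (1 / q)"
    have pos: "enn2real ?I > 0" "enn2real ?J > 0" using 3
      by (auto simp: enn2real_positive_iff less_top zero_less_iff_neq_zero)
    then have ab: "a > 0" "b > 0" by (auto simp: a_def b_def)
    have IJ: "?I = ennreal (a powr p)" "?J = ennreal (b powr q)"
    proof -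
      have "a powr p = enn2real ?I" "b powr q = enn2real ?J"
        using p(1) q(1) pos by (auto simp: a_def b_def powr_powr)
      then show "?I = ennreal (a powr p)" "?J = ennreal (b powr q)"
        using 3(3,4) by (simp_all only: ennreal_enn2real less_top)
    qed
    have "(\<integral>\<^sup>+x. f x * g x \<partial>M) \<le> (\<integral>\<^sup>+x. ennreal (a * b / p / a powr p) * epowr (f x) p + ennreal (a * b / q / b powr q) * epowr (g x) q \<partial>M)"
      by (intro nn_integral_mono Young_epowr p ab)
    also have "\<dots> = ennreal (a * b / p / a powr p) * ?I + ennreal (a * b / q / b powr q) * ?J"
      by (simp add: nn_integral_add nn_integral_cmult)
    also have "\<dots> = ennreal (a * b / p + a * b / q)"
    proof -
      have "ennreal (a * b / p / a powr p) * ennreal (a powr p) = ennreal (a * b / p)"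
        using ab p(1) by (subst ennreal_mult[symmetric]) auto
      moreover have "ennreal (a * b / q / b powr q) * ennreal (b powr q) = ennreal (a * b / q)"
        using ab q(1) by (subst ennreal_mult[symmetric]) auto
      ultimately show ?thesis unfolding IJ using ab p(1) q(1) by (subst ennreal_plus) auto
    qed
    also have "a * b / p + a * b / q = a * b * (1 / p + 1 / q)" by (simp add: algebra_simps)
    also have "\<dots> = a * b" by (simp only: p mult_1_right)
    also have "ennreal (a * b) = epowr ?I (1 / p) * epowr ?J (1 / q)"
    proof -
      have "epowr ?I (1 / p) = ennreal a" "epowr ?J (1 / q) = ennreal b"
        unfolding IJ using ab p(1) q(1) by (subst epowr_ennreal; simp add: powr_powr)+
      then show ?thesis using ab by (simp only: ennreal_mult less_imp_le)
    qed
    finally show ?thesis .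
  qed
qed

text \<open>Jensen's inequality for the measure with density \<open>h\<close>, obtained from Hoelder's inequality; it is the form that Schur's test uses.\<close>

lemma power_mean_nn_integral:
  assumes p: "1 < p"
    and [measurable]: "g \<in> borel_measurable M" "h \<in> borel_measurable M"
  shows "epowr (\<integral>\<^sup>+x. g x * h x \<partial>M) p \<le> epowr (\<integral>\<^sup>+x. h x \<partial>M) (p - 1) * (\<integral>\<^sup>+x. epowr (g x) p * h x \<partial>M)"
proof -
  define q where "q = p / (p - 1)"
  have pq: "1 / p + 1 / q = 1" using p by (simp add: q_def field_simps)
  note q = conjugate_exponents[OF p pq]
  have y: "epowr y (1 / p) * epowr y (1 / q) = y" for y
    unfolding epowr_add_exponents[symmetric] pq by (rule epowr_1)
  have "(\<integral>\<^sup>+x. g x * h x \<partial>M) = (\<integral>\<^sup>+x. (g x * epowr (h x) (1 / p)) * epowr (h x) (1 / q) \<partial>M)"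
    by (simp only: mult.assoc y)
  also have "\<dots> \<le> epowr (\<integral>\<^sup>+x. epowr (g x * epowr (h x) (1 / p)) p \<partial>M) (1 / p)
      * epowr (\<integral>\<^sup>+x. epowr (epowr (h x) (1 / q)) q \<partial>M) (1 / q)"
    by (intro Hoelder_nn_integral p pq) auto
  also have "\<dots> = epowr (\<integral>\<^sup>+x. epowr (g x) p * h x \<partial>M) (1 / p) * epowr (\<integral>\<^sup>+x. h x \<partial>M) (1 / q)"
    using p(1) q(1) by (simp add: epowr_mult epowr_epowr)
  finally have "epowr (\<integral>\<^sup>+x. g x * h x \<partial>M) p \<le> epowr (epowr (\<integral>\<^sup>+x. epowr (g x) p * h x \<partial>M) (1 / p) * epowr (\<integral>\<^sup>+x. h x \<partial>M) (1 / q)) p"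
    using p by (intro epowr_mono) auto
  also have "\<dots> = (\<integral>\<^sup>+x. epowr (g x) p * h x \<partial>M) * epowr (\<integral>\<^sup>+x. h x \<partial>M) (1 / q * p)"
    unfolding epowr_mult epowr_epowr using p by simp
  also have "1 / q * p = p - 1" using q(3) by simp
  finally show ?thesis by (simp only: mult.commute)
qed

section \<open>Schur's test\<close>

text \<open>Insert \<open>\<phi>\<close> and its reciprocal, apply the power mean inequality with the weight \<open>k \<phi>\<close>, and exchange the integrals. Allowing \<open>\<psi>\<close> to differ from \<open>\<phi>\<close> keeps the two integral conditions separate.\<close>

lemma Schur_test:
  fixes k :: "'b::euclidean_space \<times> 'c::euclidean_space \<Rightarrow> ennreal"
  assumes p: "1 < p"
    and k: "k \<in> borel_measurable borel"
    and [measurable]: "\<phi> \<in> borel_measurable borel" "\<psi> \<in> borel_measurable borel" "f \<in> borel_measurable borel"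
    and pos: "AE w in lborel. 0 < \<phi> w" and psi: "\<And>z. 0 \<le> \<psi> z" and A: "0 \<le> A"
    and 1: "AE z in lborel. (NNINT w. k (z, w) * ennreal (\<phi> w)) \<le> ennreal (A * \<psi> z)"
    and 2: "AE w in lborel. (NNINT z. k (z, w) * ennreal (\<psi> z powr (p - 1))) \<le> ennreal (B * \<phi> w powr (p - 1))"
  shows "(NNINT z. epowr (NNINT w. k (z, w) * f w) p)
    \<le> ennreal (A powr (p - 1) * B) * (NNINT w. epowr (f w) p)"
proof -
  have [measurable]: "k \<in> borel_measurable (borel \<Otimes>\<^sub>M borel)"
    using k by (simp add: borel_prod)
  let ?g = "\<lambda>w. epowr (f w) p * ennreal (\<phi> w powr (1 - p))"
  have step: "AE z in lborel. epowr (NNINT w. k (z, w) * f w) p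
      \<le> ennreal (A powr (p - 1)) * (NNINT w. ennreal (\<psi> z powr (p - 1)) * (k (z, w) * ?g w))"
    using 1
  proof eventually_elim
    fix z assume z: "(NNINT w. k (z, w) * ennreal (\<phi> w)) \<le> ennreal (A * \<psi> z)"
    have "(NNINT w. k (z, w) * f w) = (NNINT w. (f w * ennreal (1 / \<phi> w)) * (k (z, w) * ennreal (\<phi> w)))"
      using pos
    proof (intro nn_integral_cong_AE, eventually_elim)
      fix w assume w: "0 < \<phi> w"
      then have "ennreal (1 / \<phi> w) * ennreal (\<phi> w) = ennreal (1 / \<phi> w * \<phi> w)"
        by (intro ennreal_mult[symmetric]) auto
      with w have e: "ennreal (1 / \<phi> w) * ennreal (\<phi> w) = 1" by simp
      have "k (z, w) * f w = k (z, w) * f w * (ennreal (1 / \<phi> w) * ennreal (\<phi> w))"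
        by (simp only: e mult_1_right)
      also have "\<dots> = f w * ennreal (1 / \<phi> w) * (k (z, w) * ennreal (\<phi> w))"
        by (simp only: mult_ac)
      finally show "k (z, w) * f w = f w * ennreal (1 / \<phi> w) * (k (z, w) * ennreal (\<phi> w))" .
    qed
    then have "epowr (NNINT w. k (z, w) * f w) p = epowr (NNINT w. (f w * ennreal (1 / \<phi> w)) * (k (z, w) * ennreal (\<phi> w))) p"
      by (rule arg_cong)
    also have "\<dots> \<le> epowr (NNINT w. k (z, w) * ennreal (\<phi> w)) (p - 1)
        * (NNINT w. epowr (f w * ennreal (1 / \<phi> w)) p * (k (z, w) * ennreal (\<phi> w)))"
      by (rule power_mean_nn_integral[OF p]) measurable
    also have "\<dots> \<le> epowr (ennreal (A * \<psi> z)) (p - 1)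
        * (NNINT w. epowr (f w * ennreal (1 / \<phi> w)) p * (k (z, w) * ennreal (\<phi> w)))"
      using z p by (intro mult_right_mono epowr_mono) auto
    also have "epowr (ennreal (A * \<psi> z)) (p - 1) = ennreal (A powr (p - 1)) * ennreal (\<psi> z powr (p - 1))"
      by (subst epowr_ennreal) (use A psi[of z] in \<open>simp_all add: powr_mult ennreal_mult\<close>)
    also have "(NNINT w. epowr (f w * ennreal (1 / \<phi> w)) p * (k (z, w) * ennreal (\<phi> w)))
       = (NNINT w. k (z, w) * ?g w)"
      using pos
    proof (intro nn_integral_cong_AE, eventually_elim)
      fix w assume w: "0 < \<phi> w"
      have "(1 / \<phi> w) powr p * \<phi> w = \<phi> w powr (1 - p)"
        using w by (simp add: powr_diff powr_divide)
      then have e: "ennreal ((1 / \<phi> w) powr p) * ennreal (\<phi> w) = ennreal (\<phi> w powr (1 - p))"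
        using ennreal_mult'[of "(1 / \<phi> w) powr p" "\<phi> w"] by simp
      show "epowr (f w * ennreal (1 / \<phi> w)) p * (k (z, w) * ennreal (\<phi> w)) = k (z, w) * ?g w"
      proof -
        have "epowr (ennreal (1 / \<phi> w)) p = ennreal ((1 / \<phi> w) powr p)"
          using w by (intro epowr_ennreal) simp
        then show ?thesis unfolding e[symmetric] by (simp only: epowr_mult mult_ac)
      qed
    qed
    finally show "epowr (NNINT w. k (z, w) * f w) p
      \<le> ennreal (A powr (p - 1)) * (NNINT w. ennreal (\<psi> z powr (p - 1)) * (k (z, w) * ?g w))"
      by (subst nn_integral_cmult) (measurable, simp only: mult.assoc)
  qed
  have "(NNINT z. epowr (NNINT w. k (z, w) * f w) p)
      \<le> (NNINT z. ennreal (A powr (p - 1)) * (NNINT w. ennreal (\<psi> z powr (p - 1)) * (k (z, w) * ?g w)))"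
    by (rule nn_integral_mono_AE[OF step])
  also have "\<dots> = ennreal (A powr (p - 1)) * (NNINT z. NNINT w. ennreal (\<psi> z powr (p - 1)) * (k (z, w) * ?g w))"
    by (rule nn_integral_cmult) measurable
  also have "(NNINT z. NNINT w. ennreal (\<psi> z powr (p - 1)) * (k (z, w) * ?g w))
     = (NNINT w. NNINT z. ennreal (\<psi> z powr (p - 1)) * (k (z, w) * ?g w))"
    by (rule lborel_pair.Fubini'[symmetric]) measurable
  also have "\<dots> = (NNINT w. ?g w * (NNINT z. k (z, w) * ennreal (\<psi> z powr (p - 1))))"
  proof (rule nn_integral_cong)
    fix w
    have "(NNINT z. ennreal (\<psi> z powr (p - 1)) * (k (z, w) * ?g w)) = (NNINT z. ?g w * (k (z, w) * ennreal (\<psi> z powr (p - 1))))"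
      by (simp only: mult_ac)
    also have "\<dots> = ?g w * (NNINT z. k (z, w) * ennreal (\<psi> z powr (p - 1)))"
      by (rule nn_integral_cmult) measurable
    finally show "(NNINT z. ennreal (\<psi> z powr (p - 1)) * (k (z, w) * ?g w)) = ?g w * (NNINT z. k (z, w) * ennreal (\<psi> z powr (p - 1)))" .
  qed
  also have "\<dots> \<le> (NNINT w. ennreal B * epowr (f w) p)"
    using 2 pos
  proof (intro nn_integral_mono_AE, eventually_elim)
    fix w assume w: "0 < \<phi> w" and le: "(NNINT z. k (z, w) * ennreal (\<psi> z powr (p - 1))) \<le> ennreal (B * \<phi> w powr (p - 1))"
    have "?g w * (NNINT z. k (z, w) * ennreal (\<psi> z powr (p - 1))) \<le> ?g w * ennreal (B * \<phi> w powr (p - 1))"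
      by (intro mult_left_mono le) simp
    also have "\<dots> = epowr (f w) p * ennreal (\<phi> w powr (1 - p) * (B * \<phi> w powr (p - 1)))"
      by (subst ennreal_mult') (auto simp: mult.assoc)
    also have "\<phi> w powr (1 - p) * (B * \<phi> w powr (p - 1)) = B"
    proof -
      have "\<phi> w powr (1 - p) * \<phi> w powr (p - 1) = 1" using w by (simp flip: powr_add)
      then have "B * (\<phi> w powr (1 - p) * \<phi> w powr (p - 1)) = B" by simp
      then show ?thesis by (simp only: mult_ac)
    qed
    finally show "?g w * (NNINT z. k (z, w) * ennreal (\<psi> z powr (p - 1))) \<le> ennreal B * epowr (f w) p"
      by (simp only: mult.commute)
  qed
  also have "\<dots> = ennreal B * (NNINT w. epowr (f w) p)"
    by (rule nn_integral_cmult) measurable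
  finally show ?thesis
    by (simp only: ennreal_mult' mult.assoc powr_ge_zero) (simp add: mult_left_mono)
qed

section \<open>Parabolic balls\<close>

text \<open>The distance for the scaling of \<open>\<partial>_t - \<Delta>\<close>: balls of radius \<open>r\<close> extend over \<open>r^2\<close> in time, so that space-time has homogeneous dimension \<open>d + 2\<close>.\<close>

definition pdist :: "real \<times> 'a::euclidean_space \<Rightarrow> real \<times> 'a \<Rightarrow> real" where
  "pdist z w = max (sqrt \<bar>fst z - fst w\<bar>) (norm (snd z - snd w))"

definition pball :: "real \<times> 'a::euclidean_space \<Rightarrow> real \<Rightarrow> (real \<times> 'a) set" where
  "pball z r = {w. pdist z w < r}"

lemma pdist_nonneg: "0 \<le> pdist z w"
  by (simp add: pdist_def le_max_iff_disj)

lemma pdist_commute: "pdist z w = pdist w z"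
  by (simp add: pdist_def abs_minus_commute norm_minus_commute)

lemma pdist_self[simp]: "pdist z z = 0"
  by (simp add: pdist_def)

lemma pdist_triangle: "pdist x z \<le> pdist x y + pdist y z"
proof -
  have "sqrt \<bar>fst x - fst z\<bar> \<le> sqrt (\<bar>fst x - fst y\<bar> + \<bar>fst y - fst z\<bar>)"
    by simp
  also have "\<dots> \<le> sqrt \<bar>fst x - fst y\<bar> + sqrt \<bar>fst y - fst z\<bar>"
    by (rule sqrt_add_le_add_sqrt) auto
  finally have 1: "sqrt \<bar>fst x - fst z\<bar> \<le> pdist x y + pdist y z"
    unfolding pdist_def by (smt (verit))
  have "norm (snd x - snd z) \<le> norm (snd x - snd y) + norm (snd y - snd z)"
    using norm_triangle_ineq[of "snd x - snd y" "snd y - snd z"] by simp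
  then have 2: "norm (snd x - snd z) \<le> pdist x y + pdist y z"
    unfolding pdist_def by (smt (verit))
  from 1 2 show ?thesis unfolding pdist_def[of x z] by simp
qed

lemma continuous_pdist: "continuous_on UNIV (\<lambda>w. pdist z w)"
  unfolding pdist_def by (intro continuous_intros)

lemma pdist_measurable[measurable (raw)]:
  fixes f g :: "'b \<Rightarrow> real \<times> 'a::euclidean_space"
  assumes [measurable]: "f \<in> borel_measurable M" "g \<in> borel_measurable M"
  shows "(\<lambda>x. pdist (f x) (g x)) \<in> borel_measurable M"
proof -
  have "continuous_on UNIV (\<lambda>p::(real \<times> 'a) \<times> (real \<times> 'a). pdist (fst p) (snd p))"
    unfolding pdist_def by (intro continuous_intros)
  then have "(\<lambda>p::(real \<times> 'a) \<times> (real \<times> 'a). pdist (fst p) (snd p)) \<in> borel_measurable borel"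
    by (rule borel_measurable_continuous_onI)
  then have "(\<lambda>p::(real \<times> 'a) \<times> (real \<times> 'a). pdist (fst p) (snd p)) \<in> borel_measurable (borel \<Otimes>\<^sub>M borel)"
    by (simp add: borel_prod)
  moreover have "(\<lambda>x. (f x, g x)) \<in> M \<rightarrow>\<^sub>M borel \<Otimes>\<^sub>M borel" by measurable
  ultimately have "(\<lambda>x. (\<lambda>p. pdist (fst p) (snd p)) (f x, g x)) \<in> borel_measurable M"
    by (rule measurable_compose[rotated])
  then show ?thesis by simp
qed

lemma open_pball: "open (pball z r)"
  unfolding pball_def by (intro open_Collect_less continuous_pdist continuous_on_const)

lemma sets_pball[measurable, simp]: "pball z r \<in> sets borel"
  by (simp add: open_pball)

lemma mem_pball: "w \<in> pball z r \<longleftrightarrow> pdist z w < r"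
  by (simp add: pball_def)

lemma pball_subset: "pdist z w + r \<le> R \<Longrightarrow> pball w r \<subseteq> pball z R"
proof
  fix y assume "pdist z w + r \<le> R" "y \<in> pball w r"
  then show "y \<in> pball z R"
    using pdist_triangle[of z y w] by (simp add: mem_pball)
qed

definition pball_const :: "'a::euclidean_space itself \<Rightarrow> real" where
  "pball_const _ = 2 * unit_ball_vol (real DIM('a))"

lemma pball_const_pos: "0 < pball_const TYPE('a::euclidean_space)"
  by (simp add: pball_const_def)

lemma emeasure_pball:
  assumes "0 < r"
  shows "emeasure lborel (pball (z :: real \<times> 'a::euclidean_space) r)
    = ennreal (pball_const TYPE('a) * r ^ (DIM('a) + 2))"
proof -
  have sq: "sqrt \<bar>x\<bar> < r \<longleftrightarrow> \<bar>x\<bar> < r\<^sup>2" for x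
    using assms real_sqrt_less_iff[of "\<bar>x\<bar>" "r\<^sup>2"] by simp
  have "w \<in> pball z r \<longleftrightarrow> w \<in> ball (fst z) (r\<^sup>2) \<times> ball (snd z) r" for w
  proof -
    have "w \<in> pball z r \<longleftrightarrow> sqrt \<bar>fst z - fst w\<bar> < r \<and> norm (snd z - snd w) < r"
      unfolding pball_def pdist_def by (simp only: mem_Collect_eq max_less_iff_conj)
    also have "\<dots> \<longleftrightarrow> w \<in> ball (fst z) (r\<^sup>2) \<times> ball (snd z) r"
      unfolding sq mem_Times_iff mem_ball dist_norm real_norm_def ..
    finally show ?thesis .
  qed
  then have "pball z r = ball (fst z) (r\<^sup>2) \<times> ball (snd z) r" by blast
  then have "emeasure lborel (pball z r) = emeasure lborel (ball (fst z) (r\<^sup>2)) * emeasure lborel (ball (snd z) r)"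
    by (simp add: lborel_prod[symmetric] lborel.emeasure_pair_measure_Times)
  also have "\<dots> = ennreal (2 * r\<^sup>2) * ennreal (unit_ball_vol (real DIM('a)) * r ^ DIM('a))"
    using assms by (simp add: emeasure_ball)
  also have "\<dots> = ennreal (pball_const TYPE('a) * r ^ (DIM('a) + 2))"
    using assms by (simp add: pball_const_def power_add mult_ac power2_eq_square flip: ennreal_mult)
  finally show ?thesis .
qed

text \<open>Choose a ball of largest radius, discard all balls that meet it (they lie in its threefold enlargement), and continue by induction on the number of balls.\<close>

lemma finite_Vitali_covering:
  fixes x :: "'i \<Rightarrow> real \<times> 'a::euclidean_space"
  assumes "finite I" "\<And>i. i \<in> I \<Longrightarrow> 0 < r i"
  shows "\<exists>J\<subseteq>I. disjoint_family_on (\<lambda>i. pball (x i) (r i)) J \<and>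
     (\<Union>i\<in>I. pball (x i) (r i)) \<subseteq> (\<Union>j\<in>J. pball (x j) (3 * r j))"
  using assms
proof (induction I rule: finite_psubset_induct)
  case (psubset I)
  show ?case
  proof (cases "I = {}")
    case False
    then have "Max (r ` I) \<in> r ` I" using psubset.hyps by auto
    then obtain m where m: "m \<in> I" "r m = Max (r ` I)" by auto
    have rm: "r i \<le> r m" if "i \<in> I" for i using that psubset.hyps m by auto
    define I' where "I' = {i \<in> I. pball (x i) (r i) \<inter> pball (x m) (r m) = {}}"
    have "x m \<in> pball (x m) (r m)" using psubset.prems[OF m(1)] by (simp add: mem_pball)
    then have "m \<notin> I'" by (auto simp: I'_def)
    moreover have "I' \<subseteq> I" by (auto simp: I'_def)
    ultimately have "I' \<subset> I" using m(1) by blast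
    with psubset.IH[of I'] psubset.prems obtain J where
      J: "J \<subseteq> I'" "disjoint_family_on (\<lambda>i. pball (x i) (r i)) J"
        "(\<Union>i\<in>I'. pball (x i) (r i)) \<subseteq> (\<Union>j\<in>J. pball (x j) (3 * r j))"
      by (metis (no_types, lifting) psubset_imp_subset subset_iff)
    have "disjoint_family_on (\<lambda>i. pball (x i) (r i)) (insert m J)"
      using J(1,2) unfolding disjoint_family_on_def I'_def by blast
    moreover have "pball (x i) (r i) \<subseteq> (\<Union>j\<in>insert m J. pball (x j) (3 * r j))" if i: "i \<in> I" for i
    proof (cases "i \<in> I'")
      case True then show ?thesis using J(3) by blast
    next
      case False
      then obtain w where w: "pdist (x i) w < r i" "pdist (x m) w < r m"
        using i by (auto simp: I'_def mem_pball)
      have "pdist (x m) (x i) \<le> pdist (x m) w + pdist w (x i)" by (rule pdist_triangle)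
      with w rm[OF i] have "pdist (x m) (x i) + r i \<le> 3 * r m" by (simp add: pdist_commute[of w])
      then show ?thesis using pball_subset by blast
    qed
    ultimately show ?thesis using J(1) m \<open>I' \<subset> I\<close>
      by (intro exI[of _ "insert m J"]) blast
  qed (auto simp: disjoint_family_on_def)
qed

section \<open>The parabolic maximal function\<close>

text \<open>The supremum runs over all balls containing \<open>z\<close>, not only over those centred at \<open>z\<close>; this makes the superlevel sets open.\<close>

definition pmax :: "(real \<times> 'a::euclidean_space \<Rightarrow> ennreal) \<Rightarrow> real \<times> 'a \<Rightarrow> ennreal" where
  "pmax f z = (SUP (x, r)\<in>{(x, r). 0 < r \<and> z \<in> pball x r}.
     (\<integral>\<^sup>+w\<in>pball x r. f w \<partial>lborel) * ennreal (1 / (pball_const TYPE('a) * r ^ (DIM('a) + 2))))"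

lemma pmax_ge:
  fixes f :: "real \<times> 'a::euclidean_space \<Rightarrow> ennreal"
  assumes "0 < r" "z \<in> pball x r"
  shows "(\<integral>\<^sup>+w\<in>pball x r. f w \<partial>lborel) * ennreal (1 / (pball_const TYPE('a) * r ^ (DIM('a) + 2))) \<le> pmax f z"
  unfolding pmax_def using assms by (intro SUP_upper2[of "(x, r)"]) auto

lemma nn_integral_pball_le_pmax:
  fixes f :: "real \<times> 'a::euclidean_space \<Rightarrow> ennreal"
  assumes r: "0 < r" "z \<in> pball x r"
  shows "(\<integral>\<^sup>+w\<in>pball x r. f w \<partial>lborel) \<le> pmax f z * ennreal (pball_const TYPE('a) * r ^ (DIM('a) + 2))"
proof -
  define v where "v = pball_const TYPE('a) * r ^ (DIM('a) + 2)"
  have v: "v > 0" using r pball_const_pos[where 'a='a] by (simp add: v_def)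
  have "ennreal (1 / v) * ennreal v = ennreal (1 / v * v)"
    using v by (intro ennreal_mult[symmetric]) auto
  then have "(\<integral>\<^sup>+w\<in>pball x r. f w \<partial>lborel) = (\<integral>\<^sup>+w\<in>pball x r. f w \<partial>lborel) * (ennreal (1 / v) * ennreal v)"
    using v by simp
  also have "\<dots> \<le> pmax f z * ennreal v"
    unfolding mult.assoc[symmetric] v_def by (intro mult_right_mono pmax_ge r) simp
  finally show ?thesis unfolding v_def .
qed

lemma pmax_superlevel:
  "{z. t < pmax f z} = (\<Union>(x, r)\<in>{(x, r). 0 < r \<and> t < (\<integral>\<^sup>+w\<in>pball x r. f w \<partial>lborel) * ennreal (1 / (pball_const TYPE('a) * r ^ (DIM('a) + 2)))}. pball (x :: real \<times> 'a::euclidean_space) r)"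
  unfolding pmax_def less_SUP_iff by fastforce

lemma open_pmax_superlevel: "open {z :: real \<times> 'a::euclidean_space. t < pmax f z}"
  unfolding pmax_superlevel by (auto intro!: open_UN open_pball)

lemma pmax_measurable[measurable]: "pmax f \<in> borel_measurable borel"
  by (rule borel_measurableI_greater) (simp add: open_pmax_superlevel)

lemma pmax_measurable'[measurable (raw)]:
  "g \<in> borel_measurable M \<Longrightarrow> (\<lambda>x. pmax f (g x)) \<in> borel_measurable M"
  using measurable_compose[OF _ pmax_measurable] by blast

text \<open>A compact subset of the superlevel set is covered by finitely many balls on which the average exceeds \<open>t\<close>; the Vitali selection makes them disjoint at the cost of the factor \<open>3^(d+2)\<close>.\<close>

lemma pmax_weak_type:
  fixes f :: "real \<times> 'a::euclidean_space \<Rightarrow> ennreal"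
  assumes t: "0 < t" and [measurable]: "f \<in> borel_measurable borel"
  shows "emeasure lborel {z. ennreal t < pmax f z} \<le> ennreal (3 ^ (DIM('a) + 2) / t) * (NNINT w. f w)"
proof -
  let ?U = "{z. ennreal t < pmax f z}"
  let ?D = "DIM('a) + 2" and ?c = "pball_const TYPE('a)"
  define S where "S = {(x :: real \<times> 'a, r). 0 < r \<and> ennreal t < (\<integral>\<^sup>+w\<in>pball x r. f w \<partial>lborel) * ennreal (1 / (?c * r ^ ?D))}"
  have U: "?U = (\<Union>i\<in>S. pball (fst i) (snd i))"
    unfolding pmax_superlevel S_def by auto
  have small: "emeasure lborel (pball (fst i) (3 * snd i)) \<le> ennreal (3 ^ ?D / t) * (\<integral>\<^sup>+w\<in>pball (fst i) (snd i). f w \<partial>lborel)"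
    if "i \<in> S" for i
  proof -
    obtain x r where i: "i = (x, r)" by (cases i)
    have r: "0 < r" and *: "ennreal t < (\<integral>\<^sup>+w\<in>pball x r. f w \<partial>lborel) * ennreal (1 / (?c * r ^ ?D))"
      using that by (auto simp: S_def i)
    define v where "v = ?c * r ^ ?D"
    have v: "v > 0" using r pball_const_pos[where 'a='a] by (simp add: v_def)
    have "ennreal (3 ^ ?D * v) = ennreal (3 ^ ?D * v / t) * ennreal t"
      using t v by (simp flip: ennreal_mult)
    also have "\<dots> \<le> ennreal (3 ^ ?D * v / t) * ((\<integral>\<^sup>+w\<in>pball x r. f w \<partial>lborel) * ennreal (1 / v))"
      using * by (intro mult_left_mono) (auto simp: v_def)
    also have "\<dots> = ennreal (3 ^ ?D * v / t) * ennreal (1 / v) * (\<integral>\<^sup>+w\<in>pball x r. f w \<partial>lborel)"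
      by (simp only: mult_ac)
    also have "ennreal (3 ^ ?D * v / t) * ennreal (1 / v) = ennreal (3 ^ ?D / t)"
      using t v by (simp flip: ennreal_mult)
    also have "3 ^ ?D * v = ?c * (3 * r) ^ ?D"
      unfolding v_def power_mult_distrib by (simp only: mult_ac)
    finally show ?thesis
      using r by (simp add: i emeasure_pball del: power_add)
  qed
  obtain C where C: "\<And>n::nat. compact (C n)" "\<And>n. C n \<subseteq> ?U" "\<And>n. C n \<subseteq> interior (C (Suc n))" "\<Union>(range C) = ?U"
    using open_Union_compact_subsets[OF open_pmax_superlevel[of "ennreal t" f]] by metis
  have bound: "emeasure lborel (C n) \<le> ennreal (3 ^ ?D / t) * (NNINT w. f w)" for n
  proof -
    have "\<exists>I\<subseteq>S. finite I \<and> C n \<subseteq> (\<Union>i\<in>I. pball (fst i) (snd i))"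
      using C(1)[of n] C(2)[of n] unfolding U by (metis (no_types, lifting) compactE_image open_pball)
    then obtain I where I: "I \<subseteq> S" "finite I" "C n \<subseteq> (\<Union>i\<in>I. pball (fst i) (snd i))" by auto
    have "\<And>i. i \<in> I \<Longrightarrow> 0 < snd i" using I(1) by (auto simp: S_def)
    with finite_Vitali_covering[OF I(2), of snd fst] obtain J where
      J: "J \<subseteq> I" "disjoint_family_on (\<lambda>i. pball (fst i) (snd i)) J"
         "(\<Union>i\<in>I. pball (fst i) (snd i)) \<subseteq> (\<Union>j\<in>J. pball (fst j) (3 * snd j))" by auto
    have fJ: "finite J" using J(1) I(2) finite_subset by auto
    have "emeasure lborel (C n) \<le> emeasure lborel (\<Union>j\<in>J. pball (fst j) (3 * snd j))"
      using I(3) J(3) fJ by (intro emeasure_mono) (auto intro!: sets.finite_UN)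
    also have "\<dots> \<le> (\<Sum>j\<in>J. emeasure lborel (pball (fst j) (3 * snd j)))"
      using fJ by (intro emeasure_subadditive_finite) auto
    also have "\<dots> \<le> (\<Sum>j\<in>J. ennreal (3 ^ ?D / t) * (\<integral>\<^sup>+w\<in>pball (fst j) (snd j). f w \<partial>lborel))"
      using I(1) J(1) by (intro sum_mono small) auto
    also have "\<dots> = ennreal (3 ^ ?D / t) * (NNINT w. (\<Sum>j\<in>J. f w * indicator (pball (fst j) (snd j)) w))"
      by (subst nn_integral_sum) (auto simp: sum_distrib_left)
    also have "\<dots> \<le> ennreal (3 ^ ?D / t) * (NNINT w. f w)"
    proof (intro mult_left_mono nn_integral_mono)
      fix w
      have "(\<Sum>j\<in>J. indicator (pball (fst j) (snd j)) w) = (indicator (\<Union>j\<in>J. pball (fst j) (snd j)) w :: ennreal)"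
        by (rule indicator_UN_disjoint[symmetric, OF fJ J(2)])
      then show "(\<Sum>j\<in>J. f w * indicator (pball (fst j) (snd j)) w) \<le> f w"
        by (simp add: sum_distrib_left[symmetric] split: split_indicator)
    qed simp
    finally show ?thesis .
  qed
  have "incseq C"
    using C(3) interior_subset by (intro incseq_SucI) blast
  then have "emeasure lborel ?U = (SUP n. emeasure lborel (C n))"
    unfolding C(4)[symmetric] using C(1) by (intro SUP_emeasure_incseq[symmetric]) (auto intro: borel_compact)
  also have "\<dots> \<le> ennreal (3 ^ ?D / t) * (NNINT w. f w)"
    by (intro SUP_least bound)
  finally show ?thesis .
qed

lemma nn_integral_powr_tail:
  assumes "e < -1" "0 < a"
  shows "(NNINT s. ennreal (if a < s then s powr e else 0)) = ennreal (a powr (e + 1) / - (e + 1))"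
proof -
  have "(NNINT s. ennreal (if a < s then s powr e else 0)) = (NNINT s. ennreal (indicator {a..} s * s powr e))"
    using AE_lborel_singleton[of a] by (intro nn_integral_cong_AE) (auto simp: indicator_def elim!: eventually_mono)
  also have "\<dots> = ennreal (- (a powr (e + 1)) / (e + 1))"
    using nn_integral_has_integral_lebesgue[OF _ has_integral_powr_to_inf[OF assms]] by simp
  also have "- (a powr (e + 1)) / (e + 1) = a powr (e + 1) / - (e + 1)"
    by (metis minus_divide_left minus_divide_right)
  finally show ?thesis .
qed

lemma nn_integral_powr_head:
  assumes "-1 < e" "0 \<le> c"
  shows "(NNINT s. ennreal (if 0 < s \<and> s \<le> c then s powr e else 0)) = ennreal (c powr (e + 1) / (e + 1))"
proof -
  have "(NNINT s. ennreal (if 0 < s \<and> s \<le> c then s powr e else 0)) = (NNINT s. ennreal (indicator {0..c} s * s powr e))"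
    using AE_lborel_singleton[of 0] by (intro nn_integral_cong_AE) (auto simp: indicator_def elim!: eventually_mono)
  also have "\<dots> = ennreal (c powr (e + 1) / (e + 1))"
    using nn_integral_has_integral_lebesgue[OF _ has_integral_powr_from_0[OF assms]] by simp
  finally show ?thesis .
qed

lemma ennreal_layer_cake:
  "x = (NNINT s. (if 0 < s \<and> ennreal s < x then 1 else 0))"
proof (cases x)
  case (real r)
  have "(\<lambda>s. if 0 < s \<and> ennreal s < x then 1 else 0) = (indicator {0<..<r} :: real \<Rightarrow> ennreal)"
    using real by (auto simp: fun_eq_iff indicator_def ennreal_less_iff)
  then have "(NNINT s. (if 0 < s \<and> ennreal s < x then 1 else 0)) = (NNINT s. indicator {0<..<r} s)"
    by (simp only:)
  also have "\<dots> = ennreal r" using real by simp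
  finally show ?thesis using real by simp
next
  case top
  have "(\<lambda>s. if 0 < s \<and> ennreal s < x then 1 else 0) = (indicator {0<..} :: real \<Rightarrow> ennreal)"
    using top by (auto simp: fun_eq_iff indicator_def)
  then have "(NNINT s. (if 0 < s \<and> ennreal s < x then 1 else 0)) = (NNINT s. indicator {0::real<..} s)"
    by (simp only:)
  also have "\<dots> = top"
  proof -
    have "ennreal (real n) \<le> emeasure lborel {0::real<..}" for n
    proof -
      have "{0<..<real n} \<subseteq> {0<..}" by auto
      from emeasure_mono[OF this, of lborel] show ?thesis by simp
    qed
    then have "of_nat n \<le> emeasure lborel {0::real<..}" for n
      by (simp add: ennreal_of_nat_eq_real_of_nat)
    then have "emeasure lborel {0::real<..} = top"
      by (meson ennreal_Ex_less_of_nat less_top not_le)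
    then show ?thesis by simp
  qed
  finally show ?thesis using top by simp
qed

text \<open>Integrate the measure of the superlevel sets against \<open>\<delta> s^(\<delta>-1)\<close>: below the level \<open>t\<close> use the measure of \<open>A\<close>, above it the weak type bound. Convergence at infinity is where \<open>\<delta> < 1\<close> enters.\<close>

lemma pmax_Kolmogorov:
  fixes f :: "real \<times> 'a::euclidean_space \<Rightarrow> ennreal"
  assumes \<delta>: "0 < \<delta>" "\<delta> < 1" and [measurable]: "f \<in> borel_measurable borel" "A \<in> sets borel"
    and a: "0 < a" "0 < t" and A: "emeasure lborel A \<le> ennreal a" and I: "(NNINT w. f w) \<le> ennreal (a * t)"
  shows "(\<integral>\<^sup>+z\<in>A. epowr (pmax f z) \<delta> \<partial>lborel) \<le> ennreal (a * t powr \<delta> * (1 + 3 ^ (DIM('a) + 2) * \<delta> / (1 - \<delta>)))"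
proof -
  let ?D = "DIM('a) + 2"
  define c where "c = t powr \<delta>"
  have c: "c > 0" using a by (simp add: c_def)
  have "(\<integral>\<^sup>+z\<in>A. epowr (pmax f z) \<delta> \<partial>lborel) = (NNINT z. (NNINT s. (if 0 < s \<and> ennreal s < epowr (pmax f z) \<delta> then 1 else 0) * indicator A z))"
    by (subst nn_integral_multc) (auto simp flip: ennreal_layer_cake)
  also have "\<dots> = (NNINT s. (NNINT z. (if 0 < s \<and> ennreal s < epowr (pmax f z) \<delta> then 1 else 0) * indicator A z))"
    by (rule lborel_pair.Fubini'[symmetric]) measurable
  also have "\<dots> \<le> (NNINT s. ennreal a * ennreal (if 0 < s \<and> s \<le> c then s powr 0 else 0)
      + ennreal (3 ^ ?D * a * t) * ennreal (if c < s then s powr (- (1 / \<delta>)) else 0))"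
  proof (intro nn_integral_mono)
    fix s :: real
    let ?L = "NNINT z. (if 0 < s \<and> ennreal s < epowr (pmax f z) \<delta> then 1 else 0) * indicator A z"
    consider "s \<le> 0" | "0 < s" "s \<le> c" | "c < s" by linarith
    then show "?L \<le> ennreal a * ennreal (if 0 < s \<and> s \<le> c then s powr 0 else 0)
      + ennreal (3 ^ ?D * a * t) * ennreal (if c < s then s powr (- (1 / \<delta>)) else 0)"
    proof cases
      case 2
      have "?L \<le> (NNINT z. indicator A z)"
        by (intro nn_integral_mono) (auto split: split_indicator)
      then show ?thesis using 2 A by simp
    next
      case 3
      then have s: "0 < s" using c by simp
      have "?L \<le> (NNINT z. indicator {z. ennreal (s powr (1 / \<delta>)) < pmax f z} z)"
      proof (intro nn_integral_mono)
        fix z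
        have "ennreal (s powr (1 / \<delta>)) < pmax f z" if "ennreal s < epowr (pmax f z) \<delta>"
        proof (rule ccontr)
          assume "\<not> ?thesis"
          then have "epowr (pmax f z) \<delta> \<le> epowr (ennreal (s powr (1 / \<delta>))) \<delta>"
            using \<delta> by (intro epowr_mono) auto
          also have "\<dots> = ennreal s" using s \<delta> by (simp add: epowr_ennreal powr_powr)
          finally show False using that by simp
        qed
        then show "(if 0 < s \<and> ennreal s < epowr (pmax f z) \<delta> then 1 else 0) * indicator A z
           \<le> (indicator {z. ennreal (s powr (1 / \<delta>)) < pmax f z} z :: ennreal)"
          by (auto split: split_indicator)
      qed
      also have "\<dots> = emeasure lborel {z. ennreal (s powr (1 / \<delta>)) < pmax f z}"
        by (intro nn_integral_indicator) (simp add: open_pmax_superlevel)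
      also have "\<dots> \<le> ennreal (3 ^ ?D / (s powr (1 / \<delta>))) * (NNINT w. f w)"
        using s by (intro pmax_weak_type) auto
      also have "\<dots> \<le> ennreal (3 ^ ?D / (s powr (1 / \<delta>))) * ennreal (a * t)"
        by (intro mult_left_mono I) auto
      also have "\<dots> = ennreal (3 ^ ?D * a * t) * ennreal (s powr (- (1 / \<delta>)))"
        using a by (simp add: powr_minus_divide flip: ennreal_mult)
      finally show ?thesis using 3 by simp
    qed auto
  qed
  also have "\<dots> = ennreal a * ennreal c + ennreal (3 ^ ?D * a * t) * ennreal (c powr (- (1 / \<delta>) + 1) / - (- (1 / \<delta>) + 1))"
    using \<delta> c by (simp add: nn_integral_add nn_integral_cmult nn_integral_powr_tail nn_integral_powr_head[of 0, simplified])
  also have "\<dots> = ennreal (a * c + 3 ^ ?D * a * t * (c powr (- (1 / \<delta>) + 1) / - (- (1 / \<delta>) + 1)))"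
    using \<delta> a c by (simp add: divide_nonneg_nonneg flip: ennreal_mult ennreal_plus)
  also have "a * c + 3 ^ ?D * a * t * (c powr (- (1 / \<delta>) + 1) / - (- (1 / \<delta>) + 1)) = a * t powr \<delta> * (1 + 3 ^ ?D * \<delta> / (1 - \<delta>))"
  proof -
    have "t * c powr (- (1 / \<delta>) + 1) = t powr 1 * t powr (\<delta> * (- (1 / \<delta>) + 1))"
      using a by (simp add: c_def powr_powr)
    also have "\<dots> = t powr (1 + \<delta> * (- (1 / \<delta>) + 1))" by (simp only: powr_add)
    also have "1 + \<delta> * (- (1 / \<delta>) + 1) = \<delta>" using \<delta> by (simp add: field_simps)
    finally have 1: "t * c powr (- (1 / \<delta>) + 1) = t powr \<delta>" .
    have "1 / (- (- (1 / \<delta>) + 1)) = \<delta> / (1 - \<delta>)" using \<delta> by (simp add: field_simps)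
    then have "3 ^ ?D * a * t * (c powr (- (1 / \<delta>) + 1) / - (- (1 / \<delta>) + 1)) = 3 ^ ?D * a * (t * c powr (- (1 / \<delta>) + 1)) * (\<delta> / (1 - \<delta>))"
      by (simp add: divide_inverse)
    then show ?thesis unfolding 1 by (simp add: c_def algebra_simps)
  qed
  finally show ?thesis .
qed

text \<open>This is the reason why small powers of maximal functions behave like constants on balls. Near part: the restriction of \<open>f\<close> to the threefold ball has small mass, so Kolmogorov's inequality applies. Far part: a ball that meets \<open>pball z r\<close> and leaves the threefold ball has radius at least comparable to \<open>r\<close>, so it is contained in a ball around \<open>z\<close> of comparable size, where the average is at most a multiple of \<open>t\<close>.\<close>

lemma pmax_A1:
  fixes \<delta> :: real
  assumes \<delta>: "0 < \<delta>" "\<delta> < 1"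
  obtains C where "0 < C"
    "\<And>f z r t. f \<in> borel_measurable borel \<Longrightarrow> 0 < r \<Longrightarrow> 0 < t \<Longrightarrow>
      (\<And>\<rho>. r \<le> \<rho> \<Longrightarrow> (\<integral>\<^sup>+w\<in>pball (z::real \<times> 'a::euclidean_space) \<rho>. f w \<partial>lborel) \<le> ennreal (t * (pball_const TYPE('a) * \<rho> ^ (DIM('a) + 2)))) \<Longrightarrow>
      (\<integral>\<^sup>+w\<in>pball z r. epowr (max (f w) (pmax f w)) \<delta> \<partial>lborel) \<le> ennreal (C * t powr \<delta> * r ^ (DIM('a) + 2))"
proof -
  let ?D = "DIM('a) + 2" and ?c = "pball_const TYPE('a)"
  have c: "?c > 0" by (rule pball_const_pos)
  define C1 where "C1 = 1 + 3 ^ ?D * \<delta> / (1 - \<delta>)"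
  have C1: "C1 > 0" using \<delta> by (simp add: C1_def add_pos_nonneg)
  define E where "E = (3 ^ ?D) powr \<delta>"
  have E: "E > 0" by (simp add: E_def)
  show ?thesis
  proof
    show "0 < ?c * (2 + 2 powr \<delta> * (E * C1 + E))" using C1 E c by (simp add: add_pos_pos)
  next
    fix f :: "real \<times> 'a \<Rightarrow> ennreal" and z :: "real \<times> 'a" and r t :: real
    assume [measurable]: "f \<in> borel_measurable borel" and r: "0 < r" and t: "0 < t"
      and avg: "\<And>\<rho>. r \<le> \<rho> \<Longrightarrow> (\<integral>\<^sup>+w\<in>pball z \<rho>. f w \<partial>lborel) \<le> ennreal (t * (?c * \<rho> ^ ?D))"
    let ?B = "pball z r"
    define f1 where "f1 w = f w * indicator (pball z (3 * r)) w" for w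
    have [measurable]: "f1 \<in> borel_measurable borel" unfolding f1_def by measurable
    define a where "a = ?c * r ^ ?D"
    have a: "a > 0" using c r by (simp add: a_def)
    have Ba: "emeasure lborel ?B = ennreal a" using r by (simp add: emeasure_pball a_def)
    define t' where "t' = 3 ^ ?D * t"
    have t': "t' > 0" using t by (simp add: t'_def)
    have tp: "t' powr \<delta> = E * t powr \<delta>" using t by (simp add: t'_def E_def powr_mult)
    have split: "pmax f y \<le> pmax f1 y + ennreal t'" if y: "y \<in> ?B" for y
    proof -
      have "(\<integral>\<^sup>+w\<in>pball x \<rho>. f w \<partial>lborel) * ennreal (1 / (?c * \<rho> ^ ?D)) \<le> pmax f1 y + ennreal t'"
        if \<rho>: "0 < \<rho>" "y \<in> pball x \<rho>" for x \<rho>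
      proof (cases "\<rho> \<le> r")
        case True
        have "pdist z x \<le> pdist z y + pdist y x" by (rule pdist_triangle)
        then have "pdist z x + \<rho> \<le> 3 * r"
          using \<rho> y True by (simp add: mem_pball pdist_commute[of y x])
        then have "pball x \<rho> \<subseteq> pball z (3 * r)" by (rule pball_subset)
        then have "(\<integral>\<^sup>+w\<in>pball x \<rho>. f w \<partial>lborel) = (\<integral>\<^sup>+w\<in>pball x \<rho>. f1 w \<partial>lborel)"
          by (intro nn_integral_cong) (auto simp: f1_def split: split_indicator)
        then show ?thesis using pmax_ge[OF \<rho>, of f1] by (simp add: add_increasing2)
      next
        case False
        have "pdist z x \<le> pdist z y + pdist y x" by (rule pdist_triangle)
        then have "pdist z x + \<rho> \<le> 3 * \<rho>"
          using \<rho> y False by (simp add: mem_pball pdist_commute[of y x])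
        then have sub: "pball x \<rho> \<subseteq> pball z (3 * \<rho>)" by (rule pball_subset)
        have v: "?c * \<rho> ^ ?D > 0" using c \<rho> by simp
        have "(\<integral>\<^sup>+w\<in>pball x \<rho>. f w \<partial>lborel) \<le> (\<integral>\<^sup>+w\<in>pball z (3 * \<rho>). f w \<partial>lborel)"
          using sub by (intro nn_integral_mono) (auto split: split_indicator)
        also have "\<dots> \<le> ennreal (t * (?c * (3 * \<rho>) ^ ?D))"
          using False r by (intro avg) auto
        finally have "(\<integral>\<^sup>+w\<in>pball x \<rho>. f w \<partial>lborel) * ennreal (1 / (?c * \<rho> ^ ?D)) \<le> ennreal (t * (?c * (3 * \<rho>) ^ ?D)) * ennreal (1 / (?c * \<rho> ^ ?D))"
          by (intro mult_right_mono) auto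
        also have "\<dots> = ennreal (t * (?c * (3 * \<rho>) ^ ?D) * (1 / (?c * \<rho> ^ ?D)))"
          using v t c \<rho> by (intro ennreal_mult[symmetric]) auto
        also have "t * (?c * (3 * \<rho>) ^ ?D) * (1 / (?c * \<rho> ^ ?D)) = t'"
          using c \<rho> unfolding t'_def power_mult_distrib by simp
        finally show ?thesis by (simp add: add_increasing)
      qed
      then show ?thesis unfolding pmax_def[of f y] by (intro SUP_least) auto
    qed
    have pw: "epowr (max (f w) (pmax f w)) \<delta> * indicator ?B w \<le>
       (ennreal (t powr \<delta>) + ennreal (t powr (\<delta> - 1)) * f w) * indicator ?B w +
       ennreal (2 powr \<delta>) * (epowr (pmax f1 w) \<delta> * indicator ?B w + ennreal (t' powr \<delta>) * indicator ?B w)" for w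
    proof (cases "w \<in> ?B")
      case True
      have 1: "epowr (f w) \<delta> \<le> ennreal (t powr \<delta>) + ennreal (t powr (\<delta> - 1)) * f w"
      proof (cases "f w")
        case top then show ?thesis using t by (simp add: ennreal_mult_top)
      next
        case (real x)
        have "x powr \<delta> \<le> t powr \<delta> + t powr (\<delta> - 1) * x"
        proof (cases "x \<le> t")
          case True
          then have "x powr \<delta> \<le> t powr \<delta>" using real \<delta> by (intro powr_mono2) auto
          then show ?thesis using real by (simp add: add_increasing2)
        next
          case False
          then have "x powr (\<delta> - 1) \<le> t powr (\<delta> - 1)" using t \<delta> by (intro powr_mono2') auto
          then have "x powr (\<delta> - 1) * x \<le> t powr (\<delta> - 1) * x" using real by (intro mult_right_mono) auto
          moreover have "x powr (\<delta> - 1) * x = x powr \<delta>"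
            using False t powr_add[of x "\<delta> - 1" 1] by simp
          ultimately show ?thesis by (simp add: add_increasing)
        qed
        then have "ennreal (x powr \<delta>) \<le> ennreal (t powr \<delta> + t powr (\<delta> - 1) * x)" by (rule ennreal_leI)
        then show ?thesis using real by (simp add: epowr_ennreal ennreal_mult)
      qed
      have "epowr (pmax f w) \<delta> \<le> epowr (pmax f1 w + ennreal t') \<delta>"
        using split[OF True] \<delta> by (intro epowr_mono) auto
      also have "\<dots> \<le> ennreal (2 powr \<delta>) * (epowr (pmax f1 w) \<delta> + epowr (ennreal t') \<delta>)"
        using \<delta> by (intro epowr_add_le) auto
      finally have 2: "epowr (pmax f w) \<delta> \<le> ennreal (2 powr \<delta>) * (epowr (pmax f1 w) \<delta> + ennreal (t' powr \<delta>))"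
        using t' by (simp add: epowr_ennreal)
      show ?thesis using 1 2 True
        by (auto simp: max_def intro: add_increasing add_increasing2)
    qed simp
    have "(\<integral>\<^sup>+w\<in>?B. epowr (max (f w) (pmax f w)) \<delta> \<partial>lborel) \<le> (NNINT w. 
       (ennreal (t powr \<delta>) + ennreal (t powr (\<delta> - 1)) * f w) * indicator ?B w +
       ennreal (2 powr \<delta>) * (epowr (pmax f1 w) \<delta> * indicator ?B w + ennreal (t' powr \<delta>) * indicator ?B w))"
      by (intro nn_integral_mono pw)
    also have "\<dots> = ennreal (t powr \<delta>) * ennreal a + ennreal (t powr (\<delta> - 1)) * (\<integral>\<^sup>+w\<in>?B. f w \<partial>lborel)
       + ennreal (2 powr \<delta>) * ((\<integral>\<^sup>+w\<in>?B. epowr (pmax f1 w) \<delta> \<partial>lborel) + ennreal (t' powr \<delta>) * ennreal a)"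
      by (simp add: nn_integral_add nn_integral_cmult distrib_right mult.assoc Ba)
    also have "\<dots> \<le> ennreal (t powr \<delta>) * ennreal a + ennreal (t powr (\<delta> - 1)) * ennreal (t * a)
       + ennreal (2 powr \<delta>) * (ennreal (a * t' powr \<delta> * C1) + ennreal (t' powr \<delta>) * ennreal a)"
    proof (intro add_mono mult_left_mono order_refl)
      show "(\<integral>\<^sup>+w\<in>?B. f w \<partial>lborel) \<le> ennreal (t * a)" using avg[of r] by (simp add: a_def)
      have "(NNINT w. f1 w) \<le> ennreal (t * (?c * (3 * r) ^ ?D))"
        unfolding f1_def using r by (intro avg) auto
      also have "t * (?c * (3 * r) ^ ?D) = a * t'"
        unfolding power_mult_distrib a_def t'_def by simp
      finally show "(\<integral>\<^sup>+w\<in>?B. epowr (pmax f1 w) \<delta> \<partial>lborel) \<le> ennreal (a * t' powr \<delta> * C1)"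
        unfolding C1_def using a t' \<delta> Ba by (intro pmax_Kolmogorov) auto
    qed auto
    also have "\<dots> = ennreal (t powr \<delta> * a + t powr (\<delta> - 1) * (t * a) + 2 powr \<delta> * (a * t' powr \<delta> * C1 + t' powr \<delta> * a))"
      using t a C1 by (simp add: ennreal_plus[symmetric] ennreal_mult[symmetric] del: ennreal_plus)
    also have "t powr \<delta> * a + t powr (\<delta> - 1) * (t * a) + 2 powr \<delta> * (a * t' powr \<delta> * C1 + t' powr \<delta> * a)
      = ?c * (2 + 2 powr \<delta> * (E * C1 + E)) * t powr \<delta> * r ^ ?D"
    proof -
      have "t powr (\<delta> - 1) * (t * a) = t powr \<delta> * a"
        using t powr_add[of t "\<delta> - 1" 1] by simp
      then show ?thesis unfolding tp by (simp add: a_def algebra_simps)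
    qed
    finally show "(\<integral>\<^sup>+w\<in>?B. epowr (max (f w) (pmax f w)) \<delta> \<partial>lborel) \<le> ennreal (?c * (2 + 2 powr \<delta> * (E * C1 + E)) * t powr \<delta> * r ^ ?D)" .
  qed
qed

section \<open>The trace inequality\<close>

text \<open>Taking the maximum with \<open>f\<close> gives a majorant at every point, without the differentiation theorem.\<close>

definition pmajorant :: "(real \<times> 'a::euclidean_space \<Rightarrow> ennreal) \<Rightarrow> real \<times> 'a \<Rightarrow> ennreal" where
  "pmajorant f z = max (f z) (pmax f z)"

lemma pmajorant_measurable[measurable (raw)]:
  assumes [measurable]: "f \<in> borel_measurable borel" "g \<in> borel_measurable M"
  shows "(\<lambda>x. pmajorant f (g x)) \<in> borel_measurable M"
proof -
  have "(\<lambda>z. pmajorant f z) \<in> borel_measurable borel" unfolding pmajorant_def by measurable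
  from measurable_compose[OF assms(2) this] show ?thesis .
qed

text \<open>The power is written as a superposition of indicators of balls, so that Riesz potentials reduce to averages over balls.\<close>

lemma Riesz_kernel_layers:
  fixes \<beta> D s :: real
  assumes "\<beta> < D" "0 \<le> s"
  shows "ennreal (s powr (\<beta> - D)) \<le> ennreal (D - \<beta>) * (NNINT r. ennreal (if s < r then r powr (\<beta> - D - 1) else 0))"
proof (cases "s = 0")
  case False
  then show ?thesis using assms
    by (simp add: nn_integral_powr_tail flip: ennreal_mult')
qed simp

text \<open>Integrate over the radii of balls centred at \<open>z\<close>. For radii below \<open>R = K / v^(1/q)\<close> the averages of \<open>f\<close> are at most \<open>v\<close>, and the resulting integral converges at zero because \<open>\<beta> > 0\<close>; for larger radii the Morrey condition bounds them by \<open>(K/r)^q\<close>, and the integral converges at infinity because \<open>\<beta> < \<gamma>\<close>. The chosen \<open>R\<close> balances both bounds.\<close>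

lemma Riesz_potential_of_pmajorant:
  fixes \<beta> \<gamma> q :: real
  assumes \<beta>: "0 < \<beta>" "\<beta> < 1" "\<beta> < \<gamma>" "\<gamma> < q"
  obtains C where "0 < C"
    "\<And>K f z v. f \<in> borel_measurable borel \<Longrightarrow> 0 < K \<Longrightarrow>
      (\<And>z r. 0 < r \<Longrightarrow> (\<integral>\<^sup>+w\<in>pball (z::real \<times> 'a::euclidean_space) r. f w \<partial>lborel) \<le> ennreal ((K / r) powr q * (pball_const TYPE('a) * r ^ (DIM('a) + 2)))) \<Longrightarrow>
      0 < v \<Longrightarrow> pmajorant f z = ennreal v \<Longrightarrow>
      (NNINT w. ennreal (pdist z w powr (\<beta> - real (DIM('a) + 2))) * epowr (pmajorant f w) (\<gamma> / q))
        \<le> ennreal (C * K powr \<beta> * v powr ((\<gamma> - \<beta>) / q))"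
proof -
  let ?D = "DIM('a) + 2" and ?c = "pball_const TYPE('a)"
  define \<delta> where "\<delta> = \<gamma> / q"
  have q: "0 < q" and \<delta>: "0 < \<delta>" "\<delta> < 1" using \<beta> by (auto simp: \<delta>_def)
  obtain C0 where C0: "0 < C0"
    "\<And>f z r t. f \<in> borel_measurable borel \<Longrightarrow> 0 < r \<Longrightarrow> 0 < t \<Longrightarrow>
      (\<And>\<rho>. r \<le> \<rho> \<Longrightarrow> (\<integral>\<^sup>+w\<in>pball (z::real \<times> 'a) \<rho>. f w \<partial>lborel) \<le> ennreal (t * (?c * \<rho> ^ ?D))) \<Longrightarrow>
      (\<integral>\<^sup>+w\<in>pball z r. epowr (max (f w) (pmax f w)) \<delta> \<partial>lborel) \<le> ennreal (C0 * t powr \<delta> * r ^ ?D)"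
    using pmax_A1[OF \<delta>, where 'a='a] by blast
  define C where "C = (real ?D - \<beta>) * C0 * (1 / \<beta> + 1 / (\<gamma> - \<beta>))"
  have Db: "real ?D - \<beta> > 0" using \<beta> by simp
  show ?thesis
  proof
    show "0 < C" using Db C0 \<beta> by (simp add: C_def add_pos_pos)
  next
    fix K f v and z :: "real \<times> 'a"
    assume [measurable]: "f \<in> borel_measurable borel" and K: "0 < K"
      and morrey: "\<And>z r. 0 < r \<Longrightarrow> (\<integral>\<^sup>+w\<in>pball (z::real \<times> 'a) r. f w \<partial>lborel) \<le> ennreal ((K / r) powr q * (?c * r ^ ?D))"
      and v: "0 < v" "pmajorant f z = ennreal v"
    have avgv: "(\<integral>\<^sup>+w\<in>pball z r. f w \<partial>lborel) \<le> ennreal (v * (?c * r ^ ?D))" if "0 < r" for r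
    proof -
      have "(\<integral>\<^sup>+w\<in>pball z r. f w \<partial>lborel) \<le> pmax f z * ennreal (?c * r ^ ?D)"
        using that by (intro nn_integral_pball_le_pmax) (auto simp: mem_pball)
      also have "\<dots> \<le> ennreal v * ennreal (?c * r ^ ?D)"
        unfolding v(2)[symmetric] pmajorant_def by (intro mult_right_mono) auto
      finally show ?thesis using v by (simp only: ennreal_mult' less_imp_le)
    qed
    have ball1: "(\<integral>\<^sup>+w\<in>pball z r. epowr (pmajorant f w) \<delta> \<partial>lborel) \<le> ennreal (C0 * v powr \<delta> * r ^ ?D)" if "0 < r" for r
      unfolding pmajorant_def using that v by (intro C0(2) avgv) auto
    have ball2: "(\<integral>\<^sup>+w\<in>pball z r. epowr (pmajorant f w) \<delta> \<partial>lborel) \<le> ennreal (C0 * (K / r) powr \<gamma> * r ^ ?D)" if r: "0 < r" for r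
    proof -
      have "(\<integral>\<^sup>+w\<in>pball z r. epowr (pmajorant f w) \<delta> \<partial>lborel) \<le> ennreal (C0 * ((K / r) powr q) powr \<delta> * r ^ ?D)"
        unfolding pmajorant_def
      proof (intro C0(2))
        fix \<rho> assume \<rho>: "r \<le> \<rho>"
        have "(\<integral>\<^sup>+w\<in>pball z \<rho>. f w \<partial>lborel) \<le> ennreal ((K / \<rho>) powr q * (?c * \<rho> ^ ?D))"
          using \<rho> r by (intro morrey) auto
        also have "\<dots> \<le> ennreal ((K / r) powr q * (?c * \<rho> ^ ?D))"
          using \<rho> r K q pball_const_pos[where 'a='a]
          by (intro ennreal_leI mult_right_mono powr_mono2 divide_left_mono) auto
        finally show "(\<integral>\<^sup>+w\<in>pball z \<rho>. f w \<partial>lborel) \<le> ennreal ((K / r) powr q * (?c * \<rho> ^ ?D))" .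
      qed (use r K in auto)
      also have "((K / r) powr q) powr \<delta> = (K / r) powr \<gamma>" using q by (simp add: powr_powr \<delta>_def)
      finally show ?thesis .
    qed
    \<comment> \<open>The radius at which the bounds \<open>v\<close> and \<open>(K/R)^q\<close> for the averages coincide.\<close>
    define R where "R = K / v powr (1 / q)"
    have R: "R > 0" using K v by (simp add: R_def)
    let ?e = "\<beta> - real ?D - 1"
    have "(NNINT w. ennreal (pdist z w powr (\<beta> - real ?D)) * epowr (pmajorant f w) \<delta>)
       \<le> (NNINT w. ennreal (real ?D - \<beta>) * (NNINT r. ennreal (if pdist z w < r then r powr ?e else 0)) * epowr (pmajorant f w) \<delta>)"
      using \<beta> by (intro nn_integral_mono mult_right_mono Riesz_kernel_layers pdist_nonneg) auto
    also have "\<dots> = (NNINT w. (NNINT r. ennreal (real ?D - \<beta>) * (ennreal (if pdist z w < r then r powr ?e else 0) * epowr (pmajorant f w) \<delta>)))"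
    proof (intro nn_integral_cong)
      fix w
      have "(NNINT r. ennreal (real ?D - \<beta>) * (ennreal (if pdist z w < r then r powr ?e else 0) * epowr (pmajorant f w) \<delta>))
        = ennreal (real ?D - \<beta>) * (NNINT r. ennreal (if pdist z w < r then r powr ?e else 0) * epowr (pmajorant f w) \<delta>)"
        by (rule nn_integral_cmult) measurable
      also have "(NNINT r. ennreal (if pdist z w < r then r powr ?e else 0) * epowr (pmajorant f w) \<delta>)
        = (NNINT r. ennreal (if pdist z w < r then r powr ?e else 0)) * epowr (pmajorant f w) \<delta>"
        by (rule nn_integral_multc) measurable
      finally show "ennreal (real ?D - \<beta>) * (NNINT r. ennreal (if pdist z w < r then r powr ?e else 0)) * epowr (pmajorant f w) \<delta>
         = (NNINT r. ennreal (real ?D - \<beta>) * (ennreal (if pdist z w < r then r powr ?e else 0) * epowr (pmajorant f w) \<delta>))"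
        by (simp only: mult.assoc)
    qed
    also have "\<dots> = (NNINT r. (NNINT w. ennreal (real ?D - \<beta>) * (ennreal (if pdist z w < r then r powr ?e else 0) * epowr (pmajorant f w) \<delta>)))"
      by (rule lborel_pair.Fubini'[symmetric]) measurable
    also have "\<dots> \<le> (NNINT r. ennreal ((real ?D - \<beta>) * C0 * v powr \<delta>) * ennreal (if 0 < r \<and> r \<le> R then r powr (\<beta> - 1) else 0)
       + ennreal ((real ?D - \<beta>) * C0 * K powr \<gamma>) * ennreal (if R < r then r powr (\<beta> - \<gamma> - 1) else 0))"
    proof (intro nn_integral_mono)
      fix r :: real
      let ?L = "NNINT w. ennreal (real ?D - \<beta>) * (ennreal (if pdist z w < r then r powr ?e else 0) * epowr (pmajorant f w) \<delta>)"
      let ?Rhs = "ennreal ((real ?D - \<beta>) * C0 * v powr \<delta>) * ennreal (if 0 < r \<and> r \<le> R then r powr (\<beta> - 1) else 0)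
       + ennreal ((real ?D - \<beta>) * C0 * K powr \<gamma>) * ennreal (if R < r then r powr (\<beta> - \<gamma> - 1) else 0)"
      have L: "?L = ennreal ((real ?D - \<beta>) * r powr ?e) * (\<integral>\<^sup>+w\<in>pball z r. epowr (pmajorant f w) \<delta> \<partial>lborel)"
      proof -
        have "?L = (NNINT w. ennreal ((real ?D - \<beta>) * r powr ?e) * (epowr (pmajorant f w) \<delta> * indicator (pball z r) w))"
          using Db by (intro nn_integral_cong) (auto simp: mem_pball ennreal_mult mult_ac split: split_indicator)
        also have "\<dots> = ennreal ((real ?D - \<beta>) * r powr ?e) * (\<integral>\<^sup>+w\<in>pball z r. epowr (pmajorant f w) \<delta> \<partial>lborel)"
          by (rule nn_integral_cmult) measurable
        finally show ?thesis .
      qed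
      have pw: "r powr ?e * r ^ ?D = r powr (\<beta> - 1)" if "0 < r"
      proof -
        have "r powr ?e * r powr (real ?D) = r powr (?e + real ?D)" by (simp only: powr_add)
        then show ?thesis using that by (simp only: powr_realpow) simp
      qed
      consider "r \<le> 0" | "0 < r" "r \<le> R" | "R < r" by linarith
      then show "?L \<le> ?Rhs"
      proof cases
        case 1
        have "\<not> pdist z w < r" for w using pdist_nonneg[of z w] 1 by linarith
        then have "pball z r = {}" unfolding pball_def by blast
        then show ?thesis unfolding L by simp
      next
        case 2
        have "?L \<le> ennreal ((real ?D - \<beta>) * r powr ?e) * ennreal (C0 * v powr \<delta> * r ^ ?D)"
          unfolding L using 2 by (intro mult_left_mono ball1) auto
        also have "\<dots> = ennreal ((real ?D - \<beta>) * r powr ?e * (C0 * v powr \<delta> * r ^ ?D))"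
          using Db by (intro ennreal_mult'[symmetric]) auto
        also have "(real ?D - \<beta>) * r powr ?e * (C0 * v powr \<delta> * r ^ ?D) = (real ?D - \<beta>) * C0 * v powr \<delta> * (r powr ?e * r ^ ?D)"
          by (simp only: mult_ac)
        also have "\<dots> = (real ?D - \<beta>) * C0 * v powr \<delta> * r powr (\<beta> - 1)" using 2 pw by simp
        also have "ennreal \<dots> = ennreal ((real ?D - \<beta>) * C0 * v powr \<delta>) * ennreal (r powr (\<beta> - 1))"
          using Db C0 by (intro ennreal_mult) auto
        finally show ?thesis using 2 by simp
      next
        case 3
        then have r: "0 < r" using R by simp
        have "?L \<le> ennreal ((real ?D - \<beta>) * r powr ?e) * ennreal (C0 * (K / r) powr \<gamma> * r ^ ?D)"
          unfolding L using r by (intro mult_left_mono ball2) auto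
        also have "\<dots> = ennreal ((real ?D - \<beta>) * r powr ?e * (C0 * (K / r) powr \<gamma> * r ^ ?D))"
          using Db by (intro ennreal_mult'[symmetric]) auto
        also have "(real ?D - \<beta>) * r powr ?e * (C0 * (K / r) powr \<gamma> * r ^ ?D) = (real ?D - \<beta>) * C0 * K powr \<gamma> * ((r powr ?e * r ^ ?D) * r powr (- \<gamma>))"
        proof -
          have kr: "(K / r) powr \<gamma> = K powr \<gamma> * r powr (- \<gamma>)" using K r by (simp add: powr_divide powr_minus_divide)
          show ?thesis by (simp only: kr mult_ac)
        qed
        also have "(r powr ?e * r ^ ?D) * r powr (- \<gamma>) = r powr (\<beta> - \<gamma> - 1)"
          unfolding pw[OF r] powr_add[symmetric] by (simp add: algebra_simps)
        also have "ennreal ((real ?D - \<beta>) * C0 * K powr \<gamma> * r powr (\<beta> - \<gamma> - 1)) = ennreal ((real ?D - \<beta>) * C0 * K powr \<gamma>) * ennreal (r powr (\<beta> - \<gamma> - 1))"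
          using Db C0 by (intro ennreal_mult) auto
        finally show ?thesis using 3 by simp
      qed
    qed
    also have "\<dots> = ennreal ((real ?D - \<beta>) * C0 * v powr \<delta>) * ennreal (R powr \<beta> / \<beta>)
       + ennreal ((real ?D - \<beta>) * C0 * K powr \<gamma>) * ennreal (R powr (\<beta> - \<gamma>) / (\<gamma> - \<beta>))"
      using \<beta> R nn_integral_powr_head[of "\<beta> - 1" R] nn_integral_powr_tail[of "\<beta> - \<gamma> - 1" R]
      by (simp add: nn_integral_add nn_integral_cmult)
    also have "\<dots> = ennreal ((real ?D - \<beta>) * C0 * v powr \<delta> * (R powr \<beta> / \<beta>) + (real ?D - \<beta>) * C0 * K powr \<gamma> * (R powr (\<beta> - \<gamma>) / (\<gamma> - \<beta>)))"
    proof -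
      have nn: "0 \<le> (real ?D - \<beta>) * C0 * v powr \<delta>" "0 \<le> (real ?D - \<beta>) * C0 * K powr \<gamma>"
        "0 \<le> R powr \<beta> / \<beta>" "0 \<le> R powr (\<beta> - \<gamma>) / (\<gamma> - \<beta>)"
        using Db C0(1) \<beta> by (auto intro!: mult_nonneg_nonneg divide_nonneg_nonneg)
      show ?thesis
        unfolding ennreal_plus[OF mult_nonneg_nonneg[OF nn(1,3)] mult_nonneg_nonneg[OF nn(2,4)]]
          ennreal_mult[OF nn(1,3)] ennreal_mult[OF nn(2,4)] ..
    qed
    also have "(real ?D - \<beta>) * C0 * v powr \<delta> * (R powr \<beta> / \<beta>) + (real ?D - \<beta>) * C0 * K powr \<gamma> * (R powr (\<beta> - \<gamma>) / (\<gamma> - \<beta>))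
      = C * K powr \<beta> * v powr ((\<gamma> - \<beta>) / q)"
    proof -
      define V where "V = v powr (1 / q)"
      have V: "V > 0" using v by (simp add: V_def)
      have alg: "A * B * x * (y / b) + A * B * u * (w / h) = A * B * ((x * y) / b + (u * w) / h)" for A B x y b u w h :: real
        by (simp add: distrib_left mult_ac)
      have alg2: "A * B * (X / b + X / h) = A * B * (1 / b + 1 / h) * X" for A B X b h :: real
        by (simp add: distrib_left distrib_right mult_ac)
      have vp: "v powr (x / q) = V powr x" for x by (simp add: powr_powr V_def)
      have RV: "R = K / V" by (simp add: R_def V_def)
      have e1: "v powr \<delta> * R powr \<beta> = K powr \<beta> * V powr (\<gamma> - \<beta>)"
        unfolding \<delta>_def vp RV using K V by (simp add: powr_divide powr_diff)
      have e2: "K powr \<gamma> * R powr (\<beta> - \<gamma>) = K powr \<beta> * V powr (\<gamma> - \<beta>)"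
        unfolding RV using K V by (simp add: powr_divide powr_diff)
      have "(real ?D - \<beta>) * C0 * v powr \<delta> * (R powr \<beta> / \<beta>) + (real ?D - \<beta>) * C0 * K powr \<gamma> * (R powr (\<beta> - \<gamma>) / (\<gamma> - \<beta>))
        = (real ?D - \<beta>) * C0 * ((v powr \<delta> * R powr \<beta>) / \<beta> + (K powr \<gamma> * R powr (\<beta> - \<gamma>)) / (\<gamma> - \<beta>))"
        by (rule alg)
      also have "\<dots> = C * (K powr \<beta> * V powr (\<gamma> - \<beta>))"
        unfolding e1 e2 C_def by (rule alg2)
      finally show ?thesis by (simp only: vp mult_ac)
    qed
    finally show "(NNINT w. ennreal (pdist z w powr (\<beta> - real ?D)) * epowr (pmajorant f w) (\<gamma> / q))
        \<le> ennreal (C * K powr \<beta> * v powr ((\<gamma> - \<beta>) / q))"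
      by (simp only: \<delta>_def)
  qed
qed

lemma pmajorant_finite:
  fixes f :: "real \<times> 'a::euclidean_space \<Rightarrow> ennreal"
  assumes q: "0 < q" and K: "0 < K" and [measurable]: "f \<in> borel_measurable borel"
    and morrey: "\<And>z r. 0 < r \<Longrightarrow> (\<integral>\<^sup>+w\<in>pball (z::real \<times> 'a::euclidean_space) r. f w \<partial>lborel) \<le> ennreal ((K / r) powr q * (pball_const TYPE('a) * r ^ (DIM('a) + 2)))"
  shows "AE z in lborel. pmajorant f z < top"
proof -
  let ?D = "DIM('a) + 2" and ?c = "pball_const TYPE('a)"
  obtain C0 where C0: "0 < C0"
    "\<And>f z r t. f \<in> borel_measurable borel \<Longrightarrow> 0 < r \<Longrightarrow> 0 < t \<Longrightarrow>
      (\<And>\<rho>. r \<le> \<rho> \<Longrightarrow> (\<integral>\<^sup>+w\<in>pball (z::real \<times> 'a) \<rho>. f w \<partial>lborel) \<le> ennreal (t * (?c * \<rho> ^ ?D))) \<Longrightarrow>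
      (\<integral>\<^sup>+w\<in>pball z r. epowr (max (f w) (pmax f w)) (1/2) \<partial>lborel) \<le> ennreal (C0 * t powr (1/2) * r ^ ?D)"
    using pmax_A1[of "1/2", where 'a='a] by auto
  have "AE z in lborel. epowr (pmajorant f z) (1/2) * indicator (pball 0 (real (Suc n))) z \<noteq> \<infinity>" for n
  proof (intro nn_integral_PInf_AE)
    have "(\<integral>\<^sup>+w\<in>pball 0 (real (Suc n)). epowr (max (f w) (pmax f w)) (1/2) \<partial>lborel) \<le> ennreal (C0 * ((K / real (Suc n)) powr q) powr (1/2) * real (Suc n) ^ ?D)"
    proof (intro C0(2))
      fix \<rho> assume \<rho>: "real (Suc n) \<le> \<rho>"
      have "(\<integral>\<^sup>+w\<in>pball 0 \<rho>. f w \<partial>lborel) \<le> ennreal ((K / \<rho>) powr q * (?c * \<rho> ^ ?D))"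
        using \<rho> by (intro morrey) auto
      also have "\<dots> \<le> ennreal ((K / real (Suc n)) powr q * (?c * \<rho> ^ ?D))"
        using \<rho> K q pball_const_pos[where 'a='a]
        by (intro ennreal_leI mult_right_mono powr_mono2 divide_left_mono) auto
      finally show "(\<integral>\<^sup>+w\<in>pball 0 \<rho>. f w \<partial>lborel) \<le> ennreal ((K / real (Suc n)) powr q * (?c * \<rho> ^ ?D))" .
    qed (use K in auto)
    then show "(\<integral>\<^sup>+w\<in>pball 0 (real (Suc n)). epowr (pmajorant f w) (1/2) \<partial>lborel) \<noteq> \<infinity>"
      unfolding pmajorant_def by (auto simp: top_unique)
  qed measurable
  then have "AE z in lborel. \<forall>n. epowr (pmajorant f z) (1/2) * indicator (pball 0 (real (Suc n))) z \<noteq> \<infinity>"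
    by (simp add: AE_all_countable)
  then show ?thesis
  proof eventually_elim
    fix z assume a: "\<forall>n. epowr (pmajorant f z) (1/2) * indicator (pball 0 (real (Suc n))) z \<noteq> \<infinity>"
    obtain n where n: "pdist 0 z < real n" using reals_Archimedean2 by blast
    then have "z \<in> pball 0 (real (Suc n))" by (simp add: mem_pball)
    then have "epowr (pmajorant f z) (1/2) \<noteq> top" using a[rule_format, of n] by simp
    then show "pmajorant f z < top" unfolding epowr_eq_top_iff less_top .
  qed
qed

text \<open>If \<open>f\<close> has positive mass, then so does its restriction to a large ball around \<open>z\<close>.\<close>

lemma pmajorant_pos:
  fixes f :: "real \<times> 'a::euclidean_space \<Rightarrow> ennreal"
  assumes [measurable]: "f \<in> borel_measurable borel" and nz: "\<not> (AE w in lborel. f w = 0)"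
  shows "0 < pmajorant f z"
proof -
  let ?D = "DIM('a) + 2" and ?c = "pball_const TYPE('a)"
  have "\<exists>n. (\<integral>\<^sup>+w\<in>pball z (real (Suc n)). f w \<partial>lborel) \<noteq> 0"
  proof (rule ccontr)
    assume "\<not> ?thesis"
    then have "AE w in lborel. f w * indicator (pball z (real (Suc n))) w = 0" for n
      by (subst nn_integral_0_iff_AE[symmetric]) auto
    then have "AE w in lborel. \<forall>n. f w * indicator (pball z (real (Suc n))) w = 0"
      unfolding AE_all_countable by blast
    then have "AE w in lborel. f w = 0"
    proof eventually_elim
      fix w assume a: "\<forall>n. f w * indicator (pball z (real (Suc n))) w = 0"
      obtain n where n: "pdist z w < real n" using reals_Archimedean2 by blast
      then have "w \<in> pball z (real (Suc n))" by (simp add: mem_pball)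
      with a[rule_format, of n] show "f w = 0" by simp
    qed
    with nz show False by simp
  qed
  then obtain n where n: "(\<integral>\<^sup>+w\<in>pball z (real (Suc n)). f w \<partial>lborel) \<noteq> 0" ..
  have "(\<integral>\<^sup>+w\<in>pball z (real (Suc n)). f w \<partial>lborel) \<le> pmax f z * ennreal (?c * real (Suc n) ^ ?D)"
    by (intro nn_integral_pball_le_pmax) (auto simp: mem_pball)
  with n have "pmax f z \<noteq> 0" by (auto simp del: power_Suc of_nat_Suc)
  then have "0 < pmax f z" by (simp add: zero_less_iff_neq_zero)
  also have "\<dots> \<le> pmajorant f z" by (simp add: pmajorant_def)
  finally show ?thesis .
qed

text \<open>Replacing \<open>w\<close> by the larger \<open>V = pmajorant (w^q)^(1/q)\<close> only increases both kernels, and Schur's test applies with the test function \<open>V^g\<close>, \<open>g = 1/p + \<epsilon>\<close>. Each of the four integral conditions is an instance of the potential estimate, and \<open>\<epsilon>\<close> is chosen so that all four exponents stay below \<open>q\<close>; this is possible exactly because \<open>q > 1\<close>.\<close>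

theorem Riesz_trace_inequality:
  fixes p q :: real
  assumes p: "1 < p" and q: "1 < q"
  obtains C where "0 < C"
    "\<And>w K f. w \<in> borel_measurable borel \<Longrightarrow> (\<And>z. 0 \<le> w z) \<Longrightarrow> 0 < K \<Longrightarrow>
      (\<And>z r. 0 < r \<Longrightarrow> (\<integral>\<^sup>+y\<in>pball (z::real \<times> 'a::euclidean_space) r. ennreal (w y powr q) \<partial>lborel) \<le> ennreal ((K / r) powr q * (pball_const TYPE('a) * r ^ (DIM('a) + 2)))) \<Longrightarrow>
      f \<in> borel_measurable borel \<Longrightarrow>
      (NNINT z. epowr (NNINT y. ennreal (w z powr (1 / p) * pdist z y powr (1 / p - real (DIM('a) + 2))) * f y) p)
        \<le> ennreal (C * K) * (NNINT y. epowr (f y) p)"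
    "\<And>w K f. w \<in> borel_measurable borel \<Longrightarrow> (\<And>z. 0 \<le> w z) \<Longrightarrow> 0 < K \<Longrightarrow>
      (\<And>z r. 0 < r \<Longrightarrow> (\<integral>\<^sup>+y\<in>pball (z::real \<times> 'a::euclidean_space) r. ennreal (w y powr q) \<partial>lborel) \<le> ennreal ((K / r) powr q * (pball_const TYPE('a) * r ^ (DIM('a) + 2)))) \<Longrightarrow>
      f \<in> borel_measurable borel \<Longrightarrow>
      (NNINT z. epowr (NNINT y. ennreal (pdist z y powr ((1 - 1 / p) - real (DIM('a) + 2)) * w y powr (1 - 1 / p)) * f y) p)
        \<le> ennreal (C * K powr (p - 1)) * (NNINT y. epowr (f y) p)"
proof -
  let ?D = "DIM('a) + 2" and ?c = "pball_const TYPE('a)"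
  \<comment> \<open>Small enough that both \<open>1 + \<epsilon>\<close> and \<open>1 + \<epsilon> (p - 1)\<close>, the largest exponents below, are less than \<open>q\<close>.\<close>
  define \<epsilon> where "\<epsilon> = (q - 1) / (2 * p)"
  have \<epsilon>: "0 < \<epsilon>" "\<epsilon> < q - 1" "\<epsilon> * (p - 1) < q - 1" "0 < \<epsilon> * (p - 1)"
  proof -
    show "0 < \<epsilon>" using p q by (simp add: \<epsilon>_def)
    then show "0 < \<epsilon> * (p - 1)" using p by simp
    have e: "2 * (\<epsilon> * p) = q - 1" using p by (simp add: \<epsilon>_def)
    have "\<epsilon> * 1 < \<epsilon> * p" using p \<open>0 < \<epsilon>\<close> by (intro mult_strict_left_mono) auto
    with e show "\<epsilon> < q - 1" using p q by simp
    from e have "\<epsilon> * p < q - 1" using q by simp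
    then show "\<epsilon> * (p - 1) < q - 1" using \<open>0 < \<epsilon>\<close> by (simp add: algebra_simps)
  qed
  define g where "g = 1 / p + \<epsilon>"
  have p1: "0 < 1 / p" "1 / p < 1" using p by auto
  have gp: "g * (p - 1) = (1 - 1 / p) + \<epsilon> * (p - 1)" using p by (simp add: g_def field_simps)
  let ?P = "\<lambda>\<beta> \<gamma> C. 0 < C \<and> (\<forall>K f z v. f \<in> borel_measurable borel \<longrightarrow> 0 < K \<longrightarrow>
      (\<forall>z r. 0 < r \<longrightarrow> (\<integral>\<^sup>+w\<in>pball (z::real \<times> 'a) r. f w \<partial>lborel) \<le> ennreal ((K / r) powr q * (?c * r ^ ?D))) \<longrightarrow>
      0 < v \<longrightarrow> pmajorant f z = ennreal v \<longrightarrow>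
      (NNINT w. ennreal (pdist z w powr (\<beta> - real ?D)) * epowr (pmajorant f w) (\<gamma> / q))
        \<le> ennreal (C * K powr \<beta> * v powr ((\<gamma> - \<beta>) / q)))"
  have ex: "\<exists>C. ?P \<beta> \<gamma> C" if "0 < \<beta>" "\<beta> < 1" "\<beta> < \<gamma>" "\<gamma> < q" for \<beta> \<gamma>
    by (rule Riesz_potential_of_pmajorant[OF that, where 'a='a]) blast
  have r1: "0 < 1 - 1 / p" "1 - 1 / p < 1" using p1 by auto
  have "1 / p < g" "g < q" using \<epsilon> p1 unfolding g_def by linarith+
  from ex[OF p1 this] obtain C1 where C1: "?P (1 / p) g C1" ..
  have "1 / p < 1 / p + g * (p - 1)" "1 / p + g * (p - 1) < q" using \<epsilon> p1 unfolding gp by linarith+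
  from ex[OF p1 this] obtain C2 where C2: "?P (1 / p) (1 / p + g * (p - 1)) C2" ..
  have "1 - 1 / p < (1 - 1 / p) + g" "(1 - 1 / p) + g < q" using \<epsilon> p1 unfolding g_def by linarith+
  from ex[OF r1 this] obtain C3 where C3: "?P (1 - 1 / p) ((1 - 1 / p) + g) C3" ..
  have "1 - 1 / p < g * (p - 1)" "g * (p - 1) < q" using \<epsilon> p1 unfolding gp by linarith+
  from ex[OF r1 this] obtain C4 where C4: "?P (1 - 1 / p) (g * (p - 1)) C4" ..
  define C where "C = C1 powr (p - 1) * C2 + C3 powr (p - 1) * C4"
  have Cpos: "0 < C1" "0 < C2" "0 < C3" "0 < C4" using C1 C2 C3 C4 by auto

  have main: "(NNINT z. epowr (NNINT y. ennreal (w z powr (1 / p) * pdist z y powr (1 / p - real ?D)) * f y) p)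
        \<le> ennreal (C1 powr (p - 1) * C2 * K) * (NNINT y. epowr (f y) p) \<and>
      (NNINT z. epowr (NNINT y. ennreal (pdist z y powr ((1 - 1 / p) - real ?D) * w y powr (1 - 1 / p)) * f y) p)
        \<le> ennreal (C3 powr (p - 1) * C4 * K powr (p - 1)) * (NNINT y. epowr (f y) p)"
    if w[measurable]: "w \<in> borel_measurable borel" and w0: "\<And>z. 0 \<le> w z" and K: "0 < K"
      and morrey: "\<And>z r. 0 < r \<Longrightarrow> (\<integral>\<^sup>+y\<in>pball (z::real \<times> 'a) r. ennreal (w y powr q) \<partial>lborel) \<le> ennreal ((K / r) powr q * (?c * r ^ ?D))"
      and f[measurable]: "f \<in> borel_measurable borel" for w :: "real \<times> 'a \<Rightarrow> real" and K f
  proof (cases "AE z in lborel. ennreal (w z powr q) = 0")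
    \<comment> \<open>A vanishing weight is treated apart, because then the majorant vanishes and cannot serve as a test function.\<close>
    case True
    then have z: "AE z in lborel. w z = 0"
    proof eventually_elim
      fix z assume "ennreal (w z powr q) = 0"
      then have "w z powr q \<le> 0" by (simp only: ennreal_eq_0_iff)
      then have "w z powr q = 0" using powr_ge_zero[of "w z" q] by linarith
      then show "w z = 0" by simp
    qed
    have "(NNINT z. epowr (NNINT y. ennreal (w z powr (1 / p) * pdist z y powr (1 / p - real ?D)) * f y) p) = (NNINT (z::real \<times> 'a). 0)"
      using z by (intro nn_integral_cong_AE, eventually_elim) simp
    moreover have "(NNINT y. ennreal (pdist z y powr ((1 - 1 / p) - real ?D) * w y powr (1 - 1 / p)) * f y) = (NNINT (z::real \<times> 'a). 0)" for z
      using z by (intro nn_integral_cong_AE, eventually_elim) simp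
    ultimately show ?thesis by simp
  next
    case False
    define F where "F z = ennreal (w z powr q)" for z
    have [measurable]: "F \<in> borel_measurable borel" unfolding F_def by measurable
    have morreyF: "0 < r \<Longrightarrow> (\<integral>\<^sup>+y\<in>pball z r. F y \<partial>lborel) \<le> ennreal ((K / r) powr q * (?c * r ^ ?D))" for z r
      using morrey unfolding F_def by blast
    have q0: "0 < q" using q by simp
    have fin: "AE z in lborel. pmajorant F z < top"
      using q0 K morreyF by (intro pmajorant_finite[of q K]) auto
    have pos: "0 < pmajorant F z" for z
      using False by (intro pmajorant_pos) (auto simp: F_def)
    define V where "V z = enn2real (pmajorant F z) powr (1 / q)" for z
    have [measurable]: "V \<in> borel_measurable borel" unfolding V_def by measurable
    have V0: "0 \<le> V z" for z by (simp add: V_def)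
    have AEV: "AE z in lborel. 0 < V z \<and> w z \<le> V z \<and> pmajorant F z = ennreal (V z powr q)"
      using fin
    proof eventually_elim
      fix z assume fz: "pmajorant F z < top"
      define v where "v = enn2real (pmajorant F z)"
      have v: "pmajorant F z = ennreal v" using fz by (simp add: v_def)
      have v0: "0 < v" using pos[of z] unfolding v by simp
      have Vz: "V z = v powr (1 / q)" by (simp add: V_def v_def)
      then have Vq: "V z powr q = v" using v0 q0 by (simp add: powr_powr)
      have "F z \<le> pmajorant F z" by (simp add: pmajorant_def)
      then have "w z powr q \<le> V z powr q"
        unfolding F_def v Vq using v0 by (subst (asm) ennreal_le_iff) auto
      then have "w z \<le> V z"
        using q0 w0 V0 by (meson not_le powr_less_mono2)
      with v0 Vq v show "0 < V z \<and> w z \<le> V z \<and> pmajorant F z = ennreal (V z powr q)"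
        by (auto simp: Vz)
    qed
    have pot: "AE z in lborel. (NNINT y. ennreal (pdist z y powr (\<beta> - real ?D)) * ennreal (V y powr \<gamma>)) \<le> ennreal (Cx * K powr \<beta> * V z powr (\<gamma> - \<beta>))"
      if Cx: "?P \<beta> \<gamma> Cx" for \<beta> \<gamma> Cx
      using AEV
    proof eventually_elim
      fix z assume z: "0 < V z \<and> w z \<le> V z \<and> pmajorant F z = ennreal (V z powr q)"
      have "(NNINT y. ennreal (pdist z y powr (\<beta> - real ?D)) * ennreal (V y powr \<gamma>))
         = (NNINT y. ennreal (pdist z y powr (\<beta> - real ?D)) * epowr (pmajorant F y) (\<gamma> / q))"
        using AEV
      proof (intro nn_integral_cong_AE, eventually_elim)
        fix y assume "0 < V y \<and> w y \<le> V y \<and> pmajorant F y = ennreal (V y powr q)"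
        then show "ennreal (pdist z y powr (\<beta> - real ?D)) * ennreal (V y powr \<gamma>) = ennreal (pdist z y powr (\<beta> - real ?D)) * epowr (pmajorant F y) (\<gamma> / q)"
          using q0 by (simp add: epowr_ennreal powr_powr)
      qed
      also have "\<dots> \<le> ennreal (Cx * K powr \<beta> * (V z powr q) powr ((\<gamma> - \<beta>) / q))"
        by (intro Cx[THEN conjunct2, rule_format] morreyF K) (use z in auto)
      finally show "(NNINT y. ennreal (pdist z y powr (\<beta> - real ?D)) * ennreal (V y powr \<gamma>)) \<le> ennreal (Cx * K powr \<beta> * V z powr (\<gamma> - \<beta>))"
        using q0 by (simp add: powr_powr)
    qed
    have Vpos: "AE z in lborel. 0 < V z powr g" using AEV by eventually_elim simp
    let ?k1 = "\<lambda>(z, y). ennreal (V z powr (1 / p) * pdist z y powr (1 / p - real ?D))"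
    let ?k2 = "\<lambda>(z, y). ennreal (pdist z y powr ((1 - 1 / p) - real ?D) * V y powr (1 - 1 / p))"
    have Vg: "(V z powr g) powr (p - 1) = V z powr (g * (p - 1))" for z by (simp add: powr_powr)
    have "(NNINT z. epowr (NNINT y. ennreal (w z powr (1 / p) * pdist z y powr (1 / p - real ?D)) * f y) p)
      \<le> (NNINT z. epowr (NNINT y. ?k1 (z, y) * f y) p)"
      using AEV
    proof (intro nn_integral_mono_AE, eventually_elim)
      fix z assume z: "0 < V z \<and> w z \<le> V z \<and> pmajorant F z = ennreal (V z powr q)"
      show "epowr (NNINT y. ennreal (w z powr (1 / p) * pdist z y powr (1 / p - real ?D)) * f y) p \<le> epowr (NNINT y. ?k1 (z, y) * f y) p"
        using z p w0[of z] unfolding split_conv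
        by (intro epowr_mono nn_integral_mono mult_right_mono ennreal_leI powr_mono2) auto
    qed
    also have "\<dots> \<le> ennreal ((C1 * K powr (1 / p)) powr (p - 1) * (C2 * K powr (1 / p))) * (NNINT y. epowr (f y) p)"
    proof (rule Schur_test[OF p, where k = "?k1" and \<phi> = "\<lambda>y. V y powr g" and \<psi> = "\<lambda>y. V y powr g"])
      have "?k1 \<in> borel_measurable (borel \<Otimes>\<^sub>M borel)" by measurable
      then show "?k1 \<in> borel_measurable borel" unfolding borel_prod .
      show "AE z in lborel. (NNINT y. ?k1 (z, y) * ennreal (V y powr g)) \<le> ennreal (C1 * K powr (1 / p) * V z powr g)"
        using pot[OF C1] AEV
      proof eventually_elim
        fix z assume le: "(NNINT y. ennreal (pdist z y powr (1 / p - real ?D)) * ennreal (V y powr g)) \<le> ennreal (C1 * K powr (1 / p) * V z powr (g - 1 / p))"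
          and z: "0 < V z \<and> w z \<le> V z \<and> pmajorant F z = ennreal (V z powr q)"
        have "(NNINT y. ?k1 (z, y) * ennreal (V y powr g)) = (NNINT y. ennreal (V z powr (1 / p)) * (ennreal (pdist z y powr (1 / p - real ?D)) * ennreal (V y powr g)))"
          unfolding split_conv by (simp only: ennreal_mult' powr_ge_zero mult.assoc)
        also have "\<dots> = ennreal (V z powr (1 / p)) * (NNINT y. ennreal (pdist z y powr (1 / p - real ?D)) * ennreal (V y powr g))"
          by (rule nn_integral_cmult) measurable
        also have "\<dots> \<le> ennreal (V z powr (1 / p)) * ennreal (C1 * K powr (1 / p) * V z powr (g - 1 / p))"
          by (intro mult_left_mono le) simp
        also have "\<dots> = ennreal (V z powr (1 / p) * (C1 * K powr (1 / p) * V z powr (g - 1 / p)))"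
          by (intro ennreal_mult'[symmetric]) simp
        also have "V z powr (1 / p) * (C1 * K powr (1 / p) * V z powr (g - 1 / p)) = C1 * K powr (1 / p) * (V z powr (1 / p) * V z powr (g - 1 / p))"
          by (simp only: mult_ac)
        also have "V z powr (1 / p) * V z powr (g - 1 / p) = V z powr g"
          unfolding powr_add[symmetric] by simp
        finally show "(NNINT y. ?k1 (z, y) * ennreal (V y powr g)) \<le> ennreal (C1 * K powr (1 / p) * V z powr g)" .
      qed
      show "AE y in lborel. (NNINT z. ?k1 (z, y) * ennreal ((V z powr g) powr (p - 1))) \<le> ennreal (C2 * K powr (1 / p) * (V y powr g) powr (p - 1))"
        using pot[OF C2]
      proof eventually_elim
        fix y assume le: "(NNINT z. ennreal (pdist y z powr (1 / p - real ?D)) * ennreal (V z powr (1 / p + g * (p - 1)))) \<le> ennreal (C2 * K powr (1 / p) * V y powr (1 / p + g * (p - 1) - 1 / p))"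
        have "?k1 (z, y) * ennreal ((V z powr g) powr (p - 1)) = ennreal (pdist y z powr (1 / p - real ?D)) * ennreal (V z powr (1 / p + g * (p - 1)))" for z
          unfolding split_conv Vg powr_add pdist_commute[of z y] by (simp only: ennreal_mult' powr_ge_zero mult_ac)
        with le show "(NNINT z. ?k1 (z, y) * ennreal ((V z powr g) powr (p - 1))) \<le> ennreal (C2 * K powr (1 / p) * (V y powr g) powr (p - 1))"
          unfolding Vg by simp
      qed
    qed (use Cpos Vpos in auto)
    also have "(C1 * K powr (1 / p)) powr (p - 1) * (C2 * K powr (1 / p)) = C1 powr (p - 1) * C2 * (K powr ((p - 1) / p) * K powr (1 / p))"
      using Cpos K by (simp add: powr_mult powr_powr)
    also have "K powr ((p - 1) / p) * K powr (1 / p) = K"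
    proof -
      have "(p - 1) / p + 1 / p = 1" using p by (simp add: field_simps)
      then show ?thesis using K by (simp flip: powr_add)
    qed
    finally have A: "(NNINT z. epowr (NNINT y. ennreal (w z powr (1 / p) * pdist z y powr (1 / p - real ?D)) * f y) p)
        \<le> ennreal (C1 powr (p - 1) * C2 * K) * (NNINT y. epowr (f y) p)" .
    have "(NNINT z. epowr (NNINT y. ennreal (pdist z y powr ((1 - 1 / p) - real ?D) * w y powr (1 - 1 / p)) * f y) p)
      \<le> (NNINT z. epowr (NNINT y. ?k2 (z, y) * f y) p)"
    proof (rule nn_integral_mono, rule epowr_mono, rule nn_integral_mono_AE)
      fix z
      show "AE y in lborel. ennreal (pdist z y powr ((1 - 1 / p) - real ?D) * w y powr (1 - 1 / p)) * f y \<le> ?k2 (z, y) * f y"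
        using AEV
      proof eventually_elim
        fix y assume "0 < V y \<and> w y \<le> V y \<and> pmajorant F y = ennreal (V y powr q)"
        then show "ennreal (pdist z y powr ((1 - 1 / p) - real ?D) * w y powr (1 - 1 / p)) * f y \<le> ?k2 (z, y) * f y"
          using r1 w0[of y] unfolding split_conv
          by (intro mult_right_mono ennreal_leI mult_left_mono powr_mono2) auto
      qed
    qed (use p in auto)
    also have "\<dots> \<le> ennreal ((C3 * K powr (1 - 1 / p)) powr (p - 1) * (C4 * K powr (1 - 1 / p))) * (NNINT y. epowr (f y) p)"
    proof (rule Schur_test[OF p, where k = "?k2" and \<phi> = "\<lambda>y. V y powr g" and \<psi> = "\<lambda>y. V y powr g"])
      have "?k2 \<in> borel_measurable (borel \<Otimes>\<^sub>M borel)" by measurable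
      then show "?k2 \<in> borel_measurable borel" unfolding borel_prod .
      show "AE z in lborel. (NNINT y. ?k2 (z, y) * ennreal (V y powr g)) \<le> ennreal (C3 * K powr (1 - 1 / p) * V z powr g)"
        using pot[OF C3]
      proof eventually_elim
        fix z assume le: "(NNINT y. ennreal (pdist z y powr ((1 - 1 / p) - real ?D)) * ennreal (V y powr ((1 - 1 / p) + g))) \<le> ennreal (C3 * K powr (1 - 1 / p) * V z powr ((1 - 1 / p) + g - (1 - 1 / p)))"
        have "?k2 (z, y) * ennreal (V y powr g) = ennreal (pdist z y powr ((1 - 1 / p) - real ?D)) * ennreal (V y powr ((1 - 1 / p) + g))" for y
          unfolding split_conv powr_add by (simp only: ennreal_mult' powr_ge_zero mult_ac)
        with le show "(NNINT y. ?k2 (z, y) * ennreal (V y powr g)) \<le> ennreal (C3 * K powr (1 - 1 / p) * V z powr g)"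
          by simp
      qed
      show "AE y in lborel. (NNINT z. ?k2 (z, y) * ennreal ((V z powr g) powr (p - 1))) \<le> ennreal (C4 * K powr (1 - 1 / p) * (V y powr g) powr (p - 1))"
        using pot[OF C4]
      proof eventually_elim
        fix y assume le: "(NNINT z. ennreal (pdist y z powr ((1 - 1 / p) - real ?D)) * ennreal (V z powr (g * (p - 1)))) \<le> ennreal (C4 * K powr (1 - 1 / p) * V y powr (g * (p - 1) - (1 - 1 / p)))"
        have "(NNINT z. ?k2 (z, y) * ennreal ((V z powr g) powr (p - 1))) = (NNINT z. ennreal (V y powr (1 - 1 / p)) * (ennreal (pdist y z powr ((1 - 1 / p) - real ?D)) * ennreal (V z powr (g * (p - 1)))))"
          unfolding split_conv Vg pdist_commute[of _ y] by (simp only: ennreal_mult' powr_ge_zero mult_ac)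
        also have "\<dots> = ennreal (V y powr (1 - 1 / p)) * (NNINT z. ennreal (pdist y z powr ((1 - 1 / p) - real ?D)) * ennreal (V z powr (g * (p - 1))))"
          by (rule nn_integral_cmult) measurable
        also have "\<dots> \<le> ennreal (V y powr (1 - 1 / p)) * ennreal (C4 * K powr (1 - 1 / p) * V y powr (g * (p - 1) - (1 - 1 / p)))"
          by (intro mult_left_mono le) simp
        also have "\<dots> = ennreal (V y powr (1 - 1 / p) * (C4 * K powr (1 - 1 / p) * V y powr (g * (p - 1) - (1 - 1 / p))))"
          by (intro ennreal_mult'[symmetric]) simp
        also have "V y powr (1 - 1 / p) * (C4 * K powr (1 - 1 / p) * V y powr (g * (p - 1) - (1 - 1 / p))) = C4 * K powr (1 - 1 / p) * (V y powr (1 - 1 / p) * V y powr (g * (p - 1) - (1 - 1 / p)))"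
          by (simp only: mult_ac)
        also have "V y powr (1 - 1 / p) * V y powr (g * (p - 1) - (1 - 1 / p)) = (V y powr g) powr (p - 1)"
          unfolding powr_add[symmetric] Vg by simp
        finally show "(NNINT z. ?k2 (z, y) * ennreal ((V z powr g) powr (p - 1))) \<le> ennreal (C4 * K powr (1 - 1 / p) * (V y powr g) powr (p - 1))" .
      qed
    qed (use Cpos Vpos in auto)
    also have "(C3 * K powr (1 - 1 / p)) powr (p - 1) * (C4 * K powr (1 - 1 / p)) = C3 powr (p - 1) * C4 * (K powr ((1 - 1 / p) * (p - 1)) * K powr (1 - 1 / p))"
      using Cpos K by (simp add: powr_mult powr_powr)
    also have "K powr ((1 - 1 / p) * (p - 1)) * K powr (1 - 1 / p) = K powr (p - 1)"
    proof -
      have "(1 - 1 / p) * (p - 1) + (1 - 1 / p) = p - 1" using p by (simp add: field_simps)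
      then show ?thesis unfolding powr_add[symmetric] by (simp only:)
    qed
    finally show ?thesis using A by blast
  qed
  have le: "ennreal (C1 powr (p - 1) * C2 * K) \<le> ennreal (C * K)" "ennreal (C3 powr (p - 1) * C4 * K) \<le> ennreal (C * K)" if "0 \<le> K" for K
    unfolding C_def using that Cpos by (auto intro!: ennreal_leI mult_right_mono)
  show ?thesis
  proof
    show "0 < C" using Cpos by (simp add: C_def add_pos_pos)
  next
    fix w :: "real \<times> 'a \<Rightarrow> real" and K and f :: "real \<times> 'a \<Rightarrow> ennreal"
    assume a: "w \<in> borel_measurable borel" "\<And>z. 0 \<le> w z" "0 < K"
       "\<And>z r. 0 < r \<Longrightarrow> (\<integral>\<^sup>+y\<in>pball (z::real \<times> 'a) r. ennreal (w y powr q) \<partial>lborel) \<le> ennreal ((K / r) powr q * (?c * r ^ ?D))"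
       "f \<in> borel_measurable borel"
    show "(NNINT z. epowr (NNINT y. ennreal (w z powr (1 / p) * pdist z y powr (1 / p - real ?D)) * f y) p)
        \<le> ennreal (C * K) * (NNINT y. epowr (f y) p)"
      by (rule order_trans[OF conjunct1[OF main[OF a]] mult_right_mono[OF le(1)]]) (use a(3) in auto)
    show "(NNINT z. epowr (NNINT y. ennreal (pdist z y powr ((1 - 1 / p) - real ?D) * w y powr (1 - 1 / p)) * f y) p)
        \<le> ennreal (C * K powr (p - 1)) * (NNINT y. epowr (f y) p)"
      by (rule order_trans[OF conjunct2[OF main[OF a]] mult_right_mono[OF le(2)]]) auto
  qed
qed

section \<open>The Lebesgue spaces\<close>

lemma Lp_norm_nonneg: "0 \<le> Lp_norm p f"
  by (simp add: Lp_norm_def)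

lemma Lp_measurable: "f \<in> Lp p \<Longrightarrow> f \<in> borel_measurable lebesgue"
  by (simp add: Lp_def)

lemma nn_integral_Lp_norm:
  assumes "0 < p" "f \<in> Lp p"
  shows "(\<integral>\<^sup>+z. ennreal (\<bar>f z\<bar> powr p) \<partial>lebesgue) = ennreal (Lp_norm p f powr p)"
proof -
  have "(\<integral>\<^sup>+z. ennreal (\<bar>f z\<bar> powr p) \<partial>lebesgue) = ennreal (\<integral>z. \<bar>f z\<bar> powr p \<partial>lebesgue)"
    using assms by (intro nn_integral_eq_integral) (auto simp: Lp_def)
  moreover have "0 \<le> (\<integral>z. \<bar>f z\<bar> powr p \<partial>lebesgue)"
    by (intro integral_nonneg_AE) auto
  ultimately show ?thesis using assms by (simp add: Lp_norm_def powr_powr)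
qed

lemma Lp_I:
  assumes p: "0 < p" and [measurable]: "f \<in> borel_measurable lebesgue" and C: "0 \<le> C"
    and le: "(\<integral>\<^sup>+z. ennreal (\<bar>f z\<bar> powr p) \<partial>lebesgue) \<le> ennreal (C powr p)"
  shows "f \<in> Lp p" "Lp_norm p f \<le> C"
proof -
  show f: "f \<in> Lp p"
    unfolding Lp_def using le by (auto simp: integrable_iff_bounded intro: le_less_trans)
  have "ennreal (Lp_norm p f powr p) \<le> ennreal (C powr p)"
    using le nn_integral_Lp_norm[OF p f] by simp
  then have "Lp_norm p f powr p \<le> C powr p" by (simp add: ennreal_le_iff)
  then show "Lp_norm p f \<le> C"
    using p C Lp_norm_nonneg by (meson not_le powr_less_mono2)
qed

lemma Lp_cong_AE:
  assumes p: "0 < p" and f: "f \<in> Lp p" and ae: "AE z in lebesgue. f z = g z"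
  shows "g \<in> Lp p" "Lp_norm p g = Lp_norm p f"
proof -
  have [measurable]: "f \<in> borel_measurable lebesgue" by (rule Lp_measurable[OF f])
  have g[measurable]: "g \<in> borel_measurable lebesgue"
    by (rule borel_measurable_AE[OF Lp_measurable[OF f] ae])
  have ae': "AE z in lebesgue. \<bar>f z\<bar> powr p = \<bar>g z\<bar> powr p" using ae by eventually_elim simp
  have "integrable lebesgue (\<lambda>z. \<bar>f z\<bar> powr p)" using f by (simp add: Lp_def)
  then have "integrable lebesgue (\<lambda>z. \<bar>g z\<bar> powr p)"
    by (rule integrable_cong_AE_imp) (use ae' in auto)
  then show "g \<in> Lp p" by (simp add: Lp_def g)
  have "(\<integral>z. \<bar>f z\<bar> powr p \<partial>lebesgue) = (\<integral>z. \<bar>g z\<bar> powr p \<partial>lebesgue)"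
    using ae' by (intro integral_cong_AE) auto
  then show "Lp_norm p g = Lp_norm p f" by (simp add: Lp_norm_def)
qed

lemma Lp_zero: "0 < p \<Longrightarrow> (\<lambda>z. 0) \<in> Lp p" "Lp_norm p (\<lambda>z. 0) = 0"
  by (auto simp: Lp_def Lp_norm_def)

lemma Lp_norm_eq_0:
  assumes p: "0 < p" and f: "f \<in> Lp p" and 0: "Lp_norm p f = 0"
  shows "AE z in lebesgue. f z = 0"
proof -
  have [measurable]: "f \<in> borel_measurable lebesgue" by (rule Lp_measurable[OF f])
  have "(\<integral>\<^sup>+z. ennreal (\<bar>f z\<bar> powr p) \<partial>lebesgue) = 0"
    using nn_integral_Lp_norm[OF p f] p 0 by simp
  then have "AE z in lebesgue. ennreal (\<bar>f z\<bar> powr p) = 0"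
    by (subst (asm) nn_integral_0_iff_AE) auto
  then show ?thesis
  proof eventually_elim
    fix z assume "ennreal (\<bar>f z\<bar> powr p) = 0"
    then have "\<bar>f z\<bar> powr p = 0" by (metis ennreal_eq_0_iff order_antisym powr_ge_zero)
    then show "f z = 0" by simp
  qed
qed

lemma Lp_cmult:
  assumes p: "0 < p" and f: "f \<in> Lp p"
  shows "(\<lambda>z. c * f z) \<in> Lp p" "Lp_norm p (\<lambda>z. c * f z) = \<bar>c\<bar> * Lp_norm p f"
proof -
  have [measurable]: "f \<in> borel_measurable lebesgue" by (rule Lp_measurable[OF f])
  have i: "integrable lebesgue (\<lambda>z. \<bar>f z\<bar> powr p)" using f by (simp add: Lp_def)
  have e: "\<bar>c * f z\<bar> powr p = \<bar>c\<bar> powr p * \<bar>f z\<bar> powr p" for z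
    by (simp add: abs_mult powr_mult)
  have "integrable lebesgue (\<lambda>z. \<bar>c * f z\<bar> powr p)" unfolding e using i by (intro integrable_mult_right)
  then show "(\<lambda>z. c * f z) \<in> Lp p" unfolding Lp_def by simp
  have n: "0 \<le> (\<integral>z. \<bar>f z\<bar> powr p \<partial>lebesgue)" by (intro integral_nonneg_AE) auto
  show "Lp_norm p (\<lambda>z. c * f z) = \<bar>c\<bar> * Lp_norm p f"
    unfolding Lp_norm_def e using p n by (simp add: powr_mult powr_powr)
qed

lemma powr_convex_combination:
  fixes x y :: real
  assumes p: "1 < p" and x: "0 \<le> x" and y: "0 \<le> y" and s: "0 < s" "0 < t" "s + t = 1"
  shows "(s * x + t * y) powr p \<le> s * x powr p + t * y powr p"
proof -
  consider "0 < x" "0 < y" | "x = 0" | "y = 0" using x y by linarith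
  then show ?thesis
  proof cases
    case 1
    have s1: "s = 1 - t" using s by simp
    show ?thesis unfolding s1 using convex_onD[OF powr_convex[of p], of t x y] 1 p s by simp
  next
    case 2
    have "t powr p \<le> t powr 1" using p s by (intro powr_mono') auto
    then have "t powr p * y powr p \<le> t * y powr p" using s by (intro mult_right_mono) auto
    then show ?thesis using 2 p y s by (simp add: powr_mult)
  next
    case 3
    have "s powr p \<le> s powr 1" using p s by (intro powr_mono') auto
    then have "s powr p * x powr p \<le> s * x powr p" using s by (intro mult_right_mono) auto
    then show ?thesis using 3 p x s by (simp add: powr_mult)
  qed
qed

text \<open>Convexity of the power function applied to the convex combination of the two normalised functions.\<close>

lemma Minkowski:
  fixes f g :: "'b::euclidean_space \<Rightarrow> real"
  assumes p: "1 < p" and f: "f \<in> Lp p" and g: "g \<in> Lp p"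
  shows "(\<lambda>z. f z + g z) \<in> Lp p" "Lp_norm p (\<lambda>z. f z + g z) \<le> Lp_norm p f + Lp_norm p g"
proof -
  have [measurable]: "f \<in> borel_measurable lebesgue" "g \<in> borel_measurable lebesgue"
    using f g by (auto simp: Lp_measurable)
  have p0: "0 < p" using p by simp
  have key: "(\<lambda>z. f z + g z) \<in> Lp p \<and> Lp_norm p (\<lambda>z. f z + g z) \<le> Lp_norm p f + Lp_norm p g + 2 * e" if e: "0 < e" for e
  proof -
    define a where "a = Lp_norm p f + e"
    define b where "b = Lp_norm p g + e"
    have ab: "0 < a" "0 < b" "Lp_norm p f \<le> a" "Lp_norm p g \<le> b"
      using e Lp_norm_nonneg[of p f] Lp_norm_nonneg[of p g] by (auto simp: a_def b_def)
    define s where "s = a / (a + b)"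
    define t where "t = b / (a + b)"
    have st: "0 < s" "0 < t" "s + t = 1" using ab by (auto simp: s_def t_def add_divide_distrib[symmetric])
    have pw: "\<bar>f z + g z\<bar> powr p \<le> (a + b) powr p * (s / a powr p * \<bar>f z\<bar> powr p + t / b powr p * \<bar>g z\<bar> powr p)" for z
    proof -
      have "\<bar>f z + g z\<bar> \<le> (a + b) * (s * (\<bar>f z\<bar> / a) + t * (\<bar>g z\<bar> / b))"
        using ab by (simp add: s_def t_def distrib_left)
      then have "\<bar>f z + g z\<bar> powr p \<le> ((a + b) * (s * (\<bar>f z\<bar> / a) + t * (\<bar>g z\<bar> / b))) powr p"
        using p by (intro powr_mono2) auto
      also have "\<dots> = (a + b) powr p * (s * (\<bar>f z\<bar> / a) + t * (\<bar>g z\<bar> / b)) powr p"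
        using ab st by (intro powr_mult)
      also have "\<dots> \<le> (a + b) powr p * (s * (\<bar>f z\<bar> / a) powr p + t * (\<bar>g z\<bar> / b) powr p)"
        using p ab st by (intro mult_left_mono powr_convex_combination) auto
      finally show ?thesis using ab by (simp add: powr_divide)
    qed
    have cn: "0 \<le> (a + b) powr p" "0 \<le> s / a powr p" "0 \<le> t / b powr p" using st ab by auto
    have "(\<integral>\<^sup>+z. ennreal (\<bar>f z + g z\<bar> powr p) \<partial>lebesgue)
       \<le> (\<integral>\<^sup>+z. ennreal ((a + b) powr p) * (ennreal (s / a powr p) * ennreal (\<bar>f z\<bar> powr p) + ennreal (t / b powr p) * ennreal (\<bar>g z\<bar> powr p)) \<partial>lebesgue)"
    proof (intro nn_integral_mono)
      fix z
      have "ennreal (\<bar>f z + g z\<bar> powr p) \<le> ennreal ((a + b) powr p * (s / a powr p * \<bar>f z\<bar> powr p + t / b powr p * \<bar>g z\<bar> powr p))"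
        by (intro ennreal_leI pw)
      also have "\<dots> = ennreal ((a + b) powr p) * (ennreal (s / a powr p) * ennreal (\<bar>f z\<bar> powr p) + ennreal (t / b powr p) * ennreal (\<bar>g z\<bar> powr p))"
        using cn by (simp only: ennreal_mult' ennreal_plus powr_ge_zero mult_nonneg_nonneg)
      finally show "ennreal (\<bar>f z + g z\<bar> powr p) \<le> \<dots>" .
    qed
    also have "\<dots> = ennreal ((a + b) powr p) * (ennreal (s / a powr p) * ennreal (Lp_norm p f powr p) + ennreal (t / b powr p) * ennreal (Lp_norm p g powr p))"
      by (subst nn_integral_cmult, measurable, subst nn_integral_add, measurable, subst nn_integral_cmult, measurable, subst nn_integral_cmult, measurable)
         (simp only: nn_integral_Lp_norm[OF p0 f] nn_integral_Lp_norm[OF p0 g])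
    also have "\<dots> = ennreal ((a + b) powr p * (s / a powr p * Lp_norm p f powr p + t / b powr p * Lp_norm p g powr p))"
      using cn by (simp only: ennreal_mult' ennreal_plus powr_ge_zero mult_nonneg_nonneg)
    also have "\<dots> \<le> ennreal ((a + b) powr p)"
    proof (intro ennreal_leI)
      have "s / a powr p * Lp_norm p f powr p \<le> s / a powr p * a powr p"
        using ab cn p Lp_norm_nonneg by (intro mult_left_mono powr_mono2) auto
      moreover have "t / b powr p * Lp_norm p g powr p \<le> t / b powr p * b powr p"
        using ab cn p Lp_norm_nonneg by (intro mult_left_mono powr_mono2) auto
      ultimately have "s / a powr p * Lp_norm p f powr p + t / b powr p * Lp_norm p g powr p \<le> 1"
        using ab st by simp
      from mult_left_mono[OF this cn(1)] show "(a + b) powr p * (s / a powr p * Lp_norm p f powr p + t / b powr p * Lp_norm p g powr p) \<le> (a + b) powr p"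
        by simp
    qed
    finally have "(\<integral>\<^sup>+z. ennreal (\<bar>f z + g z\<bar> powr p) \<partial>lebesgue) \<le> ennreal ((a + b) powr p)" .
    from Lp_I[OF p0 _ _ this] ab show ?thesis by (auto simp: a_def b_def)
  qed
  from key[of 1] show "(\<lambda>z. f z + g z) \<in> Lp p" by simp
  show "Lp_norm p (\<lambda>z. f z + g z) \<le> Lp_norm p f + Lp_norm p g"
  proof (rule field_le_epsilon)
    fix e :: real assume "0 < e"
    then show "Lp_norm p (\<lambda>z. f z + g z) \<le> Lp_norm p f + Lp_norm p g + e" using key[of "e / 2"] by simp
  qed
qed

lemma Lp_diff:
  assumes p: "1 < p" and f: "f \<in> Lp p" and g: "g \<in> Lp p"
  shows "(\<lambda>z. f z - g z) \<in> Lp p" "Lp_norm p (\<lambda>z. f z - g z) \<le> Lp_norm p f + Lp_norm p g"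
    "Lp_norm p f \<le> Lp_norm p (\<lambda>z. f z - g z) + Lp_norm p g"
proof -
  have g': "(\<lambda>z. (-1) * g z) \<in> Lp p" "Lp_norm p (\<lambda>z. (-1) * g z) = Lp_norm p g"
    using Lp_cmult[of p g "-1"] p g by auto
  have e: "(\<lambda>z. f z - g z) = (\<lambda>z. f z + (-1) * g z)" by auto
  show 1: "(\<lambda>z. f z - g z) \<in> Lp p" "Lp_norm p (\<lambda>z. f z - g z) \<le> Lp_norm p f + Lp_norm p g"
    unfolding e using Minkowski[OF p f g'(1)] g'(2) by auto
  show "Lp_norm p f \<le> Lp_norm p (\<lambda>z. f z - g z) + Lp_norm p g"
    using Minkowski(2)[OF p 1(1) g] by simp
qed

lemma Lp_sum:
  assumes p: "1 < p" and "finite A" "\<And>i. i \<in> A \<Longrightarrow> g i \<in> Lp p"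
  shows "(\<lambda>z. \<Sum>i\<in>A. g i z) \<in> Lp p" "Lp_norm p (\<lambda>z. \<Sum>i\<in>A. g i z) \<le> (\<Sum>i\<in>A. Lp_norm p (g i))"
proof -
  have "(\<lambda>z. \<Sum>i\<in>A. g i z) \<in> Lp p \<and> Lp_norm p (\<lambda>z. \<Sum>i\<in>A. g i z) \<le> (\<Sum>i\<in>A. Lp_norm p (g i))"
    using assms(2,3)
  proof (induction A)
    case empty
    then show ?case using p by (simp add: Lp_zero)
  next
    case (insert i A)
    then have 1: "(\<lambda>z. \<Sum>i\<in>A. g i z) \<in> Lp p" "Lp_norm p (\<lambda>z. \<Sum>i\<in>A. g i z) \<le> (\<Sum>i\<in>A. Lp_norm p (g i))"
      and 2: "g i \<in> Lp p" by auto
    from Minkowski[OF p 2 1(1)] 1(2) show ?case using insert.hyps by simp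
  qed
  then show "(\<lambda>z. \<Sum>i\<in>A. g i z) \<in> Lp p" "Lp_norm p (\<lambda>z. \<Sum>i\<in>A. g i z) \<le> (\<Sum>i\<in>A. Lp_norm p (g i))" by auto
qed

lemma Lp_abs:
  assumes "f \<in> Lp p" shows "(\<lambda>z. \<bar>f z\<bar>) \<in> Lp p" "Lp_norm p (\<lambda>z. \<bar>f z\<bar>) = Lp_norm p f"
  using assms by (auto simp: Lp_def Lp_norm_def)

lemma Lp_dominated:
  assumes p: "0 < p" and g: "g \<in> Lp p" and [measurable]: "f \<in> borel_measurable lebesgue"
    and le: "AE z in lebesgue. \<bar>f z\<bar> \<le> C * \<bar>g z\<bar>" and C: "0 \<le> C"
  shows "f \<in> Lp p" "Lp_norm p f \<le> C * Lp_norm p g"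
proof -
  have [measurable]: "g \<in> borel_measurable lebesgue" using g by (rule Lp_measurable)
  have "(\<integral>\<^sup>+z. ennreal (\<bar>f z\<bar> powr p) \<partial>lebesgue) \<le> (\<integral>\<^sup>+z. ennreal (C powr p) * ennreal (\<bar>g z\<bar> powr p) \<partial>lebesgue)"
    using le
  proof (intro nn_integral_mono_AE, eventually_elim)
    fix z assume "\<bar>f z\<bar> \<le> C * \<bar>g z\<bar>"
    then have "\<bar>f z\<bar> powr p \<le> (C * \<bar>g z\<bar>) powr p" using p by (intro powr_mono2) auto
    then have "\<bar>f z\<bar> powr p \<le> C powr p * \<bar>g z\<bar> powr p" using C by (simp add: powr_mult)
    then show "ennreal (\<bar>f z\<bar> powr p) \<le> ennreal (C powr p) * ennreal (\<bar>g z\<bar> powr p)"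
      by (simp add: ennreal_mult'[symmetric] ennreal_leI)
  qed
  also have "\<dots> = ennreal (C powr p) * ennreal (Lp_norm p g powr p)"
    by (subst nn_integral_cmult) (auto simp: nn_integral_Lp_norm[OF p g])
  also have "\<dots> = ennreal ((C * Lp_norm p g) powr p)"
    using C Lp_norm_nonneg by (simp add: powr_mult ennreal_mult')
  finally have *: "(\<integral>\<^sup>+z. ennreal (\<bar>f z\<bar> powr p) \<partial>lebesgue) \<le> ennreal ((C * Lp_norm p g) powr p)" .
  have "0 \<le> C * Lp_norm p g" by (intro mult_nonneg_nonneg C Lp_norm_nonneg)
  from Lp_I[OF p _ this *] show "f \<in> Lp p" "Lp_norm p f \<le> C * Lp_norm p g" by auto
qed

text \<open>Dominated convergence with dominating function \<open>\<bar>f\<bar>^p\<close>. It serves for every truncation below.\<close>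

lemma Lp_mult_tendsto_0:
  fixes f :: "'b::euclidean_space \<Rightarrow> real"
  assumes p: "0 < p" and f: "f \<in> Lp p" and m[measurable]: "\<And>n::nat. m n \<in> borel_measurable lebesgue"
    and le: "\<And>n z. \<bar>m n z\<bar> \<le> 1" and lim: "\<And>z. (\<lambda>n. m n z) \<longlonglongrightarrow> 0"
  shows "(\<lambda>n. Lp_norm p (\<lambda>z. m n z * f z)) \<longlonglongrightarrow> 0"
proof -
  have [measurable]: "f \<in> borel_measurable lebesgue" using f by (rule Lp_measurable)
  have "(\<lambda>n. \<integral>z. \<bar>m n z * f z\<bar> powr p \<partial>lebesgue) \<longlonglongrightarrow> integral\<^sup>L lebesgue (\<lambda>z::'b. 0)"
  proof (rule integral_dominated_convergence[where w = "\<lambda>z. \<bar>f z\<bar> powr p"])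
    show "integrable lebesgue (\<lambda>z. \<bar>f z\<bar> powr p)" using f by (simp add: Lp_def)
    show "AE z in lebesgue. (\<lambda>n. \<bar>m n z * f z\<bar> powr p) \<longlonglongrightarrow> 0"
    proof (rule AE_I2)
      fix z
      have "(\<lambda>n. \<bar>m n z * f z\<bar>) \<longlonglongrightarrow> \<bar>0 * f z\<bar>" by (intro tendsto_intros lim)
      then show "(\<lambda>n. \<bar>m n z * f z\<bar> powr p) \<longlonglongrightarrow> 0"
        using p by (intro tendsto_zero_powrI[where b = p]) auto
    qed
    show "AE z in lebesgue. norm (\<bar>m n z * f z\<bar> powr p) \<le> \<bar>f z\<bar> powr p" for n
    proof (rule AE_I2)
      fix z
      have "\<bar>m n z\<bar> * \<bar>f z\<bar> \<le> 1 * \<bar>f z\<bar>" by (intro mult_right_mono le) auto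
      then have "\<bar>m n z * f z\<bar> powr p \<le> \<bar>f z\<bar> powr p" using p by (intro powr_mono2) (auto simp: abs_mult)
      then show "norm (\<bar>m n z * f z\<bar> powr p) \<le> \<bar>f z\<bar> powr p" by simp
    qed
  qed measurable
  then have "(\<lambda>n. \<integral>z. \<bar>m n z * f z\<bar> powr p \<partial>lebesgue) \<longlonglongrightarrow> 0" by simp
  moreover have "0 \<le> (\<integral>z. \<bar>m n z * f z\<bar> powr p \<partial>lebesgue)" for n by (intro integral_nonneg_AE) auto
  ultimately show ?thesis
    unfolding Lp_norm_def using p by (intro tendsto_zero_powrI[where b = "1 / p"]) auto
qed

text \<open>The increasing partial sums of the absolute values have bounded norms, so their limit is finite almost everywhere and dominates the series.\<close>

lemma Riesz_Fischer:
  fixes g :: "nat \<Rightarrow> 'b::euclidean_space \<Rightarrow> real"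
  assumes p: "1 < p" and g: "\<And>n. g n \<in> Lp p" and a: "\<And>n. Lp_norm p (g n) \<le> a n" "summable a"
  shows "\<exists>s\<in>Lp p. (\<lambda>N. Lp_norm p (\<lambda>z. s z - (\<Sum>n<N. g n z))) \<longlonglongrightarrow> 0"
proof -
  have p0: "0 < p" using p by simp
  have [measurable]: "g n \<in> borel_measurable lebesgue" for n using g by (rule Lp_measurable)
  have a0: "0 \<le> a n" for n using a(1)[of n] Lp_norm_nonneg[of p "g n"] by linarith
  define G where "G N z = (\<Sum>n<N. \<bar>g n z\<bar>)" for N z
  have [measurable]: "G N \<in> borel_measurable lebesgue" for N unfolding G_def by measurable
  have GLp: "G N \<in> Lp p" "Lp_norm p (G N) \<le> suminf a" for N
  proof -
    show "G N \<in> Lp p"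
      unfolding G_def using p g Lp_abs by (auto intro!: Lp_sum)
    have "Lp_norm p (G N) \<le> (\<Sum>n<N. Lp_norm p (\<lambda>z. \<bar>g n z\<bar>))"
      unfolding G_def using p g Lp_abs by (intro Lp_sum) auto
    also have "(\<Sum>n<N. Lp_norm p (\<lambda>z. \<bar>g n z\<bar>)) \<le> (\<Sum>n<N. a n)"
      using Lp_abs(2)[OF g] a(1) by (intro sum_mono) simp
    also have "\<dots> \<le> suminf a" using a0 a(2) by (intro sum_le_suminf) auto
    finally show "Lp_norm p (G N) \<le> suminf a" .
  qed
  have sa: "0 \<le> suminf a" using a0 a(2) by (intro suminf_nonneg) auto
  have "(\<integral>\<^sup>+z. liminf (\<lambda>N. ennreal (\<bar>G N z\<bar> powr p)) \<partial>lebesgue) \<le> liminf (\<lambda>N. \<integral>\<^sup>+z. ennreal (\<bar>G N z\<bar> powr p) \<partial>lebesgue)"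
    by (intro nn_integral_liminf) measurable
  also have "\<dots> \<le> ennreal (suminf a powr p)"
  proof (intro Liminf_le always_eventually allI)
    fix N
    show "(\<integral>\<^sup>+z. ennreal (\<bar>G N z\<bar> powr p) \<partial>lebesgue) \<le> ennreal (suminf a powr p)"
      unfolding nn_integral_Lp_norm[OF p0 GLp(1)] using p Lp_norm_nonneg GLp(2) by (intro ennreal_leI powr_mono2) auto
  qed simp
  finally have "(\<integral>\<^sup>+z. liminf (\<lambda>N. ennreal (\<bar>G N z\<bar> powr p)) \<partial>lebesgue) \<noteq> \<infinity>" by (auto simp: top_unique)
  then have "AE z in lebesgue. liminf (\<lambda>N. ennreal (\<bar>G N z\<bar> powr p)) \<noteq> \<infinity>"
    by (intro nn_integral_PInf_AE) measurable
  then have sm: "AE z in lebesgue. summable (\<lambda>n. \<bar>g n z\<bar>)"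
  proof eventually_elim
    fix z assume "liminf (\<lambda>N. ennreal (\<bar>G N z\<bar> powr p)) \<noteq> \<infinity>"
    then obtain r where r: "0 \<le> r" "liminf (\<lambda>N. ennreal (\<bar>G N z\<bar> powr p)) = ennreal r"
      by (cases "liminf (\<lambda>N. ennreal (\<bar>G N z\<bar> powr p))") auto
    define B where "B = r + 1"
    have B: "0 \<le> B" "liminf (\<lambda>N. ennreal (\<bar>G N z\<bar> powr p)) < ennreal B"
      using r(1) unfolding r(2) by (simp_all add: B_def ennreal_less_iff)
    have freq: "\<exists>m\<ge>N. ennreal (\<bar>G m z\<bar> powr p) < ennreal B" for N
    proof (rule ccontr)
      assume "\<not> ?thesis"
      then have "eventually (\<lambda>m. ennreal B \<le> ennreal (\<bar>G m z\<bar> powr p)) sequentially"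
        unfolding eventually_sequentially by (auto simp: not_less)
      then have "ennreal B \<le> liminf (\<lambda>N. ennreal (\<bar>G N z\<bar> powr p))" by (rule Liminf_bounded)
      with B show False by simp
    qed
    have "G N z \<le> B powr (1 / p)" for N
    proof -
      obtain m where m: "N \<le> m" "ennreal (\<bar>G m z\<bar> powr p) < ennreal B" using freq by blast
      have G0: "0 \<le> G k z" for k by (simp add: G_def sum_nonneg)
      have "G m z powr p \<le> B" using m B G0[of m] by (simp add: ennreal_less_iff)
      then have "(G m z powr p) powr (1 / p) \<le> B powr (1 / p)" using p by (intro powr_mono2) auto
      then have "G m z \<le> B powr (1 / p)" using p G0[of m] by (simp add: powr_powr)
      moreover have "G N z \<le> G m z" unfolding G_def using m by (intro sum_mono2) auto
      ultimately show ?thesis by simp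
    qed
    then show "summable (\<lambda>n. \<bar>g n z\<bar>)"
      unfolding G_def by (intro summableI_nonneg_bounded) auto
  qed
  define s where "s z = (\<Sum>n. g n z)" for z
  have [measurable]: "s \<in> borel_measurable lebesgue" unfolding s_def by measurable
  have tail: "(\<lambda>z. s z - (\<Sum>n<N. g n z)) \<in> Lp p \<and> Lp_norm p (\<lambda>z. s z - (\<Sum>n<N. g n z)) \<le> (\<Sum>n. a (n + N))" for N
  proof -
    have an: "0 \<le> (\<Sum>n. a (n + N))" using a0 a(2) by (intro suminf_nonneg) (auto simp: summable_iff_shift)
    have "(\<integral>\<^sup>+z. ennreal (\<bar>s z - (\<Sum>n<N. g n z)\<bar> powr p) \<partial>lebesgue) = (\<integral>\<^sup>+z. liminf (\<lambda>M. ennreal (\<bar>\<Sum>n<M. g (n + N) z\<bar> powr p)) \<partial>lebesgue)"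
      using sm
    proof (intro nn_integral_cong_AE, eventually_elim)
      fix z assume "summable (\<lambda>n. \<bar>g n z\<bar>)"
      then have "summable (\<lambda>n. g n z)" by (rule summable_rabs_cancel)
      then have "(\<lambda>n. g (n + N) z) sums (s z - (\<Sum>n<N. g n z))"
        unfolding s_def using sums_iff_shift[of "\<lambda>n. g n z" N] by (simp add: summable_sums)
      then have "(\<lambda>M. \<Sum>n<M. g (n + N) z) \<longlonglongrightarrow> s z - (\<Sum>n<N. g n z)" by (simp add: sums_def)
      then have "(\<lambda>M. \<bar>\<Sum>n<M. g (n + N) z\<bar> powr p) \<longlonglongrightarrow> \<bar>s z - (\<Sum>n<N. g n z)\<bar> powr p"
        using p by (intro tendsto_powr' tendsto_rabs tendsto_const) auto
      then have "(\<lambda>M. ennreal (\<bar>\<Sum>n<M. g (n + N) z\<bar> powr p)) \<longlonglongrightarrow> ennreal (\<bar>s z - (\<Sum>n<N. g n z)\<bar> powr p)"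
        by (rule tendsto_ennrealI)
      from lim_imp_Liminf[OF _ this] show "ennreal (\<bar>s z - (\<Sum>n<N. g n z)\<bar> powr p) = liminf (\<lambda>M. ennreal (\<bar>\<Sum>n<M. g (n + N) z\<bar> powr p))"
        by simp
    qed
    also have "\<dots> \<le> liminf (\<lambda>M. \<integral>\<^sup>+z. ennreal (\<bar>\<Sum>n<M. g (n + N) z\<bar> powr p) \<partial>lebesgue)"
      by (intro nn_integral_liminf) measurable
    also have "\<dots> \<le> ennreal ((\<Sum>n. a (n + N)) powr p)"
    proof (intro Liminf_le always_eventually allI)
      fix M
      have 1: "(\<lambda>z. \<Sum>n<M. g (n + N) z) \<in> Lp p" "Lp_norm p (\<lambda>z. \<Sum>n<M. g (n + N) z) \<le> (\<Sum>n<M. Lp_norm p (g (n + N)))"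
        using p g by (auto intro!: Lp_sum)
      have "(\<Sum>n<M. Lp_norm p (g (n + N))) \<le> (\<Sum>n<M. a (n + N))" by (intro sum_mono a)
      also have "\<dots> \<le> (\<Sum>n. a (n + N))" using a0 a(2) by (intro sum_le_suminf) (auto simp: summable_iff_shift)
      finally show "(\<integral>\<^sup>+z. ennreal (\<bar>\<Sum>n<M. g (n + N) z\<bar> powr p) \<partial>lebesgue) \<le> ennreal ((\<Sum>n. a (n + N)) powr p)"
        unfolding nn_integral_Lp_norm[OF p0 1(1)] using p 1(2) Lp_norm_nonneg by (intro ennreal_leI powr_mono2) auto
    qed simp
    finally have *: "(\<integral>\<^sup>+z. ennreal (\<bar>s z - (\<Sum>n<N. g n z)\<bar> powr p) \<partial>lebesgue) \<le> ennreal ((\<Sum>n. a (n + N)) powr p)" .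
    from Lp_I[OF p0 _ an *] show ?thesis by auto
  qed
  have "s \<in> Lp p" using tail[of 0] by simp
  moreover have "(\<lambda>N. Lp_norm p (\<lambda>z. s z - (\<Sum>n<N. g n z))) \<longlonglongrightarrow> 0"
  proof (rule tendsto_sandwich[OF _ _ tendsto_const suminf_exist_split2[OF a(2)]])
    show "\<forall>\<^sub>F N in sequentially. 0 \<le> Lp_norm p (\<lambda>z. s z - (\<Sum>n<N. g n z))" by (simp add: Lp_norm_nonneg)
    show "\<forall>\<^sub>F N in sequentially. Lp_norm p (\<lambda>z. s z - (\<Sum>n<N. g n z)) \<le> (\<Sum>n. a (n + N))" using tail by simp
  qed
  ultimately show ?thesis by blast
qed

section \<open>Bounded operators and Neumann series\<close>

lemma Lp_bounded_opD:
  assumes "Lp_bounded_op p T" "f \<in> Lp p"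
  shows "T f \<in> Lp p" "g \<in> Lp p \<Longrightarrow> AE z in lebesgue. T (\<lambda>w. f w + g w) z = T f z + T g z"
    "AE z in lebesgue. T (\<lambda>w. c * f w) z = c * T f z"
  using assms by (auto simp: Lp_bounded_op_def)

lemma Lp_bounded_op_cong_AE:
  assumes p: "1 < p" and T: "Lp_bounded_op p T" and f: "f \<in> Lp p" and g: "g \<in> Lp p"
    and ae: "AE z in lebesgue. f z = g z"
  shows "AE z in lebesgue. T f z = T g z"
proof -
  have p0: "0 < p" using p by simp
  let ?h = "\<lambda>z. f z + (-1) * g z"
  have g': "(\<lambda>z. (-1) * g z) \<in> Lp p" using Lp_cmult(1)[OF p0 g] .
  have h: "?h \<in> Lp p" using Minkowski(1)[OF p f g'] .
  have "AE z in lebesgue. 0 = ?h z" using ae by eventually_elim simp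
  from Lp_cong_AE(2)[OF p0 Lp_zero(1)[OF p0] this] have "Lp_norm p ?h = 0" by (simp add: Lp_zero)
  moreover obtain C where "Lp_norm p (T ?h) \<le> C * Lp_norm p ?h" using T h unfolding Lp_bounded_op_def by blast
  ultimately have "Lp_norm p (T ?h) = 0" using Lp_norm_nonneg[of p "T ?h"] by simp
  moreover have "T ?h \<in> Lp p" using T h unfolding Lp_bounded_op_def by blast
  ultimately have "AE z in lebesgue. T ?h z = 0" using Lp_norm_eq_0[OF p0] by blast
  moreover have "AE z in lebesgue. T ?h z = T f z + T (\<lambda>z. (-1) * g z) z" by (rule Lp_bounded_opD(2)[OF T f g'])
  moreover have "AE z in lebesgue. T (\<lambda>z. (-1) * g z) z = (-1) * T g z" by (rule Lp_bounded_opD(3)[OF T g])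
  ultimately show ?thesis by eventually_elim simp
qed

lemma Lp_bounded_op_diff:
  assumes p: "1 < p" and T: "Lp_bounded_op p T" and f: "f \<in> Lp p" and g: "g \<in> Lp p"
  shows "AE z in lebesgue. T (\<lambda>z. f z - g z) z = T f z - T g z"
proof -
  have g': "(\<lambda>z. (-1) * g z) \<in> Lp p" using Lp_cmult(1)[OF _ g, where c = "-1"] p by simp
  have "AE z in lebesgue. T (\<lambda>z. f z + (-1) * g z) z = T f z + T (\<lambda>z. (-1) * g z) z" by (rule Lp_bounded_opD(2)[OF T f g'])
  moreover have "AE z in lebesgue. T (\<lambda>z. (-1) * g z) z = (-1) * T g z" by (rule Lp_bounded_opD(3)[OF T g])
  ultimately show ?thesis by eventually_elim simp
qed

lemma Lp_bounded_op_sum: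
  assumes p: "1 < p" and T: "Lp_bounded_op p T" and g: "\<And>n::nat. g n \<in> Lp p"
  shows "AE z in lebesgue. T (\<lambda>z. \<Sum>n<N. g n z) z = (\<Sum>n<N. T (g n) z)"
proof (induction N)
  case 0
  have "AE z in lebesgue. T (\<lambda>w. 0 * g 0 w) z = 0 * T (g 0) z" by (rule Lp_bounded_opD(3)[OF T g])
  then show ?case by simp
next
  case (Suc N)
  have "(\<lambda>z. \<Sum>n<N. g n z) \<in> Lp p" using p g by (auto intro: Lp_sum)
  then have "AE z in lebesgue. T (\<lambda>z. (\<Sum>n<N. g n z) + g N z) z = T (\<lambda>z. \<Sum>n<N. g n z) z + T (g N) z"
    by (rule Lp_bounded_opD(2)[OF T _ g])
  with Suc show ?case by eventually_elim simp
qed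

lemma one_plus_contraction_bound:
  assumes p: "1 < p" and T: "Lp_bounded_op p T" and le: "\<And>f. f \<in> Lp p \<Longrightarrow> Lp_norm p (T f) \<le> \<theta> * Lp_norm p f"
    and g: "g \<in> Lp p"
  shows "(\<lambda>z. g z + T g z) \<in> Lp p" "(1 - \<theta>) * Lp_norm p g \<le> Lp_norm p (\<lambda>z. g z + T g z)"
proof -
  have Tg: "T g \<in> Lp p" using T g unfolding Lp_bounded_op_def by blast
  show 1: "(\<lambda>z. g z + T g z) \<in> Lp p" by (rule Minkowski(1)[OF p g Tg])
  have "Lp_norm p (\<lambda>z. (g z + T g z) - T g z) \<le> Lp_norm p (\<lambda>z. g z + T g z) + Lp_norm p (T g)"
    by (rule Lp_diff(2)[OF p 1 Tg])
  then show "(1 - \<theta>) * Lp_norm p g \<le> Lp_norm p (\<lambda>z. g z + T g z)" using le[OF g] by (simp add: algebra_simps)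
qed

lemma one_plus_contraction_inj:
  assumes p: "1 < p" and T: "Lp_bounded_op p T" and le: "\<And>f. f \<in> Lp p \<Longrightarrow> Lp_norm p (T f) \<le> \<theta> * Lp_norm p f"
    and \<theta>: "\<theta> < 1" and g: "g \<in> Lp p" "g' \<in> Lp p" and eq: "AE z in lebesgue. g z + T g z = g' z + T g' z"
  shows "AE z in lebesgue. g z = g' z"
proof -
  have p0: "0 < p" using p by simp
  let ?h = "\<lambda>z. g z - g' z"
  have h: "?h \<in> Lp p" by (rule Lp_diff(1)[OF p g])
  have "AE z in lebesgue. 0 = ?h z + T ?h z" using eq Lp_bounded_op_diff[OF p T g] by eventually_elim simp
  from Lp_cong_AE(2)[OF p0 Lp_zero(1)[OF p0] this] have "Lp_norm p (\<lambda>z. ?h z + T ?h z) = 0" by (simp add: Lp_zero)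
  with one_plus_contraction_bound(2)[OF p T le h] \<theta> have "Lp_norm p ?h \<le> 0" by (simp add: mult_le_0_iff)
  then have "Lp_norm p ?h = 0" using Lp_norm_nonneg[of p ?h] by simp
  from Lp_norm_eq_0[OF p0 h this] show ?thesis by eventually_elim simp
qed

text \<open>The Neumann series. Operators are linear only up to null sets, so the equation is verified in norm for the partial sums and then in the limit.\<close>

lemma one_plus_contraction_surj:
  assumes p: "1 < p" and T: "Lp_bounded_op p T" and le: "\<And>f. f \<in> Lp p \<Longrightarrow> Lp_norm p (T f) \<le> \<theta> * Lp_norm p f"
    and \<theta>: "0 \<le> \<theta>" "\<theta> < 1" and h: "h \<in> Lp p"
  shows "\<exists>g\<in>Lp p. AE z in lebesgue. g z + T g z = h z"
proof -
  have p0: "0 < p" using p by simp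
  have TLp: "T f \<in> Lp p" if "f \<in> Lp p" for f using T that unfolding Lp_bounded_op_def by blast
  define G where "G n = ((\<lambda>f z. (-1) * T f z) ^^ n) h" for n
  have GS: "G (Suc n) = (\<lambda>z. (-1) * T (G n) z)" for n by (simp add: G_def)
  have G: "G n \<in> Lp p" for n
  proof (induction n)
    case 0 show ?case by (simp add: G_def h)
  next
    case (Suc n) show ?case unfolding GS by (rule Lp_cmult(1)[OF p0 TLp[OF Suc]])
  qed
  have Gn: "Lp_norm p (G n) \<le> \<theta> ^ n * Lp_norm p h" for n
  proof (induction n)
    case 0 show ?case by (simp add: G_def)
  next
    case (Suc n)
    have "Lp_norm p (G (Suc n)) = Lp_norm p (T (G n))" unfolding GS Lp_cmult(2)[OF p0 TLp[OF G]] by simp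
    also have "\<dots> \<le> \<theta> * Lp_norm p (G n)" by (rule le[OF G])
    also have "\<dots> \<le> \<theta> * (\<theta> ^ n * Lp_norm p h)" by (intro mult_left_mono Suc \<theta>)
    finally show ?case by (simp add: mult_ac)
  qed
  have sum: "summable (\<lambda>n. \<theta> ^ n * Lp_norm p h)" using \<theta> by (intro summable_mult2 summable_geometric) auto
  obtain s where s: "s \<in> Lp p" "(\<lambda>N. Lp_norm p (\<lambda>z. s z - (\<Sum>n<N. G n z))) \<longlonglongrightarrow> 0"
    using Riesz_Fischer[OF p G Gn sum] by blast
  have SN: "(\<lambda>z. \<Sum>n<N. G n z) \<in> Lp p" for N using p G by (auto intro: Lp_sum)
  have sT: "(\<lambda>z. s z + T s z) \<in> Lp p" by (rule Minkowski(1)[OF p s(1) TLp[OF s(1)]])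
  let ?e = "\<lambda>z. (s z + T s z) - h z"
  have e: "?e \<in> Lp p" by (rule Lp_diff(1)[OF p sT h])
  have bound: "Lp_norm p ?e \<le> (1 + \<theta>) * Lp_norm p (\<lambda>z. s z - (\<Sum>n<N. G n z)) + \<theta> ^ N * Lp_norm p h" for N
  proof -
    let ?r = "\<lambda>z. s z - (\<Sum>n<N. G n z)"
    have r: "?r \<in> Lp p" by (rule Lp_diff(1)[OF p s(1) SN])
    have "AE z in lebesgue. (?r z + T ?r z) - G N z = ?e z"
      using Lp_bounded_op_diff[OF p T s(1) SN[of N]] Lp_bounded_op_sum[OF p T G, where N = N]
    proof eventually_elim
      fix z assume 1: "T ?r z = T s z - T (\<lambda>z. \<Sum>n<N. G n z) z" and 2: "T (\<lambda>z. \<Sum>n<N. G n z) z = (\<Sum>n<N. T (G n) z)"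
      have "(\<Sum>n<N. G n z) + (\<Sum>n<N. T (G n) z) = (\<Sum>n<N. G n z) - (\<Sum>n<N. G (Suc n) z)"
        by (simp add: GS sum_negf)
      also have "\<dots> = G 0 z - G N z" unfolding sum_subtractf[symmetric] by (rule sum_lessThan_telescope')
      also have "G 0 z = h z" by (simp add: G_def)
      finally show "(?r z + T ?r z) - G N z = ?e z" unfolding 1 2 by simp
    qed
    then have "Lp_norm p ?e = Lp_norm p (\<lambda>z. (?r z + T ?r z) - G N z)"
      by (intro Lp_cong_AE(2)[OF p0 Lp_diff(1)[OF p Minkowski(1)[OF p r TLp[OF r]] G]])
    also have "\<dots> \<le> Lp_norm p (\<lambda>z. ?r z + T ?r z) + Lp_norm p (G N)"
      by (rule Lp_diff(2)[OF p Minkowski(1)[OF p r TLp[OF r]] G])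
    also have "\<dots> \<le> (Lp_norm p ?r + Lp_norm p (T ?r)) + \<theta> ^ N * Lp_norm p h"
      by (intro add_mono Minkowski(2)[OF p r TLp[OF r]] Gn)
    also have "\<dots> \<le> (1 + \<theta>) * Lp_norm p ?r + \<theta> ^ N * Lp_norm p h"
      using le[OF r] by (simp add: algebra_simps)
    finally show ?thesis .
  qed
  have "(\<lambda>N. (1 + \<theta>) * Lp_norm p (\<lambda>z. s z - (\<Sum>n<N. G n z)) + \<theta> ^ N * Lp_norm p h) \<longlonglongrightarrow> (1 + \<theta>) * 0 + 0 * Lp_norm p h"
    using \<theta> by (intro tendsto_intros s(2) LIMSEQ_power_zero) auto
  then have "Lp_norm p ?e \<le> (1 + \<theta>) * 0 + 0 * Lp_norm p h"
    using bound by (intro LIMSEQ_le_const) auto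
  then have "Lp_norm p ?e = 0" using Lp_norm_nonneg[of p ?e] by simp
  from Lp_norm_eq_0[OF p0 e this] have "AE z in lebesgue. s z + T s z = h z" by eventually_elim simp
  with s(1) show ?thesis by blast
qed

section \<open>Integral operators on Lebesgue spaces\<close>

definition kop :: "('b::euclidean_space \<times> 'b \<Rightarrow> real) \<Rightarrow> ('b \<Rightarrow> real) \<Rightarrow> 'b \<Rightarrow> real" where
  "kop K h z = (\<integral>w. K (z, w) * h w \<partial>lebesgue)"

text \<open>The \<open>L^p\<close> bound is demanded of the absolute value of the kernel and for all nonnegative functions. It then passes to dominated kernels, and it yields absolute convergence of the integral almost everywhere.\<close>

definition kernel_bound :: "real \<Rightarrow> ('b::euclidean_space \<times> 'b \<Rightarrow> real) \<Rightarrow> real \<Rightarrow> bool" where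
  "kernel_bound p K C \<longleftrightarrow> 0 \<le> C \<and> K \<in> borel_measurable borel \<and>
     (\<forall>f\<in>borel_measurable borel. (NNINT z. epowr (NNINT w. ennreal \<bar>K (z, w)\<bar> * f w) p)
        \<le> ennreal (C powr p) * (NNINT w. epowr (f w) p))"

lemma kernel_measurable_pair:
  "K \<in> borel_measurable borel \<Longrightarrow> (K :: 'b::euclidean_space \<times> 'c::euclidean_space \<Rightarrow> real) \<in> borel_measurable (borel \<Otimes>\<^sub>M borel)"
  by (simp add: borel_prod)

lemma borel_lebesgue: "f \<in> borel_measurable borel \<Longrightarrow> f \<in> borel_measurable lebesgue"
  by (simp add: measurable_completion)

lemma lebesgue_ex_borel:
  fixes h :: "'b::euclidean_space \<Rightarrow> real"
  assumes "h \<in> borel_measurable lebesgue"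
  obtains h' where "h' \<in> borel_measurable borel" "AE z in lebesgue. h z = h' z" "AE z in lborel. h z = h' z"
  using completion_ex_borel_measurable_real[OF assms] by (auto intro: AE_completion that)

lemma kernel_slice_measurable:
  fixes K :: "'b::euclidean_space \<times> 'c::euclidean_space \<Rightarrow> real"
  assumes "K \<in> borel_measurable borel"
  shows "(\<lambda>w. K (z, w)) \<in> borel_measurable borel"
proof -
  have [measurable]: "K \<in> borel_measurable (borel \<Otimes>\<^sub>M borel)" using assms by (rule kernel_measurable_pair)
  show ?thesis by measurable
qed

text \<open>The operators agree at every point, not only almost everywhere, since the integral does not see null sets.\<close>

lemma kop_cong_AE:
  assumes K: "K \<in> borel_measurable borel" and h: "h \<in> borel_measurable lebesgue"
    and ae: "AE w in lebesgue. h w = h' w"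
  shows "kop K h = kop K h'"
proof
  fix z
  have [measurable]: "h \<in> borel_measurable lebesgue" "h' \<in> borel_measurable lebesgue" "(\<lambda>w. K (z, w)) \<in> borel_measurable lebesgue"
    using h borel_measurable_AE[OF h ae] kernel_slice_measurable[OF K] by (auto intro: borel_lebesgue)
  show "kop K h z = kop K h' z"
    unfolding kop_def using ae by (intro integral_cong_AE) auto
qed

lemma kop_borel:
  assumes K: "K \<in> borel_measurable borel" and h: "h \<in> borel_measurable borel"
  shows "kop K h z = (LBINT w. K (z, w) * h w)"
proof -
  have [measurable]: "(\<lambda>w. K (z, w)) \<in> borel_measurable borel" "h \<in> borel_measurable borel"
    using kernel_slice_measurable[OF K] h by auto
  show ?thesis unfolding kop_def by (rule integral_completion) measurable
qed

lemma kop_measurable: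
  assumes K: "K \<in> borel_measurable borel" and h: "h \<in> borel_measurable lebesgue"
  shows "kop K h \<in> borel_measurable borel"
proof -
  obtain h' where h': "h' \<in> borel_measurable borel" "AE z in lebesgue. h z = h' z" "AE z in lborel. h z = h' z"
    using lebesgue_ex_borel[OF h] by blast
  have [measurable]: "K \<in> borel_measurable (borel \<Otimes>\<^sub>M borel)" "h' \<in> borel_measurable borel"
    using K h' by (auto intro: kernel_measurable_pair)
  have "kop K h = (\<lambda>z. LBINT w. K (z, w) * h' w)"
    unfolding kop_cong_AE[OF K h h'(2)] using kop_borel[OF K h'(1)] by auto
  also have "\<dots> \<in> borel_measurable borel" by measurable
  finally show ?thesis .
qed

lemma kop_cmult: "kop K (\<lambda>w. c * h w) z = c * kop K h z"
proof -
  have "kop K (\<lambda>w. c * h w) z = (\<integral>w. c * (K (z, w) * h w) \<partial>lebesgue)"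
    unfolding kop_def by (intro Bochner_Integration.integral_cong) auto
  then show ?thesis by (simp add: kop_def)
qed

lemma nn_integral_Lp_borel:
  assumes p: "0 < p" and h: "h \<in> Lp p" and h'[measurable]: "h' \<in> borel_measurable borel" and ae: "AE z in lebesgue. h z = h' z"
  shows "(NNINT w. epowr (ennreal \<bar>h' w\<bar>) p) = ennreal (Lp_norm p h powr p)"
proof -
  have h'Lp: "h' \<in> Lp p" "Lp_norm p h' = Lp_norm p h" using Lp_cong_AE[OF p h ae] by auto
  have "(NNINT w. epowr (ennreal \<bar>h' w\<bar>) p) = (NNINT w. ennreal (\<bar>h' w\<bar> powr p))"
    by (simp add: epowr_ennreal)
  also have "\<dots> = (\<integral>\<^sup>+w. ennreal (\<bar>h' w\<bar> powr p) \<partial>lebesgue)"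
    by (simp add: nn_integral_completion)
  also have "\<dots> = ennreal (Lp_norm p h powr p)"
    unfolding nn_integral_Lp_norm[OF p h'Lp(1)] h'Lp(2) ..
  finally show ?thesis .
qed

lemma kop_abs_finite:
  assumes p: "1 < p" and K: "kernel_bound p K C" and h: "h \<in> Lp p" and h'[measurable]: "h' \<in> borel_measurable borel" and ae: "AE z in lebesgue. h z = h' z"
  shows "(NNINT z. epowr (NNINT w. ennreal \<bar>K (z, w)\<bar> * ennreal \<bar>h' w\<bar>) p) \<le> ennreal ((C * Lp_norm p h) powr p)"
    "AE z in lborel. (NNINT w. ennreal \<bar>K (z, w)\<bar> * ennreal \<bar>h' w\<bar>) < \<infinity>"
proof -
  have p0: "0 < p" using p by simp
  have [measurable]: "K \<in> borel_measurable (borel \<Otimes>\<^sub>M borel)" using K by (auto simp: kernel_bound_def intro: kernel_measurable_pair)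
  have C: "0 \<le> C" using K by (simp add: kernel_bound_def)
  have "(NNINT z. epowr (NNINT w. ennreal \<bar>K (z, w)\<bar> * ennreal \<bar>h' w\<bar>) p)
     \<le> ennreal (C powr p) * (NNINT w. epowr (ennreal \<bar>h' w\<bar>) p)"
    using K by (simp add: kernel_bound_def)
  also have "\<dots> = ennreal ((C * Lp_norm p h) powr p)"
    unfolding nn_integral_Lp_borel[OF p0 h h' ae] using C Lp_norm_nonneg[of p h] by (simp add: powr_mult ennreal_mult')
  finally show 1: "(NNINT z. epowr (NNINT w. ennreal \<bar>K (z, w)\<bar> * ennreal \<bar>h' w\<bar>) p) \<le> ennreal ((C * Lp_norm p h) powr p)" .
  have "AE z in lborel. epowr (NNINT w. ennreal \<bar>K (z, w)\<bar> * ennreal \<bar>h' w\<bar>) p \<noteq> \<infinity>"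
    using 1 by (intro nn_integral_PInf_AE) (measurable, auto simp: top_unique)
  then show "AE z in lborel. (NNINT w. ennreal \<bar>K (z, w)\<bar> * ennreal \<bar>h' w\<bar>) < \<infinity>"
    by eventually_elim (simp add: less_top)
qed

lemma kop_integrable:
  assumes p: "1 < p" and K: "kernel_bound p K C" and h: "h \<in> Lp p"
  shows "AE z in lebesgue. integrable lebesgue (\<lambda>w. K (z, w) * h w)"
proof -
  have Kb: "K \<in> borel_measurable borel" using K by (simp add: kernel_bound_def)
  obtain h' where h'[measurable]: "h' \<in> borel_measurable borel" and ae: "AE z in lebesgue. h z = h' z"
    using lebesgue_ex_borel[OF Lp_measurable[OF h]] by blast
  have "AE z in lebesgue. (NNINT w. ennreal \<bar>K (z, w)\<bar> * ennreal \<bar>h' w\<bar>) < \<infinity>"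
    by (rule AE_completion[OF kop_abs_finite(2)[OF p K h h' ae]])
  then show ?thesis
  proof eventually_elim
    fix z assume fin: "(NNINT w. ennreal \<bar>K (z, w)\<bar> * ennreal \<bar>h' w\<bar>) < \<infinity>"
    have [measurable]: "(\<lambda>w. K (z, w)) \<in> borel_measurable borel" by (rule kernel_slice_measurable[OF Kb])
    have [measurable]: "(\<lambda>w. K (z, w)) \<in> borel_measurable lebesgue" "h \<in> borel_measurable lebesgue"
      using Lp_measurable[OF h] by (auto intro: borel_lebesgue)
    have "integrable lborel (\<lambda>w. K (z, w) * h' w)"
      using fin by (simp add: integrable_iff_bounded abs_mult ennreal_mult)
    then have "integrable lebesgue (\<lambda>w. K (z, w) * h' w)" by (simp add: integrable_completion)
    then show "integrable lebesgue (\<lambda>w. K (z, w) * h w)"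
      by (rule integrable_cong_AE_imp) (use ae in \<open>auto elim!: eventually_mono\<close>)
  qed
qed

lemma kop_Lp:
  assumes p: "1 < p" and K: "kernel_bound p K C" and h: "h \<in> Lp p"
  shows "kop K h \<in> Lp p" "Lp_norm p (kop K h) \<le> C * Lp_norm p h"
proof -
  have p0: "0 < p" using p by simp
  have Kb: "K \<in> borel_measurable borel" and C: "0 \<le> C" using K by (auto simp: kernel_bound_def)
  obtain h' where h'[measurable]: "h' \<in> borel_measurable borel" and ae: "AE z in lebesgue. h z = h' z"
    using lebesgue_ex_borel[OF Lp_measurable[OF h]] by blast
  have [measurable]: "kop K h \<in> borel_measurable borel" by (rule kop_measurable[OF Kb Lp_measurable[OF h]])
  have "(\<integral>\<^sup>+z. ennreal (\<bar>kop K h z\<bar> powr p) \<partial>lebesgue) = (NNINT z. ennreal (\<bar>kop K h z\<bar> powr p))"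
    by (simp add: nn_integral_completion)
  also have "\<dots> \<le> (NNINT z. epowr (NNINT w. ennreal \<bar>K (z, w)\<bar> * ennreal \<bar>h' w\<bar>) p)"
  proof (intro nn_integral_mono)
    fix z
    have [measurable]: "(\<lambda>w. K (z, w)) \<in> borel_measurable borel" by (rule kernel_slice_measurable[OF Kb])
    have "kop K h z = (LBINT w. K (z, w) * h' w)"
      unfolding kop_cong_AE[OF Kb Lp_measurable[OF h] ae] by (rule kop_borel[OF Kb h'])
    then have "ennreal \<bar>kop K h z\<bar> \<le> (NNINT w. ennreal \<bar>K (z, w) * h' w\<bar>)"
      using integral_norm_bound_ennreal[of lborel "\<lambda>w. K (z, w) * h' w"]
      by (cases "integrable lborel (\<lambda>w. K (z, w) * h' w)") (auto simp: not_integrable_integral_eq)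
    also have "\<dots> = (NNINT w. ennreal \<bar>K (z, w)\<bar> * ennreal \<bar>h' w\<bar>)"
      by (simp add: abs_mult ennreal_mult)
    finally have "epowr (ennreal \<bar>kop K h z\<bar>) p \<le> epowr (NNINT w. ennreal \<bar>K (z, w)\<bar> * ennreal \<bar>h' w\<bar>) p"
      using p by (intro epowr_mono) auto
    then show "ennreal (\<bar>kop K h z\<bar> powr p) \<le> epowr (NNINT w. ennreal \<bar>K (z, w)\<bar> * ennreal \<bar>h' w\<bar>) p"
      by (simp add: epowr_ennreal)
  qed
  also have "\<dots> \<le> ennreal ((C * Lp_norm p h) powr p)" by (rule kop_abs_finite(1)[OF p K h h' ae])
  finally have *: "(\<integral>\<^sup>+z. ennreal (\<bar>kop K h z\<bar> powr p) \<partial>lebesgue) \<le> ennreal ((C * Lp_norm p h) powr p)" .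
  have "0 \<le> C * Lp_norm p h" by (intro mult_nonneg_nonneg C Lp_norm_nonneg)
  from Lp_I[OF p0 borel_lebesgue[OF kop_measurable[OF Kb Lp_measurable[OF h]]] this *]
  show "kop K h \<in> Lp p" "Lp_norm p (kop K h) \<le> C * Lp_norm p h" .
qed

lemma kop_bounded_op:
  fixes K :: "'b::euclidean_space \<times> 'b \<Rightarrow> real"
  assumes p: "1 < p" and K: "kernel_bound p K C"
  shows "Lp_bounded_op p (kop K)"
  unfolding Lp_bounded_op_def
proof (intro conjI ballI allI)
  fix f :: "'b \<Rightarrow> real" assume "f \<in> Lp p" then show "kop K f \<in> Lp p" by (rule kop_Lp(1)[OF p K])
next
  fix f g :: "'b \<Rightarrow> real" assume "f \<in> Lp p" "g \<in> Lp p"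
  from kop_integrable[OF p K this(1)] kop_integrable[OF p K this(2)]
  show "AE z in lebesgue. kop K (\<lambda>w. f w + g w) z = kop K f z + kop K g z"
    by eventually_elim (simp add: kop_def distrib_left)
next
  show "\<exists>C. \<forall>f\<in>Lp p. Lp_norm p (kop K f) \<le> C * Lp_norm p f" using kop_Lp(2)[OF p K] by blast
qed (simp add: kop_cmult)

text \<open>Tonelli for the absolute values justifies the exchange of integrals; finiteness comes from the bound for the composed kernel.\<close>

lemma kop_composition:
  fixes K1 K2 K3 :: "'b::euclidean_space \<times> 'b \<Rightarrow> real"
  assumes p: "1 < p" and K1: "K1 \<in> borel_measurable borel" and K2: "K2 \<in> borel_measurable borel" and K3: "kernel_bound p K3 C"
    and nn: "\<And>z. 0 \<le> K1 z" "\<And>z. 0 \<le> K2 z" "\<And>z. 0 \<le> K3 z"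
    and comp: "\<And>z w. (NNINT y. ennreal (K1 (z, y) * K2 (y, w))) = ennreal (K3 (z, w))"
    and h: "h \<in> Lp p"
  shows "AE z in lebesgue. kop K1 (kop K2 h) z = kop K3 h z"
proof -
  have K3b: "K3 \<in> borel_measurable borel" using K3 by (simp add: kernel_bound_def)
  obtain h' where h'[measurable]: "h' \<in> borel_measurable borel" and ae: "AE z in lebesgue. h z = h' z"
    using lebesgue_ex_borel[OF Lp_measurable[OF h]] by blast
  have [measurable]: "K1 \<in> borel_measurable (borel \<Otimes>\<^sub>M borel)" "K2 \<in> borel_measurable (borel \<Otimes>\<^sub>M borel)" "K3 \<in> borel_measurable (borel \<Otimes>\<^sub>M borel)"
    using K1 K2 K3b by (auto intro: kernel_measurable_pair)
  have eq: "kop K2 h = kop K2 h'" "kop K3 h = kop K3 h'"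
    using kop_cong_AE[OF K2 Lp_measurable[OF h] ae] kop_cong_AE[OF K3b Lp_measurable[OF h] ae] by auto
  have [measurable]: "kop K2 h' \<in> borel_measurable borel" by (rule kop_measurable[OF K2 borel_lebesgue[OF h']])
  have "AE z in lebesgue. (NNINT w. ennreal \<bar>K3 (z, w)\<bar> * ennreal \<bar>h' w\<bar>) < \<infinity>"
    by (rule AE_completion[OF kop_abs_finite(2)[OF p K3 h h' ae]])
  then show ?thesis
  proof eventually_elim
    fix z assume fin: "(NNINT w. ennreal \<bar>K3 (z, w)\<bar> * ennreal \<bar>h' w\<bar>) < \<infinity>"
    let ?f = "\<lambda>y w. K1 (z, y) * K2 (y, w) * h' w"
    have "(\<integral>\<^sup>+x. ennreal (norm (case x of (y, w) \<Rightarrow> ?f y w)) \<partial>(lborel \<Otimes>\<^sub>M lborel))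
       = (NNINT w. (NNINT y. ennreal (norm (?f y w))))"
      by (subst lborel_pair.nn_integral_snd[symmetric]) (auto simp: case_prod_beta')
    also have "\<dots> = (NNINT w. ennreal \<bar>K3 (z, w)\<bar> * ennreal \<bar>h' w\<bar>)"
    proof (intro nn_integral_cong)
      fix w
      have "(NNINT y. ennreal (norm (?f y w))) = (NNINT y. ennreal (K1 (z, y) * K2 (y, w)) * ennreal \<bar>h' w\<bar>)"
        using nn by (intro nn_integral_cong) (simp add: abs_mult ennreal_mult)
      also have "\<dots> = ennreal (K3 (z, w)) * ennreal \<bar>h' w\<bar>"
        by (subst nn_integral_multc) (auto simp: comp)
      finally show "(NNINT y. ennreal (norm (?f y w))) = ennreal \<bar>K3 (z, w)\<bar> * ennreal \<bar>h' w\<bar>"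
        using nn by simp
    qed
    finally have int: "integrable (lborel \<Otimes>\<^sub>M lborel) (\<lambda>(y, w). ?f y w)"
      using fin by (simp add: integrable_iff_bounded case_prod_beta')
    have "kop K1 (kop K2 h) z = (LBINT y. K1 (z, y) * kop K2 h' y)"
      unfolding eq by (rule kop_borel[OF K1]) measurable
    also have "\<dots> = (LBINT y. (LBINT w. ?f y w))"
      using kop_borel[OF K2 h'] by (simp add: mult.assoc)
    also have "\<dots> = (LBINT w. (LBINT y. ?f y w))"
      by (rule lborel_pair.Fubini_integral[symmetric, OF int])
    also have "\<dots> = (LBINT w. K3 (z, w) * h' w)"
    proof (intro Bochner_Integration.integral_cong refl)
      fix w
      have "(LBINT y. K1 (z, y) * K2 (y, w)) = enn2real (NNINT y. ennreal (K1 (z, y) * K2 (y, w)))"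
        using nn by (intro integral_eq_nn_integral) auto
      then have "(LBINT y. K1 (z, y) * K2 (y, w)) = K3 (z, w)" using nn by (simp add: comp)
      then show "(LBINT y. ?f y w) = K3 (z, w) * h' w" by simp
    qed
    also have "\<dots> = kop K3 h z" unfolding eq by (rule kop_borel[OF K3b h', symmetric])
    finally show "kop K1 (kop K2 h) z = kop K3 h z" .
  qed
qed

lemma kernel_bound_mono:
  assumes p: "1 < p" and K: "K \<in> borel_measurable borel" and K': "kernel_bound p K' C" and c: "0 \<le> c"
    and le: "\<And>z w. \<bar>K (z, w)\<bar> \<le> c * \<bar>K' (z, w)\<bar>"
  shows "kernel_bound p K (c * C)"
proof -
  have C: "0 \<le> C" and K'b: "K' \<in> borel_measurable borel" using K' by (auto simp: kernel_bound_def)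
  have [measurable]: "K' \<in> borel_measurable (borel \<Otimes>\<^sub>M borel)" using K'b by (rule kernel_measurable_pair)
  show ?thesis
    unfolding kernel_bound_def
  proof (intro conjI ballI)
    show "0 \<le> c * C" using c C by simp
    show "K \<in> borel_measurable borel" by (rule K)
    fix f :: "'a \<Rightarrow> ennreal" assume [measurable]: "f \<in> borel_measurable borel"
    have "(NNINT z. epowr (NNINT w. ennreal \<bar>K (z, w)\<bar> * f w) p)
       \<le> (NNINT z. ennreal (c powr p) * epowr (NNINT w. ennreal \<bar>K' (z, w)\<bar> * f w) p)"
    proof (intro nn_integral_mono)
      fix z
      have "(NNINT w. ennreal \<bar>K (z, w)\<bar> * f w) \<le> (NNINT w. ennreal c * (ennreal \<bar>K' (z, w)\<bar> * f w))"
        using le c by (intro nn_integral_mono) (auto simp flip: mult.assoc ennreal_mult' intro!: mult_right_mono ennreal_leI)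
      also have "\<dots> = ennreal c * (NNINT w. ennreal \<bar>K' (z, w)\<bar> * f w)"
        by (rule nn_integral_cmult) measurable
      finally have "epowr (NNINT w. ennreal \<bar>K (z, w)\<bar> * f w) p \<le> epowr (ennreal c * (NNINT w. ennreal \<bar>K' (z, w)\<bar> * f w)) p"
        using p by (intro epowr_mono) auto
      then show "epowr (NNINT w. ennreal \<bar>K (z, w)\<bar> * f w) p \<le> ennreal (c powr p) * epowr (NNINT w. ennreal \<bar>K' (z, w)\<bar> * f w) p"
        using c by (simp add: epowr_mult epowr_ennreal)
    qed
    also have "\<dots> = ennreal (c powr p) * (NNINT z. epowr (NNINT w. ennreal \<bar>K' (z, w)\<bar> * f w) p)"
      by (rule nn_integral_cmult) measurable
    also have "\<dots> \<le> ennreal (c powr p) * (ennreal (C powr p) * (NNINT w. epowr (f w) p))"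
      using K' by (intro mult_left_mono) (auto simp: kernel_bound_def)
    also have "\<dots> = ennreal ((c * C) powr p) * (NNINT w. epowr (f w) p)"
      using c C by (simp add: powr_mult ennreal_mult' mult.assoc)
    finally show "(NNINT z. epowr (NNINT w. ennreal \<bar>K (z, w)\<bar> * f w) p)
        \<le> ennreal ((c * C) powr p) * (NNINT w. epowr (f w) p)" .
  qed
qed

lemma kernel_bound_add:
  assumes p: "1 < p" and K1: "kernel_bound p K1 C1" and K2: "kernel_bound p K2 C2"
    and K: "K \<in> borel_measurable borel" and le: "\<And>z w. \<bar>K (z, w)\<bar> \<le> \<bar>K1 (z, w)\<bar> + \<bar>K2 (z, w)\<bar>"
  shows "kernel_bound p K (4 * (C1 + C2))"
proof -
  have C: "0 \<le> C1" "0 \<le> C2" and Kb: "K1 \<in> borel_measurable borel" "K2 \<in> borel_measurable borel"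
    using K1 K2 by (auto simp: kernel_bound_def)
  have [measurable]: "K1 \<in> borel_measurable (borel \<Otimes>\<^sub>M borel)" "K2 \<in> borel_measurable (borel \<Otimes>\<^sub>M borel)"
    using Kb by (auto intro: kernel_measurable_pair)
  show ?thesis
    unfolding kernel_bound_def
  proof (intro conjI ballI)
    show "0 \<le> 4 * (C1 + C2)" using C by simp
    show "K \<in> borel_measurable borel" by (rule K)
    fix f :: "'a \<Rightarrow> ennreal" assume [measurable]: "f \<in> borel_measurable borel"
    let ?I1 = "\<lambda>z. NNINT w. ennreal \<bar>K1 (z, w)\<bar> * f w" and ?I2 = "\<lambda>z. NNINT w. ennreal \<bar>K2 (z, w)\<bar> * f w"
    let ?F = "NNINT w. epowr (f w) p"
    have "(NNINT z. epowr (NNINT w. ennreal \<bar>K (z, w)\<bar> * f w) p)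
       \<le> (NNINT z. ennreal (2 powr p) * (epowr (?I1 z) p + epowr (?I2 z) p))"
    proof (intro nn_integral_mono)
      fix z
      have "(NNINT w. ennreal \<bar>K (z, w)\<bar> * f w) \<le> (NNINT w. ennreal \<bar>K1 (z, w)\<bar> * f w + ennreal \<bar>K2 (z, w)\<bar> * f w)"
        using le by (intro nn_integral_mono) (auto simp flip: distrib_right ennreal_plus intro!: mult_right_mono ennreal_leI)
      also have "\<dots> = ?I1 z + ?I2 z" by (rule nn_integral_add) measurable
      finally have "epowr (NNINT w. ennreal \<bar>K (z, w)\<bar> * f w) p \<le> epowr (?I1 z + ?I2 z) p"
        using p by (intro epowr_mono) auto
      also have "\<dots> \<le> ennreal (2 powr p) * (epowr (?I1 z) p + epowr (?I2 z) p)" using p by (intro epowr_add_le) auto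
      finally show "epowr (NNINT w. ennreal \<bar>K (z, w)\<bar> * f w) p \<le> ennreal (2 powr p) * (epowr (?I1 z) p + epowr (?I2 z) p)" .
    qed
    also have "\<dots> = ennreal (2 powr p) * ((NNINT z. epowr (?I1 z) p) + (NNINT z. epowr (?I2 z) p))"
      by (subst nn_integral_cmult, measurable, subst nn_integral_add, measurable)
    also have "\<dots> \<le> ennreal (2 powr p) * (ennreal (C1 powr p) * ?F + ennreal (C2 powr p) * ?F)"
      using K1 K2 by (intro mult_left_mono add_mono) (auto simp: kernel_bound_def)
    also have "\<dots> = ennreal (2 powr p * (C1 powr p + C2 powr p)) * ?F"
      by (simp add: ennreal_mult' distrib_right mult.assoc)
    also have "\<dots> \<le> ennreal ((4 * (C1 + C2)) powr p) * ?F"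
    proof (intro mult_right_mono ennreal_leI)
      have "C1 powr p \<le> (C1 + C2) powr p" "C2 powr p \<le> (C1 + C2) powr p" using C p by (auto intro!: powr_mono2)
      then have "2 powr p * (C1 powr p + C2 powr p) \<le> 2 powr p * (2 * (C1 + C2) powr p)" by (intro mult_left_mono) auto
      also have "\<dots> \<le> 2 powr p * (2 powr p * (C1 + C2) powr p)"
        using p powr_mono[of 1 p 2] by (intro mult_left_mono mult_right_mono) auto
      also have "\<dots> = (2 * (2 * (C1 + C2))) powr p"
        using C by (simp only: powr_mult zero_le_numeral mult_nonneg_nonneg add_nonneg_nonneg)
      finally show "2 powr p * (C1 powr p + C2 powr p) \<le> (4 * (C1 + C2)) powr p" by simp
    qed simp
    finally show "(NNINT z. epowr (NNINT w. ennreal \<bar>K (z, w)\<bar> * f w) p) \<le> ennreal ((4 * (C1 + C2)) powr p) * ?F" .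
  qed
qed

text \<open>Young's inequality, as the case of Schur's test with constant test functions.\<close>

lemma convolution_kernel_bound:
  fixes k :: "'b::euclidean_space \<Rightarrow> real"
  assumes p: "1 < p" and k[measurable]: "k \<in> borel_measurable borel" and m: "0 \<le> m" and mass: "(NNINT z. ennreal \<bar>k z\<bar>) \<le> ennreal m"
  shows "kernel_bound p (\<lambda>(z, w). k (z - w)) m"
proof -
  have K: "(\<lambda>(z, w). k (z - w)) \<in> borel_measurable (borel \<Otimes>\<^sub>M borel)" by measurable
  have K': "(\<lambda>x. ennreal \<bar>case x of (z, w) \<Rightarrow> k (z - w)\<bar>) \<in> borel_measurable (borel \<Otimes>\<^sub>M borel)" using K by measurable
  have 1: "(NNINT w. ennreal \<bar>k (z - w)\<bar>) \<le> ennreal m" for z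
    using nn_integral_lborel_reflect[of "\<lambda>w. ennreal \<bar>k w\<bar>" z] mass by simp
  have 2: "(NNINT z. ennreal \<bar>k (z - w)\<bar>) \<le> ennreal m" for w
    using nn_integral_lborel_translate[of "\<lambda>w. ennreal \<bar>k w\<bar>" "- w"] mass by simp
  show ?thesis
    unfolding kernel_bound_def
  proof (intro conjI ballI)
    show "0 \<le> m" by (rule m)
    show "(\<lambda>(z, w). k (z - w)) \<in> borel_measurable borel" using K unfolding borel_prod .
    fix f :: "'b \<Rightarrow> ennreal" assume f: "f \<in> borel_measurable borel"
    have "(NNINT z. epowr (NNINT w. ennreal \<bar>case (z, w) of (z, w) \<Rightarrow> k (z - w)\<bar> * f w) p)
      \<le> ennreal (m powr (p - 1) * m) * (NNINT w. epowr (f w) p)"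
    proof (rule Schur_test[OF p, where k = "\<lambda>x. ennreal \<bar>case x of (z, w) \<Rightarrow> k (z - w)\<bar>" and \<phi> = "\<lambda>_. 1" and \<psi> = "\<lambda>_. 1"])
      show "(\<lambda>x. ennreal \<bar>case x of (z, w) \<Rightarrow> k (z - w)\<bar>) \<in> borel_measurable borel" using K' unfolding borel_prod .
    qed (use f m 1 2 in auto)
    also have "m powr (p - 1) * m = m powr p" using m powr_mult_base[of m "p - 1"] by (simp add: mult.commute)
    finally show "(NNINT z. epowr (NNINT w. ennreal \<bar>case (z, w) of (z, w) \<Rightarrow> k (z - w)\<bar> * f w) p)
      \<le> ennreal (m powr p) * (NNINT w. epowr (f w) p)" .
  qed
qed

section \<open>The parabolic potentials as integral operators\<close>

definition Pk :: "real \<Rightarrow> real \<Rightarrow> (real \<times> 'a::euclidean_space) \<times> (real \<times> 'a) \<Rightarrow> real" where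
  "Pk lam \<alpha> = (\<lambda>(z, w). pk lam \<alpha> (z - w))"

lemma par_potential_kop: "par_potential lam \<alpha> = kop (Pk lam \<alpha>)"
  by (intro ext) (simp add: par_potential_eq kop_def Pk_def)

lemma Pk_bound: "1 < p \<Longrightarrow> 0 < \<alpha> \<Longrightarrow> 0 < lam \<Longrightarrow> kernel_bound p (Pk lam \<alpha>) (lam powr (- \<alpha> / 2))"
  unfolding Pk_def by (intro convolution_kernel_bound) (auto simp: pk_nonneg pk_mass)

lemma Pk_nonneg: "0 < \<alpha> \<Longrightarrow> 0 \<le> Pk lam \<alpha> z"
  by (simp add: Pk_def case_prod_beta' pk_nonneg)

lemma Pk_measurable: "Pk lam \<alpha> \<in> borel_measurable borel"
proof -
  have "Pk lam \<alpha> \<in> borel_measurable (borel \<Otimes>\<^sub>M borel)" unfolding Pk_def by measurable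
  then show ?thesis unfolding borel_prod .
qed

text \<open>The composition of the kernels is their convolution, hence \<open>pk_convolution\<close> applies.\<close>

lemma par_potential_semigroup:
  fixes h :: "real \<times> 'a::euclidean_space \<Rightarrow> real"
  assumes p: "1 < p" and \<alpha>: "0 < \<alpha>" "0 < \<beta>" and lam: "0 < lam" and h: "h \<in> Lp p"
  shows "AE z in lebesgue. par_potential lam \<alpha> (par_potential lam \<beta> h) z = par_potential lam (\<alpha> + \<beta>) h z"
  unfolding par_potential_kop
proof (rule kop_composition[OF p Pk_measurable Pk_measurable Pk_bound _ _ _ _ h])
  fix z w :: "real \<times> 'a"
  have "(NNINT y. ennreal (Pk lam \<alpha> (z, y) * Pk lam \<beta> (y, w))) = (NNINT y. ennreal (pk lam \<alpha> (z - w - (- w + y)) * pk lam \<beta> (- w + y)))"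
    by (simp add: Pk_def)
  also have "\<dots> = (NNINT y. ennreal (pk lam \<alpha> (z - w - y) * pk lam \<beta> y))"
    by (rule nn_integral_lborel_translate) measurable
  also have "\<dots> = ennreal (Pk lam (\<alpha> + \<beta>) (z, w))" using \<alpha> by (simp add: pk_convolution Pk_def)
  finally show "(NNINT y. ennreal (Pk lam \<alpha> (z, y) * Pk lam \<beta> (y, w))) = ennreal (Pk lam (\<alpha> + \<beta>) (z, w))" .
qed (use p \<alpha> lam in \<open>auto simp: Pk_nonneg\<close>)

section \<open>Gaussian majorants\<close>

text \<open>A heat-type kernel with half the Gaussian decay rate and with parabolic homogeneity \<open>\<beta> - (d+2)\<close>. The smaller rate absorbs the factor \<open>\<bar>x\<bar>/t\<close> produced by a spatial derivative.\<close>

definition gk :: "real \<Rightarrow> real \<Rightarrow> real \<times> 'a::euclidean_space \<Rightarrow> real" where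
  "gk lam \<beta> z = (if fst z > 0 then
     exp (- lam * fst z) * fst z powr ((\<beta> - real (DIM('a) + 2)) / 2) * exp (- (norm (snd z))\<^sup>2 / (8 * fst z)) else 0)"

text \<open>The derivative of \<open>pk lam \<alpha>\<close> in the spatial direction \<open>e\<close>.\<close>

definition dpk :: "real \<Rightarrow> real \<Rightarrow> 'a \<Rightarrow> real \<times> 'a::euclidean_space \<Rightarrow> real" where
  "dpk lam \<alpha> e z = - ((snd z \<bullet> e) / (2 * fst z)) * pk lam \<alpha> z"

lemma gk_nonneg: "0 \<le> gk lam \<beta> z"
  by (simp add: gk_def)

lemma gk_measurable[measurable]: "gk lam \<beta> \<in> borel_measurable borel"
  unfolding borel_prod[symmetric] gk_def by measurable

lemma dpk_measurable[measurable]: "dpk lam \<alpha> e \<in> borel_measurable borel"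
proof -
  have [measurable]: "pk lam \<alpha> \<in> borel_measurable (borel \<Otimes>\<^sub>M borel)" unfolding borel_prod by measurable
  show ?thesis unfolding borel_prod[symmetric] dpk_def by measurable
qed

lemma gk_measurable'[measurable (raw)]:
  "f \<in> borel_measurable M \<Longrightarrow> (\<lambda>x. gk lam \<beta> (f x)) \<in> borel_measurable M"
  using measurable_compose[OF _ gk_measurable] by blast

lemma dpk_measurable'[measurable (raw)]:
  "f \<in> borel_measurable M \<Longrightarrow> (\<lambda>x. dpk lam \<alpha> e (f x)) \<in> borel_measurable M"
  using measurable_compose[OF _ dpk_measurable] by blast

lemma gk_mass:
  assumes \<beta>: "0 < \<beta>" and lam: "0 < lam"
  shows "(NNINT z. ennreal (gk lam \<beta> (z :: real \<times> 'a::euclidean_space)))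
     = ennreal (Gamma (\<beta> / 2) * (8 * pi) powr (real DIM('a) / 2) * lam powr (- \<beta> / 2))"
proof -
  let ?d = "real DIM('a) / 2"
  have "(NNINT z. ennreal (gk lam \<beta> (z :: real \<times> 'a))) = (NNINT s. NNINT (y::'a). ennreal (gk lam \<beta> (s, y)))"
    by (subst nn_integral_spacetime) auto
  also have "\<dots> = (NNINT s. ennreal ((8 * pi) powr ?d) * ennreal (if s > 0 then exp (- lam * s) * s powr (\<beta> / 2 - 1) else 0))"
  proof (intro nn_integral_cong)
    fix s :: real
    show "(NNINT (y::'a). ennreal (gk lam \<beta> (s, y))) = ennreal ((8 * pi) powr ?d) * ennreal (if s > 0 then exp (- lam * s) * s powr (\<beta> / 2 - 1) else 0)"
    proof (cases "s > 0")
      case True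
      have pw: "s powr ((\<beta> - real (DIM('a) + 2)) / 2) = s powr (\<beta> / 2 - 1) / s powr ?d"
      proof -
        have e: "(\<beta> - real (DIM('a) + 2)) / 2 = (\<beta> / 2 - 1) - ?d" by (simp add: diff_divide_distrib add_divide_distrib)
        show ?thesis unfolding e by (rule powr_diff)
      qed
      have "(NNINT (y::'a). ennreal (gk lam \<beta> (s, y)))
        = (NNINT (y::'a). ennreal ((8 * pi) powr ?d * (exp (- lam * s) * s powr (\<beta> / 2 - 1))) * ennreal (heat (2 * s) y))"
      proof (intro nn_integral_cong)
        fix y :: 'a
        have "4 * pi * (2 * s) = 8 * pi * s" by simp
        then have m: "(4 * pi * (2 * s)) powr ?d = (8 * pi) powr ?d * s powr ?d"
          using True by (simp only: powr_mult)
        have "gk lam \<beta> (s, y) = (8 * pi) powr ?d * (exp (- lam * s) * s powr (\<beta> / 2 - 1)) * heat (2 * s) y"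
          using True unfolding gk_def heat_def fst_conv snd_conv pw m by simp
        then show "ennreal (gk lam \<beta> (s, y)) = ennreal ((8 * pi) powr ?d * (exp (- lam * s) * s powr (\<beta> / 2 - 1))) * ennreal (heat (2 * s) y)"
          by (simp add: ennreal_mult heat_nonneg)
      qed
      also have "\<dots> = ennreal ((8 * pi) powr ?d * (exp (- lam * s) * s powr (\<beta> / 2 - 1)))"
        using True by (subst nn_integral_cmult) (auto simp: heat_mass)
      finally show ?thesis using True by (simp add: ennreal_mult)
    qed (simp add: gk_def)
  qed
  also have "\<dots> = ennreal ((8 * pi) powr ?d) * ennreal (Gamma (\<beta> / 2) * lam powr (- (\<beta> / 2)))"
    using assms nn_integral_Gamma[of "\<beta> / 2" lam] by (subst nn_integral_cmult) auto
  also have "\<dots> = ennreal (Gamma (\<beta> / 2) * (8 * pi) powr ?d * lam powr (- \<beta> / 2))"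
    using assms by (simp add: ennreal_mult'[symmetric] mult_ac)
  finally show ?thesis .
qed

lemma powr_mult_exp_bound:
  fixes x m :: real
  assumes "0 < m" "0 < x"
  shows "x powr m * exp (- x) \<le> m powr m"
proof -
  have "x / m \<le> exp (x / m)" using exp_ge_add_one_self[of "x / m"] by linarith
  then have "(x / m) powr m \<le> exp (x / m) powr m" using assms by (intro powr_mono2) auto
  also have "exp (x / m) powr m = exp x" using assms by (simp add: exp_powr_real)
  finally have "x powr m \<le> m powr m * exp x" using assms by (simp add: powr_divide field_simps)
  then show ?thesis by (simp add: exp_minus field_simps)
qed

text \<open>For \<open>\<bar>x\<bar>^2 \<le> t\<close> the power of \<open>t\<close> alone suffices; otherwise the exponential beats any power of \<open>\<bar>x\<bar>^2/t\<close>.\<close>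

lemma gk_le_pdist:
  fixes \<beta> :: real
  assumes \<beta>: "\<beta> < real (DIM('a::euclidean_space) + 2)"
  obtains C where "0 < C" "\<And>lam z w. 0 \<le> lam \<Longrightarrow> gk lam \<beta> (z - w) \<le> C * pdist z (w :: real \<times> 'a) powr (\<beta> - real (DIM('a) + 2))"
proof -
  let ?D = "real (DIM('a) + 2)"
  define m where "m = (?D - \<beta>) / 2"
  have m: "0 < m" using \<beta> by (simp add: m_def)
  have e: "(\<beta> - ?D) / 2 = - m" "\<beta> - ?D = - (2 * m)" by (simp_all add: m_def field_simps)
  show ?thesis
  proof
    show "0 < 1 + (8 * m) powr m" by (simp add: add_pos_nonneg)
  next
    fix lam :: real and z w :: "real \<times> 'a"
    assume lam: "0 \<le> lam"
    define \<tau> where "\<tau> = fst z - fst w"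
    define \<xi> where "\<xi> = snd z - snd w"
    show "gk lam \<beta> (z - w) \<le> (1 + (8 * m) powr m) * pdist z w powr (\<beta> - ?D)"
    proof (cases "0 < \<tau>")
      case False
      then show ?thesis by (simp add: gk_def \<tau>_def add_nonneg_nonneg)
    next
      case True
      have el: "exp (- lam * \<tau>) \<le> 1" using lam True by simp
      have pd: "pdist z w = max (sqrt \<tau>) (norm \<xi>)" using True by (simp add: pdist_def \<tau>_def \<xi>_def)
      have g: "gk lam \<beta> (z - w) = exp (- lam * \<tau>) * (\<tau> powr (- m) * exp (- (norm \<xi>)\<^sup>2 / (8 * \<tau>)))"
        using True unfolding gk_def e by (simp add: \<tau>_def \<xi>_def)
      have g1: "gk lam \<beta> (z - w) \<le> \<tau> powr (- m) * exp (- (norm \<xi>)\<^sup>2 / (8 * \<tau>))"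
        unfolding g using mult_right_mono[OF el, of "\<tau> powr (- m) * exp (- (norm \<xi>)\<^sup>2 / (8 * \<tau>))"] by simp
      show ?thesis
      proof (cases "norm \<xi> \<le> sqrt \<tau>")
        case le: True
        have "gk lam \<beta> (z - w) \<le> \<tau> powr (- m) * exp (- (norm \<xi>)\<^sup>2 / (8 * \<tau>))" by (rule g1)
        also have "\<dots> \<le> \<tau> powr (- m) * 1"
          using True by (intro mult_left_mono) auto
        also have "\<tau> powr (- m) = pdist z w powr (\<beta> - ?D)"
          unfolding e pd using le True by (simp add: max_absorb1 powr_half_sqrt[symmetric] powr_powr)
        finally have "gk lam \<beta> (z - w) \<le> 1 * pdist z w powr (\<beta> - ?D)" by (simp only: mult_1_left mult_1_right)
        also have "\<dots> \<le> (1 + (8 * m) powr m) * pdist z w powr (\<beta> - ?D)" by (intro mult_right_mono) auto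
        finally show ?thesis .
      next
        case False
        define r where "r = norm \<xi>"
        have r: "0 < r" using False True unfolding r_def by (meson le_less_trans not_le real_sqrt_ge_zero less_imp_le)
        define x where "x = r\<^sup>2 / (8 * \<tau>)"
        have x: "0 < x" using r True by (simp add: x_def)
        have t: "\<tau> = r\<^sup>2 / (8 * x)" using r True by (simp add: x_def)
        have "\<tau> powr (- m) = (8 * x) powr m * (r\<^sup>2) powr (- m)"
          unfolding t using r x by (simp add: powr_divide powr_minus field_simps)
        also have "(r\<^sup>2) powr (- m) = r powr (\<beta> - ?D)"
          unfolding e using r by (simp add: powr_powr flip: powr_numeral)
        also have "(8 * x) powr m = 8 powr m * x powr m" using x by (simp add: powr_mult)
        finally have "\<tau> powr (- m) * exp (- x) = 8 powr m * (x powr m * exp (- x)) * r powr (\<beta> - ?D)"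
          by (simp only: mult_ac)
        also have "\<dots> \<le> 8 powr m * m powr m * r powr (\<beta> - ?D)"
          by (intro mult_right_mono mult_left_mono powr_mult_exp_bound m x) auto
        also have "8 powr m * m powr m = (8 * m) powr m" using m by (simp add: powr_mult)
        finally have "gk lam \<beta> (z - w) \<le> (8 * m) powr m * r powr (\<beta> - ?D)"
          using g1 by (simp add: x_def r_def)
        also have "r = pdist z w" unfolding pd r_def using False by simp
        also have "(8 * m) powr m * pdist z w powr (\<beta> - ?D) \<le> (1 + (8 * m) powr m) * pdist z w powr (\<beta> - ?D)" by (intro mult_right_mono) auto
        finally show ?thesis .
      qed
    qed
  qed
qed

definition pk_const :: "'a::euclidean_space itself \<Rightarrow> real \<Rightarrow> real" where
  "pk_const _ \<alpha> = 1 / (Gamma (\<alpha> / 2) * (4 * pi) powr (real DIM('a) / 2))"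

lemma pk_const_pos: "0 < \<alpha> \<Longrightarrow> 0 < pk_const TYPE('a::euclidean_space) \<alpha>"
  by (simp add: pk_const_def Gamma_real_pos)

lemma pk_eq:
  assumes "0 < fst z"
  shows "pk lam \<alpha> (z :: real \<times> 'a::euclidean_space) = pk_const TYPE('a) \<alpha> * (exp (- lam * fst z) * fst z powr ((\<alpha> - real (DIM('a) + 2)) / 2) * exp (- (norm (snd z))\<^sup>2 / (4 * fst z)))"
proof -
  have "fst z powr ((\<alpha> - real (DIM('a) + 2)) / 2) = fst z powr (\<alpha> / 2 - 1) / fst z powr (real DIM('a) / 2)"
  proof -
    have e: "(\<alpha> - real (DIM('a) + 2)) / 2 = (\<alpha> / 2 - 1) - real DIM('a) / 2" by (simp add: diff_divide_distrib add_divide_distrib)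
    show ?thesis unfolding e by (rule powr_diff)
  qed
  moreover have "(4 * pi * fst z) powr (real DIM('a) / 2) = (4 * pi) powr (real DIM('a) / 2) * fst z powr (real DIM('a) / 2)"
    using assms by (simp add: powr_mult)
  ultimately show ?thesis using assms by (simp add: pk_def heat_def pk_const_def)
qed

lemma pk_le_gk:
  assumes "0 < \<alpha>"
  shows "pk lam \<alpha> z \<le> pk_const TYPE('a) \<alpha> * gk lam \<alpha> (z :: real \<times> 'a::euclidean_space)"
proof (cases "0 < fst z")
  case True
  have "exp (- (norm (snd z))\<^sup>2 / (4 * fst z)) \<le> exp (- (norm (snd z))\<^sup>2 / (8 * fst z))"
    using True by (simp add: divide_simps)
  then show ?thesis unfolding pk_eq[OF True] gk_def using True pk_const_pos[OF assms, where 'a='a]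
    by (auto intro!: mult_left_mono)
qed (simp add: pk_def gk_def)

text \<open>A spatial derivative costs one parabolic order: \<open>\<bar>x\<bar>/(2t)\<close> times a part of the Gaussian is bounded by a multiple of \<open>t^(-1/2)\<close>.\<close>

lemma dpk_le_gk:
  assumes \<alpha>: "0 < \<alpha>"
  shows "\<bar>dpk lam \<alpha> e z\<bar> \<le> norm e * pk_const TYPE('a) \<alpha> * gk lam (\<alpha> - 1) (z :: real \<times> 'a::euclidean_space)"
proof (cases "0 < fst z")
  case True
  let ?D = "real (DIM('a) + 2)"
  define \<tau> where "\<tau> = fst z"
  define r where "r = norm (snd z)"
  have \<tau>: "0 < \<tau>" using True by (simp add: \<tau>_def)
  have r: "0 \<le> r" by (simp add: r_def)
  define y where "y = r / sqrt \<tau>"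
  have y2: "y\<^sup>2 = r\<^sup>2 / \<tau>" using \<tau> by (simp add: y_def power_divide)
  have "y / 2 \<le> 1 + y\<^sup>2 / 8"
  proof -
    have "0 \<le> (y - 2)\<^sup>2" by simp
    then show ?thesis by (simp add: power2_eq_square algebra_simps)
  qed
  also have "\<dots> \<le> exp (y\<^sup>2 / 8)" by (rule exp_ge_add_one_self)
  finally have "y / 2 * exp (- (y\<^sup>2 / 4)) \<le> exp (y\<^sup>2 / 8) * exp (- (y\<^sup>2 / 4))" by (intro mult_right_mono) auto
  also have "\<dots> = exp (- (y\<^sup>2 / 8))" by (simp flip: exp_add)
  finally have key: "y / 2 * exp (- r\<^sup>2 / (4 * \<tau>)) \<le> exp (- r\<^sup>2 / (8 * \<tau>))"
    unfolding y2 by (simp add: mult.commute)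
  have ry: "r / (2 * \<tau>) = \<tau> powr (- (1/2)) * (y / 2)"
    using \<tau> by (simp add: y_def powr_minus powr_half_sqrt divide_simps)
  have pw: "\<tau> powr (- (1/2)) * \<tau> powr ((\<alpha> - ?D) / 2) = \<tau> powr ((\<alpha> - 1 - ?D) / 2)"
    by (simp add: powr_add[symmetric] diff_divide_distrib add_divide_distrib)
  let ?E = "pk_const TYPE('a) \<alpha> * exp (- lam * \<tau>)"
  have E: "0 \<le> ?E" using pk_const_pos[OF \<alpha>, where 'a='a] by simp
  have "\<bar>dpk lam \<alpha> e z\<bar> \<le> (norm e * r / (2 * \<tau>)) * pk lam \<alpha> z"
  proof -
    have "\<bar>snd z \<bullet> e\<bar> \<le> norm e * r" using Cauchy_Schwarz_ineq2[of "snd z" e] by (simp add: r_def mult.commute)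
    then have "\<bar>snd z \<bullet> e\<bar> / (2 * \<tau>) \<le> norm e * r / (2 * \<tau>)" using \<tau> by (intro divide_right_mono) auto
    from mult_right_mono[OF this pk_nonneg[OF \<alpha>, of lam z]] show ?thesis
      using \<tau> pk_nonneg[OF \<alpha>, of lam z] by (simp add: dpk_def abs_mult \<tau>_def)
  qed
  also have "\<dots> = norm e * ?E * ((r / (2 * \<tau>)) * (\<tau> powr ((\<alpha> - ?D) / 2) * exp (- r\<^sup>2 / (4 * \<tau>))))"
    unfolding pk_eq[OF True] by (simp add: \<tau>_def r_def)
  also have "(r / (2 * \<tau>)) * (\<tau> powr ((\<alpha> - ?D) / 2) * exp (- r\<^sup>2 / (4 * \<tau>))) = \<tau> powr ((\<alpha> - 1 - ?D) / 2) * (y / 2 * exp (- r\<^sup>2 / (4 * \<tau>)))"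
    unfolding ry pw[symmetric] by (simp only: mult_ac)
  also have "norm e * ?E * (\<tau> powr ((\<alpha> - 1 - ?D) / 2) * (y / 2 * exp (- r\<^sup>2 / (4 * \<tau>)))) \<le> norm e * ?E * (\<tau> powr ((\<alpha> - 1 - ?D) / 2) * exp (- r\<^sup>2 / (8 * \<tau>)))"
    using E by (intro mult_left_mono key) auto
  also have "\<dots> = norm e * pk_const TYPE('a) \<alpha> * gk lam (\<alpha> - 1) z"
    using True by (simp add: gk_def \<tau>_def r_def)
  finally show ?thesis .
qed (simp add: dpk_def pk_def gk_def)

lemma kernel_bound_weaken:
  assumes p: "1 < p" and K: "kernel_bound p K C" and le: "C \<le> C'"
  shows "kernel_bound p K C'"
proof -
  have C: "0 \<le> C" using K by (simp add: kernel_bound_def)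
  then have "ennreal (C powr p) \<le> ennreal (C' powr p)" using le p by (intro ennreal_leI powr_mono2) auto
  then have "ennreal (C powr p) * x \<le> ennreal (C' powr p) * x" for x by (intro mult_right_mono) auto
  with K C le show ?thesis unfolding kernel_bound_def by (meson order_trans)
qed

lemma powr_add_le_add_powr:
  fixes a b s :: real
  assumes "0 \<le> a" "0 \<le> b" "0 < s" "s \<le> 1"
  shows "(a + b) powr s \<le> a powr s + b powr s"
proof (cases "a + b = 0")
  case False
  then have ab: "0 < a + b" using assms by simp
  have le: "x / (a + b) \<le> (x / (a + b)) powr s" if "0 \<le> x" "x \<le> a + b" for x
  proof (cases "x = 0")
    case False
    with that ab assms have "(x / (a + b)) powr 1 \<le> (x / (a + b)) powr s" by (intro powr_mono') auto
    then show ?thesis using that ab by simp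
  qed simp
  have "1 = a / (a + b) + b / (a + b)" using ab by (simp flip: add_divide_distrib)
  also have "\<dots> \<le> (a / (a + b)) powr s + (b / (a + b)) powr s" using assms by (intro add_mono le) auto
  also have "\<dots> = (a powr s + b powr s) / (a + b) powr s" using assms ab by (simp add: powr_divide add_divide_distrib)
  finally show ?thesis using ab by (simp add: divide_simps)
qed (use assms in simp)

text \<open>The weight is split as \<open>w + M\<close>. The part \<open>w\<close> falls under the trace inequality, and \<open>M\<close> acts by a convolution of mass proportional to \<open>lam^(-s/2)\<close>, \<open>s = 1/p\<close> or \<open>1 - 1/p\<close>; the condition \<open>M \<le> K sqrt lam\<close> makes the second contribution no larger than the first. The constant must not depend on \<open>K\<close>, because the product of the two bounds, a multiple of \<open>K\<close>, is to be made small.\<close>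

theorem weighted_potential_bounds:
  fixes p q :: real
  assumes p: "1 < p" and q: "1 < q"
  obtains C where "0 < C"
    "\<And>w v M K lam. \<lbrakk>w \<in> borel_measurable borel; v \<in> borel_measurable borel; \<And>z. 0 \<le> w z; \<And>z. 0 \<le> v z; \<And>z. v z \<le> w z + M; 0 \<le> M; 0 < K; 0 < lam; M \<le> K * sqrt lam;
      \<And>z r. 0 < r \<Longrightarrow> (\<integral>\<^sup>+y\<in>pball (z::real \<times> 'a::euclidean_space) r. ennreal (w y powr q) \<partial>lborel) \<le> ennreal ((K / r) powr q * (pball_const TYPE('a) * r ^ (DIM('a) + 2)))\<rbrakk>
      \<Longrightarrow> kernel_bound p (\<lambda>(z, y). v z powr (1 / p) * gk lam (1 / p) (z - y)) (C * K powr (1 / p)) \<and>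
          kernel_bound p (\<lambda>(z, y). gk lam (1 - 1 / p) (z - y) * v y powr (1 - 1 / p)) (C * K powr (1 - 1 / p))"
proof -
  let ?D = "real (DIM('a) + 2)"
  obtain C0 where C0: "0 < C0"
    "\<And>w K f. w \<in> borel_measurable borel \<Longrightarrow> (\<And>z. 0 \<le> w z) \<Longrightarrow> 0 < K \<Longrightarrow>
      (\<And>z r. 0 < r \<Longrightarrow> (\<integral>\<^sup>+y\<in>pball (z::real \<times> 'a) r. ennreal (w y powr q) \<partial>lborel) \<le> ennreal ((K / r) powr q * (pball_const TYPE('a) * r ^ (DIM('a) + 2)))) \<Longrightarrow>
      f \<in> borel_measurable borel \<Longrightarrow>
      (NNINT z. epowr (NNINT y. ennreal (w z powr (1 / p) * pdist z y powr (1 / p - ?D)) * f y) p)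
        \<le> ennreal (C0 * K) * (NNINT y. epowr (f y) p)"
    "\<And>w K f. w \<in> borel_measurable borel \<Longrightarrow> (\<And>z. 0 \<le> w z) \<Longrightarrow> 0 < K \<Longrightarrow>
      (\<And>z r. 0 < r \<Longrightarrow> (\<integral>\<^sup>+y\<in>pball (z::real \<times> 'a) r. ennreal (w y powr q) \<partial>lborel) \<le> ennreal ((K / r) powr q * (pball_const TYPE('a) * r ^ (DIM('a) + 2)))) \<Longrightarrow>
      f \<in> borel_measurable borel \<Longrightarrow>
      (NNINT z. epowr (NNINT y. ennreal (pdist z y powr ((1 - 1 / p) - ?D) * w y powr (1 - 1 / p)) * f y) p)
        \<le> ennreal (C0 * K powr (p - 1)) * (NNINT y. epowr (f y) p)"
    using Riesz_trace_inequality[OF p q, where 'a='a] by blast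
  have s: "0 < 1 / p" "1 / p < 1" "0 < 1 - 1 / p" "1 - 1 / p < 1" using p by auto
  have "1 < ?D" by simp
  with s have sD: "1 / p < ?D" "1 - 1 / p < ?D" by linarith+
  obtain G1 where G1: "0 < G1" "\<And>lam z w. 0 \<le> lam \<Longrightarrow> gk lam (1 / p) (z - w) \<le> G1 * pdist z (w :: real \<times> 'a) powr (1 / p - ?D)"
    using gk_le_pdist[OF sD(1)] by blast
  obtain G2 where G2: "0 < G2" "\<And>lam z w. 0 \<le> lam \<Longrightarrow> gk lam (1 - 1 / p) (z - w) \<le> G2 * pdist z (w :: real \<times> 'a) powr (1 - 1 / p - ?D)"
    using gk_le_pdist[OF sD(2)] by blast
  define m where "m \<beta> = Gamma (\<beta> / 2) * (8 * pi) powr (real DIM('a) / 2)" for \<beta>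
  have m: "0 < m \<beta>" if "0 < \<beta>" for \<beta> using that by (simp add: m_def Gamma_real_pos)
  define A where "A = C0 powr (1 / p)"
  have A: "0 < A" using C0(1) by (simp add: A_def)
  define C where "C = 4 * (G1 * A + m (1 / p)) + 4 * (G2 * A + m (1 - 1 / p))"
  have pos: "0 < G1 * A" "0 < G2 * A" "0 < m (1 / p)" "0 < m (1 - 1 / p)"
    using mult_pos_pos[OF G1(1) A] mult_pos_pos[OF G2(1) A] m[OF s(1)] m[OF s(3)] by auto
  have C1: "4 * (G1 * A + m (1 / p)) \<le> C" "4 * (G2 * A + m (1 - 1 / p)) \<le> C"
  proof -
    have "0 \<le> 4 * (G1 * A + m (1 / p))" "0 \<le> 4 * (G2 * A + m (1 - 1 / p))"
      using pos by (auto intro!: add_nonneg_nonneg less_imp_le)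
    then show "4 * (G1 * A + m (1 / p)) \<le> C" "4 * (G2 * A + m (1 - 1 / p)) \<le> C"
      unfolding C_def by (simp_all only: le_add_same_cancel1 le_add_same_cancel2)
  qed
  show ?thesis
  proof
    show "0 < C" unfolding C_def by (intro add_pos_pos mult_pos_pos[of 4] pos) simp_all
  next
    fix w v :: "real \<times> 'a \<Rightarrow> real" and M K lam :: real
    assume w[measurable]: "w \<in> borel_measurable borel" and v[measurable]: "v \<in> borel_measurable borel" and w0: "\<And>z. 0 \<le> w z" and v0: "\<And>z. 0 \<le> v z"
      and vw: "\<And>z. v z \<le> w z + M" and M: "0 \<le> M" and K: "0 < K" and lam: "0 < lam" and MK: "M \<le> K * sqrt lam"
      and morrey: "\<And>z r. 0 < r \<Longrightarrow> (\<integral>\<^sup>+y\<in>pball (z::real \<times> 'a) r. ennreal (w y powr q) \<partial>lborel) \<le> ennreal ((K / r) powr q * (pball_const TYPE('a) * r ^ (DIM('a) + 2)))"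
    have vs: "v z powr s \<le> w z powr s + M powr s" if "0 < s" "s < 1" for s z
    proof -
      have "v z powr s \<le> (w z + M) powr s" using that v0 vw by (intro powr_mono2) auto
      also have "\<dots> \<le> w z powr s + M powr s" using that w0 M by (intro powr_add_le_add_powr) auto
      finally show ?thesis .
    qed
    have Ms: "M powr s * (m s * lam powr (- s / 2)) \<le> m s * K powr s" if "0 < s" for s
    proof -
      have "M powr s \<le> (K * sqrt lam) powr s" using that M MK by (intro powr_mono2) auto
      also have "\<dots> = K powr s * lam powr (s / 2)" using K lam by (simp add: powr_mult powr_half_sqrt[symmetric] powr_powr)
      finally have "M powr s * (m s * lam powr (- s / 2)) \<le> K powr s * lam powr (s / 2) * (m s * lam powr (- s / 2))"
        using m[OF that] by (intro mult_right_mono) auto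
      also have "\<dots> = m s * K powr s * (lam powr (s / 2) * lam powr (- s / 2))" by (simp only: mult_ac)
      also have "lam powr (s / 2) * lam powr (- s / 2) = 1" using lam by (simp flip: powr_add)
      finally show ?thesis by simp
    qed
    have gb: "kernel_bound p (\<lambda>(z, y :: real \<times> 'a). gk lam s (z - y)) (m s * lam powr (- s / 2))" if "0 < s" for s
      using that lam m[OF that] gk_mass[OF that lam, where 'a='a]
      by (intro convolution_kernel_bound p) (auto simp: gk_nonneg m_def)
    have toB: "f \<in> borel_measurable borel" if "f \<in> borel_measurable (borel \<Otimes>\<^sub>M borel)" for f :: "(real \<times> 'a) \<times> (real \<times> 'a) \<Rightarrow> real"
      using that unfolding borel_prod .
    have "kernel_bound p (\<lambda>(z, y). w z powr (1 / p) * pdist z y powr (1 / p - ?D)) (A * K powr (1 / p))"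
      unfolding kernel_bound_def
    proof (intro conjI ballI)
      show "0 \<le> A * K powr (1 / p)" using A by simp
      show "(\<lambda>(z, y). w z powr (1 / p) * pdist z y powr (1 / p - ?D)) \<in> borel_measurable borel" by (rule toB) measurable
      fix f :: "real \<times> 'a \<Rightarrow> ennreal" assume f: "f \<in> borel_measurable borel"
      have "(A * K powr (1 / p)) powr p = C0 * K" using C0(1) K p by (simp add: A_def powr_mult powr_powr)
      then show "(NNINT z. epowr (NNINT y. ennreal \<bar>case (z, y) of (z, y) \<Rightarrow> w z powr (1 / p) * pdist z y powr (1 / p - ?D)\<bar> * f y) p)
         \<le> ennreal ((A * K powr (1 / p)) powr p) * (NNINT y. epowr (f y) p)"
        using C0(2)[OF w w0 K morrey f] by simp
    qed
    then have B1: "kernel_bound p (\<lambda>(z, y). G1 * (w z powr (1 / p) * pdist z y powr (1 / p - ?D))) (G1 * (A * K powr (1 / p)))"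
      using G1(1) by (rule_tac kernel_bound_mono[OF p]) (auto intro!: toB simp: abs_mult)
    have B2: "kernel_bound p (\<lambda>(z, y :: real \<times> 'a). M powr (1 / p) * gk lam (1 / p) (z - y)) (M powr (1 / p) * (m (1 / p) * lam powr (- (1 / p) / 2)))"
    proof (rule kernel_bound_mono[OF p])
      show "kernel_bound p (\<lambda>(z, y :: real \<times> 'a). gk lam (1 / p) (z - y)) (m (1 / p) * lam powr (- (1 / p) / 2))" by (rule gb[OF s(1)])
      show "(\<lambda>(z, y :: real \<times> 'a). M powr (1 / p) * gk lam (1 / p) (z - y)) \<in> borel_measurable borel" by (rule toB) measurable
      show "\<bar>case (z, y) of (z, y :: real \<times> 'a) \<Rightarrow> M powr (1 / p) * gk lam (1 / p) (z - y)\<bar> \<le> M powr (1 / p) * \<bar>case (z, y) of (z, y) \<Rightarrow> gk lam (1 / p) (z - y)\<bar>" for z y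
        unfolding split_conv abs_mult by simp
    qed simp
    have R: "kernel_bound p (\<lambda>(z, y). v z powr (1 / p) * gk lam (1 / p) (z - y)) (4 * (G1 * (A * K powr (1 / p)) + M powr (1 / p) * (m (1 / p) * lam powr (- (1 / p) / 2))))"
    proof (rule kernel_bound_add[OF p B1 B2])
      show "(\<lambda>(z, y). v z powr (1 / p) * gk lam (1 / p) (z - y)) \<in> borel_measurable borel" by (rule toB) measurable
      fix z y :: "real \<times> 'a"
      have "v z powr (1 / p) * gk lam (1 / p) (z - y) \<le> (w z powr (1 / p) + M powr (1 / p)) * gk lam (1 / p) (z - y)"
        by (intro mult_right_mono vs s gk_nonneg)
      also have "\<dots> = w z powr (1 / p) * gk lam (1 / p) (z - y) + M powr (1 / p) * gk lam (1 / p) (z - y)" by (rule distrib_right)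
      also have "w z powr (1 / p) * gk lam (1 / p) (z - y) \<le> w z powr (1 / p) * (G1 * pdist z y powr (1 / p - ?D))"
        using lam by (intro mult_left_mono G1(2)) auto
      finally show "\<bar>case (z, y) of (z, y) \<Rightarrow> v z powr (1 / p) * gk lam (1 / p) (z - y)\<bar> \<le> \<bar>case (z, y) of (z, y) \<Rightarrow> G1 * (w z powr (1 / p) * pdist z y powr (1 / p - ?D))\<bar> + \<bar>case (z, y) of (z, y) \<Rightarrow> M powr (1 / p) * gk lam (1 / p) (z - y)\<bar>"
        using G1(1) by (simp add: abs_mult gk_nonneg mult_ac)
    qed
    have "4 * (G1 * (A * K powr (1 / p)) + M powr (1 / p) * (m (1 / p) * lam powr (- (1 / p) / 2))) \<le> 4 * (G1 * (A * K powr (1 / p)) + m (1 / p) * K powr (1 / p))"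
      using Ms[OF s(1)] by simp
    also have "\<dots> = 4 * (G1 * A + m (1 / p)) * K powr (1 / p)" by (simp add: algebra_simps)
    also have "\<dots> \<le> C * K powr (1 / p)" by (intro mult_right_mono C1) auto
    finally have R': "kernel_bound p (\<lambda>(z, y). v z powr (1 / p) * gk lam (1 / p) (z - y)) (C * K powr (1 / p))"
      by (rule kernel_bound_weaken[OF p R])
    have "kernel_bound p (\<lambda>(z, y). pdist z y powr (1 - 1 / p - ?D) * w y powr (1 - 1 / p)) (A * K powr (1 - 1 / p))"
      unfolding kernel_bound_def
    proof (intro conjI ballI)
      show "0 \<le> A * K powr (1 - 1 / p)" using A by simp
      show "(\<lambda>(z, y). pdist z y powr (1 - 1 / p - ?D) * w y powr (1 - 1 / p)) \<in> borel_measurable borel" by (rule toB) measurable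
      fix f :: "real \<times> 'a \<Rightarrow> ennreal" assume f: "f \<in> borel_measurable borel"
      have "(1 - 1 / p) * p = p - 1" using p by (simp add: field_simps)
      then have "(A * K powr (1 - 1 / p)) powr p = C0 * K powr (p - 1)" using C0(1) K p by (simp add: A_def powr_mult powr_powr)
      then show "(NNINT z. epowr (NNINT y. ennreal \<bar>case (z, y) of (z, y) \<Rightarrow> pdist z y powr (1 - 1 / p - ?D) * w y powr (1 - 1 / p)\<bar> * f y) p)
         \<le> ennreal ((A * K powr (1 - 1 / p)) powr p) * (NNINT y. epowr (f y) p)"
        using C0(3)[OF w w0 K morrey f] by simp
    qed
    then have B3: "kernel_bound p (\<lambda>(z, y). G2 * (pdist z y powr (1 - 1 / p - ?D) * w y powr (1 - 1 / p))) (G2 * (A * K powr (1 - 1 / p)))"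
      using G2(1) by (rule_tac kernel_bound_mono[OF p]) (auto intro!: toB simp: abs_mult)
    have B4: "kernel_bound p (\<lambda>(z, y :: real \<times> 'a). M powr (1 - 1 / p) * gk lam (1 - 1 / p) (z - y)) (M powr (1 - 1 / p) * (m (1 - 1 / p) * lam powr (- (1 - 1 / p) / 2)))"
    proof (rule kernel_bound_mono[OF p])
      show "kernel_bound p (\<lambda>(z, y :: real \<times> 'a). gk lam (1 - 1 / p) (z - y)) (m (1 - 1 / p) * lam powr (- (1 - 1 / p) / 2))" by (rule gb[OF s(3)])
      show "(\<lambda>(z, y :: real \<times> 'a). M powr (1 - 1 / p) * gk lam (1 - 1 / p) (z - y)) \<in> borel_measurable borel" by (rule toB) measurable
      show "\<bar>case (z, y) of (z, y :: real \<times> 'a) \<Rightarrow> M powr (1 - 1 / p) * gk lam (1 - 1 / p) (z - y)\<bar> \<le> M powr (1 - 1 / p) * \<bar>case (z, y) of (z, y) \<Rightarrow> gk lam (1 - 1 / p) (z - y)\<bar>" for z y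
        unfolding split_conv abs_mult by simp
    qed simp
    have Q: "kernel_bound p (\<lambda>(z, y). gk lam (1 - 1 / p) (z - y) * v y powr (1 - 1 / p)) (4 * (G2 * (A * K powr (1 - 1 / p)) + M powr (1 - 1 / p) * (m (1 - 1 / p) * lam powr (- (1 - 1 / p) / 2))))"
    proof (rule kernel_bound_add[OF p B3 B4])
      show "(\<lambda>(z, y). gk lam (1 - 1 / p) (z - y) * v y powr (1 - 1 / p)) \<in> borel_measurable borel" by (rule toB) measurable
      fix z y :: "real \<times> 'a"
      have "gk lam (1 - 1 / p) (z - y) * v y powr (1 - 1 / p) \<le> gk lam (1 - 1 / p) (z - y) * (w y powr (1 - 1 / p) + M powr (1 - 1 / p))"
        by (intro mult_left_mono vs s gk_nonneg)
      also have "\<dots> = gk lam (1 - 1 / p) (z - y) * w y powr (1 - 1 / p) + M powr (1 - 1 / p) * gk lam (1 - 1 / p) (z - y)" by (simp add: distrib_left mult.commute)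
      also have "gk lam (1 - 1 / p) (z - y) * w y powr (1 - 1 / p) \<le> (G2 * pdist z y powr (1 - 1 / p - ?D)) * w y powr (1 - 1 / p)"
        using lam by (intro mult_right_mono G2(2)) auto
      finally show "\<bar>case (z, y) of (z, y) \<Rightarrow> gk lam (1 - 1 / p) (z - y) * v y powr (1 - 1 / p)\<bar> \<le> \<bar>case (z, y) of (z, y) \<Rightarrow> G2 * (pdist z y powr (1 - 1 / p - ?D) * w y powr (1 - 1 / p))\<bar> + \<bar>case (z, y) of (z, y) \<Rightarrow> M powr (1 - 1 / p) * gk lam (1 - 1 / p) (z - y)\<bar>"
        using G2(1) by (simp add: abs_mult gk_nonneg mult_ac)
    qed
    have "4 * (G2 * (A * K powr (1 - 1 / p)) + M powr (1 - 1 / p) * (m (1 - 1 / p) * lam powr (- (1 - 1 / p) / 2))) \<le> 4 * (G2 * (A * K powr (1 - 1 / p)) + m (1 - 1 / p) * K powr (1 - 1 / p))"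
      using Ms[OF s(3)] by simp
    also have "\<dots> = 4 * (G2 * A + m (1 - 1 / p)) * K powr (1 - 1 / p)" by (simp add: algebra_simps)
    also have "\<dots> \<le> C * K powr (1 - 1 / p)" by (intro mult_right_mono C1) auto
    finally have Q': "kernel_bound p (\<lambda>(z, y). gk lam (1 - 1 / p) (z - y) * v y powr (1 - 1 / p)) (C * K powr (1 - 1 / p))"
      by (rule kernel_bound_weaken[OF p Q])
    show "kernel_bound p (\<lambda>(z, y). v z powr (1 / p) * gk lam (1 / p) (z - y)) (C * K powr (1 / p)) \<and>
          kernel_bound p (\<lambda>(z, y). gk lam (1 - 1 / p) (z - y) * v y powr (1 - 1 / p)) (C * K powr (1 - 1 / p))"
      using R' Q' by blast
  qed
qed

section \<open>From parabolic cylinders to parabolic balls\<close>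

lemma par_cylinder_eq: "par_cylinder r z = {fst z .. fst z + r\<^sup>2} \<times> cball (snd z) r"
  by (auto simp: par_cylinder_def dist_norm)

lemma measure_par_cylinder:
  assumes "0 < r"
  shows "measure lebesgue (par_cylinder r (z :: real \<times> 'a::euclidean_space)) = pball_const TYPE('a) / 2 * r ^ (DIM('a) + 2)"
proof -
  have c: "closed (par_cylinder r z)" unfolding par_cylinder_eq by (intro closed_Times) auto
  have "emeasure lborel (par_cylinder r z) = ennreal (r\<^sup>2) * ennreal (unit_ball_vol (real DIM('a)) * r ^ DIM('a))"
    unfolding par_cylinder_eq lborel_prod[symmetric] using assms
    by (subst lborel.emeasure_pair_measure_Times) (auto simp: emeasure_cball)
  also have "\<dots> = ennreal (pball_const TYPE('a) / 2 * r ^ (DIM('a) + 2))"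
    using assms by (simp add: pball_const_def power_add mult_ac power2_eq_square flip: ennreal_mult)
  finally have e: "emeasure lborel (par_cylinder r z) = ennreal (pball_const TYPE('a) / 2 * r ^ (DIM('a) + 2))" .
  have "measure lebesgue (par_cylinder r z) = measure lborel (par_cylinder r z)"
    using c by (intro measure_completion) auto
  also have "\<dots> = pball_const TYPE('a) / 2 * r ^ (DIM('a) + 2)"
    unfolding measure_def e using assms pball_const_pos[where 'a='a] by simp
  finally show ?thesis .
qed

text \<open>A two-sided ball of radius \<open>r\<close> lies in the forward cylinder of radius \<open>2 r\<close> whose base is shifted back in time by \<open>r^2\<close>; the power of two pays for the ratio of the volumes.\<close>

lemma morrey_ball_bound:
  fixes bs :: "real \<times> 'a::euclidean_space \<Rightarrow> 'a"
  assumes q: "1 < q" and bs: "bs \<in> morrey_class q" and c: "0 < c" and norm: "morrey_norm q bs < ereal c"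
    and w[measurable]: "w \<in> borel_measurable borel" and ae: "AE z in lebesgue. w z = norm (bs z)" and r: "0 < r"
  shows "(\<integral>\<^sup>+y\<in>pball (z::real \<times> 'a) r. ennreal (w y powr q) \<partial>lborel)
     \<le> ennreal ((2 ^ (DIM('a) + 2) * c / r) powr q * (pball_const TYPE('a) * r ^ (DIM('a) + 2)))"
proof -
  let ?D = "DIM('a) + 2" and ?c = "pball_const TYPE('a)"
  define R where "R = 2 * r"
  have R: "0 < R" using r by (simp add: R_def)
  define z0 where "z0 = (fst z - r\<^sup>2, snd z)"
  let ?C = "par_cylinder R z0"
  have sub: "pball z r \<subseteq> ?C"
  proof
    fix y assume "y \<in> pball z r"
    then have a: "sqrt \<bar>fst z - fst y\<bar> < r" and b: "norm (snd z - snd y) < r"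
      by (auto simp: pball_def pdist_def)
    have "\<bar>fst z - fst y\<bar> < r\<^sup>2" using a r real_sqrt_less_iff[of "\<bar>fst z - fst y\<bar>" "r\<^sup>2"] by simp
    moreover have "R\<^sup>2 = 4 * r\<^sup>2" by (simp add: R_def power2_eq_square)
    ultimately show "y \<in> ?C" using b r unfolding par_cylinder_def z0_def by (cases y) (auto simp: R_def)
  qed
  have cC: "compact ?C" unfolding par_cylinder_eq by (intro compact_Times) auto
  then have [measurable]: "?C \<in> sets borel" by (rule borel_compact)
  define V where "V = ?c / 2 * R ^ ?D"
  have V: "0 < V" using R pball_const_pos[where 'a='a] by (simp add: V_def)
  have mV: "measure lebesgue ?C = V" unfolding V_def by (rule measure_par_cylinder[OF R])
  let ?I = "LINT y:?C|lebesgue. norm (bs y) powr q"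
  have si: "set_integrable lebesgue ?C (\<lambda>y. norm (bs y) powr q)" using bs cC by (auto simp: morrey_class_def)
  have I0: "0 \<le> ?I" unfolding set_lebesgue_integral_def by (intro integral_nonneg_AE) auto
  have "ereal (R * (1 / V * ?I) powr (1 / q)) \<le> morrey_norm q bs"
    unfolding morrey_norm_def mV[symmetric] using R by (intro SUP_upper2[of "(R, z0)"]) simp_all
  from le_less_trans[OF this norm] have "(1 / V * ?I) powr (1 / q) < c / R" using R by (simp add: field_simps)
  then have "((1 / V * ?I) powr (1 / q)) powr q \<le> (c / R) powr q" using q by (intro powr_mono2) auto
  moreover have "((1 / V * ?I) powr (1 / q)) powr q = 1 / V * ?I" using q V I0 by (simp add: powr_powr)
  ultimately have "1 / V * ?I \<le> (c / R) powr q" by simp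
  then have I: "?I \<le> (c / R) powr q * V" using V by (simp add: field_simps)
  have "(\<integral>\<^sup>+y\<in>pball z r. ennreal (w y powr q) \<partial>lborel) \<le> (NNINT y. ennreal (w y powr q) * indicator ?C y)"
    using sub by (intro nn_integral_mono) (auto split: split_indicator)
  also have "\<dots> = (\<integral>\<^sup>+y. ennreal (w y powr q) * indicator ?C y \<partial>lebesgue)"
    by (simp add: nn_integral_completion)
  also have "\<dots> = (\<integral>\<^sup>+y. ennreal (indicator ?C y *\<^sub>R (norm (bs y) powr q)) \<partial>lebesgue)"
    using ae by (intro nn_integral_cong_AE, eventually_elim) (auto split: split_indicator)
  also have "\<dots> = ennreal ?I"
    using si unfolding set_lebesgue_integral_def set_integrable_def by (intro nn_integral_eq_integral) auto
  also have "\<dots> \<le> ennreal ((c / R) powr q * V)" by (intro ennreal_leI I)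
  also have "\<dots> \<le> ennreal ((2 ^ ?D * c / r) powr q * (?c * r ^ ?D))"
  proof (intro ennreal_leI)
    have "(c / R) powr q * V \<le> (c / r) powr q * (?c * (2 ^ ?D * r ^ ?D))"
    proof (intro mult_mono)
      show "(c / R) powr q \<le> (c / r) powr q" using c r q by (intro powr_mono2 divide_left_mono) (auto simp: R_def)
      show "V \<le> ?c * (2 ^ ?D * r ^ ?D)" unfolding V_def R_def power_mult_distrib
        using r pball_const_pos[where 'a='a] by (intro mult_right_mono) auto
    qed (use V in auto)
    also have "\<dots> = 2 ^ ?D * ((c / r) powr q * (?c * r ^ ?D))" by (simp only: mult_ac)
    also have "\<dots> \<le> (2 ^ ?D) powr q * ((c / r) powr q * (?c * r ^ ?D))"
    proof (intro mult_right_mono)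
      have "(2 ^ ?D :: real) powr 1 \<le> (2 ^ ?D) powr q" using q by (intro powr_mono one_le_power) auto
      then show "(2 ^ ?D :: real) \<le> (2 ^ ?D) powr q" by (simp del: power_add)
      show "0 \<le> (c / r) powr q * (?c * r ^ ?D)" using r pball_const_pos[where 'a='a] by (intro mult_nonneg_nonneg) auto
    qed
    also have "\<dots> = (2 ^ ?D * c / r) powr q * (?c * r ^ ?D)"
    proof -
      have "(2 ^ ?D * (c / r)) powr q = (2 ^ ?D) powr q * (c / r) powr q" using c r by (intro powr_mult) 
      then show ?thesis by (simp only: times_divide_eq_right mult.assoc)
    qed
    finally show "(c / R) powr q * V \<le> (2 ^ ?D * c / r) powr q * (?c * r ^ ?D)" .
  qed
  finally show ?thesis .
qed

section \<open>Smooth test functions\<close>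

text \<open>The family is closed under differentiation up to linear combinations, as \<open>flat_deriv\<close> shows; this gives smoothness to all orders by induction.\<close>

definition flat :: "nat \<Rightarrow> real \<Rightarrow> real" where
  "flat k x = (if x > 0 then (1 / x) ^ k * exp (- 1 / x) else 0)"

lemma flat_tendsto_0: "((\<lambda>x. (1 / x) ^ k * exp (- 1 / x)) \<longlongrightarrow> 0) (at_right (0::real))"
proof -
  have "((\<lambda>y::real. y ^ k / exp y) \<longlongrightarrow> 0) at_top" by (rule tendsto_power_div_exp_0)
  then have "((\<lambda>x::real. inverse x ^ k / exp (inverse x)) \<longlongrightarrow> 0) (at_right 0)"
    by (rule filterlim_compose[OF _ filterlim_inverse_at_top_right])
  moreover have "(1 / x) ^ k * exp (- 1 / x) = inverse x ^ k / exp (inverse x)" for x :: real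
    by (simp add: divide_inverse exp_minus)
  ultimately show ?thesis by (simp only:)
qed

lemma flat_deriv: "(flat k has_real_derivative (flat (k + 2) x - real k * flat (k + 1) x)) (at x)"
proof -
  consider "x < 0" | "x = 0" | "0 < x" by linarith
  then show ?thesis
  proof cases
    case 1
    have "((\<lambda>_. 0) has_real_derivative 0) (at x)" by simp
    then have "(flat k has_real_derivative 0) (at x)"
      by (rule has_field_derivative_transform_within_open[where S = "{..<0}"]) (use 1 in \<open>auto simp: flat_def\<close>)
    then show ?thesis using 1 by (simp add: flat_def)
  next
    case 3
    have "((\<lambda>x. (1 / x) ^ k * exp (- 1 / x)) has_real_derivative (1 / x) ^ (k + 2) * exp (- 1 / x) - real k * ((1 / x) ^ (k + 1) * exp (- 1 / x))) (at x)"
    proof -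
      have 1: "((\<lambda>x. 1 / x) has_real_derivative - ((1 / x) * (1 / x))) (at x)"
        using 3 by (auto intro!: derivative_eq_intros simp: power2_eq_square)
      have pw: "((\<lambda>x. (1 / x) ^ k) has_real_derivative - real k * (1 / x) ^ (k + 1)) (at x)" for k
      proof (induction k)
        case (Suc k)
        have alg: "- (y * y) * y ^ k + - real k * y ^ (k + 1) * y = - real (Suc k) * y ^ (Suc k + 1)" for y :: real
          by (simp add: algebra_simps)
        show ?case unfolding power_Suc[of _ k] by (rule DERIV_cong[OF DERIV_mult[OF 1 Suc] alg])
      qed simp
      have e: "((\<lambda>x. exp (- 1 / x)) has_real_derivative exp (- 1 / x) * ((1 / x) * (1 / x))) (at x)"
        using 3 by (auto intro!: derivative_eq_intros simp: power2_eq_square)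
      have alg: "- real k * y ^ (k + 1) * E + E * (y * y) * y ^ k = y ^ (k + 2) * E - real k * (y ^ (k + 1) * E)" for y E :: real
        by (simp add: algebra_simps)
      show ?thesis by (rule DERIV_cong[OF DERIV_mult[OF pw e] alg])
    qed
    then have "(flat k has_real_derivative (1 / x) ^ (k + 2) * exp (- 1 / x) - real k * ((1 / x) ^ (k + 1) * exp (- 1 / x))) (at x)"
      by (rule has_field_derivative_transform_within_open[where S = "{0<..}"]) (use 3 in \<open>auto simp: flat_def\<close>)
    then show ?thesis using 3 by (simp add: flat_def)
  next
    case 2
    have "((\<lambda>h. flat k h / h) \<longlongrightarrow> 0) (at 0)"
    proof (rule filterlim_split_at_real)
      show "((\<lambda>h. flat k h / h) \<longlongrightarrow> 0) (at_left 0)"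
        by (rule tendsto_eventually) (auto simp: eventually_at_filter flat_def)
      have "((\<lambda>h::real. (1 / h) ^ (k + 1) * exp (- 1 / h)) \<longlongrightarrow> 0) (at_right 0)" by (rule flat_tendsto_0)
      then show "((\<lambda>h. flat k h / h) \<longlongrightarrow> 0) (at_right 0)"
        by (rule Lim_transform_eventually) (auto simp: eventually_at_filter flat_def)
    qed
    then have "(flat k has_real_derivative 0) (at 0)"
      by (simp add: has_field_derivative_iff flat_def)
    then show ?thesis using 2 by (simp add: flat_def)
  qed
qed

text \<open>A syntactic class of functions that is closed under derivatives and contains the bump functions; membership replaces computations with iterated derivatives.\<close>

inductive smoothc :: "('b::euclidean_space \<Rightarrow> real) \<Rightarrow> bool" where
  smoothc_flat: "smoothc (\<lambda>z. flat k (z \<bullet> c + d))"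
| smoothc_const: "smoothc (\<lambda>z. a)"
| smoothc_mult: "smoothc f \<Longrightarrow> smoothc g \<Longrightarrow> smoothc (\<lambda>z. f z * g z)"
| smoothc_add: "smoothc f \<Longrightarrow> smoothc g \<Longrightarrow> smoothc (\<lambda>z. f z + g z)"

lemma smoothc_derivative:
  assumes "smoothc f"
  shows "\<exists>D. \<forall>z. (f has_derivative D z) (at z) \<and> (\<forall>v. smoothc (\<lambda>z. D z v))"
  using assms
proof induction
  case (smoothc_flat k c d)
  let ?D = "\<lambda>z v. (flat (k + 2) (z \<bullet> c + d) - real k * flat (k + 1) (z \<bullet> c + d)) * (v \<bullet> c)"
  have "((\<lambda>z. flat k (z \<bullet> c + d)) has_derivative ?D z) (at z)" for z
  proof -
    have "((\<lambda>z. z \<bullet> c + d) has_derivative (\<lambda>v. v \<bullet> c)) (at z)" by (auto intro!: derivative_eq_intros)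
    from has_derivative_compose[OF this flat_deriv[unfolded has_field_derivative_def]]
    show ?thesis .
  qed
  moreover have "smoothc (\<lambda>z. ?D z v)" for v
  proof -
    have "smoothc (\<lambda>z. (flat (k + 2) (z \<bullet> c + d) + (- real k) * flat (k + 1) (z \<bullet> c + d)) * (v \<bullet> c))"
      by (intro smoothc.intros)
    then show ?thesis by simp
  qed
  ultimately show ?case by (intro exI[of _ ?D]) auto
next
  case (smoothc_const a)
  have "smoothc (\<lambda>z::'a. 0)" by (rule smoothc.smoothc_const)
  then show ?case by (intro exI[of _ "\<lambda>z v. 0"]) auto
next
  case (smoothc_mult f g)
  then obtain D E where D: "\<And>z. (f has_derivative D z) (at z)" "\<And>v. smoothc (\<lambda>z. D z v)"
    and E: "\<And>z. (g has_derivative E z) (at z)" "\<And>v. smoothc (\<lambda>z. E z v)" by blast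
  show ?case
    by (intro exI[of _ "\<lambda>z v. f z * E z v + D z v * g z"] allI conjI has_derivative_mult D E smoothc.intros smoothc_mult.hyps)
next
  case (smoothc_add f g)
  then obtain D E where D: "\<And>z. (f has_derivative D z) (at z)" "\<And>v. smoothc (\<lambda>z. D z v)"
    and E: "\<And>z. (g has_derivative E z) (at z)" "\<And>v. smoothc (\<lambda>z. E z v)" by blast
  show ?case
    by (intro exI[of _ "\<lambda>z v. D z v + E z v"] allI conjI has_derivative_add D E smoothc.intros)
qed

lemma smoothc_C_order: "smoothc f \<Longrightarrow> C_order k f"
proof (induction k arbitrary: f)
  case 0
  then obtain D where "\<And>z. (f has_derivative D z) (at z)" using smoothc_derivative by blast
  then have "continuous_on UNIV f"
    by (auto simp: continuous_on_eq_continuous_at intro: has_derivative_continuous)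
  then show ?case by simp
next
  case (Suc k)
  then obtain D where D: "\<And>z. (f has_derivative D z) (at z)" "\<And>v. smoothc (\<lambda>z. D z v)" using smoothc_derivative by blast
  have "frechet_derivative f (at z) = D z" for z using D(1) by (rule frechet_derivative_at[symmetric])
  then show ?case using D Suc.IH by (auto simp: differentiable_def)
qed

lemma smoothc_prod: "finite I \<Longrightarrow> (\<And>i. i \<in> I \<Longrightarrow> smoothc (f i)) \<Longrightarrow> smoothc (\<lambda>z. \<Prod>i\<in>I. f i z)"
  by (induction I rule: finite_induct) (auto intro: smoothc.intros)

text \<open>A product of factors \<open>exp (-1/(m t))\<close>, \<open>t\<close> being the distance to a face of the box; as \<open>m\<close> grows it increases to the indicator of the box.\<close>

definition bump :: "nat \<Rightarrow> 'b::euclidean_space \<Rightarrow> 'b \<Rightarrow> 'b \<Rightarrow> real" where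
  "bump m a b z = (\<Prod>i\<in>Basis. flat 0 (z \<bullet> (real (Suc m) *\<^sub>R i) + (- real (Suc m) * (a \<bullet> i)))
     * flat 0 (z \<bullet> (- real (Suc m) *\<^sub>R i) + real (Suc m) * (b \<bullet> i)))"

lemma flat_0_bounds: "0 \<le> flat 0 x" "flat 0 x \<le> 1"
  by (auto simp: flat_def)

lemma bump_bounds: "0 \<le> bump m a b z" "bump m a b z \<le> 1"
  unfolding bump_def by (auto intro!: prod_nonneg prod_le_1 mult_nonneg_nonneg mult_le_one flat_0_bounds)

lemma bump_eq_0: "z \<notin> box a b \<Longrightarrow> bump m a b z = 0"
proof -
  assume "z \<notin> box a b"
  then obtain i where i: "i \<in> Basis" "z \<bullet> i \<le> a \<bullet> i \<or> b \<bullet> i \<le> z \<bullet> i" by (auto simp: box_def not_less)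
  have "flat 0 (z \<bullet> (real (Suc m) *\<^sub>R i) + (- real (Suc m) * (a \<bullet> i))) * flat 0 (z \<bullet> (- real (Suc m) *\<^sub>R i) + real (Suc m) * (b \<bullet> i)) = 0"
  proof -
    have "z \<bullet> (real (Suc m) *\<^sub>R i) + (- real (Suc m) * (a \<bullet> i)) = real (Suc m) * (z \<bullet> i - a \<bullet> i)"
      "z \<bullet> (- real (Suc m) *\<^sub>R i) + real (Suc m) * (b \<bullet> i) = real (Suc m) * (b \<bullet> i - z \<bullet> i)"
      by (simp_all add: algebra_simps)
    then show ?thesis using i(2) by (auto simp: flat_def zero_less_mult_iff)
  qed
  then show ?thesis unfolding bump_def using i(1) by (intro prod_zero) auto
qed

lemma bump_test_function: "bump m a b \<in> test_functions"
proof -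
  have "smoothc (bump m a b)" unfolding bump_def
    by (intro smoothc_prod smoothc_mult smoothc_flat) auto
  moreover have "compact (closure {z. bump m a b z \<noteq> 0})"
  proof -
    have "{z. bump m a b z \<noteq> 0} \<subseteq> cbox a b" using bump_eq_0[of _ a b m] box_subset_cbox by blast
    then have "bounded {z. bump m a b z \<noteq> 0}" using bounded_cbox bounded_subset by blast
    then show ?thesis by (simp add: compact_closure)
  qed
  ultimately show ?thesis by (simp add: test_functions_def smoothc_C_order)
qed

lemma bump_tendsto: "(\<lambda>m. bump m a b z) \<longlonglongrightarrow> indicator (box a b) z"
proof (cases "z \<in> box a b")
  case True
  have f: "(\<lambda>m. flat 0 (real (Suc m) * x)) \<longlonglongrightarrow> 1" if "0 < x" for x
  proof -
    have "(\<lambda>m. exp (- (1 / x) * inverse (real (Suc m)))) \<longlonglongrightarrow> exp (- (1 / x) * 0)"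
      by (intro tendsto_intros LIMSEQ_inverse_real_of_nat)
    moreover have "flat 0 (real (Suc m) * x) = exp (- (1 / x) * inverse (real (Suc m)))" for m
      using that by (simp add: flat_def divide_inverse mult.commute del: of_nat_Suc)
    ultimately show ?thesis by simp
  qed
  have e: "z \<bullet> (real (Suc m) *\<^sub>R i) + (- real (Suc m) * (a \<bullet> i)) = real (Suc m) * (z \<bullet> i - a \<bullet> i)"
    "z \<bullet> (- real (Suc m) *\<^sub>R i) + real (Suc m) * (b \<bullet> i) = real (Suc m) * (b \<bullet> i - z \<bullet> i)" for m i
    by (simp_all add: algebra_simps)
  have "(\<lambda>m. bump m a b z) \<longlonglongrightarrow> (\<Prod>i\<in>(Basis::'a set). 1 * 1)"
    unfolding bump_def e using True by (intro tendsto_prod tendsto_mult f) (auto simp: box_def)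
  then show ?thesis using True by simp
next
  case False then show ?thesis by (simp add: bump_eq_0)
qed

text \<open>The positive and the negative part of \<open>f\<close> are densities of measures that agree on boxes, hence on all Borel sets.\<close>

lemma AE_zero_if_integrals_over_boxes_zero:
  fixes f :: "'b::euclidean_space \<Rightarrow> real"
  assumes int: "\<And>a b. set_integrable lebesgue (box a b) f" and zero: "\<And>a b. (LINT z:box a b|lebesgue. f z) = 0"
  shows "AE z in lebesgue. f z = 0"
proof -
  have "AE z in lebesgue. z \<in> box (- (real n *\<^sub>R One)) (real n *\<^sub>R One) \<longrightarrow> f z = 0" for n
  proof -
    let ?B = "box (- (real n *\<^sub>R One)) (real n *\<^sub>R One) :: 'b set"
    have "integrable lebesgue (\<lambda>z. indicator ?B z * f z)" using int[of "- (real n *\<^sub>R One)" "real n *\<^sub>R One"] by (simp add: set_integrable_def)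
    then obtain g where g[measurable]: "g \<in> borel_measurable borel" and ae: "AE z in lebesgue. indicator ?B z * f z = g z"
      using lebesgue_ex_borel by blast
    have gi: "integrable lborel g"
    proof -
      have [measurable]: "g \<in> borel_measurable lebesgue" by (rule borel_lebesgue[OF g])
      have "integrable lebesgue g"
        by (rule integrable_cong_AE_imp[OF \<open>integrable lebesgue (\<lambda>z. indicator ?B z * f z)\<close>]) (use ae in \<open>auto elim!: eventually_mono\<close>)
      then show ?thesis by (simp add: integrable_completion)
    qed
    have gz: "(LBINT z. indicator (box a b) z * g z) = 0" for a b
    proof -
      obtain c d where cd: "box a b \<inter> ?B = box c d"
        by (rule that[OF box_Int_box])
      have [measurable]: "g \<in> borel_measurable lebesgue" by (rule borel_lebesgue[OF g])
      have m: "(\<lambda>z. indicator (box c d) z * f z) \<in> borel_measurable lebesgue"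
        using int[of c d] by (auto simp: set_integrable_def)
      have m1: "(\<lambda>z. indicator (box a b) z * g z) \<in> borel_measurable lebesgue"
        by (intro borel_measurable_times borel_measurable_indicator borel_lebesgue[OF g]) auto
      have "(LBINT z. indicator (box a b) z * g z) = (\<integral>z. indicator (box a b) z * g z \<partial>lebesgue)"
        by (rule integral_completion[symmetric]) measurable
      also have "\<dots> = (\<integral>z. indicator (box c d) z * f z \<partial>lebesgue)"
      proof (rule integral_cong_AE)
        show "AE z in lebesgue. indicator (box a b) z * g z = indicator (box c d) z * f z"
          using ae
        proof eventually_elim
          fix z assume "indicator ?B z * f z = g z"
          then show "indicator (box a b) z * g z = indicator (box c d) z * f z"
            unfolding cd[symmetric] indicator_inter_arith by (simp only: mult.assoc)
        qed
      qed (rule m1, rule m)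
      also have "\<dots> = 0" using zero[of c d] by (simp add: set_lebesgue_integral_def)
      finally show ?thesis .
    qed
    let ?P = "\<lambda>z. ennreal (g z)" and ?N = "\<lambda>z. ennreal (- g z)"
    have eqb: "(NNINT z. ?P z * indicator (box a b) z) = (NNINT z. ?N z * indicator (box a b) z)" for a b
    proof -
      have inj: "x = y" if "enn2real x = enn2real y" "x \<noteq> top" "y \<noteq> top" for x y :: ennreal
        using that by (cases x; cases y) auto
      let ?h = "\<lambda>z. indicator (box a b) z * g z"
      have hi: "integrable lborel ?h" using integrable_real_mult_indicator[OF _ gi, of "box a b"] by (simp add: mult.commute)
      have "enn2real (NNINT z. ennreal (?h z)) = enn2real (NNINT z. ennreal (- ?h z))"
        using gz[of a b] real_lebesgue_integral_def[OF hi] by simp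
      moreover have "(NNINT z. ennreal (?h z)) \<noteq> top" "(NNINT z. ennreal (- ?h z)) \<noteq> top"
        using hi by (auto simp: real_integrable_def)
      ultimately have "(NNINT z. ennreal (?h z)) = (NNINT z. ennreal (- ?h z))"
        by (rule inj)
      moreover have "(NNINT z. ?P z * indicator (box a b) z) = (NNINT z. ennreal (?h z))"
        "(NNINT z. ?N z * indicator (box a b) z) = (NNINT z. ennreal (- ?h z))"
        by (auto intro!: nn_integral_cong split: split_indicator)
      ultimately show ?thesis by simp
    qed
    have "density lborel ?P = density lborel ?N"
    proof (rule measure_eqI_generator_eq[where E = "range (\<lambda>(a, b). box a b)" and \<Omega> = UNIV and A = "\<lambda>i::nat. box (- (real i *\<^sub>R One)) (real i *\<^sub>R One)"])
      show "Int_stable (range (\<lambda>(a, b). box a b :: 'b set))"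
        by (auto simp: Int_stable_def box_Int_box)
      show "emeasure (density lborel ?P) X = emeasure (density lborel ?N) X" if "X \<in> range (\<lambda>(a, b). box a b)" for X
        using that eqb by (auto simp: emeasure_density)
      show "sets (density lborel ?P) = sigma_sets UNIV (range (\<lambda>(a, b). box a b))"
        "sets (density lborel ?N) = sigma_sets UNIV (range (\<lambda>(a, b). box a b))"
        by (simp_all add: borel_eq_box)
      show "(\<Union>i. box (- (real i *\<^sub>R One)) (real i *\<^sub>R One) :: 'b set) = UNIV" by (rule UN_box_eq_UNIV)
      show "emeasure (density lborel ?P) (box (- (real i *\<^sub>R One)) (real i *\<^sub>R One)) \<noteq> \<infinity>" for i
      proof -
        have "emeasure (density lborel ?P) (box (- (real i *\<^sub>R One)) (real i *\<^sub>R One)) \<le> (NNINT z. ?P z)"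
          by (simp add: emeasure_density) (intro nn_integral_mono, auto split: split_indicator)
        moreover have "(NNINT z. ?P z) \<noteq> \<infinity>" using gi by (simp add: real_integrable_def)
        ultimately show ?thesis by (auto simp: top_unique)
      qed
    qed auto
    then have "AE z in lborel. ?P z = ?N z"
      by (subst (asm) sigma_finite_measure.density_unique_iff[OF sigma_finite_lborel]) auto
    then have "AE z in lebesgue. ?P z = ?N z" by (rule AE_completion)
    with ae show ?thesis
    proof eventually_elim
      fix z assume 1: "indicator ?B z * f z = g z" and 2: "ennreal (g z) = ennreal (- g z)"
      have "g z = 0"
        using 2 by (cases "0 \<le> g z") (auto simp: ennreal_neg ennreal_eq_0_iff dest!: sym[of _ "0::ennreal"])
      with 1 show "z \<in> ?B \<longrightarrow> f z = 0" by auto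
    qed
  qed
  then have "AE z in lebesgue. \<forall>n. z \<in> box (- (real n *\<^sub>R One)) (real n *\<^sub>R One) \<longrightarrow> f z = 0"
    unfolding AE_all_countable by blast
  then show ?thesis
  proof eventually_elim
    fix z :: 'b assume a: "\<forall>n. z \<in> box (- (real n *\<^sub>R One)) (real n *\<^sub>R One) \<longrightarrow> f z = 0"
    have "z \<in> (\<Union>i::nat. box (- (real i *\<^sub>R One)) (real i *\<^sub>R One))" by (simp add: UN_box_eq_UNIV)
    with a show "f z = 0" by blast
  qed
qed

text \<open>Testing with the bump functions and passing to the limit shows that all integrals over boxes vanish.\<close>

lemma fundamental_lemma:
  fixes f :: "'b::euclidean_space \<Rightarrow> real"
  assumes li: "locally_integrable f" and zero: "\<And>\<phi>. \<phi> \<in> test_functions \<Longrightarrow> (\<integral>z. f z * \<phi> z \<partial>lebesgue) = 0"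
  shows "AE z in lebesgue. f z = 0"
proof (rule AE_zero_if_integrals_over_boxes_zero)
  fix a b :: 'b
  have c: "set_integrable lebesgue (cbox a b) f" using li by (auto simp: locally_integrable_def)
  show s: "set_integrable lebesgue (box a b) f"
    by (rule set_integrable_subset[OF c]) (auto intro: box_subset_cbox[THEN subsetD])
  have fm: "(\<lambda>z. indicator (box a b) z *\<^sub>R f z) \<in> borel_measurable lebesgue" using s by (auto simp: set_integrable_def)
  have bm: "bump m a b \<in> borel_measurable borel" for m
  proof -
    have "continuous_on UNIV (bump m a b)" using bump_test_function[of m a b] unfolding test_functions_def by (auto dest: spec[of _ 0])
    then show ?thesis by (rule borel_measurable_continuous_onI)
  qed
  have eq: "f z * bump m a b z = (indicator (box a b) z *\<^sub>R f z) * bump m a b z" for m z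
    by (cases "z \<in> box a b") (auto simp: bump_eq_0)
  have "(\<lambda>m. \<integral>z. f z * bump m a b z \<partial>lebesgue) \<longlonglongrightarrow> (\<integral>z. indicator (box a b) z *\<^sub>R f z \<partial>lebesgue)"
  proof (rule integral_dominated_convergence[where w = "\<lambda>z. \<bar>indicator (box a b) z *\<^sub>R f z\<bar>"])
    show "(\<lambda>z. indicator (box a b) z *\<^sub>R f z) \<in> borel_measurable lebesgue" by (rule fm)
    show "(\<lambda>z. f z * bump m a b z) \<in> borel_measurable lebesgue" for m
      unfolding eq by (intro borel_measurable_times fm borel_lebesgue[OF bm])
    show "integrable lebesgue (\<lambda>z. \<bar>indicator (box a b) z *\<^sub>R f z\<bar>)" using s unfolding set_integrable_def by (rule integrable_abs)
    show "AE z in lebesgue. (\<lambda>m. f z * bump m a b z) \<longlonglongrightarrow> indicator (box a b) z *\<^sub>R f z"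
    proof (rule AE_I2)
      fix z
      have "(\<lambda>m. f z * bump m a b z) \<longlonglongrightarrow> f z * indicator (box a b) z" by (intro tendsto_intros bump_tendsto)
      then show "(\<lambda>m. f z * bump m a b z) \<longlonglongrightarrow> indicator (box a b) z *\<^sub>R f z" by (simp add: mult.commute)
    qed
    show "AE z in lebesgue. norm (f z * bump m a b z) \<le> \<bar>indicator (box a b) z *\<^sub>R f z\<bar>" for m
    proof (rule AE_I2)
      fix z
      have "\<bar>indicator (box a b) z *\<^sub>R f z\<bar> * \<bar>bump m a b z\<bar> \<le> \<bar>indicator (box a b) z *\<^sub>R f z\<bar> * 1"
        using bump_bounds[of m a b z] by (intro mult_left_mono) auto
      then show "norm (f z * bump m a b z) \<le> \<bar>indicator (box a b) z *\<^sub>R f z\<bar>" unfolding eq by (simp add: abs_mult)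
    qed
  qed
  moreover have "(\<integral>z. f z * bump m a b z \<partial>lebesgue) = 0" for m by (rule zero[OF bump_test_function])
  ultimately show "(LINT z:box a b|lebesgue. f z) = 0"
    unfolding set_lebesgue_integral_def by (simp add: LIMSEQ_const_iff)
qed

lemma has_weak_grad_unique:
  fixes u :: "real \<times> 'a::euclidean_space \<Rightarrow> real"
  assumes G: "has_weak_grad u G" and G': "has_weak_grad u G'"
  shows "AE z in lebesgue. G z = G' z"
proof -
  have "AE z in lebesgue. (G z - G' z) \<bullet> e = 0" if e: "e \<in> Basis" for e
  proof (rule fundamental_lemma)
    have li: "locally_integrable (\<lambda>z. H z \<bullet> e)" if "locally_integrable H" for H :: "real \<times> 'a \<Rightarrow> 'a"
      using that unfolding locally_integrable_def set_integrable_def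
      by (auto simp: inner_scaleR_left[symmetric] simp del: inner_scaleR_left)
    have liG: "locally_integrable (\<lambda>z. G z \<bullet> e)" "locally_integrable (\<lambda>z. G' z \<bullet> e)"
      using G G' by (auto simp: has_weak_grad_def intro!: li)
    then show "locally_integrable (\<lambda>z. (G z - G' z) \<bullet> e)"
      unfolding locally_integrable_def by (auto simp: inner_diff_left)
    fix \<phi> :: "real \<times> 'a \<Rightarrow> real" assume \<phi>: "\<phi> \<in> test_functions"
    have c\<phi>: "continuous_on UNIV \<phi>" and cs: "compact (closure {z. \<phi> z \<noteq> 0})"
      using \<phi> C_order.simps(1)[of \<phi>] by (auto simp: test_functions_def)
    have int: "integrable lebesgue (\<lambda>z. H z * \<phi> z)" if "locally_integrable H" for H :: "real \<times> 'a \<Rightarrow> real"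
    proof -
      let ?S = "closure {z. \<phi> z \<noteq> 0}"
      have "bounded (\<phi> ` ?S)" using c\<phi> cs by (meson compact_continuous_image compact_imp_bounded continuous_on_subset subset_UNIV)
      then obtain C where C: "\<And>z. z \<in> ?S \<Longrightarrow> \<bar>\<phi> z\<bar> \<le> C" by (auto simp: bounded_iff)
      have i: "integrable lebesgue (\<lambda>z. indicator ?S z *\<^sub>R H z)" using that cs by (auto simp: locally_integrable_def set_integrable_def)
      have eq: "H z * \<phi> z = (indicator ?S z *\<^sub>R H z) * \<phi> z" for z
        using closure_subset[of "{z. \<phi> z \<noteq> 0}"] by (cases "z \<in> ?S") auto
      show ?thesis
      proof (rule Bochner_Integration.integrable_bound[of lebesgue "\<lambda>z. C * (indicator ?S z *\<^sub>R H z)"])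
        show "integrable lebesgue (\<lambda>z. C * (indicator ?S z *\<^sub>R H z))" using i by auto
        show "(\<lambda>z. H z * \<phi> z) \<in> borel_measurable lebesgue"
          unfolding eq
          by (intro borel_measurable_times borel_measurable_integrable[OF i] borel_lebesgue[OF borel_measurable_continuous_onI[OF c\<phi>]])
        show "AE z in lebesgue. norm (H z * \<phi> z) \<le> norm (C * (indicator ?S z *\<^sub>R H z))"
        proof (rule AE_I2)
          fix z
          show "norm (H z * \<phi> z) \<le> norm (C * (indicator ?S z *\<^sub>R H z))"
          proof (cases "z \<in> ?S")
            case True
            then have "\<bar>\<phi> z\<bar> * \<bar>H z\<bar> \<le> \<bar>C\<bar> * \<bar>H z\<bar>" using C[OF True] by (intro mult_right_mono) auto
            then show ?thesis using True by (simp add: abs_mult mult.commute)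
          qed (unfold eq, simp)
        qed
      qed
    qed
    have "(\<integral>z. ((G z - G' z) \<bullet> e) * \<phi> z \<partial>lebesgue) = (\<integral>z. (G z \<bullet> e) * \<phi> z \<partial>lebesgue) - (\<integral>z. (G' z \<bullet> e) * \<phi> z \<partial>lebesgue)"
      using int[OF liG(1)] int[OF liG(2)] by (subst Bochner_Integration.integral_diff[symmetric]) (auto simp: inner_diff_left left_diff_distrib)
    also have "\<dots> = 0" using G G' \<phi> e by (simp add: has_weak_grad_def)
    finally show "(\<integral>z. ((G z - G' z) \<bullet> e) * \<phi> z \<partial>lebesgue) = 0" .
  qed
  then have "AE z in lebesgue. \<forall>e\<in>Basis. (G z - G' z) \<bullet> e = 0"
    by (subst AE_finite_all) auto
  then show ?thesis
  proof eventually_elim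
    fix z assume "\<forall>e\<in>Basis. (G z - G' z) \<bullet> e = 0"
    then have "G z - G' z = 0" unfolding euclidean_eq_iff[of "G z - G' z" 0] inner_zero_left .
    then show "G z = G' z" by simp
  qed
qed

section \<open>Weak gradients of potentials\<close>

lemma lborel_integral_translate:
  fixes F :: "'b::euclidean_space \<Rightarrow> real"
  assumes [measurable]: "F \<in> borel_measurable borel"
  shows "(LBINT x. F (c + x)) = (LBINT x. F x)" "integrable lborel (\<lambda>x. F (c + x)) \<longleftrightarrow> integrable lborel F"
proof -
  have "(LBINT x. F x) = (\<integral>x. F x \<partial>distr lborel borel ((+) c))" by (simp add: lborel_distr_plus)
  also have "\<dots> = (LBINT x. F (c + x))" by (subst integral_distr) auto
  finally show "(LBINT x. F (c + x)) = (LBINT x. F x)" by simp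
  have "integrable lborel F \<longleftrightarrow> integrable (distr lborel borel ((+) c)) F" by (simp add: lborel_distr_plus)
  also have "\<dots> \<longleftrightarrow> integrable lborel (\<lambda>x. F (c + x))" by (subst integrable_distr_eq) auto
  finally show "integrable lborel (\<lambda>x. F (c + x)) \<longleftrightarrow> integrable lborel F" by simp
qed

text \<open>The difference quotients have vanishing integral by translation invariance and are dominated, since the derivative is bounded and the support is compact.\<close>

lemma integral_directional_derivative_eq_0:
  fixes F F' :: "'b::euclidean_space \<Rightarrow> real"
  assumes [measurable]: "F \<in> borel_measurable borel" "F' \<in> borel_measurable borel"
    and F: "integrable lborel F"
    and deriv: "\<And>x. ((\<lambda>r. F (x + r *\<^sub>R v)) has_real_derivative F' x) (at 0)"
    and C: "\<And>x. \<bar>F' x\<bar> \<le> C" and R: "\<And>x. R < norm x \<Longrightarrow> F x = 0"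
  shows "(LBINT x. F' x) = 0"
proof -
  define D where "D n x = (F (x + (1 / real (Suc n)) *\<^sub>R v) - F x) / (1 / real (Suc n))" for n x
  have [measurable]: "D n \<in> borel_measurable borel" for n unfolding D_def by measurable
  have D0: "(LBINT x. D n x) = 0" for n
  proof -
    have "integrable lborel (\<lambda>x. F (x + (1 / real (Suc n)) *\<^sub>R v))"
      "(LBINT x. F (x + (1 / real (Suc n)) *\<^sub>R v)) = (LBINT x. F x)"
      using lborel_integral_translate[of F "(1 / real (Suc n)) *\<^sub>R v"] F by (simp_all add: add.commute)
    then show ?thesis unfolding D_def using F by simp
  qed
  have deriv_line: "((\<lambda>r. F (x + r *\<^sub>R v)) has_real_derivative F' (x + s *\<^sub>R v)) (at s)" for x s
  proof -
    have "((\<lambda>r. F ((x + s *\<^sub>R v) + (r - s) *\<^sub>R v)) has_real_derivative F' (x + s *\<^sub>R v) * 1) (at s)"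
      by (rule DERIV_chain'[where f = "\<lambda>r. r - s" and g = "\<lambda>r. F ((x + s *\<^sub>R v) + r *\<^sub>R v)"])
         (use deriv[of "x + s *\<^sub>R v"] in \<open>auto intro!: derivative_eq_intros\<close>)
    moreover have "(x + s *\<^sub>R v) + (r - s) *\<^sub>R v = x + r *\<^sub>R v" for r by (simp add: algebra_simps)
    ultimately show ?thesis by simp
  qed
  have Dbound: "\<bar>D n x\<bar> \<le> C" for n x
  proof -
    obtain z where z: "F (x + (1 / real (Suc n)) *\<^sub>R v) - F (x + 0 *\<^sub>R v) = (1 / real (Suc n) - 0) * F' (x + z *\<^sub>R v)"
      using MVT2[of 0 "1 / real (Suc n)" "\<lambda>r. F (x + r *\<^sub>R v)" "\<lambda>r. F' (x + r *\<^sub>R v)"] deriv_line by auto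
    then have "D n x = F' (x + z *\<^sub>R v)" by (simp add: D_def)
    then show ?thesis using C by simp
  qed
  have Dsupp: "D n x = 0" if "R + norm v < norm x" for n x
  proof -
    have "norm ((1 / real (Suc n)) *\<^sub>R v) \<le> norm v" using mult_left_mono[of 1 "1 + real n" "norm v"] by (simp add: divide_le_eq)
    then have "R < norm (x + (1 / real (Suc n)) *\<^sub>R v)" "R < norm x"
      using that norm_diff_ineq[of x "(1 / real (Suc n)) *\<^sub>R v"] norm_ge_zero[of v] by linarith+
    then show ?thesis by (simp add: D_def R)
  qed
  have "(\<lambda>n. LBINT x. D n x) \<longlonglongrightarrow> (LBINT x. F' x)"
  proof (rule integral_dominated_convergence[where w = "\<lambda>x. C * indicator (cball 0 (R + norm v)) x"])
    show "integrable lborel (\<lambda>x. C * indicator (cball (0::'b) (R + norm v)) x :: real)"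
      using emeasure_bounded_finite[OF bounded_cball, of "0::'b" "R + norm v"]
      by (intro integrable_mult_right integrable_real_indicator) auto
    show "AE x in lborel. (\<lambda>n. D n x) \<longlonglongrightarrow> F' x"
    proof (rule AE_I2)
      fix x
      have "((\<lambda>r. (F (x + r *\<^sub>R v) - F (x + 0 *\<^sub>R v)) / (r - 0)) \<longlongrightarrow> F' x) (at 0)"
        using deriv[of x] unfolding has_field_derivative_iff by simp
      moreover have "filterlim (\<lambda>n. 1 / real (Suc n)) (at 0) sequentially"
        unfolding filterlim_at using LIMSEQ_inverse_real_of_nat by (auto simp: inverse_eq_divide)
      ultimately have "(\<lambda>n. (F (x + (1 / real (Suc n)) *\<^sub>R v) - F (x + 0 *\<^sub>R v)) / (1 / real (Suc n) - 0)) \<longlonglongrightarrow> F' x"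
        by (rule filterlim_compose)
      then show "(\<lambda>n. D n x) \<longlonglongrightarrow> F' x" by (simp add: D_def)
    qed
    show "AE x in lborel. norm (D n x) \<le> C * indicator (cball 0 (R + norm v)) x" for n
    proof (rule AE_I2)
      fix x
      show "norm (D n x) \<le> C * indicator (cball 0 (R + norm v)) x"
        using Dbound[of n x] Dsupp[of x n] by (cases "norm x \<le> R + norm v") auto
    qed
  qed measurable
  then show ?thesis unfolding D0 by (simp add: LIMSEQ_const_iff)
qed

lemma pk_spatial_derivative:
  fixes x e :: "'a::euclidean_space"
  shows "((\<lambda>r. pk lam \<alpha> (t, x + r *\<^sub>R e)) has_real_derivative dpk lam \<alpha> e (t, x)) (at 0)"
proof (cases "0 < t")
  case True
  let ?P = "pk_const TYPE('a) \<alpha> * (exp (- lam * t) * t powr ((\<alpha> - real (DIM('a) + 2)) / 2))"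
  have e: "pk lam \<alpha> (t, x + r *\<^sub>R e) = ?P * exp (- ((norm x)\<^sup>2 + 2 * r * (x \<bullet> e) + r\<^sup>2 * (norm e)\<^sup>2) / (4 * t))" for r
  proof -
    have "(norm (x + r *\<^sub>R e))\<^sup>2 = (norm x)\<^sup>2 + 2 * r * (x \<bullet> e) + r\<^sup>2 * (norm e)\<^sup>2"
      unfolding power2_norm_eq_inner by (simp add: inner_add_left inner_add_right inner_commute power2_eq_square)
    then show ?thesis using True by (subst pk_eq) auto
  qed
  have "((\<lambda>r. ?P * exp (- ((norm x)\<^sup>2 + 2 * r * (x \<bullet> e) + r\<^sup>2 * (norm e)\<^sup>2) / (4 * t))) has_real_derivative
     ?P * (exp (- ((norm x)\<^sup>2 + 2 * 0 * (x \<bullet> e) + 0\<^sup>2 * (norm e)\<^sup>2) / (4 * t)) * (- (2 * (x \<bullet> e)) / (4 * t)))) (at 0)"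
    using True by (intro DERIV_cmult DERIV_fun_exp) (auto intro!: derivative_eq_intros)
  moreover have "?P * (exp (- ((norm x)\<^sup>2 + 2 * 0 * (x \<bullet> e) + 0\<^sup>2 * (norm e)\<^sup>2) / (4 * t)) * (- (2 * (x \<bullet> e)) / (4 * t))) = dpk lam \<alpha> e (t, x)"
    using True e[of 0] by (simp add: dpk_def)
  ultimately show ?thesis unfolding e by simp
next
  case False then show ?thesis by (simp add: pk_def dpk_def)
qed

lemma gk_slice_bound: "gk lam \<beta> (t, x) \<le> exp (- lam * t) * t powr ((\<beta> - real (DIM('a) + 2)) / 2)" for x :: "'a::euclidean_space"
  by (auto simp: gk_def intro!: mult_left_le)

lemma gk_integrable:
  assumes "0 < \<beta>" "0 < lam"
  shows "integrable lborel (\<lambda>z. gk lam \<beta> (z - (w :: real \<times> 'a::euclidean_space)))"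
proof -
  have "integrable lborel (gk lam \<beta> :: real \<times> 'a \<Rightarrow> real)"
    using assms gk_mass[of \<beta> lam, where 'a='a] by (simp add: integrable_iff_bounded gk_nonneg)
  then show ?thesis using lborel_integral_translate(2)[of "gk lam \<beta>" "- w"] by simp
qed

lemma test_function_facts:
  fixes \<phi> :: "'b::euclidean_space \<Rightarrow> real"
  assumes \<phi>: "\<phi> \<in> test_functions"
  obtains D C R where "\<And>z. (\<phi> has_derivative D z) (at z)" "\<And>z v. frechet_derivative \<phi> (at z) v = D z v"
    "continuous_on UNIV \<phi>" "\<And>v. continuous_on UNIV (\<lambda>z. D z v)"
    "\<And>z. \<bar>\<phi> z\<bar> \<le> C" "\<And>z. R < norm z \<Longrightarrow> \<phi> z = 0" "\<And>z v. R < norm z \<Longrightarrow> D z v = 0" "0 \<le> C"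
proof -
  have co: "C_order 0 \<phi>" "C_order (Suc 0) \<phi>" and cs: "compact (closure {z. \<phi> z \<noteq> 0})"
    using \<phi> unfolding test_functions_def by auto
  let ?S = "closure {z. \<phi> z \<noteq> 0}"
  define D where "D z = frechet_derivative \<phi> (at z)" for z
  have D: "(\<phi> has_derivative D z) (at z)" for z using co(2) by (simp add: D_def frechet_derivative_works[symmetric])
  have c: "continuous_on UNIV \<phi>" using co(1) by simp
  have cD: "continuous_on UNIV (\<lambda>z. D z v)" for v using co(2) by (simp add: D_def)
  obtain R where R: "\<And>z. z \<in> ?S \<Longrightarrow> norm z \<le> R" using compact_imp_bounded[OF cs] by (auto simp: bounded_iff)
  have z: "\<phi> z = 0" if "z \<notin> ?S" for z using that closure_subset[of "{z. \<phi> z \<noteq> 0}"] by auto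
  have zR: "\<phi> z = 0" if "R < norm z" for z using that R[of z] z[of z] by (meson not_le)
  have zD: "D z v = 0" if "R < norm z" for z v
  proof -
    have "((\<lambda>_. 0) has_derivative (\<lambda>_. 0)) (at z)" by simp
    then have "(\<phi> has_derivative (\<lambda>_. 0)) (at z)"
      by (rule has_derivative_transform_within_open[where s = "- cball 0 R"]) (use that zR in \<open>auto\<close>)
    then have "D z = (\<lambda>_. 0)" using D has_derivative_unique by blast
    then show ?thesis by simp
  qed
  have "bounded (\<phi> ` ?S)" using c cs by (meson compact_continuous_image compact_imp_bounded continuous_on_subset subset_UNIV)
  then obtain C where C: "\<And>z. z \<in> ?S \<Longrightarrow> \<bar>\<phi> z\<bar> \<le> C" by (auto simp: bounded_iff)
  have C': "\<bar>\<phi> z\<bar> \<le> max C 0" for z using C[of z] z[of z] by (cases "z \<in> ?S") auto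
  show ?thesis by (rule that[of D "max C 0" R]) (use D D_def c cD C' zR zD in auto)
qed

text \<open>On a time slice the kernel is smooth in space, so the directional derivative of kernel times test function integrates to zero; the slices are put together by Fubini. Integrability over the slices is where \<open>\<alpha> > 1\<close> enters.\<close>

lemma pk_integration_by_parts:
  fixes w :: "real \<times> 'a::euclidean_space"
  assumes \<alpha>: "1 < \<alpha>" and lam: "0 < lam" and \<phi>: "\<phi> \<in> test_functions"
  shows "(LBINT z. pk lam \<alpha> (z - w) * frechet_derivative \<phi> (at z) (0, e)) = - (LBINT z. dpk lam \<alpha> e (z - w) * \<phi> z)"
proof -
  obtain D C R where D: "\<And>z. (\<phi> has_derivative D z) (at z)" and fD: "\<And>z v. frechet_derivative \<phi> (at z) v = D z v"
    and c: "continuous_on UNIV \<phi>" "\<And>v. continuous_on UNIV (\<lambda>z. D z v)"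
    and C: "\<And>z. \<bar>\<phi> z\<bar> \<le> C" and R: "\<And>z. R < norm z \<Longrightarrow> \<phi> z = 0" "\<And>z v. R < norm z \<Longrightarrow> D z v = 0" and C0: "0 \<le> C"
    using test_function_facts[OF \<phi>] by blast
  have "bounded ((\<lambda>z. D z (0, e)) ` cball 0 R)"
    by (intro compact_imp_bounded compact_continuous_image continuous_on_subset[OF c(2)]) auto
  then obtain B where B0: "\<forall>y\<in>(\<lambda>z. D z (0, e)) ` cball 0 R. norm y \<le> B" unfolding bounded_iff by blast
  have B: "\<bar>D z (0, e)\<bar> \<le> B" if "norm z \<le> R" for z
    using bspec[OF B0 imageI[of z]] that by (simp only: mem_cball_0 real_norm_def)
  define B' where "B' = max B 0"
  have B': "\<bar>D z (0, e)\<bar> \<le> B'" for z using B[of z] R(2)[of z] by (cases "norm z \<le> R") (auto simp: B'_def)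
  have B'0: "0 \<le> B'" by (simp add: B'_def)
  have \<alpha>0: "0 < \<alpha>" "0 < \<alpha> - 1" using \<alpha> by auto
  let ?pc = "pk_const TYPE('a) \<alpha>"
  have pc: "0 < ?pc" by (rule pk_const_pos[OF \<alpha>0(1)])
  have [measurable]: "\<phi> \<in> borel_measurable borel" "(\<lambda>z. D z (0, e)) \<in> borel_measurable borel"
    using c by (auto intro: borel_measurable_continuous_onI)
  let ?A = "\<lambda>z. pk lam \<alpha> (z - w) * D z (0, e)" and ?B = "\<lambda>z. dpk lam \<alpha> e (z - w) * \<phi> z"
  have iA: "integrable lborel ?A"
  proof (rule Bochner_Integration.integrable_bound[of lborel "\<lambda>z. ?pc * B' * gk lam \<alpha> (z - w)"])
    show "integrable lborel (\<lambda>z. ?pc * B' * gk lam \<alpha> (z - w))" by (intro integrable_mult_right gk_integrable \<alpha>0 lam)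
    show "AE z in lborel. norm (?A z) \<le> norm (?pc * B' * gk lam \<alpha> (z - w))"
    proof (rule AE_I2)
      fix z
      have "norm (?A z) \<le> (?pc * gk lam \<alpha> (z - w)) * B'"
        unfolding real_norm_def abs_mult using pk_nonneg[OF \<alpha>0(1), of lam "z - w"] pk_le_gk[OF \<alpha>0(1), of lam "z - w"] pc gk_nonneg[of lam \<alpha> "z - w"]
        by (intro mult_mono B') auto
      also have "\<dots> = norm (?pc * B' * gk lam \<alpha> (z - w))" using pc B'0 gk_nonneg[of lam \<alpha> "z - w"] by (simp add: abs_mult)
      finally show "norm (?A z) \<le> norm (?pc * B' * gk lam \<alpha> (z - w))" .
    qed
  qed measurable
  have iB: "integrable lborel ?B"
  proof (rule Bochner_Integration.integrable_bound[of lborel "\<lambda>z. norm e * ?pc * C * gk lam (\<alpha> - 1) (z - w)"])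
    show "integrable lborel (\<lambda>z. norm e * ?pc * C * gk lam (\<alpha> - 1) (z - w))" by (intro integrable_mult_right gk_integrable \<alpha>0 lam)
    show "AE z in lborel. norm (?B z) \<le> norm (norm e * ?pc * C * gk lam (\<alpha> - 1) (z - w))"
    proof (rule AE_I2)
      fix z
      have "norm (?B z) \<le> (norm e * ?pc * gk lam (\<alpha> - 1) (z - w)) * C"
        unfolding real_norm_def abs_mult using pc gk_nonneg[of lam "\<alpha> - 1" "z - w"]
        by (intro mult_mono C dpk_le_gk \<alpha>0) (auto intro!: mult_nonneg_nonneg)
      also have "\<dots> = norm (norm e * ?pc * C * gk lam (\<alpha> - 1) (z - w))" using pc C0 gk_nonneg[of lam "\<alpha> - 1" "z - w"] by (simp add: abs_mult)
      finally show "norm (?B z) \<le> norm (norm e * ?pc * C * gk lam (\<alpha> - 1) (z - w))" .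
    qed
  qed measurable
  obtain s y where w: "w = (s, y)" by (cases w)
  have slice: "(LBINT x. ?A (t, x) + ?B (t, x)) = 0" for t
  proof (cases "s < t")
    case False
    then show ?thesis by (simp add: w pk_def dpk_def)
  next
    case True
    define \<tau> where "\<tau> = t - s"
    have \<tau>: "0 < \<tau>" using True by (simp add: \<tau>_def)
    define X where "X \<beta> = exp (- lam * \<tau>) * \<tau> powr ((\<beta> - real (DIM('a) + 2)) / 2)" for \<beta>
    have X: "gk lam \<beta> (\<tau>, x) \<le> X \<beta>" for \<beta> and x :: 'a unfolding X_def by (rule gk_slice_bound)
    have X0: "0 \<le> X \<beta>" for \<beta> by (simp add: X_def)
    have [measurable]: "(\<lambda>x. \<phi> (t, x)) \<in> borel_measurable borel" "(\<lambda>x. D (t, x) (0, e)) \<in> borel_measurable borel"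
      by (auto intro!: borel_measurable_continuous_onI continuous_on_compose2[OF c(1)] continuous_on_compose2[OF c(2)] continuous_intros)
    have [measurable]: "(\<lambda>x. pk lam \<alpha> (\<tau>, x - y)) \<in> borel_measurable borel" "(\<lambda>x. dpk lam \<alpha> e (\<tau>, x - y)) \<in> borel_measurable borel"
    proof -
      have [measurable]: "pk lam \<alpha> \<in> borel_measurable (borel \<Otimes>\<^sub>M borel)" "dpk lam \<alpha> e \<in> borel_measurable (borel \<Otimes>\<^sub>M borel)"
        unfolding borel_prod by measurable
      show "(\<lambda>x. pk lam \<alpha> (\<tau>, x - y)) \<in> borel_measurable borel" "(\<lambda>x. dpk lam \<alpha> e (\<tau>, x - y)) \<in> borel_measurable borel" by measurable
    qed
    let ?F = "\<lambda>x. pk lam \<alpha> (\<tau>, x - y) * \<phi> (t, x)"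
    let ?F' = "\<lambda>x. pk lam \<alpha> (\<tau>, x - y) * D (t, x) (0, e) + dpk lam \<alpha> e (\<tau>, x - y) * \<phi> (t, x)"
    have nz: "R < norm (t, x)" if "R < norm x" for x :: 'a
      using that norm_snd_le[of x t] by linarith
    have "(LBINT x. ?F' x) = 0"
    proof (rule integral_directional_derivative_eq_0[where F = ?F and v = e and C = "?pc * X \<alpha> * B' + norm e * ?pc * X (\<alpha> - 1) * C" and R = R])
      show "integrable lborel ?F"
      proof (rule Bochner_Integration.integrable_bound[of lborel "\<lambda>x. ?pc * X \<alpha> * C * indicator (cball 0 R) x"])
        show "integrable lborel (\<lambda>x. ?pc * X \<alpha> * C * indicator (cball (0::'a) R) x :: real)"
          using emeasure_bounded_finite[OF bounded_cball, of "0::'a" R]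
          by (intro integrable_mult_right integrable_real_indicator) auto
        show "AE x in lborel. norm (?F x) \<le> norm (?pc * X \<alpha> * C * indicator (cball 0 R) x)"
        proof (rule AE_I2)
          fix x
          show "norm (?F x) \<le> norm (?pc * X \<alpha> * C * indicator (cball 0 R) x)"
          proof (cases "norm x \<le> R")
            case True
            have "norm (?F x) \<le> (?pc * X \<alpha>) * C"
              unfolding real_norm_def abs_mult using pk_nonneg[OF \<alpha>0(1), of lam "(\<tau>, x - y)"] order_trans[OF pk_le_gk[OF \<alpha>0(1), of lam "(\<tau>, x - y)"] mult_left_mono[OF X]] pc X0
              by (intro mult_mono C) auto
            then show ?thesis using True pc X0 C0 by (simp add: abs_mult)
          next
            case False then show ?thesis using R(1)[OF nz[of x]] by simp
          qed
        qed
      qed measurable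
      show "((\<lambda>r. ?F (x + r *\<^sub>R e)) has_real_derivative ?F' x) (at 0)" for x
      proof -
        have 1: "((\<lambda>r. pk lam \<alpha> (\<tau>, (x - y) + r *\<^sub>R e)) has_real_derivative dpk lam \<alpha> e (\<tau>, x - y)) (at 0)"
          by (rule pk_spatial_derivative)
        have "((\<lambda>r. (t, x + r *\<^sub>R e)) has_derivative (\<lambda>r. (0, r *\<^sub>R e))) (at 0)"
          by (auto intro!: derivative_eq_intros has_derivative_Pair)
        from has_derivative_compose[OF this D]
        have "((\<lambda>r. \<phi> (t, x + r *\<^sub>R e)) has_derivative (\<lambda>r. D (t, x) (0, r *\<^sub>R e))) (at 0)" by simp
        moreover have "D (t, x) (0, r *\<^sub>R e) = D (t, x) (0, e) * r" for r
        proof -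
          have "linear (D (t, x))" using D has_derivative_linear by blast
          then have "D (t, x) (r *\<^sub>R (0, e)) = r *\<^sub>R D (t, x) (0, e)" by (rule linear_scale)
          then show ?thesis by simp
        qed
        ultimately have 2: "((\<lambda>r. \<phi> (t, x + r *\<^sub>R e)) has_real_derivative D (t, x) (0, e)) (at 0)"
          by (simp add: has_field_derivative_def)
        have e: "(x - y) + r *\<^sub>R e = x + r *\<^sub>R e - y" for r by simp
        from DERIV_mult[OF 1 2] show ?thesis unfolding e by (simp add: mult_ac add_ac)
      qed
      show "\<bar>?F' x\<bar> \<le> ?pc * X \<alpha> * B' + norm e * ?pc * X (\<alpha> - 1) * C" for x
      proof -
        have "\<bar>pk lam \<alpha> (\<tau>, x - y) * D (t, x) (0, e)\<bar> \<le> (?pc * X \<alpha>) * B'"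
          unfolding abs_mult using pk_nonneg[OF \<alpha>0(1), of lam "(\<tau>, x - y)"] order_trans[OF pk_le_gk[OF \<alpha>0(1), of lam "(\<tau>, x - y)"] mult_left_mono[OF X]] pc X0
          by (intro mult_mono B') auto
        moreover have "\<bar>dpk lam \<alpha> e (\<tau>, x - y) * \<phi> (t, x)\<bar> \<le> (norm e * ?pc * X (\<alpha> - 1)) * C"
          unfolding abs_mult
          using order_trans[OF dpk_le_gk[OF \<alpha>0(1), of lam e "(\<tau>, x - y)"] mult_left_mono[OF X]] pc X0
          by (intro mult_mono C) (auto intro!: mult_nonneg_nonneg)
        ultimately show ?thesis by linarith
      qed
      show "?F x = 0" if "R < norm x" for x using R(1)[OF nz[OF that]] by simp
    qed measurable
    then show ?thesis by (simp add: w \<tau>_def)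
  qed
  have "integrable (lborel \<Otimes>\<^sub>M lborel) (\<lambda>z. ?A z + ?B z)" unfolding lborel_prod using iA iB by (rule Bochner_Integration.integrable_add)
  then have "(LBINT t. LBINT x. ?A (t, x) + ?B (t, x)) = (\<integral>z. ?A z + ?B z \<partial>(lborel \<Otimes>\<^sub>M lborel))"
    by (rule lborel_pair.integral_fst')
  then have "(LBINT z. ?A z + ?B z) = 0" unfolding slice lborel_prod by simp
  then show ?thesis unfolding fD using iA iB by simp
qed

lemma Lp_locally_integrable:
  fixes f :: "'b::euclidean_space \<Rightarrow> real"
  assumes p: "1 < p" and f: "f \<in> Lp p"
  shows "locally_integrable f"
  unfolding locally_integrable_def
proof (intro allI impI)
  fix K :: "'b set" assume K: "compact K"
  have [measurable]: "f \<in> borel_measurable lebesgue" by (rule Lp_measurable[OF f])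
  have Kb: "K \<in> sets borel" by (rule borel_compact[OF K])
  then have [measurable]: "K \<in> sets lebesgue" by auto
  have fin: "emeasure lebesgue K < \<infinity>" using Kb emeasure_compact_finite[OF K] by simp
  show "set_integrable lebesgue K f"
    unfolding set_integrable_def
  proof (rule Bochner_Integration.integrable_bound[of lebesgue "\<lambda>z. indicator K z + \<bar>f z\<bar> powr p"])
    show "integrable lebesgue (\<lambda>z. indicator K z + \<bar>f z\<bar> powr p)"
      using f fin by (intro Bochner_Integration.integrable_add integrable_real_indicator) (auto simp: Lp_def)
    show "AE z in lebesgue. norm (indicator K z *\<^sub>R f z) \<le> norm (indicator K z + \<bar>f z\<bar> powr p)"
    proof (rule AE_I2)
      fix z
      have "\<bar>f z\<bar> \<le> 1 + \<bar>f z\<bar> powr p"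
      proof (cases "\<bar>f z\<bar> \<le> 1")
        case False
        then have "\<bar>f z\<bar> powr 1 \<le> \<bar>f z\<bar> powr p" using p by (intro powr_mono) auto
        then show ?thesis by simp
      qed (simp add: add_increasing2)
      then show "norm (indicator K z *\<^sub>R f z) \<le> norm (indicator K z + \<bar>f z\<bar> powr p)"
        by (auto split: split_indicator)
    qed
  qed measurable
qed

text \<open>The adjoint acts on the test function; since \<open>\<psi>\<close> is bounded with bounded support, local integrability of the potential of \<open>\<bar>h\<bar>\<close> suffices for the exchange.\<close>

lemma kop_Fubini:
  fixes K :: "'b::euclidean_space \<times> 'b \<Rightarrow> real"
  assumes p: "1 < p" and K: "kernel_bound p K C" and h: "h \<in> Lp p" and h'[measurable]: "h' \<in> borel_measurable borel" and ae: "AE z in lebesgue. h z = h' z"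
    and \<psi>[measurable]: "\<psi> \<in> borel_measurable borel" and B: "\<And>z. \<bar>\<psi> z\<bar> \<le> B" and R: "\<And>z. R < norm z \<Longrightarrow> \<psi> z = 0"
  shows "(\<integral>z. kop K h z * \<psi> z \<partial>lebesgue) = (LBINT w. h' w * (LBINT z. K (z, w) * \<psi> z))"
proof -
  have Kb: "K \<in> borel_measurable borel" using K by (simp add: kernel_bound_def)
  have [measurable]: "K \<in> borel_measurable (borel \<Otimes>\<^sub>M borel)" using Kb by (rule kernel_measurable_pair)
  have [measurable]: "kop K h \<in> borel_measurable borel" by (rule kop_measurable[OF Kb Lp_measurable[OF h]])
  have B0: "0 \<le> B" using B[of 0] by linarith
  have [measurable]: "cball (0::'b) R \<in> sets borel" by simp
  let ?I = "\<lambda>z. NNINT w. ennreal \<bar>K (z, w)\<bar> * ennreal \<bar>h' w\<bar>"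
  let ?f = "\<lambda>z w. K (z, w) * h' w * \<psi> z"
  have "(\<integral>\<^sup>+x. ennreal (norm (case x of (z, w) \<Rightarrow> ?f z w)) \<partial>(lborel \<Otimes>\<^sub>M lborel)) = (NNINT z. (NNINT w. ennreal (norm (?f z w))))"
    by (subst lborel.nn_integral_fst[symmetric]) (auto simp: case_prod_beta')
  also have "\<dots> \<le> (NNINT z. ennreal B * (indicator (cball 0 R) z + epowr (?I z) p))"
  proof (intro nn_integral_mono)
    fix z
    have "(NNINT w. ennreal (norm (?f z w))) = (NNINT w. (ennreal \<bar>K (z, w)\<bar> * ennreal \<bar>h' w\<bar>) * ennreal \<bar>\<psi> z\<bar>)"
      by (intro nn_integral_cong) (simp add: abs_mult ennreal_mult)
    also have "\<dots> = ?I z * ennreal \<bar>\<psi> z\<bar>" by (rule nn_integral_multc) measurable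
    also have "\<dots> \<le> ennreal B * (indicator (cball 0 R) z + epowr (?I z) p)"
    proof (cases "norm z \<le> R")
      case False
      then show ?thesis using R[of z] by simp
    next
      case True
      have "?I z \<le> 1 + epowr (?I z) p"
      proof (cases "?I z \<le> 1")
        case False
        have "epowr (?I z) 1 \<le> epowr (?I z) p"
        proof (cases "?I z")
          case (real r)
          then have "1 < r" using False by simp
          then have "r powr 1 \<le> r powr p" using p by (intro powr_mono) auto
          then show ?thesis unfolding real(2) using real(1) by (simp only: epowr_ennreal ennreal_leI)
        qed simp
        then show ?thesis by (simp add: add_increasing)
      qed (simp add: add_increasing2)
      then have "?I z * ennreal \<bar>\<psi> z\<bar> \<le> (1 + epowr (?I z) p) * ennreal B"
        using B by (intro mult_mono ennreal_leI) auto
      then show ?thesis using True by (simp add: mult.commute)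
    qed
    finally show "(NNINT w. ennreal (norm (?f z w))) \<le> ennreal B * (indicator (cball 0 R) z + epowr (?I z) p)" .
  qed
  also have "\<dots> = ennreal B * (emeasure lborel (cball (0::'b) R) + (NNINT z. epowr (?I z) p))"
  proof -
    have "(NNINT z. ennreal B * (indicator (cball 0 R) z + epowr (?I z) p)) = ennreal B * (NNINT z. indicator (cball 0 R) z + epowr (?I z) p)"
      by (rule nn_integral_cmult) measurable
    also have "(NNINT z. indicator (cball 0 R) z + epowr (?I z) p) = (NNINT z. indicator (cball (0::'b) R) z) + (NNINT z. epowr (?I z) p)"
      by (rule nn_integral_add) measurable
    finally show ?thesis by simp
  qed
  also have "\<dots> < \<infinity>"
    using le_less_trans[OF kop_abs_finite(1)[OF p K h h' ae] ennreal_less_top] emeasure_bounded_finite[OF bounded_cball, of "0::'b" R]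
    by (auto simp: ennreal_mult_less_top)
  finally have int: "integrable (lborel \<Otimes>\<^sub>M lborel) (\<lambda>(z, w). ?f z w)"
    by (simp add: integrable_iff_bounded case_prod_beta')
  have "(\<integral>z. kop K h z * \<psi> z \<partial>lebesgue) = (LBINT z. kop K h z * \<psi> z)"
    by (rule integral_completion) measurable
  also have "\<dots> = (LBINT z. (LBINT w. ?f z w))"
    unfolding kop_cong_AE[OF Kb Lp_measurable[OF h] ae] kop_borel[OF Kb h'] by simp
  also have "\<dots> = (LBINT w. (LBINT z. ?f z w))"
    by (rule lborel_pair.Fubini_integral[symmetric, OF int])
  also have "\<dots> = (LBINT w. h' w * (LBINT z. K (z, w) * \<psi> z))"
    by (simp add: mult_ac flip: Bochner_Integration.integral_mult_right_zero)
  finally show ?thesis .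
qed

definition Dk :: "real \<Rightarrow> real \<Rightarrow> 'a \<Rightarrow> (real \<times> 'a::euclidean_space) \<times> (real \<times> 'a) \<Rightarrow> real" where
  "Dk lam \<alpha> e = (\<lambda>(z, w). dpk lam \<alpha> e (z - w))"

lemma Dk_measurable: "Dk lam \<alpha> e \<in> borel_measurable borel"
proof -
  have "Dk lam \<alpha> e \<in> borel_measurable (borel \<Otimes>\<^sub>M borel)" unfolding Dk_def by measurable
  then show ?thesis unfolding borel_prod .
qed

lemma Dk_bound:
  assumes p: "1 < p" and \<alpha>: "1 < \<alpha>" and lam: "0 < lam"
  shows "\<exists>C. kernel_bound p (Dk lam \<alpha> (e :: 'a::euclidean_space)) C"
proof -
  have a: "0 < \<alpha>" "0 < \<alpha> - 1" using \<alpha> by auto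
  define m where "m = Gamma ((\<alpha> - 1) / 2) * (8 * pi) powr (real DIM('a) / 2) * lam powr (- (\<alpha> - 1) / 2)"
  have m: "0 \<le> m" using a by (simp add: m_def Gamma_real_pos less_imp_le)
  have "kernel_bound p (\<lambda>(z, w :: real \<times> 'a). gk lam (\<alpha> - 1) (z - w)) m"
    using gk_mass[OF a(2) lam, where 'a='a] m by (intro convolution_kernel_bound p) (auto simp: gk_nonneg m_def)
  then have "kernel_bound p (Dk lam \<alpha> e) (norm e * pk_const TYPE('a) \<alpha> * m)"
  proof (rule kernel_bound_mono[OF p Dk_measurable])
    show "0 \<le> norm e * pk_const TYPE('a) \<alpha>" using pk_const_pos[OF a(1), where 'a='a] by simp
    show "\<bar>Dk lam \<alpha> e (z, w)\<bar> \<le> norm e * pk_const TYPE('a) \<alpha> * \<bar>case (z, w) of (z, w) \<Rightarrow> gk lam (\<alpha> - 1) (z - w)\<bar>" for z w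
      using dpk_le_gk[OF a(1), of lam e "z - w"] by (simp add: Dk_def gk_nonneg)
  qed
  then show ?thesis by blast
qed

text \<open>Move the derivative from the test function to the kernel under the integral sign, for each \<open>w\<close> separately, and exchange the order of integration before and after.\<close>

lemma weak_grad_potential:
  fixes h :: "real \<times> 'a::euclidean_space \<Rightarrow> real"
  assumes p: "1 < p" and \<alpha>: "1 < \<alpha>" and lam: "0 < lam" and h: "h \<in> Lp p"
  shows "has_weak_grad (par_potential lam \<alpha> h) (\<lambda>z. \<Sum>e\<in>Basis. kop (Dk lam \<alpha> e) h z *\<^sub>R e)"
proof -
  have a: "0 < \<alpha>" using \<alpha> by simp
  have DLp: "kop (Dk lam \<alpha> e) h \<in> Lp p" for e using Dk_bound[OF p \<alpha> lam, of e] kop_Lp(1)[OF p _ h] by blast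
  obtain h' where h'[measurable]: "h' \<in> borel_measurable borel" and ae: "AE z in lebesgue. h z = h' z"
    using lebesgue_ex_borel[OF Lp_measurable[OF h]] by blast
  show ?thesis
    unfolding has_weak_grad_def
  proof (intro conjI ballI)
    show "locally_integrable (par_potential lam \<alpha> h)"
      unfolding par_potential_kop by (intro Lp_locally_integrable[OF p] kop_Lp[OF p Pk_bound[OF p a lam] h])
    show "locally_integrable (\<lambda>z. \<Sum>e\<in>Basis. kop (Dk lam \<alpha> e) h z *\<^sub>R e)"
      unfolding locally_integrable_def set_integrable_def
    proof (intro allI impI)
      fix K :: "(real \<times> 'a) set" assume K: "compact K"
      have "integrable lebesgue (\<lambda>z. indicator K z *\<^sub>R kop (Dk lam \<alpha> e) h z)" for e
        using Lp_locally_integrable[OF p DLp, of e] K by (simp add: locally_integrable_def set_integrable_def)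
      then have "integrable lebesgue (\<lambda>z. \<Sum>e\<in>Basis. (indicator K z *\<^sub>R kop (Dk lam \<alpha> e) h z) *\<^sub>R e)"
        by (intro Bochner_Integration.integrable_sum integrable_scaleR_left)
      then show "integrable lebesgue (\<lambda>z. indicator K z *\<^sub>R (\<Sum>e\<in>Basis. kop (Dk lam \<alpha> e) h z *\<^sub>R e))"
        by (simp add: scaleR_sum_right)
    qed
  next
    fix \<phi> :: "real \<times> 'a \<Rightarrow> real" and e :: 'a assume \<phi>: "\<phi> \<in> test_functions" and e: "e \<in> Basis"
    obtain D C R where D: "\<And>z v. frechet_derivative \<phi> (at z) v = D z v"
      and c: "continuous_on UNIV \<phi>" "\<And>v. continuous_on UNIV (\<lambda>z. D z v)"
      and C: "\<And>z. \<bar>\<phi> z\<bar> \<le> C" and R: "\<And>z. R < norm z \<Longrightarrow> \<phi> z = 0" "\<And>z v. R < norm z \<Longrightarrow> D z v = 0"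
      using test_function_facts[OF \<phi>] by metis
    have "bounded ((\<lambda>z. D z (0, e)) ` cball 0 R)"
      by (intro compact_imp_bounded compact_continuous_image continuous_on_subset[OF c(2)]) auto
    then obtain B where B0: "\<forall>y\<in>(\<lambda>z. D z (0, e)) ` cball 0 R. norm y \<le> B" unfolding bounded_iff by blast
    have B: "\<bar>D z (0, e)\<bar> \<le> B" if "norm z \<le> R" for z
      using bspec[OF B0 imageI[of z]] that by (simp only: mem_cball_0 real_norm_def)
    have B': "\<bar>D z (0, e)\<bar> \<le> max B 0" for z using B[of z] R(2)[of z] by (cases "norm z \<le> R") auto
    have m: "\<phi> \<in> borel_measurable borel" "(\<lambda>z. D z (0, e)) \<in> borel_measurable borel"
      using c by (auto intro: borel_measurable_continuous_onI)
    have G: "(\<Sum>e\<in>Basis. kop (Dk lam \<alpha> e) h z *\<^sub>R e) \<bullet> e = kop (Dk lam \<alpha> e) h z" for z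
      using e by (simp add: inner_sum_left inner_Basis if_distrib cong: if_cong)
    obtain CD where CD: "kernel_bound p (Dk lam \<alpha> e) CD" using Dk_bound[OF p \<alpha> lam] by blast
    have "(\<integral>z. par_potential lam \<alpha> h z * D z (0, e) \<partial>lebesgue) = (LBINT w. h' w * (LBINT z. Pk lam \<alpha> (z, w) * D z (0, e)))"
      unfolding par_potential_kop by (rule kop_Fubini[OF p Pk_bound[OF p a lam] h h' ae m(2) B' R(2)])
    also have "\<dots> = - (LBINT w. h' w * (LBINT z. Dk lam \<alpha> e (z, w) * \<phi> z))"
      using pk_integration_by_parts[OF \<alpha> lam \<phi>, of _ e] by (simp add: Pk_def Dk_def D)
    also have "\<dots> = - (\<integral>z. kop (Dk lam \<alpha> e) h z * \<phi> z \<partial>lebesgue)"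
      by (subst kop_Fubini[OF p CD h h' ae m(1) C R(1)]) auto
    finally show "(\<integral>z. par_potential lam \<alpha> h z * frechet_derivative \<phi> (at z) (0, e) \<partial>lebesgue) =
        - (\<integral>z. ((\<Sum>e\<in>Basis. kop (Dk lam \<alpha> e) h z *\<^sub>R e) \<bullet> e) * \<phi> z \<partial>lebesgue)"
      unfolding D G .
  qed
qed

lemma has_weak_grad_cong_AE:
  fixes u u' :: "real \<times> 'a::euclidean_space \<Rightarrow> real"
  assumes ae: "AE z in lebesgue. u z = u' z" and u: "has_weak_grad u G"
  shows "has_weak_grad u' G"
proof -
  have li: "locally_integrable u'"
    unfolding locally_integrable_def set_integrable_def
  proof (intro allI impI)
    fix K :: "(real \<times> 'a) set" assume "compact K"
    then have i: "integrable lebesgue (\<lambda>z. indicator K z *\<^sub>R u z)" using u by (auto simp: has_weak_grad_def locally_integrable_def set_integrable_def)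
    have ae': "AE z in lebesgue. indicator K z *\<^sub>R u z = indicator K z *\<^sub>R u' z" using ae by eventually_elim simp
    from integrable_cong_AE_imp[OF i borel_measurable_AE[OF borel_measurable_integrable[OF i] ae']] ae'
    show "integrable lebesgue (\<lambda>z. indicator K z *\<^sub>R u' z)" by (auto elim!: eventually_mono)
  qed
  have "(\<integral>z. u z * f z \<partial>lebesgue) = (\<integral>z. u' z * f z \<partial>lebesgue)" for f
  proof (cases "(\<lambda>z. u z * f z) \<in> borel_measurable lebesgue")
    case True
    have ae': "AE z in lebesgue. u z * f z = u' z * f z" using ae by eventually_elim simp
    show ?thesis by (rule integral_cong_AE[OF True borel_measurable_AE[OF True ae'] ae'])
  next
    case False
    have ae': "AE z in lebesgue. u' z * f z = u z * f z" using ae by eventually_elim simp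
    have F': "(\<lambda>z. u' z * f z) \<notin> borel_measurable lebesgue" using borel_measurable_AE[OF _ ae'] False by blast
    show ?thesis using False F' by (metis borel_measurable_integrable not_integrable_integral_eq)
  qed
  with u li show ?thesis unfolding has_weak_grad_def by simp
qed

lemma weak_grad_cong_AE:
  assumes "AE z in lebesgue. u z = u' z"
  shows "weak_grad u = weak_grad u'"
proof -
  have "AE z in lebesgue. u' z = u z" using assms by eventually_elim simp
  then have "has_weak_grad u = has_weak_grad u'"
    using has_weak_grad_cong_AE[OF assms] has_weak_grad_cong_AE by blast
  then show ?thesis by (simp add: weak_grad_def)
qed

lemma weak_grad_eq:
  assumes "has_weak_grad u G"
  shows "AE z in lebesgue. weak_grad u z = G z"
  unfolding weak_grad_def using has_weak_grad_unique[OF someI[of "has_weak_grad u", OF assms] assms] .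

section \<open>Injectivity of the potentials\<close>

lemma pk_two: "0 < fst z \<Longrightarrow> pk lam 2 z = exp (- lam * fst z) * heat (fst z) (snd z)"
  by (simp add: pk_def)

text \<open>The resolvent identity for the kernels: after the Chapman--Kolmogorov identity only \<open>exp ((mu - lam) s)\<close> has to be integrated over \<open>(0, t)\<close>.\<close>

lemma resolvent_kernel:
  fixes z :: "real \<times> 'a::euclidean_space"
  assumes lm: "0 < lam" "lam < mu"
  shows "(NNINT w. ennreal (pk mu 2 (z - w) * pk lam 2 w)) = ennreal ((pk lam 2 z - pk mu 2 z) / (mu - lam))"
proof -
  obtain t x where z: "z = (t, x)" by (cases z)
  let ?f = "\<lambda>s. exp (- mu * t) * exp ((mu - lam) * s)"
  have "(NNINT w. ennreal (pk mu 2 (z - w) * pk lam 2 w))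
     = (NNINT s. NNINT (y::'a). ennreal (pk mu 2 (t - s, x - y) * pk lam 2 (s, y)))"
    by (subst nn_integral_spacetime) (auto simp: z)
  also have "\<dots> = (NNINT s. ennreal (heat t x) * (if 0 < s \<and> s < t then ennreal (?f s) else 0))"
  proof (intro nn_integral_cong)
    fix s :: real
    show "(NNINT (y::'a). ennreal (pk mu 2 (t - s, x - y) * pk lam 2 (s, y))) = ennreal (heat t x) * (if 0 < s \<and> s < t then ennreal (?f s) else 0)"
    proof (cases "0 < s \<and> s < t")
      case True
      have e: "exp (- mu * (t - s)) * exp (- lam * s) = ?f s"
        by (simp add: exp_add[symmetric] algebra_simps)
      have "(NNINT (y::'a). ennreal (pk mu 2 (t - s, x - y) * pk lam 2 (s, y))) = (NNINT (y::'a). ennreal (?f s) * ennreal (heat (t - s) (x - y) * heat s y))"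
      proof (intro nn_integral_cong)
        fix y :: 'a
        have "pk mu 2 (t - s, x - y) * pk lam 2 (s, y) = ?f s * (heat (t - s) (x - y) * heat s y)"
          unfolding e[symmetric] using True by (simp add: pk_two)
        then show "ennreal (pk mu 2 (t - s, x - y) * pk lam 2 (s, y)) = ennreal (?f s) * ennreal (heat (t - s) (x - y) * heat s y)"
          by (simp only:) (rule ennreal_mult', simp)
      qed
      also have "\<dots> = ennreal (?f s) * ennreal (heat t x)"
        using True by (subst nn_integral_cmult) (auto simp: heat_chapman_kolmogorov)
      finally show ?thesis using True by (simp add: mult.commute)
    next
      case False
      then have *: "pk mu 2 (t - s, x - y) * pk lam 2 (s, y) = 0" for y :: 'a by (auto simp: pk_def)
      show ?thesis unfolding * using False by (simp only: if_False) simp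
    qed
  qed
  also have "\<dots> = ennreal ((pk lam 2 z - pk mu 2 z) / (mu - lam))"
  proof (cases "0 < t")
    case True
    let ?F = "\<lambda>s. exp (- mu * t) * exp ((mu - lam) * s) / (mu - lam)"
    have "(NNINT s. ennreal (heat t x) * (if 0 < s \<and> s < t then ennreal (?f s) else 0))
       = ennreal (heat t x) * (NNINT s. (if 0 < s \<and> s < t then ennreal (?f s) else 0))"
      by (rule nn_integral_cmult) measurable
    also have "(NNINT s. (if 0 < s \<and> s < t then ennreal (?f s) else 0)) = (NNINT s. ennreal (?f s) * indicator {0..t} s)"
    proof (rule nn_integral_cong_AE)
      show "AE s in lborel. (if 0 < s \<and> s < t then ennreal (?f s) else 0) = ennreal (?f s) * indicator {0..t} s"
        using AE_lborel_singleton[of "0::real"] AE_lborel_singleton[of t]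
        by eventually_elim (auto simp: indicator_def)
    qed
    also have "\<dots> = ennreal (?F t - ?F 0)"
      using True lm by (intro nn_integral_FTC_Icc) (auto intro!: derivative_eq_intros)
    also have "ennreal (heat t x) * ennreal (?F t - ?F 0) = ennreal (heat t x * (?F t - ?F 0))"
      by (rule ennreal_mult'[symmetric]) (rule heat_nonneg)
    also have "heat t x * (?F t - ?F 0) = (pk lam 2 z - pk mu 2 z) / (mu - lam)"
    proof -
      have "exp (- mu * t) * exp ((mu - lam) * t) = exp (- lam * t)" by (simp add: exp_add[symmetric] algebra_simps)
      then show ?thesis using True by (simp add: pk_two z diff_divide_distrib[symmetric] algebra_simps)
    qed
    finally show ?thesis .
  next
    case False
    then have "(\<lambda>s. ennreal (heat t x) * (if 0 < s \<and> s < t then ennreal (?f s) else 0)) = (\<lambda>s. 0)" by auto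
    with False show ?thesis by (simp add: pk_def z)
  qed
  finally show ?thesis .
qed

lemma pk_two_antimono: "0 < lam \<Longrightarrow> lam < mu \<Longrightarrow> pk mu 2 z \<le> pk lam 2 z"
  by (cases "0 < fst z") (auto simp: pk_two heat_nonneg intro!: mult_right_mono, simp add: pk_def)

lemma kop_zero: "kop K (\<lambda>_. 0) = (\<lambda>_. 0)"
  by (simp add: kop_def fun_eq_iff)

text \<open>Apply the operator at \<open>mu\<close> to the vanishing potential at \<open>lam\<close>; by the resolvent identity the result is a multiple of the difference of the two potentials.\<close>

lemma resolvent_kernel_zero:
  fixes g :: "real \<times> 'a::euclidean_space \<Rightarrow> real"
  assumes p: "1 < p" and lm: "0 < lam" "lam < mu" and g: "g \<in> Lp p"
    and zero: "AE z in lebesgue. kop (Pk lam 2) g z = 0"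
  shows "AE z in lebesgue. kop (Pk mu 2) g z = 0"
proof -
  have mu: "0 < mu" using lm by simp
  define K3 :: "(real \<times> 'a) \<times> (real \<times> 'a) \<Rightarrow> real" where "K3 x = (Pk lam 2 x - Pk mu 2 x) / (mu - lam)" for x
  have nn3: "0 \<le> K3 x" for x 
  proof -
    obtain z w where Pair: "x = (z, w)" by (cases x)
    show ?thesis unfolding K3_def Pk_def Pair split_conv using pk_two_antimono[OF lm, of "z - w"] lm by (intro divide_nonneg_pos) linarith+
  qed
  have K3m: "K3 \<in> borel_measurable borel" unfolding K3_def
    by (intro borel_measurable_divide borel_measurable_diff borel_measurable_const Pk_measurable)
  have K3b: "kernel_bound p K3 (1 / (mu - lam) * lam powr (- 2 / 2))"
  proof (rule kernel_bound_mono[OF p K3m Pk_bound[OF p _ lm(1)]])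
    show "\<bar>K3 (z, w)\<bar> \<le> 1 / (mu - lam) * \<bar>Pk lam 2 (z, w)\<bar>" for z w
    proof -
      have "K3 (z, w) \<le> Pk lam 2 (z, w) / (mu - lam)"
        unfolding K3_def using lm Pk_nonneg[of 2 mu "(z, w)"] by (intro divide_right_mono) auto
      then show ?thesis using nn3[of "(z, w)"] Pk_nonneg[of 2 lam "(z, w)"] by simp
    qed
  qed (use lm in auto)
  have "AE z in lebesgue. kop (Pk mu 2) (kop (Pk lam 2) g) z = kop K3 g z"
  proof (rule kop_composition[OF p Pk_measurable Pk_measurable K3b _ _ nn3 _ g])
    fix z w :: "real \<times> 'a"
    have "(NNINT y. ennreal (Pk mu 2 (z, y) * Pk lam 2 (y, w))) = (NNINT y. ennreal (pk mu 2 (z - w - (- w + y)) * pk lam 2 (- w + y)))"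
      by (simp add: Pk_def)
    also have "\<dots> = (NNINT y. ennreal (pk mu 2 (z - w - y) * pk lam 2 y))"
      by (rule nn_integral_lborel_translate) measurable
    also have "\<dots> = ennreal (K3 (z, w))" by (simp only: resolvent_kernel[OF lm] K3_def Pk_def split_conv)
    finally show "(NNINT y. ennreal (Pk mu 2 (z, y) * Pk lam 2 (y, w))) = ennreal (K3 (z, w))" .
  qed (auto simp: Pk_nonneg)
  moreover have "kop (Pk mu 2) (kop (Pk lam 2) g) = kop (Pk mu 2) (\<lambda>_. 0)"
    by (rule kop_cong_AE[OF Pk_measurable borel_lebesgue[OF kop_measurable[OF Pk_measurable Lp_measurable[OF g]]] zero])
  ultimately have 1: "AE z in lebesgue. kop K3 g z = 0" unfolding kop_zero by (auto elim!: eventually_mono)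
  have i1: "AE z in lebesgue. integrable lebesgue (\<lambda>w. Pk lam 2 (z, w) * g w)" by (rule kop_integrable[OF p Pk_bound[OF p _ lm(1)] g]) simp
  have i2: "AE z in lebesgue. integrable lebesgue (\<lambda>w. Pk mu 2 (z, w) * g w)" by (rule kop_integrable[OF p Pk_bound[OF p _ mu] g]) simp
  from 1 i1 i2 zero show ?thesis
  proof eventually_elim
    fix z assume a: "kop K3 g z = 0" "integrable lebesgue (\<lambda>w. Pk lam 2 (z, w) * g w)" "integrable lebesgue (\<lambda>w. Pk mu 2 (z, w) * g w)" "kop (Pk lam 2) g z = 0"
    have "kop K3 g z = (\<integral>w. (Pk lam 2 (z, w) * g w - Pk mu 2 (z, w) * g w) / (mu - lam) \<partial>lebesgue)"
      unfolding kop_def K3_def by (intro Bochner_Integration.integral_cong) (auto simp: left_diff_distrib)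
    also have "\<dots> = (kop (Pk lam 2) g z - kop (Pk mu 2) g z) / (mu - lam)"
      using a(2,3) by (simp add: kop_def)
    finally show "kop (Pk mu 2) g z = 0" using a(1,4) lm by simp
  qed
qed

text \<open>Outside a neighbourhood of the origin the kernel \<open>mu * pk mu 2\<close> has mass of order \<open>1/mu\<close>: large times are paid for by \<open>1 \<le> s/\<rho>\<close>, large \<open>\<bar>x\<bar>\<close> by half of the Gaussian, which is at most a multiple of \<open>s/\<rho>^2\<close>.\<close>

lemma resolvent_tail:
  assumes \<rho>: "0 < \<rho>"
  obtains C where "\<And>mu. 0 < mu \<Longrightarrow> (NNINT (z::real \<times> 'a::euclidean_space). ennreal (mu * pk mu 2 z) * indicator {z. \<rho> \<le> fst z \<or> \<rho> \<le> norm (snd z)} z) \<le> ennreal (C / mu)"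
proof -
  let ?d = "real DIM('a) / 2"
  define C where "C = 1 / \<rho> + 2 powr ?d * (8 / \<rho>\<^sup>2)"
  have C: "0 \<le> C" using \<rho> by (simp add: C_def)
  show ?thesis
  proof
    fix mu :: real assume mu: "0 < mu"
    let ?T = "{z::real \<times> 'a. \<rho> \<le> fst z \<or> \<rho> \<le> norm (snd z)}"
    let ?H = "\<lambda>s (y::'a). ennreal (mu * exp (- mu * s) * (s / \<rho>)) * ennreal (heat s y) + ennreal (mu * exp (- mu * s) * (2 powr ?d * (8 * s / \<rho>\<^sup>2))) * ennreal (heat (2 * s) y)"
    have pw: "ennreal (mu * pk mu 2 (s, y)) * indicator ?T (s, y) \<le> (if 0 < s then ?H s y else 0)" for s and y :: 'a
    proof (cases "0 < s \<and> (s, y) \<in> ?T")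
      case True
      then have s: "0 < s" by simp
      have "heat s y \<le> (s / \<rho>) * heat s y + (2 powr ?d * (8 * s / \<rho>\<^sup>2)) * heat (2 * s) y"
      proof (cases "\<rho> \<le> s")
        case True
        have "1 * heat s y \<le> (s / \<rho>) * heat s y" using True \<rho> by (intro mult_right_mono heat_nonneg) simp
        moreover have "0 \<le> (2 powr ?d * (8 * s / \<rho>\<^sup>2)) * heat (2 * s) y" using s by (intro mult_nonneg_nonneg heat_nonneg) auto
        ultimately show ?thesis by simp
      next
        case False
        then have r: "\<rho> \<le> norm y" using \<open>0 < s \<and> (s, y) \<in> ?T\<close> by simp
        have p2: "(4 * pi * (2 * s)) powr ?d = 2 powr ?d * (4 * pi * s) powr ?d"
        proof -
          have "4 * pi * (2 * s) = 2 * (4 * pi * s)" by simp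
          then show ?thesis using s by (simp only: powr_mult)
        qed
        have ex: "exp (- (norm y)\<^sup>2 / (4 * s)) = exp (- (norm y)\<^sup>2 / (8 * s)) * exp (- (norm y)\<^sup>2 / (4 * (2 * s)))"
          using s by (simp add: exp_add[symmetric] field_simps)
        have h: "heat s y = exp (- (norm y)\<^sup>2 / (8 * s)) * (2 powr ?d * heat (2 * s) y)"
          unfolding heat_def p2 ex by simp
        have "exp (- (norm y)\<^sup>2 / (8 * s)) \<le> 8 * s / \<rho>\<^sup>2"
        proof -
          define x where "x = \<rho>\<^sup>2 / (8 * s)"
          have x: "0 < x" using \<rho> s by (simp add: x_def)
          have "\<rho>\<^sup>2 \<le> (norm y)\<^sup>2" using r \<rho> by (intro power_mono) auto
          then have "x \<le> (norm y)\<^sup>2 / (8 * s)" using s unfolding x_def by (intro divide_right_mono) auto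
          then have "exp (- (norm y)\<^sup>2 / (8 * s)) \<le> exp (- x)" by simp
          also have "exp (- x) \<le> 1 / x"
          proof -
            have "x \<le> exp x" using exp_ge_add_one_self[of x] by linarith
            then show ?thesis using x by (simp add: exp_minus field_simps)
          qed
          also have "1 / x = 8 * s / \<rho>\<^sup>2" by (simp add: x_def)
          finally show ?thesis .
        qed
        then have "heat s y \<le> (8 * s / \<rho>\<^sup>2) * (2 powr ?d * heat (2 * s) y)"
          unfolding h by (intro mult_right_mono mult_nonneg_nonneg heat_nonneg) auto
        moreover have "0 \<le> (s / \<rho>) * heat s y" using s \<rho> by (intro mult_nonneg_nonneg heat_nonneg) auto
        ultimately show ?thesis by (simp add: mult_ac)
      qed
      then have "mu * exp (- mu * s) * heat s y \<le> mu * exp (- mu * s) * ((s / \<rho>) * heat s y + (2 powr ?d * (8 * s / \<rho>\<^sup>2)) * heat (2 * s) y)"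
        using mu by (intro mult_left_mono) auto
      then have "ennreal (mu * pk mu 2 (s, y)) \<le> ennreal (mu * exp (- mu * s) * (s / \<rho>) * heat s y + mu * exp (- mu * s) * (2 powr ?d * (8 * s / \<rho>\<^sup>2)) * heat (2 * s) y)"
        using s by (intro ennreal_leI) (simp add: pk_two algebra_simps)
      also have "\<dots> = ?H s y"
      proof -
        have "0 \<le> mu * exp (- mu * s) * (s / \<rho>)" "0 \<le> mu * exp (- mu * s) * (2 powr ?d * (8 * s / \<rho>\<^sup>2))"
          using mu s \<rho> by auto
        then show ?thesis by (simp only: ennreal_plus ennreal_mult heat_nonneg mult_nonneg_nonneg)
      qed
      finally show ?thesis using True by simp
    next
      case False
      then show ?thesis by (cases "0 < s") (auto simp: pk_def)
    qed
    have "(NNINT z. ennreal (mu * pk mu 2 z) * indicator ?T z) = (NNINT s. NNINT y. ennreal (mu * pk mu 2 (s, y)) * indicator ?T (s, y))"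
    proof (rule nn_integral_spacetime)
      have "closed ?T"
      proof -
        have "?T = {z. \<rho> \<le> fst z} \<union> {z. \<rho> \<le> norm (snd z)}" by auto
        then show ?thesis by (auto intro!: closed_Un closed_Collect_le continuous_intros)
      qed
      then have [measurable]: "?T \<in> sets borel" by simp
      show "(\<lambda>z. ennreal (mu * pk mu 2 z) * indicator ?T z) \<in> borel_measurable borel" by measurable
    qed
    also have "\<dots> \<le> (NNINT s. NNINT y. (if 0 < s then ?H s y else 0))"
      by (intro nn_integral_mono pw)
    also have "\<dots> = (NNINT s. ennreal (mu * C) * ennreal (if 0 < s then exp (- mu * s) * s powr (2 - 1) else 0))"
    proof (intro nn_integral_cong)
      fix s :: real
      show "(NNINT y. (if 0 < s then ?H s y else 0)) = ennreal (mu * C) * ennreal (if 0 < s then exp (- mu * s) * s powr (2 - 1) else 0)"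
      proof (cases "0 < s")
        case True
        have "(NNINT y. (if 0 < s then ?H s y else 0)) = (NNINT y. ?H s y)" using True by simp
        also have "\<dots> = (NNINT y. ennreal (mu * exp (- mu * s) * (s / \<rho>)) * ennreal (heat s (y::'a))) + (NNINT y. ennreal (mu * exp (- mu * s) * (2 powr ?d * (8 * s / \<rho>\<^sup>2))) * ennreal (heat (2 * s) (y::'a)))"
          by (rule nn_integral_add) measurable
        also have "\<dots> = ennreal (mu * exp (- mu * s) * (s / \<rho>)) + ennreal (mu * exp (- mu * s) * (2 powr ?d * (8 * s / \<rho>\<^sup>2)))"
          using True by (simp add: nn_integral_cmult heat_mass)
        also have "\<dots> = ennreal (mu * exp (- mu * s) * (s / \<rho>) + mu * exp (- mu * s) * (2 powr ?d * (8 * s / \<rho>\<^sup>2)))"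
          using mu True \<rho> by (intro ennreal_plus[symmetric]) auto
        also have "mu * exp (- mu * s) * (s / \<rho>) + mu * exp (- mu * s) * (2 powr ?d * (8 * s / \<rho>\<^sup>2)) = mu * C * (exp (- mu * s) * s)"
          by (simp add: C_def algebra_simps)
        also have "ennreal (mu * C * (exp (- mu * s) * s)) = ennreal (mu * C) * ennreal (exp (- mu * s) * s)"
          using mu C True by (intro ennreal_mult) auto
        finally show ?thesis using True by simp
      qed simp
    qed
    also have "\<dots> = ennreal (mu * C) * (NNINT s. ennreal (if 0 < s then exp (- mu * s) * s powr (2 - 1) else 0))"
      by (rule nn_integral_cmult) measurable
    also have "(NNINT s. ennreal (if 0 < s then exp (- mu * s) * s powr (2 - 1) else 0)) = ennreal (Gamma 2 * mu powr (- 2))"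
      using nn_integral_Gamma[of 2 mu] mu by simp
    also have "ennreal (mu * C) * ennreal (Gamma 2 * mu powr (- 2)) = ennreal (mu * C * (Gamma 2 * mu powr (- 2)))"
      using mu C by (intro ennreal_mult'[symmetric]) auto
    also have "mu * C * (Gamma 2 * mu powr (- 2)) = C / mu"
    proof -
      have "Gamma (2::real) = 1" using Gamma_fact[of 1, where 'a=real] by (simp add: numeral_2_eq_2)
      moreover have "mu powr (- 2) = 1 / mu\<^sup>2" using mu by (simp add: powr_minus_divide)
      ultimately show ?thesis using mu by (simp add: power2_eq_square)
    qed
    finally show "(NNINT z. ennreal (mu * pk mu 2 z) * indicator ?T z) \<le> ennreal (C / mu)" .
  qed
qed

lemma resolvent_mass:
  assumes "0 < lam"
  shows "(NNINT (z::real \<times> 'a::euclidean_space). ennreal (lam * pk lam 2 z)) = 1"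
proof -
  have "(NNINT (z::real \<times> 'a). ennreal (lam * pk lam 2 z)) = (NNINT (z::real \<times> 'a). ennreal lam * ennreal (pk lam 2 z))"
    using assms by (intro nn_integral_cong ennreal_mult') simp
  also have "\<dots> = ennreal lam * ennreal (lam powr (- 2 / 2))"
    using assms by (subst nn_integral_cmult, measurable, subst pk_mass) auto
  also have "\<dots> = 1" using assms by (subst ennreal_mult'[symmetric]) (auto simp: powr_minus_divide)
  finally show ?thesis .
qed

text \<open>The kernels \<open>mu * pk mu 2\<close> are probability densities that concentrate at the origin, and away from the frontier the indicator is locally constant.\<close>

lemma resolvent_box_tendsto:
  fixes a b w :: "real \<times> 'a::euclidean_space"
  assumes w: "w \<notin> frontier (box a b)"
  shows "(\<lambda>n. LBINT z. real (Suc n) * pk (real (Suc n)) 2 (z - w) * indicator (box a b) z) \<longlonglongrightarrow> indicator (box a b) w"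
proof -
  let ?\<psi> = "indicator (box a b) :: real \<times> 'a \<Rightarrow> real"
  define k where "k n z = real (Suc n) * pk (real (Suc n)) 2 z" for n and z :: "real \<times> 'a"
  have [measurable]: "k n \<in> borel_measurable borel" for n unfolding k_def by measurable
  have k0: "0 \<le> k n z" for n z unfolding k_def by (intro mult_nonneg_nonneg pk_nonneg) auto
  have km: "(NNINT z. ennreal (k n z)) = 1" for n unfolding k_def by (rule resolvent_mass) simp
  have kmw: "(NNINT z. ennreal (k n (z - w))) = 1" for n
    using nn_integral_lborel_translate[of "\<lambda>z. ennreal (k n z)" "- w"] km by simp
  have ki: "integrable lborel (\<lambda>z. k n (z - w))" for n
    using kmw[of n] k0 by (simp add: integrable_iff_bounded)
  have ki1: "(LBINT z. k n (z - w)) = 1" for n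
    using kmw[of n] k0 by (simp add: integral_eq_nn_integral)
  obtain e where e: "0 < e" "\<And>z. dist w z < e \<Longrightarrow> ?\<psi> z = ?\<psi> w"
  proof (cases "w \<in> box a b")
    case True
    then obtain e where "0 < e" "ball w e \<subseteq> box a b" using open_box open_contains_ball by blast
    with True show thesis by (intro that[of e]) (auto simp: indicator_def)
  next
    case False
    then have "w \<in> - closure (box a b)" using w interior_open[OF open_box, of a b] unfolding frontier_def by blast
    then obtain e where "0 < e" "ball w e \<subseteq> - closure (box a b)" using open_contains_ball[of "- closure (box a b)"] by blast
    then show thesis using False closure_subset[of "box a b"] by (intro that[of e]) (auto simp: indicator_def)
  qed
  define \<rho> where "\<rho> = e / 2"
  have \<rho>: "0 < \<rho>" using e by (simp add: \<rho>_def)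
  let ?T = "{z::real \<times> 'a. \<rho> \<le> fst z \<or> \<rho> \<le> norm (snd z)}"
  obtain C where C: "\<And>mu. 0 < mu \<Longrightarrow> (NNINT (z::real \<times> 'a). ennreal (mu * pk mu 2 z) * indicator ?T z) \<le> ennreal (C / mu)"
    using resolvent_tail[OF \<rho>, where 'a='a] by blast
  have bound: "\<bar>(LBINT z. k n (z - w) * ?\<psi> z) - ?\<psi> w\<bar> \<le> max C 0 / real (Suc n)" for n
  proof -
    have i2: "integrable lborel (\<lambda>z. k n (z - w) * ?\<psi> z)"
      by (rule Bochner_Integration.integrable_bound[OF ki[of n]]) (auto intro!: AE_I2 simp: k0 split: split_indicator)
    have "(LBINT z. k n (z - w) * ?\<psi> z) - ?\<psi> w = (LBINT z. k n (z - w) * ?\<psi> z) - (LBINT z. k n (z - w) * ?\<psi> w)"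
      using ki1[of n] by simp
    also have "\<dots> = (LBINT z. k n (z - w) * ?\<psi> z - k n (z - w) * ?\<psi> w)"
      using i2 ki[of n] by (intro Bochner_Integration.integral_diff[symmetric]) auto
    finally have eq: "(LBINT z. k n (z - w) * ?\<psi> z) - ?\<psi> w = (LBINT z. k n (z - w) * ?\<psi> z - k n (z - w) * ?\<psi> w)" .
    have "ennreal \<bar>(LBINT z. k n (z - w) * ?\<psi> z) - ?\<psi> w\<bar> \<le> (NNINT z. ennreal \<bar>k n (z - w) * ?\<psi> z - k n (z - w) * ?\<psi> w\<bar>)"
      unfolding eq using i2 ki[of n] integral_norm_bound_ennreal[of lborel "\<lambda>z. k n (z - w) * ?\<psi> z - k n (z - w) * ?\<psi> w"] by simp
    also have "\<dots> \<le> (NNINT z. ennreal (k n (- w + z)) * indicator ?T (- w + z))"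
    proof (intro nn_integral_mono)
      fix z
      show "ennreal \<bar>k n (z - w) * ?\<psi> z - k n (z - w) * ?\<psi> w\<bar> \<le> ennreal (k n (- w + z)) * indicator ?T (- w + z)"
      proof (cases "fst (z - w) \<le> 0 \<or> ?\<psi> z = ?\<psi> w")
        case True
        then show ?thesis by (auto simp: k_def pk_def)
      next
        case False
        have "- w + z \<in> ?T"
        proof (rule ccontr)
          assume "- w + z \<notin> ?T"
          then have "\<bar>fst (z - w)\<bar> < \<rho>" "norm (snd (z - w)) < \<rho>" using False by auto
          then have "norm (z - w) < e" 
            using sqrt_sum_squares_le_sum_abs[of "norm (fst (z - w))" "norm (snd (z - w))"] by (simp add: \<rho>_def norm_prod_def)
          then have "?\<psi> z = ?\<psi> w" by (intro e(2)) (simp add: dist_norm norm_minus_commute)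
          with False show False by simp
        qed
        moreover have "\<bar>k n (z - w) * ?\<psi> z - k n (z - w) * ?\<psi> w\<bar> \<le> k n (z - w)"
          using k0[of n "z - w"] by (auto split: split_indicator)
        ultimately show ?thesis by (auto intro: ennreal_leI)
      qed
    qed
    also have "\<dots> = (NNINT z. ennreal (k n z) * indicator ?T z)"
    proof (rule nn_integral_lborel_translate)
      have "?T = {z. \<rho> \<le> fst z} \<union> {z. \<rho> \<le> norm (snd z)}" by auto
      then have "closed ?T" by (auto intro!: closed_Un closed_Collect_le continuous_intros)
      then have [measurable]: "?T \<in> sets borel" by simp
      show "(\<lambda>z. ennreal (k n z) * indicator ?T z) \<in> borel_measurable borel" by measurable
    qed
    also have "\<dots> \<le> ennreal (C / real (Suc n))" unfolding k_def by (rule C) simp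
    also have "\<dots> \<le> ennreal (max C 0 / real (Suc n))" by (intro ennreal_leI divide_right_mono) auto
    finally show ?thesis by (subst (asm) ennreal_le_iff) auto
  qed
  have "(\<lambda>n. max C 0 * inverse (real (Suc n))) \<longlonglongrightarrow> max C 0 * 0"
    by (intro tendsto_intros LIMSEQ_inverse_real_of_nat)
  then have lim: "(\<lambda>n. max C 0 / real (Suc n)) \<longlonglongrightarrow> 0" by (simp add: divide_inverse)
  have "(\<lambda>n. (LBINT z. k n (z - w) * ?\<psi> z) - ?\<psi> w) \<longlonglongrightarrow> 0"
    by (rule Lim_null_comparison[OF _ lim]) (use bound in auto)
  then have "(\<lambda>n. LBINT z. k n (z - w) * ?\<psi> z) \<longlonglongrightarrow> ?\<psi> w" by (simp add: LIM_zero_iff)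
  then show ?thesis by (simp only: k_def)
qed

text \<open>If the potential of \<open>g\<close> vanishes at one \<open>lam\<close>, it vanishes at all larger \<open>mu\<close>. By duality \<open>g\<close> is then orthogonal to the functions \<open>B n\<close>, which converge to the indicator of a box in \<open>L^1\<close> by Scheffe's lemma and, being bounded by one, also in the dual space of \<open>L^p\<close>.\<close>

lemma resolvent_inj:
  fixes g :: "real \<times> 'a::euclidean_space \<Rightarrow> real"
  assumes p: "1 < p" and lam: "0 < lam" and g: "g \<in> Lp p" and zero: "AE z in lebesgue. kop (Pk lam 2) g z = 0"
  shows "AE z in lebesgue. g z = 0"
proof (rule AE_zero_if_integrals_over_boxes_zero)
  fix a b :: "real \<times> 'a"
  let ?\<psi> = "indicator (box a b) :: real \<times> 'a \<Rightarrow> real"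
  have p0: "0 < p" using p by simp
  define p' where "p' = p / (p - 1)"
  have pp: "1 / p + 1 / p' = 1" using p by (simp add: p'_def field_simps)
  have p': "1 < p'" by (rule conjugate_exponents(1)[OF p pp])
  have "set_integrable lebesgue (cbox a b) g" using Lp_locally_integrable[OF p g] by (simp add: locally_integrable_def)
  then show si: "set_integrable lebesgue (box a b) g"
    by (rule set_integrable_subset) (auto intro: box_subset_cbox[THEN subsetD])
  obtain g' where g'[measurable]: "g' \<in> borel_measurable borel" and ae: "AE z in lebesgue. g z = g' z"
    using lebesgue_ex_borel[OF Lp_measurable[OF g]] by blast
  define k where "k n z = real (Suc n) * pk (real (Suc n)) 2 z" for n and z :: "real \<times> 'a"
  have [measurable]: "k n \<in> borel_measurable borel" for n unfolding k_def by measurable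
  have k0: "0 \<le> k n z" for n z unfolding k_def by (intro mult_nonneg_nonneg pk_nonneg) auto
  have km: "(NNINT z. ennreal (k n z)) = 1" for n unfolding k_def by (rule resolvent_mass) simp
  have kmr: "(NNINT w. ennreal (k n (z - w))) = 1" for n z
    using nn_integral_lborel_reflect[of "\<lambda>w. ennreal (k n w)" z] km by simp
  have kmt: "(NNINT z. ennreal (k n (z - w))) = 1" for n w
    using nn_integral_lborel_translate[of "\<lambda>z. ennreal (k n z)" "- w"] km by simp
  define B where "B n w = (LBINT z. k n (z - w) * ?\<psi> z)" for n w
  have [measurable]: "B n \<in> borel_measurable borel" for n unfolding B_def by measurable
  have Bnn: "ennreal (B n w) = (NNINT z. ennreal (k n (z - w) * ?\<psi> z))" for n w
  proof -
    have "integrable lborel (\<lambda>z. k n (z - w))" using kmt[of n w] k0 by (simp add: integrable_iff_bounded)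
    then have "integrable lborel (\<lambda>z. k n (z - w) * ?\<psi> z)"
      by (rule Bochner_Integration.integrable_bound) (auto intro!: AE_I2 simp: k0 split: split_indicator)
    then show ?thesis unfolding B_def using k0 by (intro nn_integral_eq_integral[symmetric]) auto
  qed
  have B0: "0 \<le> B n w" for n w unfolding B_def using k0 by (intro integral_nonneg_AE) auto
  have B1: "B n w \<le> 1" for n w
  proof -
    have "ennreal (B n w) \<le> (NNINT z. ennreal (k n (z - w)))"
      unfolding Bnn using k0 by (intro nn_integral_mono ennreal_leI) (auto split: split_indicator)
    then have "ennreal (B n w) \<le> ennreal 1" unfolding kmt by simp
    then show ?thesis by (subst (asm) ennreal_le_iff) auto
  qed
  have \<psi>i: "integrable lborel ?\<psi>"
    using emeasure_bounded_finite[OF bounded_box, of a b] by (intro integrable_real_indicator) auto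
  have "(NNINT w. ennreal (norm (B n w))) \<le> (NNINT w. ennreal (norm (?\<psi> w)))" for n
  proof -
    have "(NNINT w. ennreal (norm (B n w))) = (NNINT w. (NNINT z. ennreal (k n (z - w)) * ennreal (?\<psi> z)))"
      using B0 k0 by (simp add: Bnn ennreal_mult)
    also have "\<dots> = (NNINT z. (NNINT w. ennreal (k n (z - w)) * ennreal (?\<psi> z)))"
      by (rule lborel_pair.Fubini') measurable
    also have "\<dots> = (NNINT z. ennreal (?\<psi> z))"
      by (intro nn_integral_cong) (simp add: nn_integral_multc kmr)
    finally show ?thesis by simp
  qed
  moreover have "AE w in lborel. (\<lambda>n. B n w) \<longlonglongrightarrow> ?\<psi> w"
  proof -
    have "frontier (box a b) \<in> null_sets lborel"
      by (simp add: null_sets_completion_iff[symmetric] negligible_iff_null_sets[symmetric] negligible_convex_frontier)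
    then have "AE w in lborel. w \<notin> frontier (box a b)" by (rule AE_not_in)
    then show ?thesis
      by eventually_elim (use resolvent_box_tendsto in \<open>simp only: B_def k_def\<close>)
  qed
  ultimately have L1: "(\<lambda>n. NNINT w. ennreal (norm (B n w - ?\<psi> w))) \<longlonglongrightarrow> 0"
    using \<psi>i by (intro Scheffe_lemma2) auto
  have AEk: "AE z in lebesgue. kop (Pk (real (Suc n)) 2) g z = 0" if "lam < real (Suc n)" for n
    by (rule resolvent_kernel_zero[OF p lam that g zero])
  have gB: "(LBINT w. g' w * B n w) = 0" if n: "lam < real (Suc n)" for n
  proof -
    obtain R where R: "\<And>z. z \<in> box a b \<Longrightarrow> norm z \<le> R" using bounded_box[of a b] by (auto simp: bounded_iff)
    have "(\<integral>z. kop (Pk (real (Suc n)) 2) g z * ?\<psi> z \<partial>lebesgue) = (LBINT w. g' w * (LBINT z. Pk (real (Suc n)) 2 (z, w) * ?\<psi> z))"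
    proof (rule kop_Fubini[OF p Pk_bound[OF p] g g' ae, where B = 1 and R = R])
      fix z :: "real \<times> 'a"
      show "?\<psi> z = 0" if "R < norm z" using R[of z] that by (cases "z \<in> box a b") simp_all
      show "\<bar>?\<psi> z\<bar> \<le> 1" by (cases "z \<in> box a b") simp_all
    qed auto
    moreover have "(\<integral>z. kop (Pk (real (Suc n)) 2) g z * ?\<psi> z \<partial>lebesgue) = 0"
      using AEk[OF n] by (intro integral_eq_zero_AE) (auto elim!: eventually_mono)
    moreover have "B n w = real (Suc n) * (LBINT z. Pk (real (Suc n)) 2 (z, w) * ?\<psi> z)" for w
      unfolding B_def k_def Pk_def by (simp add: mult.assoc del: of_nat_Suc)
    moreover have "(LBINT w. g' w * (c * I w)) = c * (LBINT w. g' w * I w)" for c and I :: "real \<times> 'a \<Rightarrow> real"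
      by (simp only: mult.left_commute integral_mult_right_zero)
    ultimately show ?thesis by (simp only: mult_zero_right)
  qed
  let ?N = "epowr (NNINT w. epowr (ennreal \<bar>g' w\<bar>) p) (1 / p)"
  have Nf: "?N < top" unfolding nn_integral_Lp_borel[OF p0 g g' ae] by (simp add: epowr_ennreal)
  have diff: "(NNINT w. ennreal \<bar>g' w\<bar> * ennreal \<bar>B n w - ?\<psi> w\<bar>) \<le> ?N * epowr (NNINT w. ennreal (norm (B n w - ?\<psi> w))) (1 / p')" for n
  proof -
    have "(NNINT w. ennreal \<bar>g' w\<bar> * ennreal \<bar>B n w - ?\<psi> w\<bar>) \<le> ?N * epowr (NNINT w. epowr (ennreal \<bar>B n w - ?\<psi> w\<bar>) p') (1 / p')"
      by (rule Hoelder_nn_integral[OF p pp]) measurable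
    also have "\<dots> \<le> ?N * epowr (NNINT w. ennreal (norm (B n w - ?\<psi> w))) (1 / p')"
    proof (intro mult_left_mono epowr_mono nn_integral_mono)
      fix w
      have x: "\<bar>B n w - ?\<psi> w\<bar> \<le> 1" using B0[of n w] B1[of n w] by (auto split: split_indicator)
      have "\<bar>B n w - ?\<psi> w\<bar> powr p' \<le> \<bar>B n w - ?\<psi> w\<bar> powr 1" using p' x by (intro powr_mono') auto
      then show "epowr (ennreal \<bar>B n w - ?\<psi> w\<bar>) p' \<le> ennreal (norm (B n w - ?\<psi> w))"
        by (simp add: epowr_ennreal ennreal_leI)
    qed (use p' in auto)
    finally show ?thesis .
  qed
  have lim0: "(\<lambda>n. ?N * epowr (NNINT w. ennreal (norm (B n w - ?\<psi> w))) (1 / p')) \<longlonglongrightarrow> 0"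
  proof -
    let ?x = "\<lambda>n. NNINT w. ennreal (norm (B n w - ?\<psi> w))"
    have ev: "eventually (\<lambda>n. ?x n < 1) sequentially" using L1 by (rule order_tendstoD) simp
    have "(\<lambda>n. enn2real (?x n)) \<longlonglongrightarrow> 0" using L1 by (intro tendsto_enn2real) auto
    then have "(\<lambda>n. enn2real (?x n) powr (1 / p')) \<longlonglongrightarrow> 0"
      using p' by (intro tendsto_zero_powrI[where b = "1 / p'"]) auto
    then have "(\<lambda>n. ennreal (enn2real (?x n) powr (1 / p'))) \<longlonglongrightarrow> ennreal 0" by (rule tendsto_ennrealI)
    then have "(\<lambda>n. epowr (?x n) (1 / p')) \<longlonglongrightarrow> 0"
      unfolding ennreal_0
    proof (rule Lim_transform_eventually)
      show "\<forall>\<^sub>F n in sequentially. ennreal (enn2real (?x n) powr (1 / p')) = epowr (?x n) (1 / p')"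
        using ev by eventually_elim (auto simp: epowr_def)
    qed
    then have "(\<lambda>n. ?N * epowr (?x n) (1 / p')) \<longlonglongrightarrow> ?N * 0"
      using Nf by (intro ennreal_tendsto_cmult) auto
    then show ?thesis by simp
  qed
  have gi: "integrable lborel (\<lambda>w. g' w * ?\<psi> w)"
  proof -
    have "integrable lebesgue (\<lambda>w. indicator (box a b) w * g w)" using si by (simp add: set_integrable_def)
    moreover have "(\<lambda>w. g' w * ?\<psi> w) \<in> borel_measurable lebesgue" by (rule borel_lebesgue) measurable
    moreover have "AE w in lebesgue. indicator (box a b) w * g w = g' w * ?\<psi> w" using ae by eventually_elim (simp add: mult.commute)
    ultimately have "integrable lebesgue (\<lambda>w. g' w * ?\<psi> w)" by (rule integrable_cong_AE_imp)
    then show ?thesis by (simp add: integrable_completion)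
  qed
  have "ennreal \<bar>\<integral>w. g' w * ?\<psi> w \<partial>lborel\<bar> \<le> 0"
  proof (rule tendsto_lowerbound[OF lim0])
    show "\<forall>\<^sub>F n in sequentially. ennreal \<bar>\<integral>w. g' w * ?\<psi> w \<partial>lborel\<bar> \<le> ?N * epowr (NNINT w. ennreal (norm (B n w - ?\<psi> w))) (1 / p')"
    proof -
      obtain n0 where n0: "lam < real n0" using reals_Archimedean2 by blast
      have evN: "\<forall>\<^sub>F n in sequentially. ?N * epowr (NNINT w. ennreal (norm (B n w - ?\<psi> w))) (1 / p') < 1"
        using lim0 by (rule order_tendstoD) simp
      have evn: "\<forall>\<^sub>F n in sequentially. n0 \<le> n" by (rule eventually_ge_at_top)
      from evN evn show ?thesis
      proof eventually_elim
        fix n assume fin: "?N * epowr (NNINT w. ennreal (norm (B n w - ?\<psi> w))) (1 / p') < 1" and n: "n0 \<le> n"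
        have nl: "lam < real (Suc n)" using n0 n by simp
        have "(NNINT w. ennreal \<bar>g' w\<bar> * ennreal \<bar>B n w - ?\<psi> w\<bar>) < 1"
          using diff[of n] fin by (rule le_less_trans)
        then have "(NNINT w. ennreal \<bar>g' w\<bar> * ennreal \<bar>B n w - ?\<psi> w\<bar>) < \<infinity>"
          by (rule less_trans) simp
        then have di: "integrable lborel (\<lambda>w. g' w * (B n w - ?\<psi> w))"
          by (simp add: integrable_iff_bounded abs_mult ennreal_mult)
        have "integrable lborel (\<lambda>w. g' w * (B n w - ?\<psi> w) + g' w * ?\<psi> w)" using di gi by (rule Bochner_Integration.integrable_add)
        then have "(LBINT w. g' w * (B n w - ?\<psi> w)) = (LBINT w. g' w * B n w) - (LBINT w. g' w * ?\<psi> w)"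
          using gi by (subst Bochner_Integration.integral_diff[symmetric]) (auto simp: algebra_simps)
        then have "\<bar>\<integral>w. g' w * ?\<psi> w \<partial>lborel\<bar> = \<bar>\<integral>w. g' w * (B n w - ?\<psi> w) \<partial>lborel\<bar>" using gB[OF nl] by simp
        then have "ennreal \<bar>\<integral>w. g' w * ?\<psi> w \<partial>lborel\<bar> \<le> (NNINT w. ennreal \<bar>g' w * (B n w - ?\<psi> w)\<bar>)"
          using integral_norm_bound_ennreal[OF di] by simp
        also have "\<dots> = (NNINT w. ennreal \<bar>g' w\<bar> * ennreal \<bar>B n w - ?\<psi> w\<bar>)"
          by (intro nn_integral_cong) (simp add: abs_mult ennreal_mult)
        also note diff[of n]
        finally show "ennreal \<bar>\<integral>w. g' w * ?\<psi> w \<partial>lborel\<bar> \<le> ?N * epowr (NNINT w. ennreal (norm (B n w - ?\<psi> w))) (1 / p')" .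
      qed
    qed
  qed simp
  then have z: "(LBINT w. g' w * ?\<psi> w) = 0" by (simp add: ennreal_eq_0_iff[symmetric])
  have "(LINT w:box a b|lebesgue. g w) = (\<integral>w. g' w * ?\<psi> w \<partial>lebesgue)"
    unfolding set_lebesgue_integral_def
  proof (rule integral_cong_AE)
    show "(\<lambda>w. indicator (box a b) w *\<^sub>R g w) \<in> borel_measurable lebesgue" using si by (auto simp: set_integrable_def)
    show "(\<lambda>w. g' w * ?\<psi> w) \<in> borel_measurable lebesgue" by (rule borel_lebesgue) measurable
    show "AE w in lebesgue. indicator (box a b) w *\<^sub>R g w = g' w * ?\<psi> w" using ae by eventually_elim simp
  qed
  also have "\<dots> = (LBINT w. g' w * ?\<psi> w)" by (rule integral_completion) measurable
  finally show "(LINT w:box a b|lebesgue. g w) = 0" using z by simp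
qed

text \<open>The semigroup property reduces every order below 2 to the resolvent.\<close>

theorem par_potential_inj:
  fixes g :: "real \<times> 'a::euclidean_space \<Rightarrow> real"
  assumes p: "1 < p" and lam: "0 < lam" and \<alpha>: "0 < \<alpha>" "\<alpha> \<le> 2" and g: "g \<in> Lp p" "g' \<in> Lp p"
    and eq: "AE z in lebesgue. par_potential lam \<alpha> g z = par_potential lam \<alpha> g' z"
  shows "AE z in lebesgue. g z = g' z"
proof -
  let ?h = "\<lambda>z. g z - g' z"
  have h: "?h \<in> Lp p" by (rule Lp_diff(1)[OF p g])
  have "AE z in lebesgue. kop (Pk lam \<alpha>) ?h z = kop (Pk lam \<alpha>) g z - kop (Pk lam \<alpha>) g' z"
    by (rule Lp_bounded_op_diff[OF p kop_bounded_op[OF p Pk_bound[OF p \<alpha>(1) lam]] g])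
  with eq have z: "AE z in lebesgue. kop (Pk lam \<alpha>) ?h z = 0" unfolding par_potential_kop by eventually_elim simp
  have "AE z in lebesgue. kop (Pk lam 2) ?h z = 0"
  proof (cases "\<alpha> = 2")
    case True then show ?thesis using z by simp
  next
    case False
    then have a: "0 < 2 - \<alpha>" using \<alpha> by simp
    have "AE z in lebesgue. kop (Pk lam (2 - \<alpha>)) (kop (Pk lam \<alpha>) ?h) z = kop (Pk lam (2 - \<alpha> + \<alpha>)) ?h z"
      using par_potential_semigroup[OF p a \<alpha>(1) lam h] unfolding par_potential_kop .
    moreover have "kop (Pk lam (2 - \<alpha>)) (kop (Pk lam \<alpha>) ?h) = kop (Pk lam (2 - \<alpha>)) (\<lambda>_. 0)"
      by (rule kop_cong_AE[OF Pk_measurable borel_lebesgue[OF kop_measurable[OF Pk_measurable Lp_measurable[OF h]]] z])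
    ultimately show ?thesis unfolding kop_zero by (auto elim!: eventually_mono)
  qed
  from resolvent_inj[OF p lam h this] show ?thesis by eventually_elim simp
qed

section \<open>Continuity of potentials of large order\<close>

text \<open>The power of the kernel is again dominated by a kernel of the same type, of order \<open>D - (D - \<alpha>) s\<close> with \<open>D = d + 2\<close>; the hypothesis says that this order is positive.\<close>

lemma pk_powr_mass:
  fixes \<alpha> s lam :: real
  assumes \<alpha>: "0 < \<alpha>" and lam: "0 < lam" and s: "1 < s" and D: "(real (DIM('a::euclidean_space) + 2) - \<alpha>) * s < real (DIM('a) + 2)"
  shows "\<exists>N\<ge>0. (NNINT (z::real \<times> 'a). epowr (ennreal (pk lam \<alpha> z)) s) \<le> ennreal N"
proof -
  define \<beta> where "\<beta> = real (DIM('a) + 2) - (real (DIM('a) + 2) - \<alpha>) * s"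
  have \<beta>: "0 < \<beta>" using D by (simp add: \<beta>_def)
  let ?c = "pk_const TYPE('a) \<alpha>"
  have c: "0 < ?c" using \<alpha> by (rule pk_const_pos)
  define G where "G = Gamma (\<beta> / 2) * (8 * pi) powr (real DIM('a) / 2) * lam powr (- \<beta> / 2)"
  have G: "0 \<le> G" using \<beta> unfolding G_def by (intro mult_nonneg_nonneg less_imp_le[OF Gamma_real_pos]) auto
  have gs: "gk lam \<alpha> z powr s \<le> gk lam \<beta> z" for z :: "real \<times> 'a"
  proof (cases "0 < fst z")
    case True
    have e1: "exp (- lam * fst z) powr s \<le> exp (- lam * fst z)"
      using True lam s by (simp add: powr_def)
    have e2: "exp (- (norm (snd z))\<^sup>2 / (8 * fst z)) powr s \<le> exp (- (norm (snd z))\<^sup>2 / (8 * fst z))"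
    proof -
      have "0 \<le> (norm (snd z))\<^sup>2 / (8 * fst z)" using True by simp
      then have "1 * ((norm (snd z))\<^sup>2 / (8 * fst z)) \<le> s * ((norm (snd z))\<^sup>2 / (8 * fst z))" using s by (intro mult_right_mono) auto
      then show ?thesis by (simp add: powr_def)
    qed
    have e3: "(fst z powr ((\<alpha> - real (DIM('a) + 2)) / 2)) powr s = fst z powr ((\<beta> - real (DIM('a) + 2)) / 2)"
      unfolding powr_powr \<beta>_def by (rule arg_cong[where f = "(powr) (fst z)"]) (simp add: algebra_simps)
    have "gk lam \<alpha> z powr s = exp (- lam * fst z) powr s * (fst z powr ((\<alpha> - real (DIM('a) + 2)) / 2)) powr s * exp (- (norm (snd z))\<^sup>2 / (8 * fst z)) powr s"
      using True unfolding gk_def by (simp only: if_True powr_mult)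
    also have "\<dots> \<le> exp (- lam * fst z) * (fst z powr ((\<alpha> - real (DIM('a) + 2)) / 2)) powr s * exp (- (norm (snd z))\<^sup>2 / (8 * fst z))"
      by (intro mult_mono e1 e2 order_refl mult_nonneg_nonneg) auto
    also have "\<dots> = gk lam \<beta> z" using True unfolding gk_def e3 by simp
    finally show ?thesis .
  qed (simp add: gk_def)
  have "(NNINT (z::real \<times> 'a). epowr (ennreal (pk lam \<alpha> z)) s) \<le> (NNINT (z::real \<times> 'a). ennreal (?c powr s) * ennreal (gk lam \<beta> z))"
  proof (rule nn_integral_mono)
    fix z :: "real \<times> 'a"
    have "pk lam \<alpha> z powr s \<le> (?c * gk lam \<alpha> z) powr s"
      using s \<alpha> by (intro powr_mono2 pk_nonneg pk_le_gk) auto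
    also have "\<dots> \<le> ?c powr s * gk lam \<beta> z"
      using gs[of z] c gk_nonneg[of lam \<alpha> z] by (simp add: powr_mult)
    finally have "ennreal (pk lam \<alpha> z powr s) \<le> ennreal (?c powr s * gk lam \<beta> z)" by (rule ennreal_leI)
    then show "epowr (ennreal (pk lam \<alpha> z)) s \<le> ennreal (?c powr s) * ennreal (gk lam \<beta> z)"
      using \<alpha> by (simp add: epowr_ennreal pk_nonneg ennreal_mult')
  qed
  also have "\<dots> = ennreal (?c powr s) * ennreal G"
    unfolding G_def gk_mass[OF \<beta> lam, symmetric, where 'a = 'a] by (rule nn_integral_cmult) measurable
  also have "\<dots> = ennreal (?c powr s * G)" using G by (simp add: ennreal_mult')
  finally show ?thesis using G by (intro exI[of _ "?c powr s * G"]) auto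
qed

lemma Hoelder_Lp:
  fixes h :: "'b::euclidean_space \<Rightarrow> real"
  assumes p: "1 < p" and ps: "1 / p + 1 / s = 1" and F[measurable]: "F \<in> borel_measurable borel" and h: "h \<in> Lp p"
    and N: "0 \<le> N" "(NNINT w. epowr (ennreal \<bar>F w\<bar>) s) \<le> ennreal N"
  shows "integrable lebesgue (\<lambda>w. F w * h w)" "\<bar>\<integral>w. F w * h w \<partial>lebesgue\<bar> \<le> N powr (1 / s) * Lp_norm p h"
proof -
  have p0: "0 < p" and s: "1 < s" using p conjugate_exponents(1)[OF p ps] by auto
  obtain h' where h'[measurable]: "h' \<in> borel_measurable borel" and ae: "AE z in lebesgue. h z = h' z"
    using lebesgue_ex_borel[OF Lp_measurable[OF h]] by blast
  have "(NNINT w. ennreal \<bar>h' w\<bar> * ennreal \<bar>F w\<bar>) \<le> epowr (NNINT w. epowr (ennreal \<bar>h' w\<bar>) p) (1 / p) * epowr (NNINT w. epowr (ennreal \<bar>F w\<bar>) s) (1 / s)"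
    by (rule Hoelder_nn_integral[OF p ps]) measurable
  also have "\<dots> \<le> ennreal (Lp_norm p h) * ennreal (N powr (1 / s))"
  proof (rule mult_mono)
    show "epowr (NNINT w. epowr (ennreal \<bar>h' w\<bar>) p) (1 / p) \<le> ennreal (Lp_norm p h)"
      unfolding nn_integral_Lp_borel[OF p0 h h' ae] using p Lp_norm_nonneg[of p h] by (simp add: epowr_ennreal powr_powr)
    show "epowr (NNINT w. epowr (ennreal \<bar>F w\<bar>) s) (1 / s) \<le> ennreal (N powr (1 / s))"
      using epowr_mono[OF N(2), of "1 / s"] s N(1) by (simp add: epowr_ennreal)
  qed auto
  also have "\<dots> = ennreal (N powr (1 / s) * Lp_norm p h)" using Lp_norm_nonneg[of p h] by (simp add: ennreal_mult mult.commute)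
  also have "(NNINT w. ennreal \<bar>h' w\<bar> * ennreal \<bar>F w\<bar>) = (NNINT w. ennreal (norm (F w * h' w)))"
    by (intro nn_integral_cong) (simp add: abs_mult ennreal_mult mult.commute)
  finally have le: "(NNINT w. ennreal (norm (F w * h' w))) \<le> ennreal (N powr (1 / s) * Lp_norm p h)" .
  have i: "integrable lborel (\<lambda>w. F w * h' w)"
    unfolding integrable_iff_bounded using le_less_trans[OF le ennreal_less_top] by simp
  have Fm: "(\<lambda>w. F w * h' w) \<in> borel_measurable borel" by measurable
  have aeF: "AE w in lebesgue. F w * h' w = F w * h w" using ae by eventually_elim simp
  have m: "(\<lambda>w. F w * h w) \<in> borel_measurable lebesgue"
    by (intro borel_measurable_times borel_lebesgue[OF F] Lp_measurable[OF h])
  have iL: "integrable lebesgue (\<lambda>w. F w * h' w)" using i Fm by (simp add: integrable_completion)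
  show "integrable lebesgue (\<lambda>w. F w * h w)" by (rule integrable_cong_AE_imp[OF iL m aeF])
  have "(\<integral>w. F w * h w \<partial>lebesgue) = (\<integral>w. F w * h' w \<partial>lebesgue)"
    by (rule integral_cong_AE[OF m borel_lebesgue[OF Fm]]) (use aeF in \<open>auto elim!: eventually_mono\<close>)
  also have "\<dots> = (LBINT w. F w * h' w)" using Fm by (simp add: integral_completion)
  finally have "ennreal \<bar>\<integral>w. F w * h w \<partial>lebesgue\<bar> \<le> ennreal (N powr (1 / s) * Lp_norm p h)"
    using order_trans[OF integral_norm_bound_ennreal[OF i] le] by simp
  then show "\<bar>\<integral>w. F w * h w \<partial>lebesgue\<bar> \<le> N powr (1 / s) * Lp_norm p h"
    using Lp_norm_nonneg[of p h] by (simp add: ennreal_le_iff)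
qed

lemma pk_isCont:
  assumes "fst z \<noteq> 0" shows "isCont (pk lam \<alpha> :: real \<times> 'a::euclidean_space \<Rightarrow> real) z"
proof (cases "0 < fst z")
  case True
  let ?U = "{z :: real \<times> 'a. 0 < fst z}"
  have o: "open ?U" by (intro open_Collect_less continuous_intros)
  have "continuous_on ?U (\<lambda>z. 1 / Gamma (\<alpha> / 2) * exp (- lam * fst z) * fst z powr (\<alpha> / 2 - 1) * heat (fst z) (snd z))"
    unfolding heat_def by (intro continuous_intros) auto
  then have "continuous_on ?U (pk lam \<alpha>)" by (rule continuous_on_eq) (simp add: pk_def)
  then have "\<forall>x\<in>?U. isCont (pk lam \<alpha>) x" by (simp only: continuous_on_eq_continuous_at[OF o])
  then show ?thesis using True by blast
next
  case False
  let ?U = "{z :: real \<times> 'a. fst z < 0}"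
  have o: "open ?U" by (intro open_Collect_less continuous_intros)
  have "continuous_on ?U (\<lambda>z. 0 :: real)" by simp
  then have "continuous_on ?U (pk lam \<alpha>)" by (rule continuous_on_eq) (simp add: pk_def)
  then have "\<forall>x\<in>?U. isCont (pk lam \<alpha>) x" by (simp only: continuous_on_eq_continuous_at[OF o])
  moreover have "z \<in> ?U" using False assms by simp
  ultimately show ?thesis by blast
qed

lemma ennreal_tendsto_0_real:
  fixes x :: "nat \<Rightarrow> ennreal"
  assumes "x \<longlonglongrightarrow> 0"
  shows "(\<lambda>n. enn2real (x n)) \<longlonglongrightarrow> 0" "\<forall>\<^sub>F n in sequentially. x n = ennreal (enn2real (x n))"
proof -
  show "(\<lambda>n. enn2real (x n)) \<longlonglongrightarrow> 0" using assms by (intro tendsto_enn2real) auto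
  have "\<forall>\<^sub>F n in sequentially. x n < 1" using assms by (rule order_tendstoD) simp
  then show "\<forall>\<^sub>F n in sequentially. x n = ennreal (enn2real (x n))"
    by eventually_elim (metis ennreal_enn2real ennreal_one_less_top less_trans)
qed

text \<open>It turns \<open>L^1\<close> convergence of the powers into convergence in \<open>L^s\<close>.\<close>

lemma abs_diff_powr_le:
  fixes a b s :: real
  assumes "0 \<le> a" "0 \<le> b" "1 < s"
  shows "\<bar>a - b\<bar> powr s \<le> \<bar>a powr s - b powr s\<bar>"
proof -
  have *: "(x - y) powr s \<le> x powr s - y powr s" if "0 \<le> y" "y \<le> x" for x y :: real
  proof -
    have "((x - y) powr s + y powr s) powr (1 / s) \<le> ((x - y) powr s) powr (1 / s) + (y powr s) powr (1 / s)"
      using assms(3) by (intro powr_add_le_add_powr) auto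
    also have "\<dots> = x" using that assms(3) by (simp add: powr_powr)
    finally have "(((x - y) powr s + y powr s) powr (1 / s)) powr s \<le> x powr s"
      using assms(3) by (intro powr_mono2) auto
    then show ?thesis using assms(3) by (simp add: powr_powr)
  qed
  show ?thesis
  proof (cases "b \<le> a")
    case True
    then show ?thesis using *[of b a] assms powr_mono2[of s b a] by simp
  next
    case False
    then show ?thesis using *[of a b] assms powr_mono2[of s a b] by simp
  qed
qed

text \<open>The translates of the kernel converge almost everywhere, since the kernel is continuous off the hyperplane of zero time, and they all have the same \<open>L^s\<close> norm; so they converge in \<open>L^s\<close> by Scheffe's lemma, and Hoelder's inequality gives continuity. At infinity either \<open>h\<close> or the kernel is evaluated on its tail.\<close>

theorem potential_C_infinity:
  fixes p \<alpha> lam :: real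
  assumes p: "1 < p" and \<alpha>: "0 < \<alpha>" and lam: "0 < lam" and D: "real (DIM('a::euclidean_space) + 2) < \<alpha> * p"
  obtains A where "0 \<le> A"
    "\<And>h. h \<in> Lp p \<Longrightarrow> kop (Pk lam \<alpha>) h \<in> (C_infinity :: (real \<times> 'a \<Rightarrow> real) set)"
    "\<And>h (z :: real \<times> 'a). h \<in> Lp p \<Longrightarrow> \<bar>kop (Pk lam \<alpha>) h z\<bar> \<le> A * Lp_norm p h"
    "\<And>h h' (z :: real \<times> 'a). h \<in> Lp p \<Longrightarrow> h' \<in> Lp p \<Longrightarrow> kop (Pk lam \<alpha>) (\<lambda>w. h w - h' w) z = kop (Pk lam \<alpha>) h z - kop (Pk lam \<alpha>) h' z"
proof -
  define s where "s = p / (p - 1)"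
  have ps: "1 / p + 1 / s = 1" using p by (simp add: s_def field_simps)
  have s: "1 < s" by (rule conjugate_exponents(1)[OF p ps])
  have "(real (DIM('a) + 2) - \<alpha>) * s < real (DIM('a) + 2)"
    using p D unfolding s_def by (simp add: field_simps)
  from pk_powr_mass[OF \<alpha> lam s this] obtain N where N: "0 \<le> N" "(NNINT (z::real \<times> 'a). epowr (ennreal (pk lam \<alpha> z)) s) \<le> ennreal N" by blast
  define k :: "real \<times> 'a \<Rightarrow> real" where "k = pk lam \<alpha>"
  have km[measurable]: "k \<in> borel_measurable borel" unfolding k_def by measurable
  have k0: "0 \<le> k z" for z unfolding k_def using \<alpha> by (rule pk_nonneg)
  have kN: "(NNINT w. epowr (ennreal \<bar>k (z - w)\<bar>) s) \<le> ennreal N" for z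
    using nn_integral_lborel_reflect[of "\<lambda>w. epowr (ennreal \<bar>k w\<bar>) s" z] N(2) k0 by (simp add: k_def pk_nonneg \<alpha>)
  have kop_k: "kop (Pk lam \<alpha>) h z = (\<integral>w. k (z - w) * h w \<partial>lebesgue)" for h z by (simp add: kop_def Pk_def k_def)
  have Fm: "(\<lambda>w. k (z - w)) \<in> borel_measurable borel" for z by measurable
  note Hk = Hoelder_Lp[OF p ps Fm _ N(1) kN]
  define A where "A = N powr (1 / s)"
  have vanish: "((kop (Pk lam \<alpha>) h) \<longlongrightarrow> 0) at_infinity" if h: "h \<in> Lp p" for h :: "real \<times> 'a \<Rightarrow> real"
    unfolding tendsto_iff
  proof (intro allI impI)
    fix e :: real assume e: "0 < e"
    have p0: "0 < p" using p by simp
    define ho where "ho n w = indicator {w. real n < norm w} w * h w" for n :: nat and w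
    have om: "{w :: real \<times> 'a. real n < norm w} \<in> sets borel" for n :: nat
      by (intro borel_open open_Collect_less continuous_intros)
    have "(\<lambda>n. Lp_norm p (ho n)) \<longlonglongrightarrow> 0"
      unfolding ho_def
    proof (rule Lp_mult_tendsto_0[OF p0 h])
      show "(\<lambda>w. indicator {w :: real \<times> 'a. real n < norm w} w :: real) \<in> borel_measurable lebesgue" for n
        by (intro borel_lebesgue borel_measurable_indicator om)
      show "\<bar>indicator {w :: real \<times> 'a. real n < norm w} w :: real\<bar> \<le> 1" for n w by (simp add: indicator_def)
      show "(\<lambda>n. indicator {w :: real \<times> 'a. real n < norm w} w :: real) \<longlonglongrightarrow> 0" for w
      proof (rule tendsto_eventually)
        obtain m where m: "norm w < real m" using reals_Archimedean2 by blast
        show "\<forall>\<^sub>F n in sequentially. indicator {w :: real \<times> 'a. real n < norm w} w = (0::real)"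
          using eventually_ge_at_top[of m] by eventually_elim (use m in simp)
      qed
    qed
    then have "(\<lambda>n. A * Lp_norm p (ho n)) \<longlonglongrightarrow> A * 0" by (intro tendsto_intros)
    then have "\<forall>\<^sub>F n in sequentially. A * Lp_norm p (ho n) < e / 2" using e by (auto dest!: order_tendstoD(2)[where a = "e / 2"])
    then obtain n where n: "A * Lp_norm p (ho n) < e / 2" by (auto simp: eventually_sequentially)
    define T where "T m = (NNINT (w::real \<times> 'a). epowr (ennreal \<bar>k w * indicator {w. real m < norm w} w\<bar>) s)" for m :: nat
    have "T \<longlonglongrightarrow> (NNINT (w::real \<times> 'a). 0)"
      unfolding T_def
    proof (rule nn_integral_dominated_convergence[where w = "\<lambda>w. epowr (ennreal (k w)) s"])
      fix j :: nat
      have [measurable]: "{w :: real \<times> 'a. real j < norm w} \<in> sets borel" by (rule om)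
      show "(\<lambda>w. epowr (ennreal \<bar>k w * indicator {w. real j < norm w} w\<bar>) s) \<in> borel_measurable lborel" by measurable
      show "AE w in lborel. epowr (ennreal \<bar>k w * indicator {w. real j < norm w} w\<bar>) s \<le> epowr (ennreal (k w)) s"
      proof (rule AE_I2)
        fix w
        show "epowr (ennreal \<bar>k w * indicator {w. real j < norm w} w\<bar>) s \<le> epowr (ennreal (k w)) s"
          by (cases "real j < norm w") (simp_all add: k0)
      qed
    next
      show "AE w in lborel. (\<lambda>m. epowr (ennreal \<bar>k w * indicator {w. real m < norm w} w\<bar>) s) \<longlonglongrightarrow> 0"
      proof (rule AE_I2, rule tendsto_eventually)
        fix w :: "real \<times> 'a"
        obtain m where m: "norm w < real m" using reals_Archimedean2 by blast
        show "\<forall>\<^sub>F j in sequentially. epowr (ennreal \<bar>k w * indicator {w. real j < norm w} w\<bar>) s = 0"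
          using eventually_ge_at_top[of m] by eventually_elim (use m in simp)
      qed
      show "(NNINT w. epowr (ennreal (k w)) s) < \<infinity>" using le_less_trans[OF N(2) ennreal_less_top] by (simp add: k_def)
    qed auto
    then have T0: "T \<longlonglongrightarrow> 0" by simp
    have "(\<lambda>m. enn2real (T m) powr (1 / s) * Lp_norm p h) \<longlonglongrightarrow> 0 * Lp_norm p h"
      using ennreal_tendsto_0_real(1)[OF T0] s by (intro tendsto_mult tendsto_zero_powrI[where b = "1 / s"] tendsto_const) auto
    then have "\<forall>\<^sub>F m in sequentially. enn2real (T m) powr (1 / s) * Lp_norm p h < e / 2" using e by (auto dest!: order_tendstoD(2)[where a = "e / 2"])
    with ennreal_tendsto_0_real(2)[OF T0] have "\<forall>\<^sub>F m in sequentially. T m = ennreal (enn2real (T m)) \<and> enn2real (T m) powr (1 / s) * Lp_norm p h < e / 2"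
      by (rule eventually_conj)
    then obtain m where m: "T m = ennreal (enn2real (T m))" "enn2real (T m) powr (1 / s) * Lp_norm p h < e / 2" by (auto simp: eventually_sequentially)
    have "dist (kop (Pk lam \<alpha>) h z) 0 < e" if z: "real n + real m + 1 \<le> norm z" for z
    proof -
      define F where "F w = k (z - w) * indicator {w. real m < norm w} (z - w)" for w
      define hi where "hi w = indicator {w. norm w \<le> real n} w * h w" for w
      have [measurable]: "{w :: real \<times> 'a. real m < norm w} \<in> sets borel" by (rule om)
      have cm: "{w :: real \<times> 'a. norm w \<le> real n} \<in> sets borel" by (intro borel_closed closed_Collect_le continuous_intros)
      have Fm': "F \<in> borel_measurable borel" unfolding F_def by measurable
      have FT: "(NNINT w. epowr (ennreal \<bar>F w\<bar>) s) \<le> ennreal (enn2real (T m))"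
      proof -
        have "(NNINT w. epowr (ennreal \<bar>F w\<bar>) s) = T m"
          unfolding F_def T_def
          by (rule nn_integral_lborel_reflect[of "\<lambda>w. epowr (ennreal \<bar>k w * indicator {w. real m < norm w} w\<bar>) s"]) measurable
        also note m(1)
        finally show ?thesis by (rule eq_refl)
      qed
      have hom: "ho n \<in> Lp p"
      proof -
        have a: "ho n \<in> borel_measurable lebesgue" unfolding ho_def
          by (intro borel_measurable_times Lp_measurable[OF h] borel_lebesgue borel_measurable_indicator om)
        have b: "AE w in lebesgue. \<bar>ho n w\<bar> \<le> 1 * \<bar>h w\<bar>" by (rule AE_I2) (simp add: ho_def indicator_def)
        show ?thesis using Lp_dominated(1)[OF p0 h a b] by simp
      qed
      have him: "hi \<in> Lp p" "Lp_norm p hi \<le> Lp_norm p h"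
      proof -
        have a: "hi \<in> borel_measurable lebesgue" unfolding hi_def
          by (intro borel_measurable_times Lp_measurable[OF h] borel_lebesgue borel_measurable_indicator cm)
        have b: "AE w in lebesgue. \<bar>hi w\<bar> \<le> 1 * \<bar>h w\<bar>" by (rule AE_I2) (simp add: hi_def indicator_def)
        show "hi \<in> Lp p" "Lp_norm p hi \<le> Lp_norm p h" using Lp_dominated[OF p0 h a b] by auto
      qed
      have pt: "k (z - w) * h w = F w * hi w + k (z - w) * ho n w" for w
      proof (cases "norm w \<le> real n")
        case True
        then have "real m < norm (z - w)" using z norm_triangle_ineq2[of z w] by linarith
        then show ?thesis using True by (simp add: F_def hi_def ho_def)
      next
        case False
        then show ?thesis by (simp add: F_def hi_def ho_def)
      qed
      note H1 = Hoelder_Lp[OF p ps Fm' him(1) enn2real_nonneg FT]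
      have "kop (Pk lam \<alpha>) h z = (\<integral>w. F w * hi w \<partial>lebesgue) + (\<integral>w. k (z - w) * ho n w \<partial>lebesgue)"
        unfolding kop_k pt by (rule Bochner_Integration.integral_add[OF H1(1) Hk(1)[OF hom]])
      moreover have "\<bar>\<integral>w. F w * hi w \<partial>lebesgue\<bar> < e / 2"
      proof -
        have "enn2real (T m) powr (1 / s) * Lp_norm p hi \<le> enn2real (T m) powr (1 / s) * Lp_norm p h"
          by (intro mult_left_mono him(2)) simp
        then show ?thesis using H1(2) m(2) by linarith
      qed
      moreover have "\<bar>\<integral>w. k (z - w) * ho n w \<partial>lebesgue\<bar> < e / 2"
        using Hk(2)[OF hom, of z] n by (simp add: A_def)
      ultimately show ?thesis by (simp add: dist_real_def)
    qed
    then show "\<forall>\<^sub>F z in at_infinity. dist (kop (Pk lam \<alpha>) h z) 0 < e"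
      unfolding eventually_at_infinity by blast
  qed
  have cont: "continuous_on UNIV (kop (Pk lam \<alpha>) h)" if h: "h \<in> Lp p" for h :: "real \<times> 'a \<Rightarrow> real"
    unfolding continuous_on_sequentially
  proof (intro allI ballI impI, elim conjE)
    fix x :: "nat \<Rightarrow> real \<times> 'a" and z assume x: "x \<longlonglongrightarrow> z"
    have i: "integrable lborel (\<lambda>w. k (z - w) powr s)"
    proof -
      have "(NNINT w. ennreal (norm (k (z - w) powr s))) < \<infinity>"
        using le_less_trans[OF kN[of z] ennreal_less_top] by (simp add: epowr_ennreal k0)
      then show ?thesis by (simp add: integrable_iff_bounded)
    qed
    define E where "E n = (NNINT w. ennreal (norm (k (x n - w) powr s - k (z - w) powr s)))" for n
    have E: "E \<longlonglongrightarrow> 0"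
      unfolding E_def
    proof (rule Scheffe_lemma2[OF _ i])
      show "(\<lambda>w. k (x n - w) powr s) \<in> borel_measurable lborel" for n by measurable
      have "AE (w :: real \<times> 'a) in lborel. fst w \<noteq> fst z"
      proof -
        have "negligible {w :: real \<times> 'a. (1, 0) \<bullet> w = fst z}" by (rule negligible_hyperplane) (simp add: zero_prod_def)
        then have "{w :: real \<times> 'a. fst w = fst z} \<in> null_sets lebesgue"
          by (simp add: negligible_iff_null_sets inner_prod_def)
        moreover have "{w :: real \<times> 'a. fst w = fst z} \<in> sets borel" by (intro borel_closed closed_Collect_eq continuous_intros)
        ultimately have "{w :: real \<times> 'a. fst w = fst z} \<in> null_sets lborel" by (simp add: null_sets_completion_iff)
        from AE_not_in[OF this] show ?thesis by simp
      qed
      then show "AE w in lborel. (\<lambda>n. k (x n - w) powr s) \<longlonglongrightarrow> k (z - w) powr s"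
      proof eventually_elim
        fix w :: "real \<times> 'a" assume "fst w \<noteq> fst z"
        then have "isCont k (z - w)" unfolding k_def by (intro pk_isCont) simp
        then have "(\<lambda>n. k (x n - w)) \<longlonglongrightarrow> k (z - w)" by (rule isCont_tendsto_compose) (intro tendsto_intros x)
        then show "(\<lambda>n. k (x n - w) powr s) \<longlonglongrightarrow> k (z - w) powr s"
          using s k0 by (intro tendsto_powr2 tendsto_const) auto
      qed
      show "(NNINT w. ennreal (norm (k (x n - w) powr s))) \<le> (NNINT w. ennreal (norm (k (z - w) powr s)))" for n
        using nn_integral_lborel_reflect[of "\<lambda>w. ennreal (norm (k w powr s))" "x n"] nn_integral_lborel_reflect[of "\<lambda>w. ennreal (norm (k w powr s))" z] by simp
    qed
    have "(\<lambda>n. enn2real (E n) powr (1 / s) * Lp_norm p h) \<longlonglongrightarrow> 0 * Lp_norm p h"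
      using ennreal_tendsto_0_real(1)[OF E] s by (intro tendsto_mult tendsto_zero_powrI[where b = "1 / s"] tendsto_const) auto
    then have lim: "(\<lambda>n. enn2real (E n) powr (1 / s) * Lp_norm p h) \<longlonglongrightarrow> 0" by simp
    have "(\<lambda>n. kop (Pk lam \<alpha>) h (x n) - kop (Pk lam \<alpha>) h z) \<longlonglongrightarrow> 0"
    proof (rule Lim_null_comparison[OF _ lim])
      show "\<forall>\<^sub>F n in sequentially. norm (kop (Pk lam \<alpha>) h (x n) - kop (Pk lam \<alpha>) h z) \<le> enn2real (E n) powr (1 / s) * Lp_norm p h"
        using ennreal_tendsto_0_real(2)[OF E]
      proof eventually_elim
        fix n assume En: "E n = ennreal (enn2real (E n))"
        have dm: "(\<lambda>w. k (x n - w) - k (z - w)) \<in> borel_measurable borel" by measurable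
        have "(NNINT w. epowr (ennreal \<bar>k (x n - w) - k (z - w)\<bar>) s) \<le> E n"
          unfolding E_def by (intro nn_integral_mono) (simp add: epowr_ennreal ennreal_leI abs_diff_powr_le k0 s)
        then have le: "(NNINT w. epowr (ennreal \<bar>k (x n - w) - k (z - w)\<bar>) s) \<le> ennreal (enn2real (E n))" using En by simp
        have "kop (Pk lam \<alpha>) h (x n) - kop (Pk lam \<alpha>) h z = (\<integral>w. (k (x n - w) - k (z - w)) * h w \<partial>lebesgue)"
          unfolding kop_k left_diff_distrib by (rule Bochner_Integration.integral_diff[symmetric, OF Hk(1)[OF h] Hk(1)[OF h]])
        then show "norm (kop (Pk lam \<alpha>) h (x n) - kop (Pk lam \<alpha>) h z) \<le> enn2real (E n) powr (1 / s) * Lp_norm p h"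
          using Hoelder_Lp(2)[OF p ps dm h enn2real_nonneg le] by simp
      qed
    qed
    then show "(kop (Pk lam \<alpha>) h \<circ> x) \<longlonglongrightarrow> kop (Pk lam \<alpha>) h z" by (simp add: LIM_zero_iff comp_def)
  qed
  show thesis
  proof
    show "0 \<le> A" by (simp add: A_def)
    show "kop (Pk lam \<alpha>) h \<in> (C_infinity :: (real \<times> 'a \<Rightarrow> real) set)" if "h \<in> Lp p" for h
      unfolding C_infinity_def using vanish[OF that] cont[OF that] by simp
    show "\<bar>kop (Pk lam \<alpha>) h z\<bar> \<le> A * Lp_norm p h" if "h \<in> Lp p" for h and z :: "real \<times> 'a"
      unfolding kop_k A_def by (rule Hk(2)[OF that])
    show "kop (Pk lam \<alpha>) (\<lambda>w. h w - h' w) z = kop (Pk lam \<alpha>) h z - kop (Pk lam \<alpha>) h' z" if "h \<in> Lp p" "h' \<in> Lp p" for h h' and z :: "real \<times> 'a"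
      unfolding kop_k right_diff_distrib by (rule Bochner_Integration.integral_diff[OF Hk(1)[OF that(1)] Hk(1)[OF that(2)]])
  qed
qed

section \<open>Operators on $L^p$\<close>

text \<open>Operators on classes of functions are only determined almost everywhere, so this is how boundedness passes from an explicit integral operator to one defined by a choice.\<close>

lemma Lp_bounded_op_AE_eq:
  assumes p: "1 < p" and T: "Lp_bounded_op p T" and eq: "\<And>f. f \<in> Lp p \<Longrightarrow> AE z in lebesgue. T f z = T' f z"
  shows "Lp_bounded_op p T'"
  unfolding Lp_bounded_op_def
proof (intro conjI ballI allI)
  have p0: "0 < p" using p by simp
  show "T' f \<in> Lp p" if f: "f \<in> Lp p" for f by (rule Lp_cong_AE(1)[OF p0 Lp_bounded_opD(1)[OF T f] eq[OF f]])
  show "AE z in lebesgue. T' (\<lambda>w. f w + g w) z = T' f z + T' g z" if f: "f \<in> Lp p" and g: "g \<in> Lp p" for f g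
    using eq[OF f] eq[OF g] eq[OF Minkowski(1)[OF p f g]] Lp_bounded_opD(2)[OF T f g] by eventually_elim simp
  show "AE z in lebesgue. T' (\<lambda>w. c * f w) z = c * T' f z" if f: "f \<in> Lp p" for f c
    using eq[OF f] eq[OF Lp_cmult(1)[OF p0 f, of c]] Lp_bounded_opD(3)[OF T f, of c] by eventually_elim simp
  obtain C where "\<forall>f\<in>Lp p. Lp_norm p (T f) \<le> C * Lp_norm p f" using T by (auto simp: Lp_bounded_op_def)
  then show "\<exists>C. \<forall>f\<in>Lp p. Lp_norm p (T' f) \<le> C * Lp_norm p f"
    using Lp_cong_AE(2)[OF p0 Lp_bounded_opD(1)[OF T] eq] by (intro exI[of _ C]) simp
qed

lemma Lp_bounded_op_comp:
  assumes p: "1 < p" and S: "Lp_bounded_op p S" and T: "Lp_bounded_op p T"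
  shows "Lp_bounded_op p (S \<circ> T)"
  unfolding Lp_bounded_op_def comp_def
proof (intro conjI ballI allI)
  have p0: "0 < p" using p by simp
  note m = Lp_bounded_opD(1)[OF T]
  show "S (T f) \<in> Lp p" if f: "f \<in> Lp p" for f by (rule Lp_bounded_opD(1)[OF S m[OF f]])
  show "AE z in lebesgue. S (T (\<lambda>w. f w + g w)) z = S (T f) z + S (T g) z" if f: "f \<in> Lp p" and g: "g \<in> Lp p" for f g
    using Lp_bounded_op_cong_AE[OF p S m[OF Minkowski(1)[OF p f g]] Minkowski(1)[OF p m[OF f] m[OF g]] Lp_bounded_opD(2)[OF T f g]]
      Lp_bounded_opD(2)[OF S m[OF f] m[OF g]] by eventually_elim simp
  show "AE z in lebesgue. S (T (\<lambda>w. c * f w)) z = c * S (T f) z" if f: "f \<in> Lp p" for f c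
    using Lp_bounded_op_cong_AE[OF p S m[OF Lp_cmult(1)[OF p0 f]] Lp_cmult(1)[OF p0 m[OF f]] Lp_bounded_opD(3)[OF T f], of c]
      Lp_bounded_opD(3)[OF S m[OF f], of c] by eventually_elim simp
  obtain C where C: "\<And>f. f \<in> Lp p \<Longrightarrow> Lp_norm p (S f) \<le> C * Lp_norm p f" using S unfolding Lp_bounded_op_def by blast
  obtain C' where C': "\<And>f. f \<in> Lp p \<Longrightarrow> Lp_norm p (T f) \<le> C' * Lp_norm p f" using T unfolding Lp_bounded_op_def by blast
  have "Lp_norm p (S (T f)) \<le> \<bar>C\<bar> * C' * Lp_norm p f" if f: "f \<in> Lp p" for f
  proof -
    have "Lp_norm p (S (T f)) \<le> \<bar>C\<bar> * Lp_norm p (T f)"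
      by (rule order_trans[OF C[OF m[OF f]]]) (intro mult_right_mono Lp_norm_nonneg, simp)
    also have "\<dots> \<le> \<bar>C\<bar> * (C' * Lp_norm p f)" by (intro mult_left_mono C' f) simp
    finally show ?thesis by (simp add: mult.assoc)
  qed
  then show "\<exists>C. \<forall>f\<in>Lp p. Lp_norm p (S (T f)) \<le> C * Lp_norm p f" by blast
qed

text \<open>An operator that is already bounded on the whole space is closed, so the closure of its restriction to a dense subspace is the operator itself.\<close>

lemma closure_of_bounded_op:
  assumes p: "1 < p" and A: "Lp_bounded_op p A"
    and dense: "\<And>f. f \<in> Lp p \<Longrightarrow> \<exists>h :: nat \<Rightarrow> _. (\<forall>n. h n \<in> D \<and> h n \<in> Lp p) \<and> (\<lambda>n. Lp_norm p (\<lambda>z. h n z - f z)) \<longlonglongrightarrow> 0"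
  shows "Lp_bounded_closure p D A" "\<And>f. f \<in> Lp p \<Longrightarrow> AE z in lebesgue. A f z = Lp_closure_op p D A f z"
proof -
  have p0: "0 < p" using p by simp
  note m = Lp_bounded_opD(1)[OF A]
  obtain C where C: "\<And>f. f \<in> Lp p \<Longrightarrow> Lp_norm p (A f) \<le> C * Lp_norm p f" using A unfolding Lp_bounded_op_def by blast
  have lim: "(\<lambda>n. Lp_norm p (\<lambda>z. A (h n) z - A f z)) \<longlonglongrightarrow> 0"
    if h: "\<And>n. h n \<in> Lp p" and f: "f \<in> Lp p" and l: "(\<lambda>n. Lp_norm p (\<lambda>z. h n z - f z)) \<longlonglongrightarrow> 0" for h :: "nat \<Rightarrow> _" and f
  proof -
    have "Lp_norm p (\<lambda>z. A (h n) z - A f z) \<le> C * Lp_norm p (\<lambda>z. h n z - f z)" for n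
      using C[OF Lp_diff(1)[OF p h[of n] f]]
        Lp_cong_AE(2)[OF p0 m[OF Lp_diff(1)[OF p h[of n] f]] Lp_bounded_op_diff[OF p A h[of n] f]] by simp
    then have ev: "\<forall>\<^sub>F n in sequentially. norm (Lp_norm p (\<lambda>z. A (h n) z - A f z)) \<le> C * Lp_norm p (\<lambda>z. h n z - f z)"
      by (simp only: real_norm_def abs_of_nonneg[OF Lp_norm_nonneg] eventually_True)
    have "(\<lambda>n. C * Lp_norm p (\<lambda>z. h n z - f z)) \<longlonglongrightarrow> C * 0" by (intro tendsto_intros l)
    then show ?thesis unfolding mult_zero_right by (rule Lim_null_comparison[OF ev])
  qed
  have in_closure: "(f, A f) \<in> Lp_graph_closure p D A" if f: "f \<in> Lp p" for f
  proof -
    obtain h :: "nat \<Rightarrow> _" where h: "\<And>n. h n \<in> D" "\<And>n. h n \<in> Lp p" "(\<lambda>n. Lp_norm p (\<lambda>z. h n z - f z)) \<longlonglongrightarrow> 0"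
      using dense[OF f] by blast
    show ?thesis unfolding Lp_graph_closure_def using h m f lim[OF h(2) f h(3)] by blast
  qed
  have val: "AE z in lebesgue. A f z = g z" if fg: "(f, g) \<in> Lp_graph_closure p D A" for f g
  proof -
    obtain h :: "nat \<Rightarrow> _" where f: "f \<in> Lp p" and g: "g \<in> Lp p" and h: "\<And>n. h n \<in> Lp p" "(\<lambda>n. Lp_norm p (\<lambda>z. h n z - f z)) \<longlonglongrightarrow> 0"
      "(\<lambda>n. Lp_norm p (\<lambda>z. A (h n) z - g z)) \<longlonglongrightarrow> 0"
      using fg unfolding Lp_graph_closure_def by blast
    let ?d = "\<lambda>z. A f z - g z"
    have d: "?d \<in> Lp p" by (rule Lp_diff(1)[OF p m[OF f] g])
    have le: "Lp_norm p ?d \<le> Lp_norm p (\<lambda>z. A (h n) z - g z) + Lp_norm p (\<lambda>z. A (h n) z - A f z)" for n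
    proof -
      have "(\<lambda>z. (A (h n) z - g z) - (A (h n) z - A f z)) = ?d" by auto
      then show ?thesis using Lp_diff(2)[OF p Lp_diff(1)[OF p m[OF h(1)[of n]] g] Lp_diff(1)[OF p m[OF h(1)[of n]] m[OF f]]] by simp
    qed
    have "(\<lambda>n. Lp_norm p (\<lambda>z. A (h n) z - g z) + Lp_norm p (\<lambda>z. A (h n) z - A f z)) \<longlonglongrightarrow> 0 + 0"
      by (intro tendsto_add h(3) lim[OF h(1) f h(2)])
    then have "Lp_norm p ?d \<le> 0" using le by (intro LIMSEQ_le_const[where X = "\<lambda>n. Lp_norm p (\<lambda>z. A (h n) z - g z) + Lp_norm p (\<lambda>z. A (h n) z - A f z)"]) auto
    then have "Lp_norm p ?d = 0" using Lp_norm_nonneg[of p ?d] by simp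
    from Lp_norm_eq_0[OF p0 d this] show ?thesis by eventually_elim simp
  qed
  show eq: "AE z in lebesgue. A f z = Lp_closure_op p D A f z" if "f \<in> Lp p" for f
  proof (rule val)
    show "(f, Lp_closure_op p D A f) \<in> Lp_graph_closure p D A"
      unfolding Lp_closure_op_def using in_closure[OF that] by (rule someI[where P = "\<lambda>g. (f, g) \<in> Lp_graph_closure p D A"])
  qed
  have "Lp_closable p D A" unfolding Lp_closable_def
  proof (intro allI impI, elim conjE)
    fix f g g' assume "(f, g) \<in> Lp_graph_closure p D A" "(f, g') \<in> Lp_graph_closure p D A"
    from val[OF this(1)] val[OF this(2)] show "AE z in lebesgue. g z = g' z" by eventually_elim simp
  qed
  moreover have "Domain (Lp_graph_closure p D A) = Lp p"
  proof
    show "Domain (Lp_graph_closure p D A) \<subseteq> Lp p" by (auto simp: Lp_graph_closure_def)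
    show "Lp p \<subseteq> Domain (Lp_graph_closure p D A)" using in_closure by blast
  qed
  ultimately show "Lp_bounded_closure p D A"
    unfolding Lp_bounded_closure_def using Lp_bounded_op_AE_eq[OF p A eq] by blast
qed

lemma Lp_opnorm_le:
  fixes T :: "('b::euclidean_space \<Rightarrow> real) \<Rightarrow> 'b \<Rightarrow> real"
  assumes p: "0 < p" and \<theta>: "0 \<le> \<theta>" and le: "\<And>f. f \<in> Lp p \<Longrightarrow> Lp_norm p (T f) \<le> \<theta> * Lp_norm p f"
  shows "Lp_opnorm p T \<le> \<theta>"
  unfolding Lp_opnorm_def
proof (rule cSUP_least)
  show "{f \<in> Lp p. Lp_norm p f \<le> 1} \<noteq> ({} :: ('b \<Rightarrow> real) set)"
  proof -
    have "(\<lambda>z. 0) \<in> {f :: 'b \<Rightarrow> real. f \<in> Lp p \<and> Lp_norm p f \<le> 1}" by (simp only: mem_Collect_eq Lp_zero(1)[OF p] Lp_zero(2) zero_le_one simp_thms)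
    then show ?thesis by blast
  qed
  fix f :: "'b \<Rightarrow> real" assume "f \<in> {f \<in> Lp p. Lp_norm p f \<le> 1}"
  then have f: "f \<in> Lp p" "Lp_norm p f \<le> 1" by auto
  have "\<theta> * Lp_norm p f \<le> \<theta> * 1" by (rule mult_left_mono[OF f(2) \<theta>])
  then show "Lp_norm p (T f) \<le> \<theta>" using le[OF f(1)] by simp
qed

text \<open>Injectivity of the potential determines the value of the choice that defines its inverse.\<close>

lemma par_power_eq:
  assumes p: "1 < p" and lam: "0 < lam" and \<alpha>: "0 < \<alpha>" "\<alpha> \<le> 2" and g: "g \<in> Lp p"
    and u: "AE z in lebesgue. par_potential lam \<alpha> g z = u z"
  shows "AE z in lebesgue. g z = par_power p lam \<alpha> u z" "par_power p lam \<alpha> u \<in> Lp p"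
proof -
  have "par_power p lam \<alpha> u \<in> Lp p \<and> (AE z in lebesgue. par_potential lam \<alpha> (par_power p lam \<alpha> u) z = u z)"
    unfolding par_power_def Lp_inverse_def using g u by (intro someI_ex[of "\<lambda>g. g \<in> Lp p \<and> (AE z in lebesgue. par_potential lam \<alpha> g z = u z)"]) blast
  then have m: "par_power p lam \<alpha> u \<in> Lp p" and e: "AE z in lebesgue. par_potential lam \<alpha> (par_power p lam \<alpha> u) z = u z" by auto
  show "par_power p lam \<alpha> u \<in> Lp p" by (rule m)
  have "AE z in lebesgue. par_potential lam \<alpha> g z = par_potential lam \<alpha> (par_power p lam \<alpha> u) z"
    using u e by eventually_elim simp
  from par_potential_inj[OF p lam \<alpha> g m this] show "AE z in lebesgue. g z = par_power p lam \<alpha> u z" .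
qed

lemma norm_vec_root: "norm (vec_root p v) = norm v powr (1 / p)"
proof (cases "v = 0")
  case False
  have "norm v powr (1 / p - 1) * norm v powr 1 = norm v powr (1 / p)" unfolding powr_add[symmetric] by simp
  then show ?thesis by (simp add: vec_root_def)
qed (simp add: vec_root_def)

lemma vec_root_complement: "v = norm v powr (1 - 1 / p) *\<^sub>R vec_root p v"
proof (cases "v = 0")
  case False
  then have "norm v powr (1 - 1 / p) * norm v powr (- 1 + 1 / p) = 1" by (simp flip: powr_add)
  then show ?thesis by (simp add: vec_root_def)
qed (simp add: vec_root_def)

text \<open>The drift enters all operators only through the two kernel bounds. Stated for a Borel representative \<open>b0\<close>, since the kernels must be jointly Borel measurable, they are inherited by truncations with the same constants. The bound \<open>grad_bound\<close> is for one partial derivative; summing over the basis accounts for the factor \<open>DIM('a)\<close> in \<open>small\<close>.\<close>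

locale form_bounded_drift =
  fixes p lam CR CQ :: real and b b0 :: "real \<times> 'a::euclidean_space \<Rightarrow> 'a"
  assumes p: "1 < p" and lam: "0 < lam"
    and b_measurable: "b \<in> borel_measurable lebesgue" and b0: "b0 \<in> borel_measurable borel"
    and b_eq: "AE z in lebesgue. b z = b0 z"
    and grad_bound: "e \<in> Basis \<Longrightarrow> kernel_bound p (\<lambda>(z, w). norm (b0 z) powr (1 / p) * dpk lam (1 + 1 / p) e (z - w)) CR"
    and pot_bound: "kernel_bound p (\<lambda>(z, w). pk lam (1 - 1 / p) (z - w) * norm (b0 w) powr (1 - 1 / p)) CQ"
    and small: "real DIM('a) * CR * CQ \<le> 1 / 2"
begin

lemma exponents: "0 < p" "1 < 1 + 1 / p" "0 < 1 + 1 / p" "1 + 1 / p \<le> 2" "0 < 1 - 1 / p" "1 / conj_exp p = 1 - 1 / p" "1 + 1 / p + (1 - 1 / p) = 2"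
  using p by (auto simp: conj_exp_def field_simps)

lemma constants_nonneg: "0 \<le> CR" "0 \<le> CQ"
  using grad_bound[OF SOME_Basis] pot_bound by (auto simp: kernel_bound_def)

lemma pot_op: "0 < \<alpha> \<Longrightarrow> Lp_bounded_op p (par_potential lam \<alpha>)"
  unfolding par_potential_kop by (rule kop_bounded_op[OF p Pk_bound[OF p _ lam]])

lemma R_eq:
  assumes h: "h \<in> Lp p"
  shows "AE z in lebesgue. R_op p lam b h z = (\<Sum>e\<in>Basis. (vec_root p (b0 z) \<bullet> e) * kop (Dk lam (1 + 1 / p) e) h z)"
  using weak_grad_eq[OF weak_grad_potential[OF p exponents(2) lam h]] b_eq
  by eventually_elim (simp add: R_op_def inner_sum_right mult.commute)

lemma R_bound:
  assumes h: "h \<in> Lp p"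
  shows "R_op p lam b h \<in> Lp p" "Lp_norm p (R_op p lam b h) \<le> real DIM('a) * CR * Lp_norm p h"
proof -
  let ?t = "\<lambda>e z. (vec_root p (b0 z) \<bullet> e) * kop (Dk lam (1 + 1 / p) e) h z"
  have t: "?t e \<in> Lp p \<and> Lp_norm p (?t e) \<le> CR * Lp_norm p h" if e: "e \<in> Basis" for e
  proof -
    let ?K = "\<lambda>(z, w). norm (b0 z) powr (1 / p) * dpk lam (1 + 1 / p) e (z - w)"
    have K: "kop ?K h z = norm (b0 z) powr (1 / p) * kop (Dk lam (1 + 1 / p) e) h z" for z
      unfolding kop_def Dk_def by (simp add: mult.assoc)
    have [measurable]: "b0 \<in> borel_measurable borel" by (rule b0)
    have "(\<lambda>z. vec_root p (b0 z) \<bullet> e) \<in> borel_measurable borel" unfolding vec_root_def by measurable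
    then have m: "?t e \<in> borel_measurable lebesgue"
      by (intro borel_lebesgue borel_measurable_times kop_measurable[OF Dk_measurable Lp_measurable[OF h]])
    have le: "AE z in lebesgue. \<bar>?t e z\<bar> \<le> 1 * \<bar>kop ?K h z\<bar>"
    proof (rule AE_I2)
      fix z
      have "\<bar>vec_root p (b0 z) \<bullet> e\<bar> \<le> norm (b0 z) powr (1 / p)"
        using Cauchy_Schwarz_ineq2[of "vec_root p (b0 z)" e] e by (simp add: norm_vec_root)
      then have "\<bar>vec_root p (b0 z) \<bullet> e\<bar> * \<bar>kop (Dk lam (1 + 1 / p) e) h z\<bar> \<le> norm (b0 z) powr (1 / p) * \<bar>kop (Dk lam (1 + 1 / p) e) h z\<bar>"
        by (rule mult_right_mono) simp
      then show "\<bar>?t e z\<bar> \<le> 1 * \<bar>kop ?K h z\<bar>" unfolding K by (simp add: abs_mult)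
    qed
    note k = kop_Lp[OF p grad_bound[OF e] h]
    show ?thesis using Lp_dominated[OF exponents(1) k(1) m le] k(2) by auto
  qed
  have "(\<Sum>e\<in>(Basis::'a set). Lp_norm p (?t e)) \<le> (\<Sum>e\<in>(Basis::'a set). CR * Lp_norm p h)"
    by (rule sum_mono) (use t in blast)
  also have "\<dots> = real DIM('a) * CR * Lp_norm p h" by simp
  finally have s: "(\<Sum>e\<in>(Basis::'a set). Lp_norm p (?t e)) \<le> real DIM('a) * CR * Lp_norm p h" .
  have sm: "(\<lambda>z. \<Sum>e\<in>(Basis::'a set). ?t e z) \<in> Lp p" "Lp_norm p (\<lambda>z. \<Sum>e\<in>(Basis::'a set). ?t e z) \<le> (\<Sum>e\<in>(Basis::'a set). Lp_norm p (?t e))"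
    using Lp_sum[OF p finite_Basis, of ?t] t by auto
  have ae: "AE z in lebesgue. (\<Sum>e\<in>Basis. ?t e z) = R_op p lam b h z" using R_eq[OF h] by eventually_elim simp
  from Lp_cong_AE[OF exponents(1) sm(1) ae] sm(2) s
  show "R_op p lam b h \<in> Lp p" "Lp_norm p (R_op p lam b h) \<le> real DIM('a) * CR * Lp_norm p h" by auto
qed

lemma R_op_bounded: "Lp_bounded_op p (R_op p lam b)"
  unfolding Lp_bounded_op_def
proof (intro conjI ballI allI)
  have D: "Lp_bounded_op p (kop (Dk lam (1 + 1 / p) e))" for e :: 'a
    using Dk_bound[OF p exponents(2) lam, of e] kop_bounded_op[OF p] by blast
  show "R_op p lam b f \<in> Lp p" if "f \<in> Lp p" for f using that by (rule R_bound)
  show "AE z in lebesgue. R_op p lam b (\<lambda>w. f w + g w) z = R_op p lam b f z + R_op p lam b g z" if f: "f \<in> Lp p" and g: "g \<in> Lp p" for f g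
  proof -
    have "AE z in lebesgue. \<forall>e\<in>Basis. kop (Dk lam (1 + 1 / p) (e::'a)) (\<lambda>w. f w + g w) z = kop (Dk lam (1 + 1 / p) e) f z + kop (Dk lam (1 + 1 / p) e) g z"
      using Lp_bounded_opD(2)[OF D f g] by (simp add: AE_finite_all)
    then show ?thesis using R_eq[OF f] R_eq[OF g] R_eq[OF Minkowski(1)[OF p f g]]
      by eventually_elim (simp add: distrib_left sum.distrib)
  qed
  show "AE z in lebesgue. R_op p lam b (\<lambda>w. c * f w) z = c * R_op p lam b f z" if f: "f \<in> Lp p" for f c
    using R_eq[OF f] R_eq[OF Lp_cmult(1)[OF exponents(1) f, of c]]
    by eventually_elim (simp add: kop_cmult sum_distrib_left mult.left_commute)
  show "\<exists>C. \<forall>f\<in>Lp p. Lp_norm p (R_op p lam b f) \<le> C * Lp_norm p f" using R_bound(2) by blast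
qed

lemma Q_pre_kop:
  assumes h: "h \<in> Lp p"
  shows "Q_pre p lam b h = kop (\<lambda>(z, w). pk lam (1 - 1 / p) (z - w) * norm (b0 w) powr (1 - 1 / p)) h"
proof -
  have bm: "(\<lambda>z. norm (b z) powr (1 - 1 / p)) \<in> borel_measurable lebesgue" using b_measurable by simp
  have "Q_pre p lam b h = kop (Pk lam (1 - 1 / p)) (\<lambda>z. norm (b0 z) powr (1 - 1 / p) * h z)"
    unfolding Q_pre_def exponents par_potential_kop
  proof (rule kop_cong_AE[OF Pk_measurable])
    show "(\<lambda>z. norm (b z) powr (1 - 1 / p) * h z) \<in> borel_measurable lebesgue" by (intro borel_measurable_times bm Lp_measurable[OF h])
    show "AE z in lebesgue. norm (b z) powr (1 - 1 / p) * h z = norm (b0 z) powr (1 - 1 / p) * h z" using b_eq by eventually_elim simp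
  qed
  also have "\<dots> = kop (\<lambda>(z, w). pk lam (1 - 1 / p) (z - w) * norm (b0 w) powr (1 - 1 / p)) h"
    by (simp add: fun_eq_iff kop_def Pk_def mult.assoc)
  finally show ?thesis .
qed

lemma Q_pre_norm: "h \<in> Lp p \<Longrightarrow> Lp_norm p (Q_pre p lam b h) \<le> CQ * Lp_norm p h"
  using kop_Lp(2)[OF p pot_bound] by (simp add: Q_pre_kop)

lemma Q_pre_bounded: "Lp_bounded_op p (Q_pre p lam b)"
  by (rule Lp_bounded_op_AE_eq[OF p kop_bounded_op[OF p pot_bound]]) (simp add: Q_pre_kop)

text \<open>The functions \<open>exp (- \<bar>b\<bar>/n) f\<close> approximate \<open>f\<close>.\<close>

lemma Q_dom_dense:
  assumes f: "f \<in> Lp p"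
  shows "\<exists>h :: nat \<Rightarrow> _. (\<forall>n. h n \<in> Q_dom p b \<and> h n \<in> Lp p) \<and> (\<lambda>n. Lp_norm p (\<lambda>z. h n z - f z)) \<longlonglongrightarrow> 0"
proof (intro exI conjI allI)
  let ?e = "\<lambda>n z. exp (- (1 / real (Suc n)) * norm (b z))"
  have em: "?e n \<in> borel_measurable lebesgue" for n using b_measurable by simp
  have e1: "?e n z \<le> 1" for n z by simp
  fix n
  show "(\<lambda>z. ?e n z * f z) \<in> Q_dom p b" unfolding Q_dom_def using f by (intro UN_I[of "1 / real (Suc n)"]) auto
  have "AE z in lebesgue. \<bar>?e n z * f z\<bar> \<le> 1 * \<bar>f z\<bar>"
    by (rule AE_I2) (use e1 in \<open>simp only: abs_mult abs_exp_cancel mult_right_mono abs_ge_zero\<close>)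
  then show "(\<lambda>z. ?e n z * f z) \<in> Lp p"
    by (rule Lp_dominated(1)[OF exponents(1) f borel_measurable_times[OF em Lp_measurable[OF f]]]) simp
next
  let ?e = "\<lambda>n z. exp (- (1 / real (Suc n)) * norm (b z))"
  have em: "?e n \<in> borel_measurable lebesgue" for n using b_measurable by simp
  have "(\<lambda>n. Lp_norm p (\<lambda>z. (?e n z - 1) * f z)) \<longlonglongrightarrow> 0"
  proof (rule Lp_mult_tendsto_0[OF exponents(1) f])
    show "(\<lambda>z. ?e n z - 1) \<in> borel_measurable lebesgue" for n by (intro borel_measurable_diff em borel_measurable_const)
    show "\<bar>?e n z - 1\<bar> \<le> 1" for n z
    proof -
      have "0 < ?e n z" "?e n z \<le> 1" by (rule exp_gt_zero, simp)
      then show ?thesis by linarith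
    qed
    show "(\<lambda>n. ?e n z - 1) \<longlonglongrightarrow> 0" for z
    proof -
      have "(\<lambda>n. exp (- inverse (real (Suc n)) * norm (b z)) - 1) \<longlonglongrightarrow> exp (- 0 * norm (b z)) - 1"
        by (intro tendsto_intros LIMSEQ_inverse_real_of_nat)
      then show ?thesis by (simp add: inverse_eq_divide)
    qed
  qed
  then show "(\<lambda>n. Lp_norm p (\<lambda>z. ?e n z * f z - f z)) \<longlonglongrightarrow> 0" by (simp only: left_diff_distrib mult_1)
qed

lemma Q_closure: "Lp_bounded_closure p (Q_dom p b) (Q_pre p lam b)"
  and Q_op_eq: "f \<in> Lp p \<Longrightarrow> AE z in lebesgue. Q_pre p lam b f z = Q_op p lam b f z"
  unfolding Q_op_def using closure_of_bounded_op[OF p Q_pre_bounded Q_dom_dense] by auto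

lemma Q_op_bounded: "Lp_bounded_op p (Q_op p lam b)"
  by (rule Lp_bounded_op_AE_eq[OF p Q_pre_bounded Q_op_eq])

lemma Q_op_norm:
  assumes "h \<in> Lp p" shows "Lp_norm p (Q_op p lam b h) \<le> CQ * Lp_norm p h"
  using Lp_cong_AE(2)[OF exponents(1) Lp_bounded_opD(1)[OF Q_pre_bounded assms] Q_op_eq[OF assms]] Q_pre_norm[OF assms] by simp

lemma T_op_bounded: "Lp_bounded_op p (T_op p lam b)"
  unfolding T_op_def by (rule Lp_bounded_op_comp[OF p R_op_bounded Q_op_bounded])

lemma T_op_norm:
  assumes h: "h \<in> Lp p" shows "Lp_norm p (T_op p lam b h) \<le> 1 / 2 * Lp_norm p h"
proof -
  have "Lp_norm p (T_op p lam b h) \<le> real DIM('a) * CR * Lp_norm p (Q_op p lam b h)"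
    unfolding T_op_def comp_def by (rule R_bound(2)[OF Lp_bounded_opD(1)[OF Q_op_bounded h]])
  also have "\<dots> \<le> real DIM('a) * CR * (CQ * Lp_norm p h)"
    using constants_nonneg by (intro mult_left_mono Q_op_norm h) auto
  also have "\<dots> \<le> 1 / 2 * Lp_norm p h"
    using mult_right_mono[OF small Lp_norm_nonneg[of p h]] by (simp add: mult.assoc)
  finally show ?thesis .
qed

lemma T_opnorm: "Lp_opnorm p (T_op p lam b) < 1"
  using Lp_opnorm_le[OF exponents(1) _ T_op_norm] by simp

definition flux :: "(real \<times> 'a \<Rightarrow> real) \<Rightarrow> real \<times> 'a \<Rightarrow> real" where
  "flux f = Lp_inverse p (\<lambda>g w. g w + T_op p lam b g w) (R_op p lam b (par_potential lam (1 / conj_exp p) f))"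

definition density :: "(real \<times> 'a \<Rightarrow> real) \<Rightarrow> real \<times> 'a \<Rightarrow> real" where
  "density f = (\<lambda>z. par_potential lam (1 - 1 / p) f z - Q_pre p lam b (flux f) z)"

lemma flux:
  assumes f: "f \<in> Lp p"
  shows "flux f \<in> Lp p" "AE z in lebesgue. flux f z + T_op p lam b (flux f) z = R_op p lam b (par_potential lam (1 - 1 / p) f) z"
proof -
  have h: "R_op p lam b (par_potential lam (1 - 1 / p) f) \<in> Lp p"
    by (rule R_bound(1)[OF Lp_bounded_opD(1)[OF pot_op[OF exponents(5)] f]])
  let ?P = "\<lambda>g. g \<in> Lp p \<and> (AE z in lebesgue. g z + T_op p lam b g z = R_op p lam b (par_potential lam (1 - 1 / p) f) z)"
  have "\<exists>g. ?P g" using one_plus_contraction_surj[OF p T_op_bounded T_op_norm _ _ h] by auto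
  then have "?P (flux f)" unfolding flux_def Lp_inverse_def exponents by (rule someI_ex)
  then show "flux f \<in> Lp p" "AE z in lebesgue. flux f z + T_op p lam b (flux f) z = R_op p lam b (par_potential lam (1 - 1 / p) f) z" by auto
qed

lemma T_op_eq: "g \<in> Lp p \<Longrightarrow> AE z in lebesgue. R_op p lam b (Q_pre p lam b g) z = T_op p lam b g z"
  unfolding T_op_def comp_def
  by (rule Lp_bounded_op_cong_AE[OF p R_op_bounded Lp_bounded_opD(1)[OF Q_pre_bounded] Lp_bounded_opD(1)[OF Q_op_bounded] Q_op_eq])

lemma pot_split:
  assumes v: "v \<in> Lp p"
  shows "AE z in lebesgue. par_potential lam (1 + 1 / p) (par_potential lam (1 - 1 / p) v) z = par_potential lam 2 v z"
  using par_potential_semigroup[OF p exponents(3,5) lam v] by (simp only: exponents)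

lemma density_Lp: "f \<in> Lp p \<Longrightarrow> density f \<in> Lp p"
  unfolding density_def by (intro Lp_diff(1)[OF p] Lp_bounded_opD(1)[OF pot_op[OF exponents(5)]] Lp_bounded_opD(1)[OF Q_pre_bounded] flux(1))

text \<open>All solutions, exact and approximate, are potentials of order \<open>1 + 1/p\<close> of densities; the convergence is studied on the level of the densities.\<close>

lemma limit_solution_eq:
  assumes f: "f \<in> Lp p"
  shows "AE z in lebesgue. par_potential lam (1 + 1 / p) (density f) z = limit_solution p lam b f z"
proof -
  note P = pot_op[OF exponents(3)] and m = Lp_bounded_opD(1)[OF pot_op[OF exponents(5)] f] and Qm = Lp_bounded_opD(1)[OF Q_pre_bounded flux(1)[OF f]]
  have "AE z in lebesgue. par_potential lam (1 + 1 / p) (Q_pre p lam b (flux f)) z = par_potential lam (1 + 1 / p) (Q_op p lam b (flux f)) z"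
    by (rule Lp_bounded_op_cong_AE[OF p P Qm Lp_bounded_opD(1)[OF Q_op_bounded flux(1)[OF f]] Q_op_eq[OF flux(1)[OF f]]])
  with Lp_bounded_op_diff[OF p P m Qm] pot_split[OF f] show ?thesis
    unfolding density_def by eventually_elim (simp add: limit_solution_def flux_def)
qed

text \<open>The factorisation \<open>b \<bullet> \<nabla> = \<bar>b\<bar>^(1-1/p) (b^(1/p) \<bullet> \<nabla>)\<close> together with the semigroup property.\<close>

lemma drift_term:
  assumes v: "v \<in> Lp p" and u: "AE z in lebesgue. par_potential lam 2 v z = u z"
  shows "b z \<bullet> weak_grad u z = norm (b z) powr (1 - 1 / p) * R_op p lam b (par_potential lam (1 - 1 / p) v) z"
proof -
  have "AE z in lebesgue. u z = par_potential lam (1 + 1 / p) (par_potential lam (1 - 1 / p) v) z"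
    using u pot_split[OF v] by eventually_elim simp
  then have "weak_grad u = weak_grad (par_potential lam (1 + 1 / p) (par_potential lam (1 - 1 / p) v))" by (rule weak_grad_cong_AE)
  then show ?thesis unfolding R_op_def by (subst vec_root_complement[of "b z" p]) simp
qed

lemma par_power_drift:
  assumes f: "f \<in> Lp p" and g: "g \<in> Lp p" and bg: "(\<lambda>z. norm (b z) powr (1 - 1 / p) * g z) \<in> Lp p"
    and v: "v \<in> Lp p" "AE z in lebesgue. v z = f z - norm (b z) powr (1 - 1 / p) * g z"
  shows "AE z in lebesgue. par_potential lam (1 - 1 / p) v z = par_potential lam (1 - 1 / p) f z - Q_pre p lam b g z"
    "AE z in lebesgue. R_op p lam b (par_potential lam (1 - 1 / p) v) z = R_op p lam b (par_potential lam (1 - 1 / p) f) z - T_op p lam b g z"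
proof -
  note P = pot_op[OF exponents(5)]
  have "AE z in lebesgue. par_potential lam (1 - 1 / p) v z = par_potential lam (1 - 1 / p) (\<lambda>z. f z - norm (b z) powr (1 - 1 / p) * g z) z"
    by (rule Lp_bounded_op_cong_AE[OF p P v(1) Lp_diff(1)[OF p f bg] v(2)])
  with Lp_bounded_op_diff[OF p P f bg]
  show 1: "AE z in lebesgue. par_potential lam (1 - 1 / p) v z = par_potential lam (1 - 1 / p) f z - Q_pre p lam b g z"
    by eventually_elim (simp add: Q_pre_def exponents(6))
  note m = Lp_bounded_opD(1)[OF P] and Qm = Lp_bounded_opD(1)[OF Q_pre_bounded g]
  from Lp_bounded_op_cong_AE[OF p R_op_bounded m[OF v(1)] Lp_diff(1)[OF p m[OF f] Qm] 1]
    Lp_bounded_op_diff[OF p R_op_bounded m[OF f] Qm] T_op_eq[OF g]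
  show "AE z in lebesgue. R_op p lam b (par_potential lam (1 - 1 / p) v) z = R_op p lam b (par_potential lam (1 - 1 / p) f) z - T_op p lam b g z"
    by eventually_elim simp
qed

text \<open>Existence: \<open>v = f - \<bar>b\<bar>^(1-1/p) g\<close> lies in \<open>L^p\<close> since \<open>b\<close> is bounded, and its potential solves the equation by the equation for the flux \<open>g\<close>. Uniqueness: the flux of any solution satisfies the same equation, in which \<open>1 + T\<close> is injective.\<close>

lemma solution_exists:
  assumes f: "f \<in> Lp p" and bounded: "\<And>z. norm (b z) \<le> B"
  shows "Lp_solution p lam b f (par_potential lam (1 + 1 / p) (density f))"
    and "\<And>u. Lp_solution p lam b f u \<Longrightarrow> AE z in lebesgue. u z = par_potential lam (1 + 1 / p) (density f) z"
proof -
  let ?b = "\<lambda>z. norm (b z) powr (1 - 1 / p)"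
  let ?g = "flux f" and ?u = "par_potential lam (1 + 1 / p) (density f)"
  have bg: "(\<lambda>z. ?b z * g z) \<in> Lp p" if g: "g \<in> Lp p" for g
  proof (rule Lp_dominated(1)[OF exponents(1) g])
    show "(\<lambda>z. ?b z * g z) \<in> borel_measurable lebesgue" using b_measurable Lp_measurable[OF g] by simp
    show "AE z in lebesgue. \<bar>?b z * g z\<bar> \<le> B powr (1 - 1 / p) * \<bar>g z\<bar>"
      using exponents(5) bounded by (intro AE_I2) (auto simp: abs_mult intro!: mult_right_mono powr_mono2)
  qed simp
  define v where "v z = f z - ?b z * ?g z" for z
  have v: "v \<in> Lp p" unfolding v_def by (rule Lp_diff(1)[OF p f bg[OF flux(1)[OF f]]])
  note pd = par_power_drift[OF f flux(1)[OF f] bg[OF flux(1)[OF f]] v]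
  have v2: "AE z in lebesgue. v z = f z - ?b z * ?g z" by (simp add: v_def)
  have "AE z in lebesgue. par_potential lam (1 + 1 / p) (par_potential lam (1 - 1 / p) v) z = ?u z"
    by (rule Lp_bounded_op_cong_AE[OF p pot_op[OF exponents(3)] Lp_bounded_opD(1)[OF pot_op[OF exponents(5)] v] density_Lp[OF f]])
       (use pd(1)[OF v2] in \<open>simp add: density_def\<close>)
  with pot_split[OF v] have uv: "AE z in lebesgue. par_potential lam 2 v z = ?u z" by eventually_elim simp
  show "Lp_solution p lam b f ?u"
    unfolding Lp_solution_def
  proof (intro conjI)
    show "?u \<in> Lp p" by (rule Lp_bounded_opD(1)[OF pot_op[OF exponents(3)] density_Lp[OF f]])
    show "?u \<in> par_space lam 2 p" unfolding par_space_def using v uv by blast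
    have "AE z in lebesgue. v z = par_power p lam 2 ?u z" by (rule par_power_eq(1)[OF p lam _ _ v uv]) auto
    with pd(2)[OF v2] flux(2)[OF f] show "AE z in lebesgue. par_power p lam 2 ?u z + b z \<bullet> weak_grad ?u z = f z"
    proof eventually_elim
      fix z assume a: "R_op p lam b (par_potential lam (1 - 1 / p) v) z = R_op p lam b (par_potential lam (1 - 1 / p) f) z - T_op p lam b ?g z"
        "?g z + T_op p lam b ?g z = R_op p lam b (par_potential lam (1 - 1 / p) f) z" "v z = par_power p lam 2 ?u z"
      have "R_op p lam b (par_potential lam (1 - 1 / p) v) z = ?g z" using a by linarith
      then show "par_power p lam 2 ?u z + b z \<bullet> weak_grad ?u z = f z"
        unfolding drift_term[OF v uv] a(3)[symmetric] by (simp add: v_def)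
    qed
  qed
  fix u assume "Lp_solution p lam b f u"
  then obtain v' where v': "v' \<in> Lp p" and u: "AE z in lebesgue. par_potential lam 2 v' z = u z"
    and eq: "AE z in lebesgue. par_power p lam 2 u z + b z \<bullet> weak_grad u z = f z"
    unfolding Lp_solution_def par_space_def by blast
  define g' where "g' = R_op p lam b (par_potential lam (1 - 1 / p) v')"
  have g': "g' \<in> Lp p" unfolding g'_def by (rule R_bound(1)[OF Lp_bounded_opD(1)[OF pot_op[OF exponents(5)] v']])
  have "AE z in lebesgue. v' z = par_power p lam 2 u z" by (rule par_power_eq(1)[OF p lam _ _ v' u]) auto
  with eq have v'2: "AE z in lebesgue. v' z = f z - ?b z * g' z"
    unfolding drift_term[OF v' u] g'_def[symmetric] by eventually_elim simp
  note pd' = par_power_drift[OF f g' bg[OF g'] v' v'2]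
  have "AE z in lebesgue. g' z = ?g z"
  proof (rule one_plus_contraction_inj[OF p T_op_bounded T_op_norm _ g' flux(1)[OF f]])
    show "AE z in lebesgue. g' z + T_op p lam b g' z = ?g z + T_op p lam b ?g z"
      using pd'(2) flux(2)[OF f] unfolding g'_def[symmetric] by eventually_elim simp
  qed auto
  with v'2 have "AE z in lebesgue. v' z = v z" by eventually_elim (simp add: v_def)
  from Lp_bounded_op_cong_AE[OF p pot_op[OF zero_less_two] v' v this] u uv
  show "AE z in lebesgue. u z = ?u z" by eventually_elim simp
qed

end

context form_bounded_drift
begin

lemma truncated_drift: "form_bounded_drift p lam CR CQ (truncated b n) (truncated b0 n)"
proof
  have [measurable]: "b0 \<in> borel_measurable borel" by (rule b0)
  show tb: "truncated b0 n \<in> borel_measurable borel" unfolding truncated_def by measurable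
  have tp[measurable]: "(\<lambda>z. norm (truncated b0 n z) powr s) \<in> borel_measurable borel" for s using tb by measurable
  show "AE z in lebesgue. truncated b n z = truncated b0 n z" using b_eq by eventually_elim (simp add: truncated_def)
  then have "AE z in lebesgue. truncated b0 n z = truncated b n z" by eventually_elim simp
  from borel_measurable_AE[OF _ this] tb show "truncated b n \<in> borel_measurable lebesgue" by (simp add: measurable_completion)
  have le: "norm (truncated b0 n z) powr s \<le> norm (b0 z) powr s" for z s by (simp add: truncated_def)
  show "kernel_bound p (\<lambda>(z, w). norm (truncated b0 n z) powr (1 / p) * dpk lam (1 + 1 / p) e (z - w)) CR" if e: "e \<in> Basis" for e
  proof -
    have "(\<lambda>(z, w). norm (truncated b0 n z) powr (1 / p) * dpk lam (1 + 1 / p) e (z - w)) \<in> borel_measurable (borel \<Otimes>\<^sub>M borel)" by measurable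
    then have "kernel_bound p (\<lambda>(z, w). norm (truncated b0 n z) powr (1 / p) * dpk lam (1 + 1 / p) e (z - w)) (1 * CR)"
      unfolding borel_prod by (rule kernel_bound_mono[OF p _ grad_bound[OF e]]) (use le in \<open>auto simp: abs_mult intro!: mult_right_mono\<close>)
    then show ?thesis by simp
  qed
  show "kernel_bound p (\<lambda>(z, w). pk lam (1 - 1 / p) (z - w) * norm (truncated b0 n w) powr (1 - 1 / p)) CQ"
  proof -
    have "(\<lambda>(z, w). pk lam (1 - 1 / p) (z - w) * norm (truncated b0 n w) powr (1 - 1 / p)) \<in> borel_measurable (borel \<Otimes>\<^sub>M borel)" by measurable
    then have "kernel_bound p (\<lambda>(z, w). pk lam (1 - 1 / p) (z - w) * norm (truncated b0 n w) powr (1 - 1 / p)) (1 * CQ)"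
      unfolding borel_prod by (rule kernel_bound_mono[OF p _ pot_bound]) (use le in \<open>auto simp: abs_mult intro!: mult_left_mono\<close>)
    then show ?thesis by simp
  qed
qed (rule p lam small)+

lemma truncated_solution:
  assumes f: "f \<in> Lp p"
  shows "Lp_solution p lam (truncated b n) f (par_potential lam (1 + 1 / p) (form_bounded_drift.density p lam (truncated b n) f))"
    and "\<And>u. Lp_solution p lam (truncated b n) f u \<Longrightarrow> AE z in lebesgue. u z = par_potential lam (1 + 1 / p) (form_bounded_drift.density p lam (truncated b n) f) z"
proof -
  have B: "norm (truncated b n z) \<le> real n" for z by (simp add: truncated_def)
  note s = form_bounded_drift.solution_exists[OF truncated_drift f B]
  show "Lp_solution p lam (truncated b n) f (par_potential lam (1 + 1 / p) (form_bounded_drift.density p lam (truncated b n) f))" by (rule s(1))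
  show "AE z in lebesgue. u z = par_potential lam (1 + 1 / p) (form_bounded_drift.density p lam (truncated b n) f) z" if "Lp_solution p lam (truncated b n) f u" for u
    using that by (rule s(2))
qed

text \<open>With \<open>i n\<close> the indicator of \<open>\<bar>b\<bar> \<le> n\<close>, truncation multiplies \<open>R\<close> from the left and \<open>Q\<close> from the right by \<open>i n\<close>. Subtracting the equations for the two fluxes leaves only terms containing \<open>(1 - i n) g\<close>, and \<open>1 + T\<close> for the truncated drift is bounded below uniformly in \<open>n\<close>.\<close>

lemma density_converges:
  assumes f: "f \<in> Lp p"
  shows "(\<lambda>n. Lp_norm p (\<lambda>z. form_bounded_drift.density p lam (truncated b n) f z - density f z)) \<longlonglongrightarrow> 0"
proof -
  define i where "i n z = (if norm (b z) \<le> real n then 1 else 0 :: real)" for n z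
  define g where "g = flux f"
  define mg where "mg n z = (1 - i n z) * g z" for n z
  have g: "g \<in> Lp p" unfolding g_def by (rule flux(1)[OF f])
  have im: "i n \<in> borel_measurable lebesgue" for n
    unfolding i_def using b_measurable by measurable
  have i1: "\<bar>i n z * x\<bar> \<le> 1 * \<bar>x\<bar>" for n z x by (simp add: i_def)
  have iLp: "(\<lambda>z. i n z * h z) \<in> Lp p" "Lp_norm p (\<lambda>z. i n z * h z) \<le> Lp_norm p h" if h: "h \<in> Lp p" for n h
    using Lp_dominated[OF exponents(1) h borel_measurable_times[OF im Lp_measurable[OF h]] AE_I2[OF i1], of n] by auto
  have mg_eq: "mg n = (\<lambda>z. g z - i n z * g z)" for n by (simp add: mg_def fun_eq_iff left_diff_distrib)
  have mgLp: "mg n \<in> Lp p" for n unfolding mg_eq by (rule Lp_diff(1)[OF p g iLp(1)[OF g]])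
  have mg0: "(\<lambda>n. Lp_norm p (mg n)) \<longlonglongrightarrow> 0"
    unfolding mg_def
  proof (rule Lp_mult_tendsto_0[OF exponents(1) g])
    show "(\<lambda>z. 1 - i n z) \<in> borel_measurable lebesgue" for n by (intro borel_measurable_diff borel_measurable_const im)
    show "\<bar>1 - i n z\<bar> \<le> 1" for n z by (simp add: i_def)
    show "(\<lambda>n. 1 - i n z) \<longlonglongrightarrow> 0" for z
    proof (rule tendsto_eventually)
      obtain m where m: "norm (b z) < real m" using reals_Archimedean2 by blast
      show "\<forall>\<^sub>F n in sequentially. 1 - i n z = 0"
        using eventually_ge_at_top[of m] by eventually_elim (use m in \<open>simp add: i_def\<close>)
    qed
  qed
  have Qn: "Q_pre p lam (truncated b n) h = Q_pre p lam b (\<lambda>z. i n z * h z)" for n h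
    unfolding Q_pre_def by (rule arg_cong[where f = "par_potential lam (1 / conj_exp p)"]) (auto simp: truncated_def i_def)
  have Rn: "R_op p lam (truncated b n) h z = i n z * R_op p lam b h z" for n h z
    by (simp add: R_op_def truncated_def i_def vec_root_def)
  have main: "Lp_norm p (\<lambda>z. form_bounded_drift.density p lam (truncated b n) f z - density f z) \<le> CQ * (4 * Lp_norm p (mg n))" for n
  proof -
    interpret tn: form_bounded_drift p lam CR CQ "truncated b n" "truncated b0 n" by (rule truncated_drift)
    define gn where "gn = tn.flux f"
    let ?T = "T_op p lam b" and ?Tn = "T_op p lam (truncated b n)"
    have gn: "gn \<in> Lp p" unfolding gn_def by (rule tn.flux(1)[OF f])
    let ?\<delta> = "\<lambda>z. gn z - g z"
    have \<delta>: "?\<delta> \<in> Lp p" by (rule Lp_diff(1)[OF p gn g])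
    have eq: "AE z in lebesgue. i n z * ?T (mg n) z - mg n z = ?\<delta> z + ?Tn ?\<delta> z"
    proof -
      have mgT: "AE z in lebesgue. ?T (mg n) z = ?T g z - ?T (\<lambda>z. i n z * g z) z"
        unfolding mg_eq by (rule Lp_bounded_op_diff[OF p T_op_bounded g iLp(1)[OF g]])
      from tn.flux(2)[OF f, folded gn_def] flux(2)[OF f, folded g_def] Lp_bounded_op_diff[OF p tn.T_op_bounded gn g]
        tn.T_op_eq[OF g] T_op_eq[OF iLp(1)[OF g, of n]] mgT
      show ?thesis unfolding Rn Qn
      proof eventually_elim
        case (elim z)
        have "?\<delta> z + ?Tn ?\<delta> z = i n z * (g z + ?T g z) - i n z * ?T (\<lambda>z. i n z * g z) z - g z"
          using elim by simp
        also have "\<dots> = i n z * ?T (mg n) z - mg n z" unfolding elim(6) mg_def by (simp add: algebra_simps)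
        finally show ?case ..
      qed
    qed
    have Tm: "?T (mg n) \<in> Lp p" by (rule Lp_bounded_opD(1)[OF T_op_bounded mgLp])
    have "(1 - 1 / 2) * Lp_norm p ?\<delta> \<le> Lp_norm p (\<lambda>z. ?\<delta> z + ?Tn ?\<delta> z)"
      by (rule one_plus_contraction_bound(2)[OF p tn.T_op_bounded tn.T_op_norm \<delta>])
    also have "\<dots> = Lp_norm p (\<lambda>z. i n z * ?T (mg n) z - mg n z)"
      by (rule Lp_cong_AE(2)[OF exponents(1) Lp_diff(1)[OF p iLp(1)[OF Tm] mgLp] eq])
    also have "\<dots> \<le> Lp_norm p (?T (mg n)) + Lp_norm p (mg n)"
      using Lp_diff(2)[OF p iLp(1)[OF Tm, of n] mgLp[of n]] iLp(2)[OF Tm, of n] by linarith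
    also have "\<dots> \<le> 3 / 2 * Lp_norm p (mg n)" using T_op_norm[OF mgLp, of n] by simp
    finally have \<delta>n: "Lp_norm p ?\<delta> \<le> 3 * Lp_norm p (mg n)" by simp
    let ?d = "\<lambda>z. g z - i n z * gn z"
    have d: "?d \<in> Lp p" by (rule Lp_diff(1)[OF p g iLp(1)[OF gn]])
    have "?d = (\<lambda>z. mg n z - i n z * ?\<delta> z)" by (simp add: mg_def fun_eq_iff algebra_simps)
    then have dn: "Lp_norm p ?d \<le> 4 * Lp_norm p (mg n)"
      using Lp_diff(2)[OF p mgLp[of n] iLp(1)[OF \<delta>, of n]] iLp(2)[OF \<delta>, of n] \<delta>n by simp
    have "AE z in lebesgue. Q_pre p lam b ?d z = tn.density f z - density f z"
      using Lp_bounded_op_diff[OF p Q_pre_bounded g iLp(1)[OF gn, of n]]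
      unfolding tn.density_def density_def Qn gn_def[symmetric] g_def[symmetric] by eventually_elim simp
    from Lp_cong_AE(2)[OF exponents(1) Lp_bounded_opD(1)[OF Q_pre_bounded d] this] Q_pre_norm[OF d]
    have "Lp_norm p (\<lambda>z. tn.density f z - density f z) \<le> CQ * Lp_norm p ?d" by simp
    also have "\<dots> \<le> CQ * (4 * Lp_norm p (mg n))" by (intro mult_left_mono dn constants_nonneg)
    finally show ?thesis .
  qed
  have "(\<lambda>n. CQ * (4 * Lp_norm p (mg n))) \<longlonglongrightarrow> CQ * (4 * 0)" by (intro tendsto_intros mg0)
  then have lim: "(\<lambda>n. CQ * (4 * Lp_norm p (mg n))) \<longlonglongrightarrow> 0" by simp
  have "\<forall>\<^sub>F n in sequentially. norm (Lp_norm p (\<lambda>z. form_bounded_drift.density p lam (truncated b n) f z - density f z)) \<le> CQ * (4 * Lp_norm p (mg n))"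
    unfolding real_norm_def abs_of_nonneg[OF Lp_norm_nonneg] by (intro always_eventually allI main)
  then show ?thesis by (rule Lim_null_comparison[OF _ lim])
qed

text \<open>The fourth claim holds since the potentials of the densities are representatives for which all estimates are pointwise.\<close>

theorem solutions_converge:
  assumes f: "f \<in> Lp p" and u: "\<And>n::nat. 1 \<le> n \<Longrightarrow> Lp_solution p lam (truncated b n) f (u n)"
  shows "limit_solution p lam b f \<in> par_space lam (1 + 1 / p) p"
    and "\<And>n. 1 \<le> n \<Longrightarrow> u n \<in> par_space lam (1 + 1 / p) p"
    and "(\<lambda>n. par_space_norm lam (1 + 1 / p) p (\<lambda>z. u n z - limit_solution p lam b f z)) \<longlonglongrightarrow> 0"
    and "real DIM('a) + 1 < p \<Longrightarrow> \<exists>u' v. (\<forall>n\<ge>1. continuous_on UNIV (u' n) \<and> (AE z in lebesgue. u' n z = u n z)) \<and>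
      v \<in> C_infinity \<and> (AE z in lebesgue. v z = limit_solution p lam b f z) \<and> uniform_limit UNIV u' v sequentially"
proof -
  let ?G = "par_potential lam (1 + 1 / p) :: (real \<times> 'a \<Rightarrow> real) \<Rightarrow> _" and ?l = "limit_solution p lam b f"
  let ?\<phi> = "\<lambda>n. form_bounded_drift.density p lam (truncated b n) f"
  have \<phi>: "?\<phi> n \<in> Lp p" for n by (rule form_bounded_drift.density_Lp[OF truncated_drift f])
  note d = density_Lp[OF f] and l = limit_solution_eq[OF f]
  have un: "AE z in lebesgue. ?G (?\<phi> n) z = u n z" if "1 \<le> n" for n
    using truncated_solution(2)[OF f u[OF that]] by eventually_elim simp
  show "?l \<in> par_space lam (1 + 1 / p) p" unfolding par_space_def using d l by blast
  show "u n \<in> par_space lam (1 + 1 / p) p" if "1 \<le> n" for n unfolding par_space_def using \<phi> un[OF that] by blast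
  have pn: "par_space_norm lam (1 + 1 / p) p (\<lambda>z. u n z - ?l z) = Lp_norm p (\<lambda>z. ?\<phi> n z - density f z)" if n: "1 \<le> n" for n
  proof -
    have "AE z in lebesgue. ?G (\<lambda>z. ?\<phi> n z - density f z) z = u n z - ?l z"
      using Lp_bounded_op_diff[OF p pot_op[OF exponents(3)] \<phi> d, of n] un[OF n] l by eventually_elim simp
    from Lp_cong_AE(2)[OF exponents(1) Lp_diff(1)[OF p \<phi> d] par_power_eq(1)[OF p lam exponents(3,4) Lp_diff(1)[OF p \<phi> d] this]]
    show ?thesis unfolding par_space_norm_def .
  qed
  have "\<forall>\<^sub>F n in sequentially. Lp_norm p (\<lambda>z. ?\<phi> n z - density f z) = par_space_norm lam (1 + 1 / p) p (\<lambda>z. u n z - ?l z)"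
    by (rule eventually_sequentiallyI[of 1], rule pn[symmetric])
  from Lim_transform_eventually[OF density_converges[OF f] this]
  show "(\<lambda>n. par_space_norm lam (1 + 1 / p) p (\<lambda>z. u n z - ?l z)) \<longlonglongrightarrow> 0" .
  assume "real DIM('a) + 1 < p"
  then have D: "real (DIM('a) + 2) < (1 + 1 / p) * p" using p by (simp add: distrib_right)
  obtain A where A: "0 \<le> A" "\<And>h. h \<in> Lp p \<Longrightarrow> ?G h \<in> C_infinity"
    "\<And>h z. h \<in> Lp p \<Longrightarrow> \<bar>?G h z\<bar> \<le> A * Lp_norm p h"
    "\<And>h h' z. h \<in> Lp p \<Longrightarrow> h' \<in> Lp p \<Longrightarrow> ?G (\<lambda>w. h w - h' w) z = ?G h z - ?G h' z"
    unfolding par_potential_kop using potential_C_infinity[OF p exponents(3) lam D] by blast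
  have le: "dist (?G (?\<phi> n) z) (?G (density f) z) \<le> A * Lp_norm p (\<lambda>z. ?\<phi> n z - density f z)" for n z
    using A(3)[OF Lp_diff(1)[OF p \<phi> d], of n z] by (simp add: A(4)[OF \<phi> d] dist_real_def)
  have lim: "(\<lambda>n. A * Lp_norm p (\<lambda>z. ?\<phi> n z - density f z)) \<longlonglongrightarrow> 0"
    using tendsto_mult[OF tendsto_const[of A] density_converges[OF f]] by simp
  have "uniform_limit UNIV (\<lambda>n. ?G (?\<phi> n)) (?G (density f)) sequentially"
  proof (rule uniform_limitI)
    fix e :: real assume "0 < e"
    with lim have "\<forall>\<^sub>F n in sequentially. A * Lp_norm p (\<lambda>z. ?\<phi> n z - density f z) < e" by (rule order_tendstoD(2))
    then show "\<forall>\<^sub>F n in sequentially. \<forall>z\<in>UNIV. dist (?G (?\<phi> n) z) (?G (density f) z) < e"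
      by eventually_elim (use le in \<open>blast intro: le_less_trans\<close>)
  qed
  then show "\<exists>u' v. (\<forall>n\<ge>1. continuous_on UNIV (u' n) \<and> (AE z in lebesgue. u' n z = u n z)) \<and>
      v \<in> C_infinity \<and> (AE z in lebesgue. v z = limit_solution p lam b f z) \<and> uniform_limit UNIV u' v sequentially"
    using un A(2)[OF \<phi>] A(2)[OF d] l unfolding C_infinity_def
    by (intro exI[of _ "\<lambda>n. ?G (?\<phi> n)"] exI[of _ "?G (density f)"]) auto
qed

end

lemma lebesgue_ex_borel_vector:
  fixes h :: "'b::euclidean_space \<Rightarrow> 'c::euclidean_space"
  assumes h: "h \<in> borel_measurable lebesgue"
  obtains h' where "h' \<in> borel_measurable borel" "AE z in lebesgue. h z = h' z"
proof -
  have "\<exists>c. c \<in> borel_measurable borel \<and> (AE z in lebesgue. h z \<bullet> e = c z)" for e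
  proof -
    have "(\<lambda>z. h z \<bullet> e) \<in> borel_measurable lebesgue" using h by simp
    from lebesgue_ex_borel[OF this] show ?thesis by blast
  qed
  then obtain c where c: "\<And>e. c e \<in> borel_measurable borel" "\<And>e. AE z in lebesgue. h z \<bullet> e = c e z" by metis
  show thesis
  proof
    show "(\<lambda>z. \<Sum>e\<in>Basis. c e z *\<^sub>R e) \<in> borel_measurable borel"
      by (intro borel_measurable_sum borel_measurable_scaleR c borel_measurable_const)
    have "AE z in lebesgue. \<forall>e\<in>Basis. h z \<bullet> e = c e z" using c(2) by (intro AE_finite_allI finite_Basis)
    then show "AE z in lebesgue. h z = (\<Sum>e\<in>Basis. c e z *\<^sub>R e)"
    proof eventually_elim
      case (elim z)
      have "(\<Sum>e\<in>Basis. c e z *\<^sub>R e) = (\<Sum>e\<in>Basis. (h z \<bullet> e) *\<^sub>R e)" using elim by (intro sum.cong) auto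
      then show ?case by (simp add: euclidean_representation)
    qed
  qed
qed

text \<open>The product of the two kernel bounds is a multiple of \<open>K\<close>, so \<open>K\<close> can be fixed in terms of \<open>p\<close>, \<open>q\<close> and the dimension; the bounded part of the drift is then absorbed by the choice of \<open>lam0\<close>.\<close>

theorem form_bounded_drift_of_morrey:
  fixes p q :: real
  assumes p: "1 < p" and q: "1 < q"
  shows "\<exists>c>0. \<forall>M. \<exists>lam0>0. \<forall>b bs bb :: real \<times> 'a::euclidean_space \<Rightarrow> 'a.
    (\<forall>z. b z = bs z + bb z) \<longrightarrow> bs \<in> morrey_class q \<longrightarrow> bb \<in> Linf \<longrightarrow> morrey_norm q bs < ereal c \<longrightarrow> Linf_norm bb = ereal M \<longrightarrow>
    (\<forall>lam\<ge>lam0. \<exists>b0 CR CQ. form_bounded_drift p lam CR CQ b b0)"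
proof -
  obtain C where C: "0 < C" and wpb:
    "\<And>w v M K lam. \<lbrakk>w \<in> borel_measurable borel; v \<in> borel_measurable borel; \<And>z. 0 \<le> w z; \<And>z. 0 \<le> v z; \<And>z. v z \<le> w z + M; 0 \<le> M; 0 < K; 0 < lam; M \<le> K * sqrt lam;
      \<And>z r. 0 < r \<Longrightarrow> (\<integral>\<^sup>+y\<in>pball (z::real \<times> 'a) r. ennreal (w y powr q) \<partial>lborel) \<le> ennreal ((K / r) powr q * (pball_const TYPE('a) * r ^ (DIM('a) + 2)))\<rbrakk>
      \<Longrightarrow> kernel_bound p (\<lambda>(z, y). v z powr (1 / p) * gk lam (1 / p) (z - y)) (C * K powr (1 / p)) \<and>
          kernel_bound p (\<lambda>(z, y). gk lam (1 - 1 / p) (z - y) * v y powr (1 - 1 / p)) (C * K powr (1 - 1 / p))"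
    using weighted_potential_bounds[OF p q, where 'a = 'a] by blast
  have e1: "0 < 1 + 1 / p" and e2: "0 < 1 - 1 / p" using p by (auto simp: field_simps)
  define A1 where "A1 = pk_const TYPE('a) (1 + 1 / p)"
  define A2 where "A2 = pk_const TYPE('a) (1 - 1 / p)"
  have A: "0 < A1" "0 < A2" unfolding A1_def A2_def using e1 e2 by (auto intro: pk_const_pos)
  \<comment> \<open>The value for which the product of the bounds of the two operators is one half.\<close>
  define K where "K = 1 / (2 * (real DIM('a) * A1 * A2 * C * C))"
  have K: "0 < K" unfolding K_def using A C by simp
  define c where "c = K / 2 ^ (DIM('a) + 2)"
  have c: "0 < c" and Kc: "2 ^ (DIM('a) + 2) * c = K" unfolding c_def using K by auto
  have small: "real DIM('a) * (A1 * (C * K powr (1 / p))) * (A2 * (C * K powr (1 - 1 / p))) \<le> 1 / 2"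
  proof -
    have "K powr (1 / p) * K powr (1 - 1 / p) = K" using K by (simp flip: powr_add)
    then have "real DIM('a) * (A1 * (C * K powr (1 / p))) * (A2 * (C * K powr (1 - 1 / p))) = (real DIM('a) * A1 * A2 * C * C) * K" by (simp add: mult_ac)
    also have "\<dots> = 1 / 2" unfolding K_def using A C by simp
    finally show ?thesis by simp
  qed
  show ?thesis
  proof (rule exI[of _ c], intro conjI c allI)
    fix M :: real
    define M' where "M' = max M 0"
    \<comment> \<open>This guarantees \<open>M' \<le> K sqrt lam\<close> for all larger \<open>lam\<close>.\<close>
    define lam0 where "lam0 = (M' / K)\<^sup>2 + 1"
    show "\<exists>lam0>0. \<forall>b bs bb :: real \<times> 'a \<Rightarrow> 'a.
      (\<forall>z. b z = bs z + bb z) \<longrightarrow> bs \<in> morrey_class q \<longrightarrow> bb \<in> Linf \<longrightarrow> morrey_norm q bs < ereal c \<longrightarrow> Linf_norm bb = ereal M \<longrightarrow>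
      (\<forall>lam\<ge>lam0. \<exists>b0 CR CQ. form_bounded_drift p lam CR CQ b b0)"
    proof (intro exI[of _ lam0] conjI allI impI)
      show "0 < lam0" unfolding lam0_def by (simp add: add_nonneg_pos)
      fix b bs bb :: "real \<times> 'a \<Rightarrow> 'a" and lam :: real
      assume b: "\<forall>z. b z = bs z + bb z" and bs: "bs \<in> morrey_class q" and bb: "bb \<in> Linf" and nbs: "morrey_norm q bs < ereal c"
        and nbb: "Linf_norm bb = ereal M" and lam0: "lam0 \<le> lam"
      have lam: "0 < lam" using lam0 \<open>0 < lam0\<close> by simp
      have "\<bar>M' / K\<bar> \<le> sqrt lam" 
      proof (rule real_le_rsqrt)
        show "\<bar>M' / K\<bar>\<^sup>2 \<le> lam" unfolding power2_abs using lam0 unfolding lam0_def by linarith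
      qed
      then have Ml: "M' \<le> K * sqrt lam" using K by (simp add: abs_le_iff divide_le_eq mult.commute)
      have bsm: "bs \<in> borel_measurable lebesgue" using bs by (simp add: morrey_class_def)
      have bbm: "bb \<in> borel_measurable lebesgue" using bb by (simp add: Linf_def)
      have "(\<lambda>z. bs z + bb z) \<in> borel_measurable lebesgue" using bsm bbm by (rule borel_measurable_add)
      moreover have "(\<lambda>z. bs z + bb z) = b" by (rule ext, rule b[rule_format, symmetric])
      ultimately have bm: "b \<in> borel_measurable lebesgue" by simp
      obtain b1 where b1: "b1 \<in> borel_measurable borel" "AE z in lebesgue. b z = b1 z" using lebesgue_ex_borel_vector[OF bm] by blast
      obtain b2 where b2: "b2 \<in> borel_measurable borel" "AE z in lebesgue. bs z = b2 z" using lebesgue_ex_borel_vector[OF bsm] by blast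
      define w where "w z = norm (b2 z)" for z
      have w[measurable]: "w \<in> borel_measurable borel" unfolding w_def using b2(1) by measurable
      have wbs: "AE z in lebesgue. w z = norm (bs z)" using b2(2) by eventually_elim (simp add: w_def)
      \<comment> \<open>The bound of the weight by \<open>w + M'\<close> is needed at every point, so it is enforced on the exceptional null set.\<close>
      define b0 where "b0 z = (if norm (b1 z) \<le> w z + M' then b1 z else 0)" for z
      have b0[measurable]: "b0 \<in> borel_measurable borel" unfolding b0_def using b1(1) by measurable
      have "AE z in lebesgue. ereal (norm (bb z)) \<le> ereal M"
        using esssup_AE[where M = lebesgue and f = "\<lambda>z. ereal (norm (bb z))"] nbb unfolding Linf_norm_def by simp
      with wbs b1(2) have b0eq: "AE z in lebesgue. b z = b0 z"
      proof eventually_elim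
        case (elim z)
        have "norm (b z) \<le> norm (bs z) + norm (bb z)" using b norm_triangle_ineq by metis
        moreover have "M \<le> M'" by (simp add: M'_def)
        ultimately have "norm (b1 z) \<le> w z + M'" using elim by simp
        then show ?case using elim by (simp add: b0_def)
      qed
      have v: "norm (b0 z) \<le> w z + M'" for z by (simp add: b0_def w_def M'_def)
      have ball: "(\<integral>\<^sup>+y\<in>pball (z::real \<times> 'a) r. ennreal (w y powr q) \<partial>lborel) \<le> ennreal ((K / r) powr q * (pball_const TYPE('a) * r ^ (DIM('a) + 2)))" if "0 < r" for z r
        using morrey_ball_bound[OF q bs c nbs w wbs that] unfolding Kc .
      have kb: "kernel_bound p (\<lambda>(z, y). norm (b0 z) powr (1 / p) * gk lam (1 / p) (z - y)) (C * K powr (1 / p)) \<and>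
          kernel_bound p (\<lambda>(z, y). gk lam (1 - 1 / p) (z - y) * norm (b0 y) powr (1 - 1 / p)) (C * K powr (1 - 1 / p))"
        by (rule wpb[where w = w and M = M' and v = "\<lambda>z. norm (b0 z)", OF w _ _ _ v _ K lam Ml ball]) (auto simp: w_def M'_def)
      have "form_bounded_drift p lam (A1 * (C * K powr (1 / p))) (A2 * (C * K powr (1 - 1 / p))) b b0"
      proof
        show "kernel_bound p (\<lambda>(z, w). norm (b0 z) powr (1 / p) * dpk lam (1 + 1 / p) e (z - w)) (A1 * (C * K powr (1 / p)))" if e: "e \<in> Basis" for e
        proof (rule kernel_bound_mono[OF p _ conjunct1[OF kb]])
          have "(\<lambda>(z, w). norm (b0 z) powr (1 / p) * dpk lam (1 + 1 / p) e (z - w)) \<in> borel_measurable (borel \<Otimes>\<^sub>M borel)" by measurable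
          then show "(\<lambda>(z, w). norm (b0 z) powr (1 / p) * dpk lam (1 + 1 / p) e (z - w)) \<in> borel_measurable borel" unfolding borel_prod .
          fix z w
          have "\<bar>dpk lam (1 + 1 / p) e (z - w)\<bar> \<le> A1 * gk lam (1 / p) (z - w)"
            using dpk_le_gk[OF e1, of lam e "z - w"] e by (simp add: A1_def)
          then have "norm (b0 z) powr (1 / p) * \<bar>dpk lam (1 + 1 / p) e (z - w)\<bar> \<le> norm (b0 z) powr (1 / p) * (A1 * gk lam (1 / p) (z - w))"
            by (rule mult_left_mono) simp
          then show "\<bar>case (z, w) of (z, w) \<Rightarrow> norm (b0 z) powr (1 / p) * dpk lam (1 + 1 / p) e (z - w)\<bar>
              \<le> A1 * \<bar>case (z, w) of (z, y) \<Rightarrow> norm (b0 z) powr (1 / p) * gk lam (1 / p) (z - y)\<bar>"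
            by (simp add: abs_mult gk_nonneg mult.left_commute)
        qed (use A in simp)
        show "kernel_bound p (\<lambda>(z, w). pk lam (1 - 1 / p) (z - w) * norm (b0 w) powr (1 - 1 / p)) (A2 * (C * K powr (1 - 1 / p)))"
        proof (rule kernel_bound_mono[OF p _ conjunct2[OF kb]])
          have "(\<lambda>(z, w). pk lam (1 - 1 / p) (z - w) * norm (b0 w) powr (1 - 1 / p)) \<in> borel_measurable (borel \<Otimes>\<^sub>M borel)" by measurable
          then show "(\<lambda>(z, w). pk lam (1 - 1 / p) (z - w) * norm (b0 w) powr (1 - 1 / p)) \<in> borel_measurable borel" unfolding borel_prod .
          fix z w
          have "pk lam (1 - 1 / p) (z - w) * norm (b0 w) powr (1 - 1 / p) \<le> A2 * gk lam (1 - 1 / p) (z - w) * norm (b0 w) powr (1 - 1 / p)"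
            unfolding A2_def by (rule mult_right_mono[OF pk_le_gk[OF e2]]) simp
          then show "\<bar>case (z, w) of (z, w) \<Rightarrow> pk lam (1 - 1 / p) (z - w) * norm (b0 w) powr (1 - 1 / p)\<bar>
              \<le> A2 * \<bar>case (z, w) of (z, y) \<Rightarrow> gk lam (1 - 1 / p) (z - y) * norm (b0 y) powr (1 - 1 / p)\<bar>"
            by (simp add: abs_mult gk_nonneg pk_nonneg[OF e2] mult.assoc)
        qed (use A in simp)
      qed (rule p lam bm b0 b0eq small)+
      then show "\<exists>b0 CR CQ. form_bounded_drift p lam CR CQ b b0" by blast
    qed
  qed
qed

theorem theorem1:
  fixes p q :: real
  assumes d: "CARD('n::finite) \<ge> 3"
    and q: "1 < q" "q \<le> real CARD('n) + 2"
    and p: "1 < p"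
  shows
    "\<exists>c>0. \<forall>M. \<exists>lam0>0.
       \<forall>b bs bb :: real \<times> (real ^ 'n) \<Rightarrow> real ^ 'n.
         (\<forall>z. b z = bs z + bb z) \<longrightarrow>
         bs \<in> morrey_class q \<longrightarrow> bb \<in> Linf \<longrightarrow>
         morrey_norm q bs < ereal c \<longrightarrow> Linf_norm bb = ereal M \<longrightarrow>
         (\<forall>lam\<ge>lam0.
            Lp_bounded_op p (R_op p lam b) \<and>
            Lp_bounded_closure p (Q_dom p b) (Q_pre p lam b) \<and>
            Lp_bounded_op p (T_op p lam b) \<and> Lp_opnorm p (T_op p lam b) < 1 \<and>
            (\<forall>f\<in>Lp p.
               (\<forall>n\<ge>1. \<exists>v. Lp_solution p lam (truncated b n) f v \<and>
                   (\<forall>w. Lp_solution p lam (truncated b n) f w \<longrightarrow>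
                        (AE z in lebesgue. w z = v z))) \<and>
               (\<forall>u :: nat \<Rightarrow> real \<times> (real ^ 'n) \<Rightarrow> real.
                  (\<forall>n\<ge>1. Lp_solution p lam (truncated b n) f (u n)) \<longrightarrow>
                  limit_solution p lam b f \<in> par_space lam (1 + 1 / p) p \<and>
                  (\<forall>n\<ge>1. u n \<in> par_space lam (1 + 1 / p) p) \<and>
                  (\<lambda>n. par_space_norm lam (1 + 1 / p) p
                         (\<lambda>z. u n z - limit_solution p lam b f z)) \<longlonglongrightarrow> 0 \<and>
                  (p > real CARD('n) + 1 \<longrightarrow>
                     (\<exists>u' v. (\<forall>n\<ge>1. continuous_on UNIV (u' n) \<and>
                                  (AE z in lebesgue. u' n z = u n z)) \<and>
                             v \<in> C_infinity \<and>
                             (AE z in lebesgue. v z = limit_solution p lam b f z) \<and>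
                             uniform_limit UNIV u' v sequentially)))))"
proof -
  obtain c where c: "0 < c" and ex: "\<And>M. \<exists>lam0>0. \<forall>b bs bb :: real \<times> (real ^ 'n) \<Rightarrow> real ^ 'n.
    (\<forall>z. b z = bs z + bb z) \<longrightarrow> bs \<in> morrey_class q \<longrightarrow> bb \<in> Linf \<longrightarrow> morrey_norm q bs < ereal c \<longrightarrow> Linf_norm bb = ereal M \<longrightarrow>
    (\<forall>lam\<ge>lam0. \<exists>b0 CR CQ. form_bounded_drift p lam CR CQ b b0)"
    using form_bounded_drift_of_morrey[OF p q(1), where 'a = "real ^ 'n"] by blast
  show ?thesis
  proof (rule exI[of _ c], intro conjI[OF c] allI, goal_cases)
    case (1 M)
    obtain lam0 where lam0: "0 < lam0" and drift: "\<And>b bs bb lam. (\<forall>z. b z = bs z + bb z) \<Longrightarrow> bs \<in> morrey_class q \<Longrightarrow> bb \<in> Linf \<Longrightarrow> morrey_norm q bs < ereal c \<Longrightarrow> Linf_norm bb = ereal M \<Longrightarrow>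
      lam0 \<le> lam \<Longrightarrow> \<exists>(b0 :: real \<times> (real ^ 'n) \<Rightarrow> real ^ 'n) CR CQ. form_bounded_drift p lam CR CQ b b0"
      using ex[of M] by blast
    show ?case
    proof (rule exI[of _ lam0], intro conjI[OF lam0] allI impI, goal_cases)
      case (1 b bs bb lam)
      obtain b0 CR CQ where "form_bounded_drift p lam CR CQ b b0" using drift[OF 1] by blast
      then interpret form_bounded_drift p lam CR CQ b b0 .
      show ?case
      proof (intro conjI ballI allI impI)
        fix f :: "real \<times> (real ^ 'n) \<Rightarrow> real" and n :: nat assume f: "f \<in> Lp p"
        show "\<exists>v. Lp_solution p lam (truncated b n) f v \<and> (\<forall>w. Lp_solution p lam (truncated b n) f w \<longrightarrow> (AE z in lebesgue. w z = v z))"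
          using truncated_solution[OF f] by blast
      next
        fix f u assume f: "f \<in> Lp p" and u: "\<forall>n\<ge>1. Lp_solution p lam (truncated b n) f (u n)"
        note conv = solutions_converge[OF f, of u, OF u[rule_format]]
        show "limit_solution p lam b f \<in> par_space lam (1 + 1 / p) p" by (rule conv(1))
        show "u n \<in> par_space lam (1 + 1 / p) p" if "1 \<le> n" for n by (rule conv(2)[OF _ that])
        show "(\<lambda>n. par_space_norm lam (1 + 1 / p) p (\<lambda>z. u n z - limit_solution p lam b f z)) \<longlonglongrightarrow> 0" by (rule conv(3))
        assume "real CARD('n) + 1 < p"
        then show "\<exists>u' v. (\<forall>n\<ge>1. continuous_on UNIV (u' n) \<and> (AE z in lebesgue. u' n z = u n z)) \<and>
          v \<in> C_infinity \<and> (AE z in lebesgue. v z = limit_solution p lam b f z) \<and> uniform_limit UNIV u' v sequentially"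
          by (intro conv(4)) (simp_all add: DIM_cart)
      qed (rule R_op_bounded Q_closure T_op_bounded T_opnorm)+
    qed
  qed
qed

end
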